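(* Let $D$ be a finite-dimensional graded-division algebra over $\mathbb R$, with abelian support $T$ and center $\mathbb K$, that satisfies $D_e\subset\mathbb K$ and admits a degree-preserving involution that makes it central simple as an algebra with involution over $\mathbb R$ (so $\mathbb K$ is isomorphic to $\mathbb R$, $\mathbb C$ or $\widetilde{\mathbb C}=\mathbb R\times\mathbb R$). Fix such a degree-preserving involution $\varphi_0$ on $D$, subject to the convention that, if $\mathbb K\not\simeq\widetilde{\mathbb C}$, $\varphi_0$ is chosen to satisfy $x\varphi_0(x)\in\mathbb R_{>0}$ for all $0\ne x\in D_t$ with $t^2=e$, and that, if $\mathbb K\ne\mathbb R$, only hermitian forms are used (i.e., $\delta=1$). Then the graded algebras with involution of the form $\mathcal M(D,\varphi_0,q,s,\underline d,\delta)$ are classified up to equivalence by $q$, $s$, $\delta$, $\mathrm{signature}(\underline d)$ (in the cases where it is defined, namely $\mathbb K\not\simeq\widetilde{\mathbb C}$ and $\delta=1$), and the orbit of the multiset $\{\deg(d_1)H,\dots,\deg(d_q)H\}$ in the elementary abelian $2$-group $V:=T/H$ under the action of $A$, where the subgroup $H\subset T$ and the group $A$ that acts on $V$ are as follows: (1) If $\mathbb K=\mathbb R$, then $H$ is trivial and $A=\mathrm{Aut}(T,\mu)$ where $\mu$ is the quadratic form on $T$ defined by $x^2\in\mu(t)\mathbb R_{>0}$ for all $0\ne x\in D_t$, $t\in T$; (2) If $\mathbb K\simeq\mathbb C$, there are two cases: (a) If $D_e=\mathbb R$, then $H=\mathrm{Supp}\,\mathbb K$ and $A=\mathrm{Aut}(V,\bar\beta)$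 where $\bar\beta$ is the nondegenerate alternating bicharacter on $V$ induced by the alternating bicharacter $\beta$ on $T$ defined by $xy=\beta(s,t)yx$ for $x\in D_s$, $y\in D_t$; (b) If $D_e\simeq\mathbb C$, then $H=T^{[2]}$ and $A=\mathrm{Aut}(T,\beta)$ (with $\beta:T\times T\to\mathbb C^\times$ defined by $xy=\beta(s,t)yx$ for $x\in D_s$, $y\in D_t$), whose image in $\mathrm{GL}(V)$ is the stabilizer of the flag $\mathcal F=\{V_i\}$ and of the symplectic forms on each of its nontrivial quotients; (3) If $\mathbb K\simeq\widetilde{\mathbb C}$, then $H=\mathrm{Supp}\,\mathbb K$ and $A=V\rtimes\mathrm{Aut}(V,\bar\mu)$ (acting by affine transformations) where $\bar\mu$ is the quadratic form on $V$ induced by $\mu$ (defined by $x^2\in\mu(t)\mathbb R_{>0}$ for $0\ne x\in D_t$).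
   Context: All algebras are associative. A graded-division algebra is a unital graded algebra in which all nonzero homogeneous elements are invertible; $D^\times_{\mathrm{gr}}$ is the group of nonzero homogeneous elements. An involution is an $\mathbb R$-linear antiautomorphism of order at most 2; degree-preserving means each homogeneous component is mapped to itself. $(D,\varphi_0)$ is central simple as an algebra with involution if it has no proper nonzero $\varphi_0$-invariant two-sided ideals and the $\varphi_0$-symmetric elements of $Z(D)$ are exactly $\mathbb R$. An equivalence of graded algebras with involution is an algebra isomorphism commuting with the involutions and mapping each nonzero homogeneous component onto a homogeneous component. "Classified up to equivalence by" means: two of them are equivalent if and only if the listed invariants coincide. For an abelian group $T$: $T_{[n]}=\{t\in T\mid t^n=e\}$, $T^{[n]}=\{t^n\mid t\in T\}$. In all cases except (2b), $D_e=\mathbb R$ and $T$ is an elementary abelian 2-group, regarded as a $GF(2)$-vector space; a quadratic form with values in $\{\pm1\}$ such as $\mu$ satisfies $\mu(st)=\mu(s)\mu(t)\beta(s,t)$. $\mathrm{Aut}(T,\mu)$, $\mathrm{Aut}(T,\beta)$, etc. denote the groups of automorphisms preserving the given form. Construction of $\mathcal M$. Let $q,s\ge0$ be integers not both zero, $\delta\in\{\pm1\}$, $\underline d=(d_1,\dots,d_q)$ with $d_i\in D^\times_{\mathrm{gr}}$, $\varphi_0(d_i)=\delta d_i$, $t_i=\deg d_i$, $k=q+2s$. $\widetilde G(T,q,s,\underline t)$ is the quotient of $F\times T$, $F$ free abelian on $\tilde g_1,\dots,\tilde g_k$, by $\tilde g_1^2t_1^{-1}=\dots=\tilde g_q^2t_q^{-1}=\tilde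 g_{q+1}\tilde g_{q+2}=\dots=\tilde g_{q+2s-1}\tilde g_{q+2s}$. $\mathcal M(D,\varphi_0,q,s,\underline d,\delta)$ is $M_k(D)=M_k(\mathbb R)\otimes D$ graded by $\deg(E_{ij}\otimes d)=\tilde g_i\tilde g_j^{-1}t$ for $0\ne d\in D_t$, with involution $X\mapsto\Phi^{-1}\varphi_0(X^T)\Phi$, $\Phi=\mathrm{diag}\left(d_1,\dots,d_q,\begin{bmatrix}0&1\\ \delta&0\end{bmatrix},\dots,\begin{bmatrix}0&1\\ \delta&0\end{bmatrix}\right)$ ($s$ blocks of size 2). Signature (for $\mathbb K\not\simeq\widetilde{\mathbb C}$, $\delta=1$): $\mathrm{signature}(\underline d)=|n^0_+-n^0_-|$, where, in cases (1) and (2a), $n^0_+$ (resp. $n^0_-$) is the number of positive (resp. negative) real numbers among the $d_i$; in case (2b), each $d_i$ with $t_i\in T^{[2]}$ counts for $n^0_+$ (resp. $n^0_-$) if the real number $cd_i\varphi_0(c)$ is positive (resp. negative) for some (equivalently, any) $0\ne c\in D_s$ with $s^2=t_i^{-1}$. Flag in case (2b): $V=T/T^{[2]}$, $V_i=T_{[2^i]}T^{[2]}/T^{[2]}$ for $i\ge0$; each nontrivial quotient $V_i/V_{i-1}$ ($i\ge1$) carries the nondegenerate alternating form induced by $(s,t)\mapsto\beta(s,t)^{2^{i-1}}\in\{\pm1\}$ on $T_{[2^i]}$. *)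

theory Defs
  imports
    "HOL-Algebra.Free_Abelian_Groups"
    "HOL-Algebra.Bij"
    "HOL-Algebra.Group_Action"
    "HOL-Algebra.QuotRing"
    "HOL-Library.Multiset"
    "Jordan_Normal_Form.Matrix"
    Complex_Main
begin

section \<open>Graded-division real algebras with involution\<close>

definition fin_dim :: "'d::real_vector itself \<Rightarrow> bool" where
  "fin_dim _ \<longleftrightarrow> (\<exists>B :: 'd set. finite B \<and> span B = UNIV)"

definition alg_center :: "'d::real_algebra_1 set" where
  "alg_center = {z. \<forall>x. z * x = x * z}"

definition is_grading :: "'t monoid \<Rightarrow> ('t \<Rightarrow> 'd::real_algebra_1 set) \<Rightarrow> bool" where
  "is_grading T D \<longleftrightarrow>
     (\<forall>t\<in>carrier T. subspace (D t)) \<and>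
     (\<forall>s\<in>carrier T. \<forall>t\<in>carrier T. \<forall>x\<in>D s. \<forall>y\<in>D t. x * y \<in> D (s \<otimes>\<^bsub>T\<^esub> t)) \<and>
     (\<forall>x. \<exists>!f. (\<forall>t\<in>carrier T. f t \<in> D t) \<and> (\<forall>t. t \<notin> carrier T \<longrightarrow> f t = 0) \<and>
              finite {t. f t \<noteq> 0} \<and> (\<Sum>t | f t \<noteq> 0. f t) = x)"

text \<open>The support of a graded-division algebra is a subgroup of the grading group, so the
  algebra is taken to be graded by its support \<open>T\<close>: all components \<open>D t\<close> are nonzero.\<close>

definition graded_division_algebra ::
    "'t monoid \<Rightarrow> ('t \<Rightarrow> 'd::real_algebra_1 set) \<Rightarrow> bool" where
  "graded_division_algebra T D \<longleftrightarrow>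
     group T \<and> is_grading T D \<and> (\<forall>t\<in>carrier T. D t \<noteq> {0}) \<and>
     (\<forall>t\<in>carrier T. \<forall>x\<in>D t. x \<noteq> 0 \<longrightarrow> (\<exists>y. x * y = 1 \<and> y * x = 1))"

definition gr_units :: "'t monoid \<Rightarrow> ('t \<Rightarrow> 'd::real_algebra_1 set) \<Rightarrow> 'd set" where
  "gr_units T D = (\<Union>t\<in>carrier T. D t) - {0}"

definition gr_deg :: "'t monoid \<Rightarrow> ('t \<Rightarrow> 'd::real_algebra_1 set) \<Rightarrow> 'd \<Rightarrow> 't" where
  "gr_deg T D d = (THE t. t \<in> carrier T \<and> d \<in> D t)"

definition is_involution :: "('d::real_algebra_1 \<Rightarrow> 'd) \<Rightarrow> bool" where
  "is_involution \<phi> \<longleftrightarrow>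
     linear \<phi> \<and> (\<forall>x y. \<phi> (x * y) = \<phi> y * \<phi> x) \<and> (\<forall>x. \<phi> (\<phi> x) = x)"

definition degree_preserving ::
    "'t monoid \<Rightarrow> ('t \<Rightarrow> 'd set) \<Rightarrow> ('d \<Rightarrow> 'd) \<Rightarrow> bool" where
  "degree_preserving T D \<phi> \<longleftrightarrow> (\<forall>t\<in>carrier T. \<phi> ` D t = D t)"

definition two_sided_ideal :: "'d::real_algebra_1 set \<Rightarrow> bool" where
  "two_sided_ideal I \<longleftrightarrow> subspace I \<and> (\<forall>a\<in>I. \<forall>x. a * x \<in> I \<and> x * a \<in> I)"

definition central_simple_with_involution :: "('d::real_algebra_1 \<Rightarrow> 'd) \<Rightarrow> bool" where
  "central_simple_with_involution \<phi> \<longleftrightarrow>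
     (\<forall>I. two_sided_ideal I \<and> \<phi> ` I \<subseteq> I \<longrightarrow> I = {0} \<or> I = UNIV) \<and>
     {z \<in> alg_center. \<phi> z = z} = range of_real"

text \<open>Isomorphism of a unital subalgebra with \<open>\<complex>\<close>, respectively with \<open>\<real> \<times> \<real>\<close> (componentwise
  product), as real algebras.\<close>

definition iso_complex :: "'d::real_algebra_1 set \<Rightarrow> bool" where
  "iso_complex S \<longleftrightarrow> (\<exists>f :: 'd \<Rightarrow> complex. bij_betw f S UNIV \<and> f 1 = 1 \<and>
     (\<forall>x\<in>S. \<forall>y\<in>S. f (x + y) = f x + f y \<and> f (x * y) = f x * f y) \<and>
     (\<forall>r. \<forall>x\<in>S. f (r *\<^sub>R x) = r *\<^sub>R f x))"

definition iso_split_complex :: "'d::real_algebra_1 set \<Rightarrow> bool" where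
  "iso_split_complex S \<longleftrightarrow> (\<exists>f g :: 'd \<Rightarrow> real. bij_betw (\<lambda>x. (f x, g x)) S UNIV \<and>
     (\<forall>h\<in>{f, g}. h 1 = 1 \<and>
        (\<forall>x\<in>S. \<forall>y\<in>S. h (x + y) = h x + h y \<and> h (x * y) = h x * h y) \<and>
        (\<forall>r. \<forall>x\<in>S. h (r *\<^sub>R x) = r * h x)))"

definition pos_real :: "'d::real_algebra_1 \<Rightarrow> bool" where
  "pos_real x \<longleftrightarrow> (\<exists>r>0. x = of_real r)"

definition neg_real :: "'d::real_algebra_1 \<Rightarrow> bool" where
  "neg_real x \<longleftrightarrow> (\<exists>r<0. x = of_real r)"

definition involution_convention ::
    "'t monoid \<Rightarrow> ('t \<Rightarrow> 'd::real_algebra_1 set) \<Rightarrow> ('d \<Rightarrow> 'd) \<Rightarrow> bool" where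
  "involution_convention T D \<phi> \<longleftrightarrow>
     (\<not> iso_split_complex (alg_center :: 'd set) \<longrightarrow>
      (\<forall>t\<in>carrier T. t \<otimes>\<^bsub>T\<^esub> t = \<one>\<^bsub>T\<^esub> \<longrightarrow> (\<forall>x\<in>D t. x \<noteq> 0 \<longrightarrow> pos_real (x * \<phi> x))))"


section \<open>Graded algebras with involution and their equivalence\<close>

record ('g, 'a) graded_inv_algebra = "(real, 'a) module" +
  grading_group :: "'g monoid"
  component :: "'g \<Rightarrow> 'a set"
  invol :: "'a \<Rightarrow> 'a"

definition gr_inv_equivalent ::
    "('g, 'a) graded_inv_algebra \<Rightarrow> ('h, 'b) graded_inv_algebra \<Rightarrow> bool" where
  "gr_inv_equivalent R S \<longleftrightarrow> (\<exists>f\<in>ring_iso R S.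
     (\<forall>r. \<forall>x\<in>carrier R. f (r \<odot>\<^bsub>R\<^esub> x) = r \<odot>\<^bsub>S\<^esub> f x) \<and>
     (\<forall>x\<in>carrier R. f (invol R x) = invol S (f x)) \<and>
     (\<forall>g\<in>carrier (grading_group R). component R g \<noteq> {\<zero>\<^bsub>R\<^esub>} \<longrightarrow>
        (\<exists>h\<in>carrier (grading_group S). f ` component R g = component S h)))"


section \<open>The group \<open>G(T,q,s,t)\<close> and the algebra \<open>M(D,\<phi>,q,s,d,\<delta>)\<close>\<close>

text \<open>Indices start at \<open>0\<close>: \<open>g\<^sub>0, \<dots>, g\<^sub>k\<^sub>-\<^sub>1\<close> with \<open>k = q + 2s\<close>, and \<open>q\<close> is the length of the list
  \<open>ts\<close> of degrees.\<close>

definition free_times :: "'t monoid \<Rightarrow> nat \<Rightarrow> ((nat \<Rightarrow>\<^sub>0 int) \<times> 't) monoid" where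
  "free_times T k = free_Abelian_group {..<k} \<times>\<times> T"

definition equated_elements :: "'t monoid \<Rightarrow> nat \<Rightarrow> 't list \<Rightarrow> ((nat \<Rightarrow>\<^sub>0 int) \<times> 't) set" where
  "equated_elements T s ts = (let q = length ts in
     {(frag_of i + frag_of i, inv\<^bsub>T\<^esub> (ts ! i)) | i. i < q} \<union>
     {(frag_of (q + 2 * j) + frag_of (q + 2 * j + 1), \<one>\<^bsub>T\<^esub>) | j. j < s})"

definition relation_subgroup :: "'t monoid \<Rightarrow> nat \<Rightarrow> 't list \<Rightarrow> ((nat \<Rightarrow>\<^sub>0 int) \<times> 't) set" where
  "relation_subgroup T s ts = (let P = free_times T (length ts + 2 * s) in
     generate P {a \<otimes>\<^bsub>P\<^esub> inv\<^bsub>P\<^esub> b | a b.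
       a \<in> equated_elements T s ts \<and> b \<in> equated_elements T s ts})"

definition Gtilde :: "'t monoid \<Rightarrow> nat \<Rightarrow> 't list \<Rightarrow> ((nat \<Rightarrow>\<^sub>0 int) \<times> 't) set monoid" where
  "Gtilde T s ts = free_times T (length ts + 2 * s) Mod relation_subgroup T s ts"

definition gtilde :: "'t monoid \<Rightarrow> nat \<Rightarrow> 't list \<Rightarrow> nat \<Rightarrow> ((nat \<Rightarrow>\<^sub>0 int) \<times> 't) set" where
  "gtilde T s ts i =
     relation_subgroup T s ts #>\<^bsub>free_times T (length ts + 2 * s)\<^esub> (frag_of i, \<one>\<^bsub>T\<^esub>)"

definition ttilde :: "'t monoid \<Rightarrow> nat \<Rightarrow> 't list \<Rightarrow> 't \<Rightarrow> ((nat \<Rightarrow>\<^sub>0 int) \<times> 't) set" where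
  "ttilde T s ts t = relation_subgroup T s ts #>\<^bsub>free_times T (length ts + 2 * s)\<^esub> (0, t)"

definition entry_degree ::
    "'t monoid \<Rightarrow> nat \<Rightarrow> 't list \<Rightarrow> nat \<Rightarrow> nat \<Rightarrow> 't \<Rightarrow> ((nat \<Rightarrow>\<^sub>0 int) \<times> 't) set" where
  "entry_degree T s ts i j t = (let G = Gtilde T s ts in
     gtilde T s ts i \<otimes>\<^bsub>G\<^esub> inv\<^bsub>G\<^esub> gtilde T s ts j \<otimes>\<^bsub>G\<^esub> ttilde T s ts t)"

definition Phi_mat :: "nat \<Rightarrow> 'd::real_algebra_1 list \<Rightarrow> real \<Rightarrow> 'd mat" where
  "Phi_mat s ds \<delta> = diag_block_mat
     (map (\<lambda>d. mat 1 1 (\<lambda>_. d)) ds @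
      replicate s (mat_of_rows_list 2 [[0, 1], [of_real \<delta>, 0]]))"

text \<open>The component of degree \<open>g\<close> below is the span of the \<open>E\<^sub>i\<^sub>j \<otimes> d\<close> with \<open>d \<in> D t\<close> and
  \<open>g\<^sub>i g\<^sub>j\<^sup>-\<^sup>1 t = g\<close>, described entry by entry (the span of the empty set is \<open>{0}\<close>).\<close>

definition M_alg ::
    "'t monoid \<Rightarrow> ('t \<Rightarrow> 'd::real_algebra_1 set) \<Rightarrow> ('d \<Rightarrow> 'd) \<Rightarrow> nat \<Rightarrow> nat \<Rightarrow> 'd list \<Rightarrow> real \<Rightarrow>
     (((nat \<Rightarrow>\<^sub>0 int) \<times> 't) set, 'd mat) graded_inv_algebra" where
  "M_alg T D \<phi> q s ds \<delta> =
     (let k = q + 2 * s; ts = map (gr_deg T D) ds; \<Phi> = Phi_mat s ds \<delta> in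
      ring_mat TYPE('d) k
       \<lparr>smult = (\<lambda>r X. map_mat (scaleR r) X),
        grading_group = Gtilde T s ts,
        component = (\<lambda>g. {X \<in> carrier_mat k k. \<forall>i<k. \<forall>j<k.
           X $$ (i, j) \<in> span (\<Union>t\<in>{t \<in> carrier T. entry_degree T s ts i j t = g}. D t)}),
        invol = (\<lambda>X. inv\<^bsub>ring_mat TYPE('d) k ()\<^esub> \<Phi> * map_mat \<phi> (transpose_mat X) * \<Phi>)\<rparr>)"

definition admissible ::
    "'t monoid \<Rightarrow> ('t \<Rightarrow> 'd::real_algebra_1 set) \<Rightarrow> ('d \<Rightarrow> 'd) \<Rightarrow>
     nat \<Rightarrow> nat \<Rightarrow> 'd list \<Rightarrow> real \<Rightarrow> bool" where
  "admissible T D \<phi> q s ds \<delta> \<longleftrightarrow>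
     length ds = q \<and> \<not> (q = 0 \<and> s = 0) \<and> \<delta> \<in> {1, -1} \<and>
     (\<forall>d\<in>set ds. d \<in> gr_units T D \<and> \<phi> d = \<delta> *\<^sub>R d) \<and>
     ((alg_center :: 'd set) \<noteq> range of_real \<longrightarrow> \<delta> = 1)"


section \<open>Subgroups of \<open>T\<close>, forms, and automorphism groups\<close>

definition torsion_part :: "'t monoid \<Rightarrow> nat \<Rightarrow> 't set" where
  "torsion_part T n = {t \<in> carrier T. t [^]\<^bsub>T\<^esub> n = \<one>\<^bsub>T\<^esub>}"

definition power_part :: "'t monoid \<Rightarrow> nat \<Rightarrow> 't set" where
  "power_part T n = {t [^]\<^bsub>T\<^esub> n | t. t \<in> carrier T}"

definition supp_center :: "'t monoid \<Rightarrow> ('t \<Rightarrow> 'd::real_algebra_1 set) \<Rightarrow> 't set" where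
  "supp_center T D = {t \<in> carrier T. D t \<inter> alg_center \<noteq> {0}}"

definition elementary_abelian_2 :: "'g monoid \<Rightarrow> bool" where
  "elementary_abelian_2 G \<longleftrightarrow> comm_group G \<and> (\<forall>x\<in>carrier G. x \<otimes>\<^bsub>G\<^esub> x = \<one>\<^bsub>G\<^esub>)"

text \<open>The commutation factor \<open>\<beta>\<close> takes values in the multiplicative group of \<open>D\<^sub>e\<close>, which is a copy
  of \<open>\<real>\<close> or of \<open>\<complex>\<close>.\<close>

definition is_beta_value ::
    "'t monoid \<Rightarrow> ('t \<Rightarrow> 'd::real_algebra_1 set) \<Rightarrow> 't \<Rightarrow> 't \<Rightarrow> 'd \<Rightarrow> bool" where
  "is_beta_value T D s t b \<longleftrightarrow> b \<in> D \<one>\<^bsub>T\<^esub> \<and> (\<forall>x\<in>D s. \<forall>y\<in>D t. x * y = b * (y * x))"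

definition beta :: "'t monoid \<Rightarrow> ('t \<Rightarrow> 'd::real_algebra_1 set) \<Rightarrow> 't \<Rightarrow> 't \<Rightarrow> 'd" where
  "beta T D s t = (THE b. is_beta_value T D s t b)"

definition is_mu_value :: "('t \<Rightarrow> 'd::real_algebra_1 set) \<Rightarrow> 't \<Rightarrow> real \<Rightarrow> bool" where
  "is_mu_value D t m \<longleftrightarrow> m \<in> {1, -1} \<and>
     (\<forall>x\<in>D t. x \<noteq> 0 \<longrightarrow> (\<exists>r>0. x * x = of_real (m * r)))"

definition mu :: "('t \<Rightarrow> 'd::real_algebra_1 set) \<Rightarrow> 't \<Rightarrow> real" where
  "mu D t = (THE m. is_mu_value D t m)"

text \<open>Forms on a quotient group, whose elements are cosets, induced from forms constant on them.\<close>

definition induced_form :: "('t \<Rightarrow> 'r) \<Rightarrow> 't set \<Rightarrow> 'r" where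
  "induced_form m X = the_elem (m ` X)"

definition induced_biform :: "('t \<Rightarrow> 't \<Rightarrow> 'r) \<Rightarrow> 't set \<Rightarrow> 't set \<Rightarrow> 'r" where
  "induced_biform b X Y = the_elem {b s t | s t. s \<in> X \<and> t \<in> Y}"

definition alternating_bicharacter ::
    "'g monoid \<Rightarrow> 'd::real_algebra_1 set \<Rightarrow> ('g \<Rightarrow> 'g \<Rightarrow> 'd) \<Rightarrow> bool" where
  "alternating_bicharacter G E b \<longleftrightarrow>
     (\<forall>x\<in>carrier G. \<forall>y\<in>carrier G. b x y \<in> E - {0}) \<and>
     (\<forall>x\<in>carrier G. \<forall>y\<in>carrier G. \<forall>z\<in>carrier G.
        b (x \<otimes>\<^bsub>G\<^esub> y) z = b x z * b y z \<and> b z (x \<otimes>\<^bsub>G\<^esub> y) = b z x * b z y) \<and>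
     (\<forall>x\<in>carrier G. b x x = 1)"

definition nondegenerate :: "'g monoid \<Rightarrow> ('g \<Rightarrow> 'g \<Rightarrow> 'd::real_algebra_1) \<Rightarrow> bool" where
  "nondegenerate G b \<longleftrightarrow>
     (\<forall>x\<in>carrier G. (\<forall>y\<in>carrier G. b x y = 1) \<longrightarrow> x = \<one>\<^bsub>G\<^esub>)"

definition quadratic_form ::
    "'g monoid \<Rightarrow> ('g \<Rightarrow> 'g \<Rightarrow> 'd::real_algebra_1) \<Rightarrow> ('g \<Rightarrow> real) \<Rightarrow> bool" where
  "quadratic_form G b m \<longleftrightarrow>
     alternating_bicharacter G {1, -1} b \<and> (\<forall>x\<in>carrier G. m x \<in> {1, -1}) \<and>
     (\<forall>x\<in>carrier G. \<forall>y\<in>carrier G. of_real (m (x \<otimes>\<^bsub>G\<^esub> y)) = of_real (m x * m y) * b x y)"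

definition Aut_form :: "'g monoid \<Rightarrow> ('g \<Rightarrow> 'r) \<Rightarrow> ('g \<Rightarrow> 'g) monoid" where
  "Aut_form G m = AutoGroup G
     \<lparr>carrier := {\<alpha> \<in> carrier (AutoGroup G). \<forall>x\<in>carrier G. m (\<alpha> x) = m x}\<rparr>"

definition Aut_biform :: "'g monoid \<Rightarrow> ('g \<Rightarrow> 'g \<Rightarrow> 'r) \<Rightarrow> ('g \<Rightarrow> 'g) monoid" where
  "Aut_biform G b = AutoGroup G
     \<lparr>carrier := {\<alpha> \<in> carrier (AutoGroup G).
        \<forall>x\<in>carrier G. \<forall>y\<in>carrier G. b (\<alpha> x) (\<alpha> y) = b x y}\<rparr>"

definition semidirect :: "'g monoid \<Rightarrow> ('g \<Rightarrow> 'g) monoid \<Rightarrow> ('g \<times> ('g \<Rightarrow> 'g)) monoid" where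
  "semidirect G A =
     \<lparr>carrier = carrier G \<times> carrier A,
      monoid.mult = (\<lambda>(v, \<alpha>) (w, \<gamma>). (v \<otimes>\<^bsub>G\<^esub> \<alpha> w, \<alpha> \<otimes>\<^bsub>A\<^esub> \<gamma>)),
      one = (\<one>\<^bsub>G\<^esub>, \<one>\<^bsub>A\<^esub>)\<rparr>"

definition affine_action :: "'g monoid \<Rightarrow> 'g \<times> ('g \<Rightarrow> 'g) \<Rightarrow> 'g \<Rightarrow> 'g" where
  "affine_action G = (\<lambda>(w, \<alpha>) v. w \<otimes>\<^bsub>G\<^esub> \<alpha> v)"

text \<open>Action on \<open>T/H\<close> of an automorphism of \<open>T\<close> leaving \<open>H\<close> invariant.\<close>

definition coset_action :: "('t \<Rightarrow> 't) \<Rightarrow> 't set \<Rightarrow> 't set" where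
  "coset_action \<alpha> X = \<alpha> ` X"


section \<open>The flag in \<open>V = T/T\<^sup>[\<^sup>2\<^sup>]\<close>\<close>

definition flag_space :: "'t monoid \<Rightarrow> 't set monoid" where
  "flag_space T = T Mod power_part T 2"

definition flag_part :: "'t monoid \<Rightarrow> nat \<Rightarrow> 't set set" where
  "flag_part T i = (\<lambda>t. power_part T 2 #>\<^bsub>T\<^esub> t) ` torsion_part T (2 ^ i)"

definition flag_quotient :: "'t monoid \<Rightarrow> nat \<Rightarrow> 't set set monoid" where
  "flag_quotient T i = (flag_space T)\<lparr>carrier := flag_part T i\<rparr> Mod flag_part T (i - 1)"

definition flag_class :: "'t monoid \<Rightarrow> nat \<Rightarrow> 't \<Rightarrow> 't set set" where
  "flag_class T i t = flag_part T (i - 1) #>\<^bsub>flag_space T\<^esub> (power_part T 2 #>\<^bsub>T\<^esub> t)"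

definition flag_form ::
    "'t monoid \<Rightarrow> ('t \<Rightarrow> 'd::real_algebra_1 set) \<Rightarrow> nat \<Rightarrow> 't set set \<Rightarrow> 't set set \<Rightarrow> 'd" where
  "flag_form T D i X Y = the_elem {beta T D s t ^ (2 ^ (i - 1)) | s t.
     s \<in> torsion_part T (2 ^ i) \<and> t \<in> torsion_part T (2 ^ i) \<and>
     flag_class T i s = X \<and> flag_class T i t = Y}"

definition nontrivial_step :: "'t monoid \<Rightarrow> nat \<Rightarrow> bool" where
  "nontrivial_step T i \<longleftrightarrow> i \<ge> 1 \<and> flag_part T i \<noteq> flag_part T (i - 1)"

definition flag_forms_symplectic ::
    "'t monoid \<Rightarrow> ('t \<Rightarrow> 'd::real_algebra_1 set) \<Rightarrow> bool" where
  "flag_forms_symplectic T D \<longleftrightarrow> (\<forall>i. nontrivial_step T i \<longrightarrow>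
     (\<forall>s\<in>torsion_part T (2 ^ i). \<forall>t\<in>torsion_part T (2 ^ i).
        flag_form T D i (flag_class T i s) (flag_class T i t) = beta T D s t ^ (2 ^ (i - 1))) \<and>
     alternating_bicharacter (flag_quotient T i) {1, -1} (flag_form T D i) \<and>
     nondegenerate (flag_quotient T i) (flag_form T D i))"

text \<open>\<open>GL(V)\<close> is the automorphism group of the elementary abelian \<open>2\<close>-group \<open>V\<close>; an element
  \<open>\<alpha>\<close> stabilizing the flag acts on \<open>V\<^sub>i / V\<^sub>i\<^sub>-\<^sub>1\<close> by taking images of cosets.\<close>

definition flag_stabilizer ::
    "'t monoid \<Rightarrow> ('t \<Rightarrow> 'd::real_algebra_1 set) \<Rightarrow> ('t set \<Rightarrow> 't set) set" where
  "flag_stabilizer T D = {\<alpha> \<in> carrier (AutoGroup (flag_space T)).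
     (\<forall>i. \<alpha> ` flag_part T i = flag_part T i) \<and>
     (\<forall>i. nontrivial_step T i \<longrightarrow>
        (\<forall>X\<in>carrier (flag_quotient T i). \<forall>Y\<in>carrier (flag_quotient T i).
           flag_form T D i (\<alpha> ` X) (\<alpha> ` Y) = flag_form T D i X Y))}"


section \<open>Signature and the classification predicate\<close>

definition signature_real :: "'d::real_algebra_1 list \<Rightarrow> int" where
  "signature_real ds =
     \<bar>int (length (filter pos_real ds)) - int (length (filter neg_real ds))\<bar>"

text \<open>Whether \<open>c d \<phi>(c)\<close> is positive or negative does not depend on the choice of \<open>c\<close>; existence
  of some \<open>c\<close> is used.\<close>

definition counts_as ::
    "'t monoid \<Rightarrow> ('t \<Rightarrow> 'd::real_algebra_1 set) \<Rightarrow> ('d \<Rightarrow> 'd) \<Rightarrow> ('d \<Rightarrow> bool) \<Rightarrow> 'd \<Rightarrow> bool" where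
  "counts_as T D \<phi> P d \<longleftrightarrow>
     gr_deg T D d \<in> power_part T 2 \<and>
     (\<exists>s\<in>carrier T. s \<otimes>\<^bsub>T\<^esub> s = inv\<^bsub>T\<^esub> (gr_deg T D d) \<and>
        (\<exists>c\<in>D s. c \<noteq> 0 \<and> P (c * d * \<phi> c)))"

definition signature_complex ::
    "'t monoid \<Rightarrow> ('t \<Rightarrow> 'd::real_algebra_1 set) \<Rightarrow> ('d \<Rightarrow> 'd) \<Rightarrow> 'd list \<Rightarrow> int" where
  "signature_complex T D \<phi> ds =
     \<bar>int (length (filter (counts_as T D \<phi> pos_real) ds)) -
      int (length (filter (counts_as T D \<phi> neg_real) ds))\<bar>"

text \<open>\<open>None\<close> stands for an undefined signature.\<close>

definition signature ::
    "'t monoid \<Rightarrow> ('t \<Rightarrow> 'd::real_algebra_1 set) \<Rightarrow> ('d \<Rightarrow> 'd) \<Rightarrow> real \<Rightarrow> 'd list \<Rightarrow> int option" where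
  "signature T D \<phi> \<delta> ds =
     (if iso_split_complex (alg_center :: 'd set) \<or> \<delta> \<noteq> 1 then None
      else if iso_complex (D \<one>\<^bsub>T\<^esub>) then Some (signature_complex T D \<phi> ds)
      else Some (signature_real ds))"

definition coset_multiset ::
    "'t monoid \<Rightarrow> ('t \<Rightarrow> 'd::real_algebra_1 set) \<Rightarrow> 't set \<Rightarrow> 'd list \<Rightarrow> 't set multiset" where
  "coset_multiset T D H ds = mset (map (\<lambda>d. H #>\<^bsub>T\<^esub> gr_deg T D d) ds)"

definition multiset_orbit ::
    "'a monoid \<Rightarrow> ('a \<Rightarrow> 'v \<Rightarrow> 'v) \<Rightarrow> 'v multiset \<Rightarrow> 'v multiset set" where
  "multiset_orbit A act = orbit A (\<lambda>a. image_mset (act a))"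

definition M_classified_by ::
    "'t monoid \<Rightarrow> ('t \<Rightarrow> 'd::real_algebra_1 set) \<Rightarrow> ('d \<Rightarrow> 'd) \<Rightarrow>
     't set \<Rightarrow> 'a monoid \<Rightarrow> ('a \<Rightarrow> 't set \<Rightarrow> 't set) \<Rightarrow> bool" where
  "M_classified_by T D \<phi> H A act \<longleftrightarrow>
     subgroup H T \<and> elementary_abelian_2 (T Mod H) \<and>
     (\<forall>q s ds \<delta> q' s' ds' \<delta>'.
        admissible T D \<phi> q s ds \<delta> \<longrightarrow> admissible T D \<phi> q' s' ds' \<delta>' \<longrightarrow>
        (gr_inv_equivalent (M_alg T D \<phi> q s ds \<delta>) (M_alg T D \<phi> q' s' ds' \<delta>') \<longleftrightarrow>
           q = q' \<and> s = s' \<and> \<delta> = \<delta>' \<and>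
           signature T D \<phi> \<delta> ds = signature T D \<phi> \<delta>' ds' \<and>
           multiset_orbit A act (coset_multiset T D H ds) =
           multiset_orbit A act (coset_multiset T D H ds')))"

end

(* Comparing primitive idempotents of the neutral component shows that two algebras
M(D, phi, q, s, d, delta) and M(D, phi, q', s', d', delta') are equivalent iff q = q', s = s' and there
are a graded automorphism h of D, a homogeneous unit v and a permutation p such that
v h(phi(x)) = phi(h(x)) v, phi(v) = delta delta' v, and phi(c_i) d'_p(i) c_i = v h(d_i) for some
homogeneous units c_i; the hyperbolic blocks impose no further condition. It remains to decide which
automorphisms of T are degree maps of such h, which degrees v can have, and when the signs match.
Isometries of T lift to D by enlarging, one degree at a time, a multiplicative graph that does not contain
(1, -1), and then fixing the positive scalars by x^N, N = |T|. If the centre does not split, the degree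
of v is orthogonal to T_[2], hence trivial in T/H; if it splits, that degree gives the translations.
Elements whose degree is not a square can change sign, the others are counted by the signature.
If D_e is the field of complex numbers, counting characters gives (T_[n])^perp = T^[n], so the forms
on the flag are nondegenerate, and an element of the stabilizer is lifted by splitting off hyperbolic
pairs of largest 2-power order. *)

theory Submission
  imports Defs
begin

section \<open>The grading group\<close>

text \<open>An equivalence only has to permute homogeneous components and comes with no homomorphism
  of grading groups. Hence the neutral component must be recognised by the identity matrix in it,
  and conversely equality of entry degrees must be shown to be both preserved and reflected, which
  forces work with the presentation of \<open>Gtilde\<close>. Signs are the second obstacle: the
  recipes for the signature differ from case to case, and are replaced by one question, whether
  \<open>d\<close> has the form \<open>e * \<phi> e\<close>. The third is that the group acting on
  T/H is in general not the group of degree maps that occur. Over a complex centre with real neutral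
  component an isometry of T/H has to be lifted through a kernel of order two with the help of
  \<mu>; over a split centre the lift must also absorb the degree of \<open>v\<close>; and a graded
  automorphism may conjugate a complex neutral component, so that its degree map preserves \<beta>
  only up to conjugation. In this last situation only the induced map of the flag is an honest
  isometry, and lifting isometries of the flag back to isometries of \<beta> closes the gap.\<close>

lemma quotient_cancel:
 assumes "comm_group H" "a \<in> carrier H" "b \<in> carrier H" "c \<in> carrier H"
 shows "(a \<otimes>\<^bsub>H\<^esub> c) \<otimes>\<^bsub>H\<^esub> inv\<^bsub>H\<^esub> (b \<otimes>\<^bsub>H\<^esub> c) = a \<otimes>\<^bsub>H\<^esub> inv\<^bsub>H\<^esub> b"
proof -
 interpret H: comm_group H by fact
 have "c \<otimes>\<^bsub>H\<^esub> inv\<^bsub>H\<^esub> (b \<otimes>\<^bsub>H\<^esub> c) = inv\<^bsub>H\<^esub> b"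
  using assms by (simp add: H.inv_mult_group H.m_assoc[symmetric])
 then show ?thesis using assms by (simp add: H.m_assoc)
qed

text \<open>The involution of the index set along which the matrix \<Phi> lives: row
  \<open>i\<close> has its only nonzero entry in column \<open>partner q i\<close>. Its fixed points
  are the blocks of size 1, which is how \<open>q\<close> is read off later.\<close>

definition partner :: "nat \<Rightarrow> nat \<Rightarrow> nat" where
 "partner q i = (if i < q then i else if even (i - q) then i + 1 else i - 1)"

lemma partner_add: "partner q (q + m) = q + (if even m then m + 1 else m - 1)"
 by (auto simp: partner_def elim: oddE)

lemma partner_cases:
 obtains "i < q" "partner q i = i" | m where "i = q + m" "partner q i = q + (if even m then m + 1 else m - 1)"
proof (cases "i < q")
 case False
 then obtain m where "i = q + m" by (metis le_Suc_ex not_less)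
 then show ?thesis using that(2) partner_add by simp
qed (use that(1) in \<open>simp add: partner_def\<close>)

lemma partner_partner [simp]: "partner q (partner q i) = i"
 by (rule partner_cases[of i q]) (auto simp: partner_add)

lemma partner_less:
 assumes "i < q + 2 * s" shows "partner q i < q + 2 * s"
proof (cases rule: partner_cases[of i q])
 case (2 m)
 then have "m < 2 * s" using assms by simp
 then have "even m \<Longrightarrow> m + 1 < 2 * s" by presburger
 then show ?thesis using 2 \<open>m < 2 * s\<close> by auto
qed (use assms in simp)

lemma partner_fixed: "partner q i = i \<longleftrightarrow> i < q"
 by (rule partner_cases[of i q]) (auto elim: oddE)

lemma partner_ge: "partner q i < q \<longleftrightarrow> i < q"
 by (rule partner_cases[of i q]) auto

definition block_degree :: "'t monoid \<Rightarrow> 't list \<Rightarrow> nat \<Rightarrow> 't" where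
 "block_degree T ts i = (if i < length ts then ts ! i else \<one>\<^bsub>T\<^esub>)"

text \<open>Indexing the equated elements by all \<open>k\<close> indices, rather than by diagonal
  entries and blocks, treats both kinds of relations alike; the two indices of a hyperbolic block
  give the same element.\<close>

definition block_element :: "'t monoid \<Rightarrow> 't list \<Rightarrow> nat \<Rightarrow> (nat \<Rightarrow>\<^sub>0 int) \<times> 't" where
 "block_element T ts i =
   (frag_of i + frag_of (partner (length ts) i), inv\<^bsub>T\<^esub> block_degree T ts i)"

definition entry_element :: "nat \<Rightarrow> nat \<Rightarrow> 't \<Rightarrow> (nat \<Rightarrow>\<^sub>0 int) \<times> 't" where
 "entry_element i j t = (frag_of i - frag_of j, t)"

locale abelian_grading = comm_group T for T :: "'t monoid" (structure)
begin

abbreviation "TT \<equiv> carrier T"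

lemma comm_group_free_times: "comm_group (free_times T k)"
 unfolding free_times_def
 by (rule group.group_comm_groupI)
  (auto intro: DirProd_group simp: m_comm add.commute)

lemma carrier_free_times: "carrier (free_times T k) = {(a, t). Poly_Mapping.keys a \<subseteq> {..<k} \<and> t \<in> TT}"
 by (auto simp: free_times_def)

lemma mult_free_times [simp]: "(a, t) \<otimes>\<^bsub>free_times T k\<^esub> (b, u) = (a + b, t \<otimes> u)"
 by (simp add: free_times_def)

lemma one_free_times [simp]: "\<one>\<^bsub>free_times T k\<^esub> = (0, \<one>)"
 by (simp add: free_times_def)

lemma inv_free_times [simp]:
 "(a, t) \<in> carrier (free_times T k) \<Longrightarrow> inv\<^bsub>free_times T k\<^esub> (a, t) = (- a, inv t)"
 using is_group by (simp add: free_times_def)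

lemma keys_frag_add: "Poly_Mapping.keys (frag_of i + frag_of j :: nat \<Rightarrow>\<^sub>0 int) \<subseteq> {i, j}"
 using Poly_Mapping.keys_add[of "frag_of i" "frag_of j"] by auto

lemma keys_frag_diff: "Poly_Mapping.keys (frag_of i - frag_of j :: nat \<Rightarrow>\<^sub>0 int) \<subseteq> {i, j}"
 using keys_diff[of "frag_of i" "frag_of j"] by auto

lemma equated_elements_eq:
 assumes "set ts \<subseteq> TT"
 shows "equated_elements T s ts = block_element T ts ` {..<length ts + 2 * s}" (is "?L = ?R")
proof
 show "?L \<subseteq> ?R"
 proof
  fix x assume "x \<in> ?L"
  then consider i where "i < length ts" "x = (frag_of i + frag_of i, inv (ts ! i))"
   | j where "j < s" "x = (frag_of (length ts + 2 * j) + frag_of (length ts + 2 * j + 1), \<one>)"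
   unfolding equated_elements_def Let_def by blast
  then show "x \<in> ?R"
  proof cases
   case 1
   then have "x = block_element T ts i" by (simp add: block_element_def block_degree_def partner_def)
   then show ?thesis using 1 by auto
  next
   case 2
   then have "x = block_element T ts (length ts + 2 * j)"
    by (simp add: block_element_def block_degree_def partner_add)
   then show ?thesis using 2 by auto
  qed
 qed
 show "?R \<subseteq> ?L"
 proof (rule image_subsetI)
  fix i assume "i \<in> {..<length ts + 2 * s}"
  then have i: "i < length ts + 2 * s" by simp
  have "i < length ts \<or> (\<exists>j<s. i = length ts + 2 * j \<or> i = length ts + 2 * j + 1)"
  proof (cases "i < length ts")
   case False
   then have "(i - length ts) div 2 < s" "i = length ts + 2 * ((i - length ts) div 2) \<or> i = length ts + 2 * ((i - length ts) div 2) + 1"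
    using i by (simp_all, presburger+)
   then show ?thesis by blast
  qed simp
  then consider "i < length ts" | j where "i = length ts + 2 * j" "j < s"
   | j where "i = length ts + 2 * j + 1" "j < s" by blast
  then show "block_element T ts i \<in> ?L"
   by cases (auto simp: equated_elements_def Let_def block_element_def block_degree_def partner_def add.commute)
 qed
qed

lemma block_degree_closed: "set ts \<subseteq> TT \<Longrightarrow> block_degree T ts i \<in> TT"
 by (auto simp: block_degree_def)

lemma block_element_closed:
 assumes "set ts \<subseteq> TT" "i < length ts + 2 * s"
 shows "block_element T ts i \<in> carrier (free_times T (length ts + 2 * s))"
 using partner_less[OF assms(2)] assms block_degree_closed[OF assms(1), of i]
  keys_frag_add[of i "partner (length ts) i"]
 by (auto simp: block_element_def carrier_free_times)

lemma entry_element_closed: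
 assumes "i < k" "j < k" "t \<in> TT"
 shows "entry_element i j t \<in> carrier (free_times T k)"
 using assms keys_frag_diff[of i j] by (auto simp: entry_element_def carrier_free_times)

lemma relation_subgroup_eq:
 assumes "set ts \<subseteq> TT"
 shows "relation_subgroup T s ts = (let k = length ts + 2 * s; P = free_times T k in
  generate P {block_element T ts i \<otimes>\<^bsub>P\<^esub> inv\<^bsub>P\<^esub> block_element T ts j | i j. i < k \<and> j < k})"
 unfolding relation_subgroup_def equated_elements_eq[OF assms] Let_def
 by (rule arg_cong[of _ _ "generate _"]) blast

lemma subgroup_relation:
 assumes "set ts \<subseteq> TT"
 shows "subgroup (relation_subgroup T s ts) (free_times T (length ts + 2 * s))"
proof -
 interpret P: comm_group "free_times T (length ts + 2 * s)" by (rule comm_group_free_times)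
 show ?thesis unfolding relation_subgroup_eq[OF assms] Let_def
  by (rule P.generate_is_subgroup) (use block_element_closed[OF assms] in auto)
qed

text \<open>The relations are quotients of equated elements, so a homomorphism may multiply all of
  these by one common factor \<open>c\<close>: it cancels in the quotients. In the application
  \<open>c\<close> is the degree of the twisting element \<open>v\<close>.\<close>

lemma relation_subgroup_image:
 assumes ts: "set ts \<subseteq> TT" "set us \<subseteq> TT"
  and k: "length ts + 2 * s = k" "length us + 2 * s' = k'"
  and h: "h \<in> hom (free_times T k) (free_times T k')"
  and c: "c \<in> carrier (free_times T k')"
  and img: "\<And>i. i < k \<Longrightarrow> \<exists>j<k'. h (block_element T ts i) = block_element T us j \<otimes>\<^bsub>free_times T k'\<^esub> c"
  and x: "x \<in> relation_subgroup T s ts"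
 shows "h x \<in> relation_subgroup T s' us"
proof -
 interpret P: comm_group "free_times T k" by (rule comm_group_free_times)
 interpret Q: comm_group "free_times T k'" by (rule comm_group_free_times)
 interpret h: group_hom "free_times T k" "free_times T k'" h by unfold_locales (rule h)
 let ?K = "{block_element T ts i \<otimes>\<^bsub>free_times T k\<^esub> inv\<^bsub>free_times T k\<^esub> block_element T ts j | i j. i < k \<and> j < k}"
 let ?L = "{block_element T us i \<otimes>\<^bsub>free_times T k'\<^esub> inv\<^bsub>free_times T k'\<^esub> block_element T us j | i j. i < k' \<and> j < k'}"
 have cl: "block_element T ts i \<in> carrier (free_times T k)" if "i < k" for i
  using block_element_closed[OF ts(1), of i s] that k by simp
 have cl': "block_element T us i \<in> carrier (free_times T k')" if "i < k'" for i
  using block_element_closed[OF ts(2), of i s'] that k by simp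
 have sub: "h ` ?K \<subseteq> ?L"
 proof (clarsimp)
  fix i j assume ij: "i < k" "j < k"
  obtain i' j' where i': "i' < k'" "h (block_element T ts i) = block_element T us i' \<otimes>\<^bsub>free_times T k'\<^esub> c"
   and j': "j' < k'" "h (block_element T ts j) = block_element T us j' \<otimes>\<^bsub>free_times T k'\<^esub> c"
   using img ij by meson
  have "h (block_element T ts i \<otimes>\<^bsub>free_times T k\<^esub> inv\<^bsub>free_times T k\<^esub> block_element T ts j)
    = (block_element T us i' \<otimes>\<^bsub>free_times T k'\<^esub> c) \<otimes>\<^bsub>free_times T k'\<^esub>
      inv\<^bsub>free_times T k'\<^esub> (block_element T us j' \<otimes>\<^bsub>free_times T k'\<^esub> c)"
   using cl ij i' j' by simp
  also have "\<dots> = block_element T us i' \<otimes>\<^bsub>free_times T k'\<^esub> inv\<^bsub>free_times T k'\<^esub> block_element T us j'"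
   by (rule quotient_cancel[OF comm_group_free_times]) (use cl' i' j' c in auto)
  finally show "\<exists>i' j'. h (block_element T ts i \<otimes>\<^bsub>free_times T k\<^esub> inv\<^bsub>free_times T k\<^esub> block_element T ts j) =
    block_element T us i' \<otimes>\<^bsub>free_times T k'\<^esub> inv\<^bsub>free_times T k'\<^esub> block_element T us j' \<and> i' < k' \<and> j' < k'"
   using i' j' by blast
 qed
 have "h x \<in> h ` generate (free_times T k) ?K"
  using x unfolding relation_subgroup_eq[OF ts(1)] k Let_def by simp
 also have "\<dots> = generate (free_times T k') (h ` ?K)"
  by (rule h.generate_img[symmetric]) (use cl in auto)
 also have "\<dots> \<subseteq> generate (free_times T k') ?L"
  using sub by (rule Q.mono_generate)
 finally show ?thesis unfolding relation_subgroup_eq[OF ts(2)] k Let_def .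
qed

text \<open>The relation subgroup is enclosed in an explicit subgroup \<open>S\<close> described by
  exponents: even at the fixed indices, equal at partners, and determining the
  \<open>T\<close>-coordinate. For \<open>i \<noteq> j\<close> the exponents of
  \<open>frag_of i - frag_of j\<close> violate parity or symmetry.\<close>

lemma relation_subgroup_entry:
 assumes ts: "set ts \<subseteq> TT" and x: "entry_element i j t \<in> relation_subgroup T s ts"
  and ij: "i < length ts + 2 * s" "j < length ts + 2 * s"
 shows "i = j \<and> t = \<one>"
proof -
 let ?q = "length ts" and ?k = "length ts + 2 * s"
 let ?P = "free_times T ?k"
 interpret P: comm_group ?P by (rule comm_group_free_times)
 \<comment> \<open>The equated element of a fixed index \<open>l\<close> has exponent 2 there and
   the inverse of \<open>ts ! l\<close> as its \<open>T\<close>-coordinate, which forces this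
   formula; hyperbolic indices contribute nothing.\<close>
 let ?f = "\<lambda>a::nat \<Rightarrow>\<^sub>0 int. \<Otimes>l\<in>{..<?q}. (ts ! l) [^] (- (Poly_Mapping.lookup a l div 2))"
 have tsl: "l < ?q \<Longrightarrow> ts ! l \<in> TT" for l using ts by auto
 define sy where "sy a \<longleftrightarrow> (\<forall>l<?k. Poly_Mapping.lookup a l = Poly_Mapping.lookup a (partner ?q l))"
  for a :: "nat \<Rightarrow>\<^sub>0 int"
 define S where "S = {(a, t). (a, t) \<in> carrier ?P \<and> (\<forall>l<?q. even (Poly_Mapping.lookup a l)) \<and>
   sy a \<and> t = ?f a}"
 have sy: "sy 0" "sy a \<Longrightarrow> sy (- a)" "sy a \<Longrightarrow> sy b \<Longrightarrow> sy (a + b)" for a b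
  unfolding sy_def by (metis lookup_zero, metis lookup_uminus, metis lookup_add)
 have fc: "?f a \<in> TT" for a by (rule finprod_closed) (use tsl in auto)
 have f0: "?f 0 = \<one>" by (rule finprod_one_eqI) simp
 have fadd: "?f (a + b) = ?f a \<otimes> ?f b" if "\<forall>l<?q. even (Poly_Mapping.lookup a l)" for a b
 proof -
  have "?f a \<otimes> ?f b = (\<Otimes>l\<in>{..<?q}. (ts ! l) [^] (- (Poly_Mapping.lookup a l div 2)) \<otimes> (ts ! l) [^] (- (Poly_Mapping.lookup b l div 2)))"
   by (rule finprod_multf[symmetric]) (use tsl in auto)
  also have "\<dots> = ?f (a + b)"
  proof (rule finprod_cong')
   fix l assume l: "l \<in> {..<?q}"
   have "(Poly_Mapping.lookup a l + Poly_Mapping.lookup b l) div 2 = Poly_Mapping.lookup a l div 2 + Poly_Mapping.lookup b l div 2"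
    by (rule div_plus_div_distrib_dvd_left) (use that l in auto)
   then show "(ts ! l) [^] (- (Poly_Mapping.lookup a l div 2)) \<otimes> (ts ! l) [^] (- (Poly_Mapping.lookup b l div 2))
    = (ts ! l) [^] (- (Poly_Mapping.lookup (a + b) l div 2))"
    using tsl l by (simp add: lookup_add int_pow_mult[symmetric])
  qed (use tsl in auto)
  finally show ?thesis by simp
 qed
 have "subgroup S ?P"
 proof (rule P.subgroupI)
  show "S \<subseteq> carrier ?P" by (auto simp: S_def)
  have "\<one>\<^bsub>?P\<^esub> \<in> S" using f0 P.one_closed sy by (auto simp: S_def)
  then show "S \<noteq> {}" by blast
 next
  fix x assume "x \<in> S"
  then obtain a t where x: "x = (a, t)" "(a, t) \<in> carrier ?P" "\<forall>l<?q. even (Poly_Mapping.lookup a l)"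
   "sy a" "t = ?f a" by (auto simp: S_def)
  have "?f (- a) \<otimes> ?f a = \<one>" using fadd[OF x(3), of "- a"] f0 m_comm[OF fc[of a] fc[of "- a"]] by simp
  then have "inv (?f a) = ?f (- a)" using fc fc by (rule inv_equality)
  then have t: "inv t = ?f (- a)" using x(5) by simp
  have "(- a, inv t) \<in> carrier ?P" using P.inv_closed[OF x(2)] x(2) by simp
  moreover have "\<forall>l<?q. even (Poly_Mapping.lookup (- a) l)" using x(3) by (simp add: lookup_uminus)
  ultimately have "(- a, inv t) \<in> S" unfolding S_def using sy(2)[OF x(4)] t by blast
  then show "inv\<^bsub>?P\<^esub> x \<in> S" using x(1,2) by simp
 next
  fix x y assume "x \<in> S" "y \<in> S"
  then obtain a t b u where x: "x = (a, t)" "(a, t) \<in> carrier ?P" "\<forall>l<?q. even (Poly_Mapping.lookup a l)"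
   "sy a" "t = ?f a"
   and y: "y = (b, u)" "(b, u) \<in> carrier ?P" "\<forall>l<?q. even (Poly_Mapping.lookup b l)"
   "sy b" "u = ?f b"
   by (auto simp: S_def)
  show "x \<otimes>\<^bsub>?P\<^esub> y \<in> S"
   using P.m_closed[OF x(2) y(2)] x y fadd[OF x(3), of b] sy by (auto simp: S_def lookup_add)
 qed
 moreover have bS: "block_element T ts i \<in> S" if i: "i < ?k" for i
 proof -
  define a where "a = (frag_of i + frag_of (partner ?q i) :: nat \<Rightarrow>\<^sub>0 int)"
  have La: "Poly_Mapping.lookup a l = (if l = i then 1 else 0) + (if l = partner ?q i then 1 else 0)" for l
   by (simp add: a_def lookup_add)
  have be: "block_element T ts i = (a, inv block_degree T ts i)" by (simp add: block_element_def a_def)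
  have "l = i \<longleftrightarrow> partner ?q l = partner ?q i" "l = partner ?q i \<longleftrightarrow> partner ?q l = i" for l
   by (metis partner_partner)+
  then have "sy a" by (auto simp: sy_def La)
  moreover have "\<forall>l<?q. even (Poly_Mapping.lookup a l)"
   using partner_fixed[of ?q i] partner_ge[of ?q i] by (auto simp: La)
  moreover have "?f a = inv block_degree T ts i"
  proof (cases "i < ?q")
   case True
   have "?f a = (\<Otimes>l\<in>{..<?q}. if i = l then inv (ts ! l) else \<one>)"
    by (rule finprod_cong') (use tsl True partner_fixed[of ?q i] in \<open>auto simp: La int_pow_neg int_pow_1\<close>)
   also have "\<dots> = inv (ts ! i)"
    by (rule finprod_singleton) (use True tsl in auto)
   finally show ?thesis using True by (simp add: block_degree_def)
  next
   case False
   have "?f a = \<one>"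
    by (rule finprod_one_eqI) (use False partner_ge[of ?q i] in \<open>auto simp: La\<close>)
   then show ?thesis using False by (simp add: block_degree_def)
  qed
  ultimately show ?thesis using block_element_closed[OF ts i] be by (simp add: S_def)
 qed
 ultimately have "relation_subgroup T s ts \<subseteq> S"
  unfolding relation_subgroup_eq[OF ts] Let_def
  by (intro P.generate_subgroup_incl) (auto intro!: subgroup.m_closed subgroup.m_inv_closed)
 then have "entry_element i j t \<in> S" using x by blast
 then have ev: "\<forall>l<?q. even (Poly_Mapping.lookup (frag_of i - frag_of j :: nat \<Rightarrow>\<^sub>0 int) l)"
  and pa: "\<forall>l<?k. Poly_Mapping.lookup (frag_of i - frag_of j :: nat \<Rightarrow>\<^sub>0 int) l
    = Poly_Mapping.lookup (frag_of i - frag_of j :: nat \<Rightarrow>\<^sub>0 int) (partner ?q l)"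
  and t: "t = ?f (frag_of i - frag_of j)"
  by (auto simp: S_def sy_def entry_element_def)
 have "i = j"
 proof (rule ccontr)
  assume ne: "i \<noteq> j"
  show False
  proof (cases "i < ?q")
   case True
   then show False using ev[rule_format, OF True] ne by (simp add: lookup_minus)
  next
   case False
   then show False using pa[rule_format, OF ij(1)] ne partner_fixed[of ?q i]
    by (auto simp: lookup_minus split: if_splits)
  qed
 qed
 then show ?thesis using t f0 by simp
qed

lemma entry_degree_coset:
 assumes ts: "set ts \<subseteq> TT" and k: "k = length ts + 2 * s" "i < k" "j < k" "t \<in> TT"
 shows "entry_degree T s ts i j t = relation_subgroup T s ts #>\<^bsub>free_times T k\<^esub> entry_element i j t"
  and "entry_degree T s ts i j t \<in> carrier (Gtilde T s ts)"
proof -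
 let ?P = "free_times T k" and ?N = "relation_subgroup T s ts"
 interpret P: comm_group ?P by (rule comm_group_free_times)
 interpret N: normal ?N ?P
  using P.subgroup_imp_normal subgroup_relation[OF ts, of s] k by simp
 have G: "Gtilde T s ts = ?P Mod ?N" by (simp add: Gtilde_def k)
 interpret Q: group "?P Mod ?N" by (rule N.factorgroup_is_group)
 interpret h: group_hom ?P "?P Mod ?N" "\<lambda>a. ?N #>\<^bsub>?P\<^esub> a"
  by unfold_locales (rule N.r_coset_hom_Mod)
 have c: "(frag_of i, \<one>) \<in> carrier ?P" "(frag_of j, \<one>) \<in> carrier ?P" "(0, t) \<in> carrier ?P"
  using k by (auto simp: carrier_free_times)
 have "entry_degree T s ts i j t = ?N #>\<^bsub>?P\<^esub> ((frag_of i, \<one>) \<otimes>\<^bsub>?P\<^esub> inv\<^bsub>?P\<^esub> (frag_of j, \<one>) \<otimes>\<^bsub>?P\<^esub> (0, t))"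
  unfolding entry_degree_def Let_def G gtilde_def ttilde_def k(1)[symmetric]
  using c by (simp only: h.hom_mult h.hom_inv P.m_closed P.inv_closed)
 then show e: "entry_degree T s ts i j t = ?N #>\<^bsub>?P\<^esub> entry_element i j t"
  using c k by (simp add: entry_element_def)
 show "entry_degree T s ts i j t \<in> carrier (Gtilde T s ts)"
  unfolding e G using h.hom_closed entry_element_closed k by blast
qed

lemma entry_degree_eq_iff:
 assumes ts: "set ts \<subseteq> TT" and k: "k = length ts + 2 * s" "i < k" "j < k" "t \<in> TT"
  "i' < k" "j' < k" "t' \<in> TT"
 shows "entry_degree T s ts i j t = entry_degree T s ts i' j' t' \<longleftrightarrow>
  (frag_of i - frag_of j - frag_of i' + frag_of j', t \<otimes> inv t') \<in> relation_subgroup T s ts"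
proof -
 let ?P = "free_times T k" and ?N = "relation_subgroup T s ts"
 interpret P: comm_group ?P by (rule comm_group_free_times)
 have N: "subgroup ?N ?P" using subgroup_relation[OF ts, of s] k by simp
 have e: "entry_element i j t \<in> carrier ?P" "entry_element i' j' t' \<in> carrier ?P"
  using entry_element_closed k by auto
 have "entry_element i j t \<otimes>\<^bsub>?P\<^esub> inv\<^bsub>?P\<^esub> entry_element i' j' t' =
   (frag_of i - frag_of j - frag_of i' + frag_of j', t \<otimes> inv t')"
  using e by (simp add: entry_element_def)
 moreover have "?N #>\<^bsub>?P\<^esub> entry_element i j t = ?N #>\<^bsub>?P\<^esub> entry_element i' j' t' \<longleftrightarrow>
   entry_element i j t \<otimes>\<^bsub>?P\<^esub> inv\<^bsub>?P\<^esub> entry_element i' j' t' \<in> ?N"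
  using e N P.coset_mult_inv1 P.coset_mult_inv2 P.coset_join1 P.coset_join2 P.m_closed P.inv_closed
   subgroup.subset[OF N] by metis
 ultimately show ?thesis using entry_degree_coset(1)[OF ts k(1)] k by simp
qed

lemma entry_degree_same_entry:
 assumes "set ts \<subseteq> TT" "i < length ts + 2 * s" "j < length ts + 2 * s" "t \<in> TT" "t' \<in> TT"
  "entry_degree T s ts i j t = entry_degree T s ts i j t'"
 shows "t = t'"
proof -
 have "entry_element i i (t \<otimes> inv t') \<in> relation_subgroup T s ts"
  using entry_degree_eq_iff[OF assms(1) refl, of i s j t i j t'] assms by (simp add: entry_element_def)
 then have "t \<otimes> inv t' = \<one>" using relation_subgroup_entry assms by blast
 then show ?thesis using assms by (metis inv_closed inv_equality inv_inv)
qed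

text \<open>This is why the neutral component of the matrix algebra consists of diagonal matrices,
  the starting point of the idempotent argument.\<close>

lemma entry_degree_diagonal:
 assumes "set ts \<subseteq> TT" "i < length ts + 2 * s" "j < length ts + 2 * s" "l < length ts + 2 * s"
  "t \<in> TT" "t' \<in> TT"
 shows "entry_degree T s ts i j t = entry_degree T s ts l l t' \<longleftrightarrow> i = j \<and> t = t'"
proof
 assume "entry_degree T s ts i j t = entry_degree T s ts l l t'"
 then have "entry_element i j (t \<otimes> inv t') \<in> relation_subgroup T s ts"
  using entry_degree_eq_iff[OF assms(1) refl, of i s j t l l t'] assms by (simp add: entry_element_def)
 then have "i = j" "t \<otimes> inv t' = \<one>" using relation_subgroup_entry assms by blast+
 then show "i = j \<and> t = t'" using assms by (metis inv_closed inv_equality inv_inv)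
next
 assume "i = j \<and> t = t'"
 then show "entry_degree T s ts i j t = entry_degree T s ts l l t'"
  using entry_degree_eq_iff[OF assms(1) refl, of i s j t l l t'] assms subgroup.one_closed[OF subgroup_relation[OF assms(1), of s]]
  by simp
qed

lemma coset_eq_iff:
 assumes "subgroup N T" "s \<in> TT" "t \<in> TT"
 shows "N #> s = N #> t \<longleftrightarrow> s \<otimes> inv t \<in> N"
proof
 note st = assms(2,3) subgroup.subset[OF assms(1)]
 have c: "s \<otimes> inv t \<in> TT" using st by simp
 {
  assume "N #> s = N #> t"
  then have "N #> (s \<otimes> inv t) = N" using st by (rule coset_mult_inv2)
  then show "s \<otimes> inv t \<in> N" using c assms(1) by (rule coset_join1)
 }
 assume "s \<otimes> inv t \<in> N"
 then have "N #> (s \<otimes> inv t) = N" using c assms(1) by (intro coset_join2)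
 then show "N #> s = N #> t" using st by (rule coset_mult_inv1)
qed

lemma coset_eq_self:
 assumes "subgroup N T" "t \<in> TT"
 shows "N #> t = N \<longleftrightarrow> t \<in> N"
 using assms coset_join1 coset_join2 by blast

lemma carrier_FactGroup: "X \<in> carrier (T Mod N) \<longleftrightarrow> (\<exists>t\<in>TT. X = N #> t)"
 by (auto simp: FactGroup_def RCOSETS_def)

lemma FactGroup_comm: "subgroup N T \<Longrightarrow> comm_group (T Mod N)"
 by (rule abelian_FactGroup)

lemma FactGroup_mult:
 assumes "subgroup N T" "s \<in> TT" "t \<in> TT"
 shows "(N #> s) \<otimes>\<^bsub>T Mod N\<^esub> (N #> t) = N #> (s \<otimes> t)"
 using normal.rcos_sum[OF subgroup_imp_normal] assms by simp

lemma FactGroup_one: "\<one>\<^bsub>T Mod N\<^esub> = N"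
 by simp

lemma elementary_abelian_FactGroup:
 assumes "subgroup N T" "\<And>t. t \<in> TT \<Longrightarrow> t \<otimes> t \<in> N"
 shows "elementary_abelian_2 (T Mod N)"
 unfolding elementary_abelian_2_def
proof (intro conjI ballI FactGroup_comm assms(1))
 fix X assume "X \<in> carrier (T Mod N)"
 then obtain t where t: "t \<in> TT" "X = N #> t" using carrier_FactGroup by blast
 then show "X \<otimes>\<^bsub>T Mod N\<^esub> X = \<one>\<^bsub>T Mod N\<^esub>"
  using FactGroup_mult[OF assms(1) t(1) t(1)] coset_join2[OF _ assms(1) assms(2)[OF t(1)]] by simp
qed

lemma AutoGroup_iff: "a \<in> carrier (AutoGroup G) \<longleftrightarrow> a \<in> hom G G \<and> a \<in> extensional (carrier G) \<and> bij_betw a (carrier G) (carrier G)"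
 by (auto simp: AutoGroup_def auto_def Bij_def)

lemma coset_image:
 assumes N: "subgroup N T" and a: "a \<in> hom T T" "a ` N = N" and t: "t \<in> TT"
 shows "coset_action a (N #> t) = N #> a t"
proof -
 have "a (n \<otimes> t) = a n \<otimes> a t" if "n \<in> N" for n
  using hom_mult[OF a(1)] subgroup.mem_carrier[OF N that] t by blast
 then have "coset_action a (N #> t) = (\<lambda>m. m \<otimes> a t) ` (a ` N)"
  by (auto simp: coset_action_def r_coset_def image_iff)
 then show ?thesis unfolding a(2) by (auto simp: r_coset_def)
qed

text \<open>The restriction is there because elements of \<open>AutoGroup\<close> are
  extensional.\<close>

lemma induced_AutoGroup:
 assumes N: "subgroup N T" and a: "a \<in> carrier (AutoGroup T)" "a ` N = N"
 shows "restrict (coset_action a) (carrier (T Mod N)) \<in> carrier (AutoGroup (T Mod N))" (is "?a \<in> _")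
proof -
 let ?V = "carrier (T Mod N)"
 have h: "a \<in> hom T T" "bij_betw a TT TT" using a(1) by (auto simp: AutoGroup_iff)
 have ac: "a t \<in> TT" if "t \<in> TT" for t using h(1) that by (auto simp: hom_def)
 note ci = coset_image[OF N h(1) a(2)]
 show ?thesis unfolding AutoGroup_iff
 proof (intro conjI)
  show "?a \<in> hom (T Mod N) (T Mod N)"
  proof (rule homI)
   fix X assume "X \<in> ?V"
   then show "?a X \<in> ?V"
    using ci ac carrier_FactGroup by auto
  next
   fix X Y assume "X \<in> ?V" "Y \<in> ?V"
   then obtain s t where st: "s \<in> TT" "X = N #> s" "t \<in> TT" "Y = N #> t" using carrier_FactGroup by metis
   have m: "N #> (s \<otimes> t) \<in> ?V" "N #> s \<in> ?V" "N #> t \<in> ?V"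
    using st carrier_FactGroup by auto
   show "?a (X \<otimes>\<^bsub>T Mod N\<^esub> Y) =
     ?a X \<otimes>\<^bsub>T Mod N\<^esub> ?a Y"
    unfolding st(2,4) FactGroup_mult[OF N st(1,3)] restrict_apply'[OF m(1)] restrict_apply'[OF m(2)] restrict_apply'[OF m(3)]
    using ci[of s] ci[of t] ci[of "s \<otimes> t"] FactGroup_mult[OF N ac[OF st(1)] ac[OF st(3)]] hom_mult[OF h(1) st(1,3)] st by simp
  qed
  show "bij_betw (?a) (?V) (?V)"
  proof (rule bij_betw_imageI)
   show "inj_on (?a) (?V)"
   proof (rule inj_onI)
    fix X Y assume XY: "X \<in> ?V" "Y \<in> ?V"
     and eq: "?a X = ?a Y"
    then have "a ` X = a ` Y" by (simp add: coset_action_def)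
    moreover have "X \<subseteq> TT" "Y \<subseteq> TT"
     using XY carrier_FactGroup r_coset_subset_G[OF subgroup.subset[OF N]] by blast+
    ultimately show "X = Y" using bij_betw_imp_inj_on[OF h(2)] by (metis inj_on_image_eq_iff)
   qed
   show "?a ` ?V = ?V"
   proof (intro equalityI subsetI)
    fix Y assume "Y \<in> ?V"
    then obtain t where t: "t \<in> TT" "Y = N #> t" using carrier_FactGroup by blast
    then obtain s where s: "s \<in> TT" "t = a s" using h(2) by (metis bij_betw_imp_surj_on imageE)
    have "Y = ?a (N #> s)"
     using ci[OF s(1)] t s carrier_FactGroup by auto
    then show "Y \<in> ?a ` ?V"
     using s carrier_FactGroup by auto
   next
    fix Y assume "Y \<in> ?a ` ?V"
    then obtain t where "t \<in> TT" "Y = coset_action a (N #> t)" using carrier_FactGroup by auto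
    then show "Y \<in> ?V" unfolding carrier_FactGroup using ci ac by metis
   qed
  qed
 qed simp
qed

end

section \<open>Groups of automorphisms that preserve a form\<close>

lemma Aut_form_iff: "a \<in> carrier (Aut_form G m) \<longleftrightarrow> a \<in> carrier (AutoGroup G) \<and> (\<forall>x\<in>carrier G. m (a x) = m x)"
 by (simp add: Aut_form_def)

lemma Aut_biform_iff: "a \<in> carrier (Aut_biform G b) \<longleftrightarrow>
  a \<in> carrier (AutoGroup G) \<and> (\<forall>x\<in>carrier G. \<forall>y\<in>carrier G. b (a x) (a y) = b x y)"
 by (simp add: Aut_biform_def)

lemma AutoGroup_mult: "a \<in> carrier (AutoGroup G) \<Longrightarrow> g \<in> carrier (AutoGroup G) \<Longrightarrow>
  a \<otimes>\<^bsub>AutoGroup G\<^esub> g = compose (carrier G) a g"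
 by (simp add: AutoGroup_def auto_def BijGroup_def)

lemma (in group) AutoGroup_id: "(\<lambda>x\<in>carrier G. x) \<in> carrier (AutoGroup G)"
 using id_in_auto by (simp add: AutoGroup_def)

lemma (in group) AutoGroup_compose:
 assumes "a \<in> carrier (AutoGroup G)" "g \<in> carrier (AutoGroup G)"
 shows "compose (carrier G) a g \<in> carrier (AutoGroup G)"
 using monoid.m_closed[OF group.is_monoid[OF AutoGroup] assms] AutoGroup_mult[OF assms] by simp

lemma (in group) AutoGroup_inv_into:
 assumes "a \<in> carrier (AutoGroup G)"
 shows "restrict (inv_into (carrier G) a) (carrier G) \<in> carrier (AutoGroup G)"
 using restrict_inv_into_hom restrict_inv_into_Bij assms by (auto simp: AutoGroup_def auto_def)

lemma AutoGroup_apply: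
 assumes "a \<in> carrier (AutoGroup G)" "x \<in> carrier G"
 shows "a x \<in> carrier G" "inv_into (carrier G) a x \<in> carrier G"
  "inv_into (carrier G) a (a x) = x" "a (inv_into (carrier G) a x) = x"
proof -
 have b: "bij_betw a (carrier G) (carrier G)" using assms(1) by (simp add: AutoGroup_def auto_def Bij_def)
 show "a x \<in> carrier G" "inv_into (carrier G) a x \<in> carrier G"
  "inv_into (carrier G) a (a x) = x" "a (inv_into (carrier G) a x) = x"
  using bij_betwE[OF b] bij_betwE[OF bij_betw_inv_into[OF b]] bij_betw_inv_into_left[OF b] bij_betw_inv_into_right[OF b] assms(2) by auto
qed

lemma Aut_biform_group_like:
 fixes G :: "'g monoid"
 assumes "group G"
 shows "(\<lambda>x\<in>carrier G. x) \<in> carrier (Aut_biform G b)"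
  "a \<in> carrier (Aut_biform G b) \<Longrightarrow> g \<in> carrier (Aut_biform G b) \<Longrightarrow> compose (carrier G) a g \<in> carrier (Aut_biform G b)"
  "a \<in> carrier (Aut_biform G b) \<Longrightarrow> restrict (inv_into (carrier G) a) (carrier G) \<in> carrier (Aut_biform G b)"
proof -
 interpret group G by fact
 show "(\<lambda>x\<in>carrier G. x) \<in> carrier (Aut_biform G b)" using AutoGroup_id by (simp add: Aut_biform_iff)
 show "a \<in> carrier (Aut_biform G b) \<Longrightarrow> g \<in> carrier (Aut_biform G b) \<Longrightarrow> compose (carrier G) a g \<in> carrier (Aut_biform G b)"
  using AutoGroup_compose[of a g] AutoGroup_apply(1)[of g G] by (simp add: Aut_biform_iff compose_eq)
 show "a \<in> carrier (Aut_biform G b) \<Longrightarrow> restrict (inv_into (carrier G) a) (carrier G) \<in> carrier (Aut_biform G b)"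
  using AutoGroup_inv_into[of a] AutoGroup_apply[of a G] by (simp add: Aut_biform_iff) metis
qed

lemma Aut_form_group_like:
 fixes G :: "'g monoid"
 assumes G: "group G"
 shows "(\<lambda>x\<in>carrier G. x) \<in> carrier (Aut_form G m)"
  "a \<in> carrier (Aut_form G m) \<Longrightarrow> g \<in> carrier (Aut_form G m) \<Longrightarrow> compose (carrier G) a g \<in> carrier (Aut_form G m)"
  "a \<in> carrier (Aut_form G m) \<Longrightarrow> restrict (inv_into (carrier G) a) (carrier G) \<in> carrier (Aut_form G m)"
proof -
 \<comment> \<open>A form is a two-variable form that ignores its second argument, so the previous
   lemma covers it; the unit serves as that argument.\<close>
 have "carrier (Aut_form G m) = carrier (Aut_biform G (\<lambda>x _. m x))"
  using monoid.one_closed[OF group.is_monoid[OF G]] by (auto simp: Aut_form_def Aut_biform_def)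
 then show "(\<lambda>x\<in>carrier G. x) \<in> carrier (Aut_form G m)"
  "a \<in> carrier (Aut_form G m) \<Longrightarrow> g \<in> carrier (Aut_form G m) \<Longrightarrow> compose (carrier G) a g \<in> carrier (Aut_form G m)"
  "a \<in> carrier (Aut_form G m) \<Longrightarrow> restrict (inv_into (carrier G) a) (carrier G) \<in> carrier (Aut_form G m)"
  using Aut_biform_group_like[OF G] by simp_all
qed

section \<open>Graded-division algebras with involution\<close>

definition hinv :: "'d::real_algebra_1 \<Rightarrow> 'd" where
 "hinv x = (SOME y. x * y = 1 \<and> y * x = 1)"

lemma hinv_eqI:
 assumes "x * y = 1" "y * x = 1"
 shows "hinv x = y"
proof -
 have "x * hinv x = 1 \<and> hinv x * x = 1"
  unfolding hinv_def by (rule someI[of _ y]) (use assms in auto)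
 then have "hinv x = (y * x) * hinv x" using assms by simp
 also have "\<dots> = y * (x * hinv x)" by (simp only: mult.assoc)
 finally show ?thesis using \<open>x * hinv x = 1 \<and> _\<close> by simp
qed

locale gr_div_inv =
 fixes T :: "'t monoid" (structure)
  and D :: "'t \<Rightarrow> 'd::real_algebra_1 set"
  and \<phi> :: "'d \<Rightarrow> 'd"
 assumes fin_dim: "fin_dim TYPE('d)"
  and grd: "graded_division_algebra T D"
  and comm: "comm_group T"
  and De_center: "D \<one> \<subseteq> alg_center"
  and invo: "is_involution \<phi>"
  and deg_pres: "degree_preserving T D \<phi>"
  and cent_simple: "central_simple_with_involution \<phi>"
begin

sublocale abelian_grading T by (intro abelian_grading.intro comm)

abbreviation "deg \<equiv> gr_deg T D"
abbreviation "K \<equiv> (alg_center :: 'd set)"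
abbreviation "degs \<equiv> coset_multiset T D"
abbreviation "P2 \<equiv> power_part T 2"
abbreviation "adm \<equiv> admissible T D \<phi>"
abbreviation "M_equiv q s ds \<delta> q' s' ds' \<delta>' \<equiv> gr_inv_equivalent (M_alg T D \<phi> q s ds \<delta>) (M_alg T D \<phi> q' s' ds' \<delta>')"

lemma grading: "is_grading T D"
 using grd by (simp add: graded_division_algebra_def)

lemma D_subspace: "t \<in> TT \<Longrightarrow> subspace (D t)"
 using grading by (simp add: is_grading_def)

lemma D_0 [simp]: "t \<in> TT \<Longrightarrow> 0 \<in> D t"
 using D_subspace subspace_0 by blast

lemma D_add: "t \<in> TT \<Longrightarrow> x \<in> D t \<Longrightarrow> y \<in> D t \<Longrightarrow> x + y \<in> D t"
 using D_subspace subspace_add by blast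

lemma D_diff: "t \<in> TT \<Longrightarrow> x \<in> D t \<Longrightarrow> y \<in> D t \<Longrightarrow> x - y \<in> D t"
 using D_subspace subspace_diff by blast

lemma D_scale: "t \<in> TT \<Longrightarrow> x \<in> D t \<Longrightarrow> r *\<^sub>R x \<in> D t"
 using D_subspace subspace_scale by blast

lemma D_neg: "t \<in> TT \<Longrightarrow> x \<in> D t \<Longrightarrow> - x \<in> D t"
 using D_subspace subspace_neg by blast

lemma D_mult: "s \<in> TT \<Longrightarrow> t \<in> TT \<Longrightarrow> x \<in> D s \<Longrightarrow> y \<in> D t \<Longrightarrow> x * y \<in> D (s \<otimes> t)"
 using grading by (simp add: is_grading_def)

lemma ex_nonzero: "t \<in> TT \<Longrightarrow> \<exists>x\<in>D t. x \<noteq> 0"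
 using grd D_0 unfolding graded_division_algebra_def by blast

lemma decomposition:
 "\<exists>!f. (\<forall>t\<in>TT. f t \<in> D t) \<and> (\<forall>t. t \<notin> TT \<longrightarrow> f t = 0) \<and>
       finite {t. f t \<noteq> 0} \<and> (\<Sum>t | f t \<noteq> 0. f t) = x"
 using grading unfolding is_grading_def by blast

lemma ex1_eq: "\<exists>!x. P x \<Longrightarrow> P a \<Longrightarrow> P b \<Longrightarrow> a = b"
 by blast

text \<open>One nonzero element from every component gives a linearly independent family, by
  uniqueness of the homogeneous decomposition, and finite dimension bounds the size of such a
  family.\<close>

lemma finite_carrier: "finite TT"
proof -
 obtain x where x: "\<And>t. t \<in> TT \<Longrightarrow> x t \<in> D t \<and> x t \<noteq> 0"
  using ex_nonzero by metis
 have zero: "u t = 0" if F: "finite F" "F \<subseteq> TT" "(\<Sum>t\<in>F. u t *\<^sub>R x t) = 0" "t \<in> F" for F u t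
 proof -
  let ?f = "\<lambda>t. if t \<in> F then u t *\<^sub>R x t else 0"
  let ?P = "\<lambda>f. (\<forall>t\<in>TT. f t \<in> D t) \<and> (\<forall>t. t \<notin> TT \<longrightarrow> f t = 0) \<and>
       finite {t. f t \<noteq> 0} \<and> (\<Sum>t | f t \<noteq> 0. f t) = 0"
  have sub: "{t. ?f t \<noteq> 0} \<subseteq> F" by auto
  have "(\<Sum>t | ?f t \<noteq> 0. ?f t) = (\<Sum>t\<in>F. ?f t)"
   by (rule sum.mono_neutral_left) (use F in auto)
  also have "\<dots> = 0" using F(3) by simp
  finally have "?P ?f"
   using F x finite_subset[OF sub F(1)] D_scale by auto
  moreover have "?P (\<lambda>_. 0)" by simp
  ultimately have "?f = (\<lambda>_. 0)" by (rule ex1_eq[OF decomposition])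
  then have "u t *\<^sub>R x t = 0" using F(4) by metis
  then show ?thesis using x F by auto
 qed
 have inj: "inj_on x TT"
 proof (rule inj_onI, rule ccontr)
  fix s t assume st: "s \<in> TT" "t \<in> TT" "x s = x t" "s \<noteq> t"
  have "(\<Sum>a\<in>{s,t}. (if a = s then 1 else -1::real) *\<^sub>R x a) = 0" using st by simp
  from zero[OF _ _ this, of s] st show False by simp
 qed
 have "independent (x ` TT)"
  unfolding dependent_explicit
 proof clarsimp
  fix S u v assume S: "finite S" "S \<subseteq> x ` TT" "(\<Sum>v\<in>S. u v *\<^sub>R v) = 0" "v \<in> S"
  define F where "F = TT \<inter> x -` S"
  have SF: "S = x ` F" "inj_on x F" using S(2) inj by (auto simp: F_def inj_on_def)
  have fin: "finite F" using S(1) SF finite_imageD by blast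
  have "(\<Sum>t\<in>F. u (x t) *\<^sub>R x t) = 0"
   using S(3) unfolding SF(1) by (simp add: sum.reindex[OF SF(2)])
  then have z: "u (x t) = 0" if "t \<in> F" for t
   using zero[OF fin _ _ that, of "\<lambda>t. u (x t)"] by (simp add: F_def)
  obtain t where "t \<in> F" "v = x t" using S(4) SF(1) by blast
  then show "u v = 0" using z by simp
 qed
 moreover obtain B :: "'d set" where "finite B" "span B = UNIV"
  using fin_dim unfolding fin_dim_def by blast
 ultimately have "finite (x ` TT)"
  using independent_span_bound[of B] by simp
 then show ?thesis using inj finite_imageD by blast
qed

definition comp :: "'d \<Rightarrow> 't \<Rightarrow> 'd" where
 "comp x = (THE f. (\<forall>t\<in>TT. f t \<in> D t) \<and> (\<forall>t. t \<notin> TT \<longrightarrow> f t = 0) \<and>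
       finite {t. f t \<noteq> 0} \<and> (\<Sum>t | f t \<noteq> 0. f t) = x)"

lemma comp_props:
 "(\<forall>t\<in>TT. comp x t \<in> D t) \<and> (\<forall>t. t \<notin> TT \<longrightarrow> comp x t = 0) \<and>
       finite {t. comp x t \<noteq> 0} \<and> (\<Sum>t | comp x t \<noteq> 0. comp x t) = x"
 unfolding comp_def by (rule theI'[OF decomposition])

lemma comp_mem: "t \<in> TT \<Longrightarrow> comp x t \<in> D t"
 using comp_props by blast

lemma sum_comp: "(\<Sum>t\<in>TT. comp x t) = x"
proof -
 have "(\<Sum>t\<in>TT. comp x t) = (\<Sum>t | comp x t \<noteq> 0. comp x t)"
  by (rule sum.mono_neutral_right) (use comp_props[of x] finite_carrier in auto)
 then show ?thesis using comp_props by simp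
qed

lemma comp_sum:
 assumes "\<And>t. t \<in> TT \<Longrightarrow> f t \<in> D t" "s \<in> TT"
 shows "comp (\<Sum>t\<in>TT. f t) s = f s"
proof -
 let ?x = "\<Sum>t\<in>TT. f t"
 let ?f = "\<lambda>t. if t \<in> TT then f t else 0"
 let ?P = "\<lambda>f. (\<forall>t\<in>TT. f t \<in> D t) \<and> (\<forall>t. t \<notin> TT \<longrightarrow> f t = 0) \<and>
       finite {t. f t \<noteq> 0} \<and> (\<Sum>t | f t \<noteq> 0. f t) = ?x"
 have sub: "{t. ?f t \<noteq> 0} \<subseteq> TT" by auto
 have "(\<Sum>t | ?f t \<noteq> 0. ?f t) = (\<Sum>t\<in>TT. ?f t)"
  by (rule sum.mono_neutral_left) (use finite_carrier in auto)
 then have "?P ?f" using assms finite_subset[OF sub finite_carrier] by auto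
 then have "comp ?x = ?f" unfolding comp_def by (rule the1_equality[OF decomposition])
 then show ?thesis using assms by simp
qed

lemma comp_hom:
 assumes "x \<in> D s" "s \<in> TT" "t \<in> TT"
 shows "comp x t = (if t = s then x else 0)"
proof -
 have "comp (\<Sum>t\<in>TT. if t = s then x else 0) t = (if t = s then x else 0)"
  by (rule comp_sum) (use assms in auto)
 then show ?thesis using assms finite_carrier by simp
qed

lemma comp_add: "t \<in> TT \<Longrightarrow> comp (x + y) t = comp x t + comp y t"
 using comp_sum[of "\<lambda>t. comp x t + comp y t" t] sum_comp[of x] sum_comp[of y]
 by (simp add: comp_mem D_add sum.distrib)

lemma comp_scale: "t \<in> TT \<Longrightarrow> comp (r *\<^sub>R x) t = r *\<^sub>R comp x t"
 using comp_sum[of "\<lambda>t. r *\<^sub>R comp x t" t] sum_comp[of x]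
 by (simp add: comp_mem D_scale scaleR_sum_right[symmetric])

lemma comp_zero [simp]: "t \<in> TT \<Longrightarrow> comp 0 t = 0"
 using comp_scale[of t 0 0] by simp

lemma D_disjoint: "s \<in> TT \<Longrightarrow> t \<in> TT \<Longrightarrow> x \<in> D s \<Longrightarrow> x \<in> D t \<Longrightarrow> x \<noteq> 0 \<Longrightarrow> s = t"
 by (metis comp_hom)

lemma comp_mult_right:
 assumes "y \<in> D s" "s \<in> TT" "t \<in> TT"
 shows "comp (x * y) (t \<otimes> s) = comp x t * y"
proof -
 let ?f = "\<lambda>u. comp x (u \<otimes> inv s) * y"
 have bij: "bij_betw (\<lambda>u. u \<otimes> inv s) TT TT"
  by (rule bij_betwI[of _ _ _ "\<lambda>u. u \<otimes> s"]) (use assms in \<open>auto simp: m_assoc\<close>)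
 have "(\<Sum>u\<in>TT. ?f u) = (\<Sum>u\<in>TT. comp x u * y)"
  by (rule sum.reindex_bij_betw[OF bij])
 also have "\<dots> = x * y" using sum_comp[of x] by (simp add: sum_distrib_right[symmetric])
 finally have e: "(\<Sum>u\<in>TT. ?f u) = x * y" .
 have "comp (\<Sum>u\<in>TT. ?f u) (t \<otimes> s) = ?f (t \<otimes> s)"
 proof (rule comp_sum)
  fix u assume u: "u \<in> TT"
  have "?f u \<in> D ((u \<otimes> inv s) \<otimes> s)" using u assms by (intro D_mult comp_mem) auto
  then show "?f u \<in> D u" using u assms by (simp add: m_assoc)
 qed (use assms in auto)
 then show ?thesis using e assms by (simp add: m_assoc)
qed

lemma comp_mult_left:
 assumes "y \<in> D s" "s \<in> TT" "t \<in> TT"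
 shows "comp (y * x) (s \<otimes> t) = y * comp x t"
proof -
 let ?f = "\<lambda>u. y * comp x (inv s \<otimes> u)"
 have bij: "bij_betw (\<lambda>u. inv s \<otimes> u) TT TT"
  by (rule bij_betwI[of _ _ _ "\<lambda>u. s \<otimes> u"]) (use assms in \<open>auto simp: m_assoc[symmetric]\<close>)
 have "(\<Sum>u\<in>TT. ?f u) = (\<Sum>u\<in>TT. y * comp x u)"
  by (rule sum.reindex_bij_betw[OF bij])
 also have "\<dots> = y * x" using sum_comp[of x] by (simp add: sum_distrib_left[symmetric])
 finally have e: "(\<Sum>u\<in>TT. ?f u) = y * x" .
 have "comp (\<Sum>u\<in>TT. ?f u) (s \<otimes> t) = ?f (s \<otimes> t)"
 proof (rule comp_sum)
  fix u assume u: "u \<in> TT"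
  have "?f u \<in> D (s \<otimes> (inv s \<otimes> u))" using u assms by (intro D_mult comp_mem) auto
  then show "?f u \<in> D u" using u assms by (simp add: m_assoc[symmetric])
 qed (use assms in auto)
 then show ?thesis using e assms by (simp add: m_assoc[symmetric])
qed

text \<open>The neutral component of 1 acts as a left identity on every homogeneous element, by
  comparison of degrees, hence on 1 itself.\<close>

lemma one_mem [simp]: "1 \<in> D \<one>"
proof -
 have "comp 1 \<one> * x = x" for x
 proof -
  have "comp x t = comp 1 \<one> * comp x t" if t: "t \<in> TT" for t
   using comp_mult_right[of "comp x t" t \<one> 1] comp_hom[of "comp x t" t t] comp_mem t by simp
  then have "(\<Sum>t\<in>TT. comp x t) = (\<Sum>t\<in>TT. comp 1 \<one> * comp x t)"
   by (intro sum.cong) auto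
  then show ?thesis using sum_comp[of x] by (simp add: sum_distrib_left[symmetric])
 qed
 from this[of 1] show ?thesis using comp_mem[of \<one> 1] by simp
qed

lemma of_real_mem [simp]: "of_real r \<in> D \<one>"
 unfolding of_real_def by (rule D_scale) auto

definition hunit :: "'t \<Rightarrow> 'd \<Rightarrow> bool" where
 "hunit t x \<longleftrightarrow> t \<in> TT \<and> x \<in> D t \<and> x \<noteq> 0"

lemma hunitD: "hunit t x \<Longrightarrow> t \<in> TT" "hunit t x \<Longrightarrow> x \<in> D t" "hunit t x \<Longrightarrow> x \<noteq> 0"
 by (auto simp: hunit_def)

lemma hunit_unique: "hunit t x \<Longrightarrow> hunit s x \<Longrightarrow> s = t"
 unfolding hunit_def using D_disjoint by blast

lemma ex_hunit: "t \<in> TT \<Longrightarrow> \<exists>x. hunit t x"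
 using ex_nonzero by (auto simp: hunit_def)

lemma hunit_inv:
 assumes "hunit t x"
 shows "x * hinv x = 1" "hinv x * x = 1"
proof -
 obtain y where "x * y = 1" "y * x = 1"
  using assms grd unfolding graded_division_algebra_def hunit_def by blast
 then show "x * hinv x = 1" "hinv x * x = 1" using hinv_eqI by metis+
qed

lemma hunit_inv2:
 assumes "hunit t x"
 shows "x * (hinv x * y) = y" "hinv x * (x * y) = y"
 using hunit_inv[OF assms] by (simp_all add: mult.assoc[symmetric])

text \<open>Comparing neutral components in \<open>x * hinv x = 1\<close> shows that the component
  of \<open>hinv x\<close> of degree \<open>inv t\<close> is already an inverse of
  \<open>x\<close>.\<close>

lemma hunit_hinv:
 assumes "hunit t x"
 shows "hunit (inv t) (hinv x)"
proof -
 have t: "t \<in> TT" "x \<in> D t" using assms by (auto simp: hunit_def)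
 have "comp (x * hinv x) (t \<otimes> inv t) = x * comp (hinv x) (inv t)"
  by (rule comp_mult_left) (use t in auto)
 then have "1 = x * comp (hinv x) (inv t)"
  using hunit_inv(1)[OF assms] t comp_hom[of 1 \<one> \<one>] by simp
 then have "hinv x * 1 = hinv x * (x * comp (hinv x) (inv t))" by simp
 then have "hinv x = comp (hinv x) (inv t)"
  by (simp add: hunit_inv2[OF assms])
 then have "hinv x \<in> D (inv t)" using comp_mem[of "inv t" "hinv x"] t by simp
 moreover have "hinv x \<noteq> 0" using hunit_inv(1)[OF assms] by auto
 ultimately show ?thesis using t by (auto simp: hunit_def)
qed

lemma hunit_mult:
 assumes "hunit s x" "hunit t y"
 shows "hunit (s \<otimes> t) (x * y)"
proof -
 have "x * y \<noteq> 0"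
 proof
  assume "x * y = 0"
  then have "hinv x * (x * y) = 0" by simp
  then show False using hunit_inv2[OF assms(1)] assms(2) by (simp add: hunit_def)
 qed
 then show ?thesis using assms D_mult by (auto simp: hunit_def)
qed

lemma hinv_mult: "hunit s x \<Longrightarrow> hunit t y \<Longrightarrow> hinv (x * y) = hinv y * hinv x"
 by (rule hinv_eqI) (simp_all add: mult.assoc hunit_inv2 hunit_inv)

lemma hunit_1 [simp]: "hunit \<one> 1" by (simp add: hunit_def)

lemma hunit_of_real: "r \<noteq> 0 \<Longrightarrow> hunit \<one> (of_real r)" by (simp add: hunit_def)

lemma hunit_scale: "hunit t x \<Longrightarrow> r \<noteq> 0 \<Longrightarrow> hunit t (r *\<^sub>R x)"
 by (auto simp: hunit_def intro: D_scale)

lemma hunit_neg: "hunit t x \<Longrightarrow> hunit t (- x)"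
 by (auto simp: hunit_def intro: D_neg)

lemma gr_units_iff: "x \<in> gr_units T D \<longleftrightarrow> (\<exists>t. hunit t x)"
 by (auto simp: gr_units_def hunit_def)

lemma gr_deg_eq: "hunit t x \<Longrightarrow> gr_deg T D x = t"
 unfolding gr_deg_def by (rule the_equality) (auto simp: hunit_def intro: D_disjoint)

lemma central_comm: "z \<in> alg_center \<Longrightarrow> z * x = x * z"
 by (simp add: alg_center_def)

lemma De_comm: "z \<in> D \<one> \<Longrightarrow> z * x = x * z"
 using De_center central_comm by blast

lemma ratio:
 assumes "hunit t x" "y \<in> D t"
 obtains l where "l \<in> D \<one>" "y = l * x"
proof
 have t: "t \<in> TT" using assms by (simp add: hunit_def)
 show "y * hinv x \<in> D \<one>"
  using D_mult[OF t _ assms(2) hunitD(2)[OF hunit_hinv[OF assms(1)]]] t by simp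
 show "y = y * hinv x * x" using hunit_inv[OF assms(1)] by (simp add: mult.assoc)
qed

lemma ratio_unit:
 assumes "hunit t x" "hunit t y"
 obtains l where "hunit \<one> l" "y = l * x"
 using ratio[OF assms(1), of y] assms(2) unfolding hunit_def
 by (metis mult_zero_left one_closed)

text \<open>Each component is a line over the neutral one, which is central.\<close>

lemma D_comm:
 assumes "t \<in> TT" "x \<in> D t" "y \<in> D t"
 shows "x * y = y * x"
proof (cases "x = 0")
 case False
 then have "hunit t x" using assms by (simp add: hunit_def)
 then obtain l where l: "l \<in> D \<one>" "y = l * x" using ratio assms by blast
 have "x * (l * x) = x * l * x" by (simp only: mult.assoc)
 also have "\<dots> = l * x * x" using De_comm[OF l(1), of x] by simp
 finally have "x * (l * x) = l * x * x" .
 then show ?thesis using l by simp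
qed simp

lemma phi_linear: "linear \<phi>" and phi_mult: "\<phi> (x * y) = \<phi> y * \<phi> x" and phi_phi [simp]: "\<phi> (\<phi> x) = x"
 using invo by (simp_all add: is_involution_def)

lemma phi_0 [simp]: "\<phi> 0 = 0" using phi_linear by (rule linear_0)
lemma phi_add: "\<phi> (x + y) = \<phi> x + \<phi> y" using phi_linear by (rule linear_add)
lemma phi_diff: "\<phi> (x - y) = \<phi> x - \<phi> y" using phi_linear by (rule linear_diff)
lemma phi_neg: "\<phi> (- x) = - \<phi> x" using phi_linear by (rule linear_neg)
lemma phi_scale: "\<phi> (r *\<^sub>R x) = r *\<^sub>R \<phi> x" using phi_linear by (rule linear_scale)
lemma phi_1 [simp]: "\<phi> 1 = 1"
 using phi_mult[of "\<phi> 1" 1] by simp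
lemma phi_of_real [simp]: "\<phi> (of_real r) = of_real r"
 by (simp add: of_real_def phi_scale)
lemma phi_sum: "\<phi> (sum f A) = (\<Sum>a\<in>A. \<phi> (f a))" using phi_linear by (rule linear_sum)
lemma phi_eq_0 [simp]: "\<phi> x = 0 \<longleftrightarrow> x = 0"
 by (metis phi_0 phi_phi)

lemma phi_mem: "t \<in> TT \<Longrightarrow> x \<in> D t \<Longrightarrow> \<phi> x \<in> D t"
 using deg_pres unfolding degree_preserving_def by blast

lemma hunit_phi: "hunit t x \<Longrightarrow> hunit t (\<phi> x)"
 by (auto simp: hunit_def phi_mem)

lemma phi_hinv: "hunit t x \<Longrightarrow> \<phi> (hinv x) = hinv (\<phi> x)"
 by (rule hinv_eqI[symmetric]) (simp_all add: phi_mult[symmetric] hunit_inv)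

lemma phi_comp: "t \<in> TT \<Longrightarrow> \<phi> (comp x t) = comp (\<phi> x) t"
 using comp_sum[of "\<lambda>t. \<phi> (comp x t)" t] by (simp add: phi_mem comp_mem phi_sum[symmetric] sum_comp)

lemma real_center: "of_real r \<in> alg_center"
 by (simp add: alg_center_def of_real_def)

lemma sym_center: "z \<in> alg_center \<Longrightarrow> \<phi> z = z \<Longrightarrow> \<exists>r. z = of_real r"
 using cent_simple unfolding central_simple_with_involution_def by blast

lemma center_mult:
 assumes "x \<in> alg_center" "y \<in> alg_center"
 shows "x * y \<in> alg_center"
 unfolding alg_center_def
proof clarify
 fix z
 have "x * y * z = x * (z * y)" using central_comm[OF assms(2), of z] by (simp only: mult.assoc)
 also have "\<dots> = z * x * y" using central_comm[OF assms(1), of z] by (simp only: mult.assoc[symmetric])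
 finally show "x * y * z = z * (x * y)" by (simp only: mult.assoc)
qed

lemma center_add: "x \<in> alg_center \<Longrightarrow> y \<in> alg_center \<Longrightarrow> x + y \<in> alg_center"
 by (auto simp: alg_center_def algebra_simps)

lemma center_diff: "x \<in> alg_center \<Longrightarrow> y \<in> alg_center \<Longrightarrow> x - y \<in> alg_center"
 by (auto simp: alg_center_def algebra_simps)

lemma center_scale: "x \<in> alg_center \<Longrightarrow> r *\<^sub>R x \<in> alg_center"
 by (auto simp: alg_center_def)

lemma center_phi: "x \<in> alg_center \<Longrightarrow> \<phi> x \<in> alg_center"
proof -
 assume x: "x \<in> alg_center"
 show ?thesis unfolding alg_center_def
 proof clarify
  fix y
  have "\<phi> (x * \<phi> y) = \<phi> (\<phi> y * x)" using central_comm[OF x] by simp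
  then show "\<phi> x * y = y * \<phi> x" by (simp add: phi_mult)
 qed
qed

lemma centralI_hom:
 assumes "\<And>t y. t \<in> TT \<Longrightarrow> y \<in> D t \<Longrightarrow> z * y = y * z"
 shows "z \<in> alg_center"
 unfolding alg_center_def
proof clarify
 fix x
 have "z * (\<Sum>t\<in>TT. comp x t) = (\<Sum>t\<in>TT. comp x t) * z"
  unfolding sum_distrib_left sum_distrib_right
  by (rule sum.cong) (use assms comp_mem in auto)
 then show "z * x = x * z" by (simp add: sum_comp)
qed

lemma center_comp:
 assumes "z \<in> alg_center" "t \<in> TT"
 shows "comp z t \<in> alg_center"
proof (rule centralI_hom)
 fix s y assume s: "s \<in> TT" "y \<in> D s"
 have "comp z t * y = comp (z * y) (t \<otimes> s)" using comp_mult_right s assms by simp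
 also have "\<dots> = comp (y * z) (s \<otimes> t)" using central_comm[OF assms(1)] s assms m_comm by simp
 also have "\<dots> = y * comp z t" using comp_mult_left s assms by simp
 finally show "comp z t * y = y * comp z t" .
qed

text \<open>Symmetric central elements are real by central simplicity, and nonzero reals live only
  in neutral degree.\<close>

lemma center_phi_hom:
 assumes "t \<in> TT" "x \<in> D t" "\<phi> x = x" "x \<in> alg_center" "x \<noteq> 0"
 shows "t = \<one>" "\<exists>r. r \<noteq> 0 \<and> x = of_real r"
proof -
 obtain r where r: "x = of_real r" using sym_center assms by blast
 then show "\<exists>r. r \<noteq> 0 \<and> x = of_real r" using assms by auto
 have "x \<in> D \<one>" using r by simp
 then show "t = \<one>" using D_disjoint[of t \<one> x] assms by simp
qed

text \<open>The three nontrivial types of centre are told apart by the degree and the square of one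
 skew homogeneous central element.\<close>

lemma center_cases:
 assumes "K \<noteq> range of_real"
 obtains f z e where "hunit f z" "z \<in> alg_center" "\<phi> z = - z" "e \<in> {1, -1}"
  "z * z = of_real e" "K = {of_real a + b *\<^sub>R z | a b. True}"
  "f \<noteq> \<one> \<or> e = -1"
proof -
 obtain k :: 'd where k: "k \<in> alg_center" "k \<notin> range of_real"
  using assms real_center by blast
 \<comment> \<open>The skew part of a nonreal central element does not vanish, and each of its
   nonzero homogeneous components is again central and skew.\<close>
 define w where "w = k - \<phi> k"
 have w: "w \<noteq> 0" "w \<in> alg_center" "\<phi> w = - w"
  using k sym_center[OF k(1)] center_phi center_diff by (auto simp: w_def phi_diff)
 obtain f where f: "f \<in> TT" "comp w f \<noteq> 0"
  using w(1) sum_comp[of w] by (metis sum.neutral)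
 define y where "y = comp w f"
 have y: "hunit f y" "y \<in> alg_center" "\<phi> y = - y"
  using f w(2) center_comp comp_mem phi_comp[OF f(1), of w] comp_scale[OF f(1), of "-1" w] w(3)
  by (auto simp: hunit_def y_def)
 have "hunit (f \<otimes> f) (y * y)" using hunit_mult y by blast
 then obtain r where r: "y * y = of_real r" "r \<noteq> 0"
  using center_phi_hom(2)[of "f \<otimes> f" "y * y"] center_mult[OF y(2) y(2)] y(3)
  by (auto simp: hunit_def phi_mult)
 \<comment> \<open>Positive scaling brings the real number \<open>y * y\<close> to its sign
   \<open>e\<close>.\<close>
 define z where "z = (1 / sqrt \<bar>r\<bar>) *\<^sub>R y"
 define e :: real where "e = sgn r"
 have z: "hunit f z" "z \<in> alg_center" "\<phi> z = - z"
  using y r center_scale hunit_scale by (auto simp: z_def phi_scale)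
 have "z * z = (1 / \<bar>r\<bar>) *\<^sub>R of_real r" using r by (simp add: z_def)
 also have "\<dots> = of_real e" using r by (simp add: e_def of_real_def sgn_if)
 finally have zz: "z * z = of_real e" .
 have e: "e \<in> {1,-1}" using r by (auto simp: e_def sgn_if)
 \<comment> \<open>For central \<open>x\<close> both \<open>x + \<phi> x\<close> and
   \<open>(x - \<phi> x) * z\<close> are symmetric, hence real; because \<open>z * z\<close> is a
   sign, these two reals are the coordinates of \<open>x\<close> up to factors 2 and
   \<open>e\<close>.\<close>
 have K: "K = {of_real a + b *\<^sub>R z | a b. True}"
 proof (intro equalityI subsetI)
  fix x :: 'd assume x: "x \<in> alg_center"
  obtain a where a: "x + \<phi> x = of_real a"
   using sym_center[of "x + \<phi> x"] x center_phi center_add by (auto simp: phi_add add.commute)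
  have xz: "\<phi> x * z = z * \<phi> x" using central_comm[OF z(2)] by simp
  have "\<phi> ((x - \<phi> x) * z) = (x - \<phi> x) * z"
   using xz central_comm[OF z(2), of x] by (simp add: phi_mult phi_diff z(3) algebra_simps)
  then obtain b where b: "(x - \<phi> x) * z = of_real b"
   using sym_center[of "(x - \<phi> x) * z"] x center_phi center_diff center_mult z by blast
  have "(x - \<phi> x) * (z * z) = of_real b * z" using b by (simp add: mult.assoc[symmetric])
  then have "e *\<^sub>R (x - \<phi> x) = b *\<^sub>R z" by (simp add: zz of_real_def)
  then have "(x - \<phi> x) = (e * b) *\<^sub>R z" using e
   by (metis insert_iff empty_iff mult_minus_left mult_1 scaleR_one scaleR_minus_left minus_minus)
  then have "x + x = of_real a + (e * b) *\<^sub>R z" using a by (metis add_diff_cancel_left' add_diff_eq diff_add_eq diff_diff_eq2)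
  then have "2 *\<^sub>R x = of_real a + (e * b) *\<^sub>R z" by (simp add: scaleR_2)
  then have "(1/2) *\<^sub>R (2 *\<^sub>R x) = (1/2) *\<^sub>R (of_real a + (e * b) *\<^sub>R z)" by simp
  then have "x = of_real (a/2) + (e * b / 2) *\<^sub>R z" by (simp add: of_real_def scaleR_add_right)
  then show "x \<in> {of_real a + b *\<^sub>R z | a b. True}" by blast
 next
  fix x assume "x \<in> {of_real a + b *\<^sub>R z | a b. True}"
  then show "x \<in> alg_center" using real_center z center_scale center_add by blast
 qed
 \<comment> \<open>In neutral degree \<open>z * z = 1\<close> would make \<open>z - 1\<close> and
   \<open>z + 1\<close> zero divisors. Both are nonzero because \<open>z\<close> is skew, and
   nonzero elements of \<open>D \<one>\<close> are invertible.\<close>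
 have "f \<noteq> \<one> \<or> e = -1"
 proof (rule ccontr)
  assume "\<not> ?thesis"
  then have fe: "f = \<one>" "e = 1" using e by auto
  then have "(z - 1) * (z + 1) = 0" using zz by (simp add: algebra_simps)
  moreover have "z \<noteq> 1" "z \<noteq> -1" using z(1,3) by (auto simp: phi_neg hunit_def)
  then have "hunit \<one> (z - 1)" "hunit \<one> (z + 1)"
   using z(1) fe by (auto simp: hunit_def add_eq_0_iff2 intro: D_diff D_add)
  ultimately show False using hunit_mult[of \<one> "z - 1" \<one> "z + 1"] by (simp add: hunit_def)
 qed
 with that z zz e K show thesis by blast
qed

end

section \<open>Matrices and equivalence\<close>

text \<open>The nonzero entries of \<Phi>, row by row; together with \<open>partner\<close> they
  describe \<Phi> completely.\<close>

definition block_coeff :: "'d::real_algebra_1 list \<Rightarrow> real \<Rightarrow> nat \<Rightarrow> 'd" where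
 "block_coeff ds e i =
   (if i < length ds then ds ! i else if even (i - length ds) then 1 else of_real e)"

definition emat :: "nat \<Rightarrow> nat \<Rightarrow> nat \<Rightarrow> 'd::zero \<Rightarrow> 'd mat" where
 "emat k i j x = mat k k (\<lambda>(a, b). if a = i \<and> b = j then x else 0)"

lemma mult_entry:
 assumes "A \<in> carrier_mat k k" "B \<in> carrier_mat k k" "i < k" "j < k"
 shows "(A * B) $$ (i, j) = (\<Sum>l<k. A $$ (i, l) * B $$ (l, j))"
 using assms by (auto simp: scalar_prod_def lessThan_atLeast0 intro!: sum.cong)

lemma emat_carrier [simp]: "emat k i j x \<in> carrier_mat k k"
 by (simp add: emat_def)

lemma emat_entry: "a < k \<Longrightarrow> b < k \<Longrightarrow> emat k i j x $$ (a, b) = (if a = i \<and> b = j then x else 0)"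
 by (simp add: emat_def)

lemma emat_add: "emat k i j (x + y) = emat k i j x + emat k i j (y :: 'd::monoid_add)"
 by (rule eq_matI) (auto simp: emat_def)

lemma emat_eq_iff: "i < k \<Longrightarrow> j < k \<Longrightarrow> emat k i j x = emat k i j y \<longleftrightarrow> x = y"
 by (metis emat_entry)

lemma emat_eq_D:
 assumes "emat k i j x = emat k i' j' y" "i < k" "j < k" "x \<noteq> 0"
 shows "i' = i \<and> j' = j"
 using assms by (metis emat_entry)

lemma emat_mult:
 fixes x y :: "'d::semiring_0"
 assumes "i < k" "j < k" "l < k" "m < k"
 shows "emat k i j x * emat k l m y = (if j = l then emat k i m (x * y) else 0\<^sub>m k k)"
proof (rule eq_matI)
 fix a b assume "a < dim_row (if j = l then emat k i m (x * y) else 0\<^sub>m k k)"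
  "b < dim_col (if j = l then emat k i m (x * y) else 0\<^sub>m k k)"
 then have ab: "a < k" "b < k" by (auto simp: emat_def split: if_splits)
 have "(emat k i j x * emat k l m y) $$ (a, b) = (\<Sum>c<k. emat k i j x $$ (a, c) * emat k l m y $$ (c, b))"
  by (rule mult_entry) (use ab in auto)
 also have "\<dots> = (\<Sum>c<k. if c = j then (if a = i \<and> j = l \<and> b = m then x * y else 0) else 0)"
  by (rule sum.cong) (use ab in \<open>auto simp: emat_entry\<close>)
 also have "\<dots> = (if a = i \<and> j = l \<and> b = m then x * y else 0)"
  using assms by simp
 finally show "(emat k i j x * emat k l m y) $$ (a, b) = (if j = l then emat k i m (x * y) else 0\<^sub>m k k) $$ (a, b)"
  using ab by (auto simp: emat_entry)
qed (auto simp: emat_def)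

lemma emat_sandwich:
 fixes X :: "'d::semiring_1 mat"
 assumes "X \<in> carrier_mat k k" "i < k" "j < k"
 shows "emat k i i 1 * X * emat k j j 1 = emat k i j (X $$ (i, j))"
proof (rule eq_matI)
 fix a b assume "a < dim_row (emat k i j (X $$ (i, j)))" "b < dim_col (emat k i j (X $$ (i, j)))"
 then have ab: "a < k" "b < k" by (auto simp: emat_def)
 have L: "(emat k i i 1 * X) $$ (a, c) = (if a = i then X $$ (i, c) else 0)" if "c < k" for c
 proof -
  have "(emat k i i 1 * X) $$ (a, c) = (\<Sum>l<k. emat k i i 1 $$ (a, l) * X $$ (l, c))"
   by (rule mult_entry) (use assms ab that in auto)
  also have "\<dots> = (\<Sum>l<k. if l = i then (if a = i then X $$ (i, c) else 0) else 0)"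
   by (rule sum.cong) (use ab in \<open>auto simp: emat_entry\<close>)
  finally show ?thesis using assms by simp
 qed
 have "(emat k i i 1 * X * emat k j j 1) $$ (a, b) = (\<Sum>l<k. (emat k i i 1 * X) $$ (a, l) * emat k j j 1 $$ (l, b))"
  by (rule mult_entry) (use assms ab in \<open>auto intro!: mult_carrier_mat\<close>)
 also have "\<dots> = (\<Sum>l<k. if l = j then (if a = i \<and> b = j then X $$ (i, j) else 0) else 0)"
  by (rule sum.cong) (use ab L in \<open>auto simp: emat_entry\<close>)
 finally show "(emat k i i 1 * X * emat k j j 1) $$ (a, b) = emat k i j (X $$ (i, j)) $$ (a, b)"
  using assms ab by (simp add: emat_entry)
qed (auto simp: emat_def)

lemma diag_block_hyperbolic:
 fixes y :: real and s :: nat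
 defines "A \<equiv> diag_block_mat (replicate s (mat_of_rows_list 2 [[0, 1], [of_real y, 0 :: 'd::real_algebra_1]]))"
 shows "dim_row A = 2 * s \<and> dim_col A = 2 * s \<and>
  (\<forall>a<2 * s. \<forall>b<2 * s. A $$ (a, b) = (if b = partner 0 a then block_coeff [] y a else 0))"
 unfolding A_def
proof (induction s)
 case (Suc s)
 let ?B = "mat_of_rows_list 2 [[0, 1], [of_real y, 0 :: 'd::real_algebra_1]]"
 let ?A = "diag_block_mat (replicate s ?B)"
 have d: "dim_row ?B = 2" "dim_col ?B = 2" by (simp_all add: mat_of_rows_list_def)
 have B: "?B $$ (a, b) = (if b = partner 0 a then block_coeff [] y a else 0)" if "a < 2" "b < 2" for a b
  using that by (auto simp: mat_of_rows_list_def partner_def block_coeff_def less_2_cases_iff)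
 have "diag_block_mat (replicate (Suc s) ?B) $$ (a, b) = (if b = partner 0 a then block_coeff [] y a else 0)"
  if ab: "a < 2 * Suc s" "b < 2 * Suc s" for a b
 proof -
  have e: "diag_block_mat (replicate (Suc s) ?B) $$ (a, b) =
   (if a < 2 then if b < 2 then ?B $$ (a, b) else 0 else if b < 2 then 0 else ?A $$ (a - 2, b - 2))"
   using ab Suc.IH d by (auto simp: Let_def)
  show ?thesis
  proof (cases "a < 2")
   case True
   then have "partner 0 a < 2" by (auto simp: partner_def less_2_cases_iff)
   then show ?thesis using e True B[of a b] by auto
  next
   case False
   then obtain c where c: "a = c + 2" by (metis add.commute le_Suc_ex not_less)
   have p: "partner 0 (c + 2) = partner 0 c + 2" by (auto simp: partner_def elim: oddE)
   have q: "block_coeff [] y (c + 2) = (block_coeff [] y c :: 'd)" by (simp add: block_coeff_def)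
   show ?thesis
   proof (cases "b < 2")
    case True
    then show ?thesis using e c p by auto
   next
    case False
    then obtain d where d: "b = d + 2" by (metis add.commute le_Suc_ex not_less)
    have "?A $$ (c, d) = (if d = partner 0 c then block_coeff [] y c else 0)"
     using Suc.IH ab c d by auto
    then show ?thesis using e c d p q by simp
   qed
  qed
 qed
 moreover have "dim_row (diag_block_mat (replicate (Suc s) ?B)) = 2 * Suc s"
  "dim_col (diag_block_mat (replicate (Suc s) ?B)) = 2 * Suc s"
  using Suc.IH d by (auto simp: Let_def)
 ultimately show ?case by blast
qed simp

lemma Phi_mat_props:
 "dim_row (Phi_mat s ds y) = length ds + 2 * s \<and> dim_col (Phi_mat s ds y) = length ds + 2 * s \<and>
  (\<forall>a<length ds + 2 * s. \<forall>b<length ds + 2 * s.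
    Phi_mat s ds y $$ (a, b) = (if b = partner (length ds) a then block_coeff ds y a else 0))"
proof (induction ds)
 case Nil
 then show ?case using diag_block_hyperbolic[of s y] by (simp add: Phi_mat_def)
next
 case (Cons d ds)
 let ?A = "Phi_mat s ds y"
 have e0: "Phi_mat s (d # ds) y = four_block_mat (mat 1 1 (\<lambda>_. d)) (0\<^sub>m 1 (dim_col ?A)) (0\<^sub>m (dim_row ?A) 1) ?A"
  by (simp add: Phi_mat_def Let_def)
 have "Phi_mat s (d # ds) y $$ (a, b) = (if b = partner (length (d # ds)) a then block_coeff (d # ds) y a else 0)"
  if ab: "a < length (d # ds) + 2 * s" "b < length (d # ds) + 2 * s" for a b
 proof (cases a)
  case 0
  then show ?thesis using ab Cons.IH e0 by (auto simp: partner_def block_coeff_def)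
 next
  case (Suc c)
  have p: "partner (length (d # ds)) (Suc c) = Suc (partner (length ds) c)"
   by (rule partner_cases[of c "length ds"]) (auto simp: partner_def elim: oddE)
  have q: "block_coeff (d # ds) y (Suc c) = block_coeff ds y c" by (simp add: block_coeff_def)
  show ?thesis
  proof (cases b)
   case 0
   then show ?thesis using Suc p ab Cons.IH e0 by auto
  next
   case (Suc e)
   then have "?A $$ (c, e) = (if e = partner (length ds) c then block_coeff ds y c else 0)"
    using Cons.IH ab \<open>a = Suc c\<close> by auto
   then show ?thesis using Suc \<open>a = Suc c\<close> p q ab Cons.IH e0 by auto
  qed
 qed
 moreover have "dim_row (Phi_mat s (d # ds) y) = length (d # ds) + 2 * s"
  "dim_col (Phi_mat s (d # ds) y) = length (d # ds) + 2 * s"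
  using Cons.IH by (auto simp: e0)
 ultimately show ?case by blast
qed

section \<open>Transport of entry degrees between two grading groups\<close>

context abelian_grading
begin

text \<open>The data define a homomorphism of \<open>F \<times> T\<close> that sends generator
  \<open>i\<close> to generator \<open>m i\<close> times \<open>g i\<close> and is \<open>f\<close>
  on \<open>T\<close>. By \<open>rel\<close> it takes every equated element to an equated element
  times \<open>w\<close>, so it respects the relations and hence equality of entry degrees.\<close>

lemma entry_degree_transfer:
 assumes ts: "set ts \<subseteq> TT" "set us \<subseteq> TT"
  and k: "length ts + 2 * s = k" "length us + 2 * s' = k"
  and p: "\<And>i. i < k \<Longrightarrow> m i < k" "\<And>i. i < k \<Longrightarrow> m (partner (length ts) i) = partner (length us) (m i)"
  and f: "f \<in> hom T T" and g: "\<And>i. i < k \<Longrightarrow> g i \<in> TT" and w: "w \<in> TT"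
  and rel: "\<And>i. i < k \<Longrightarrow> g i \<otimes> block_degree T us (m i) \<otimes> g (partner (length ts) i) = w \<otimes> f (block_degree T ts i)"
  and ij: "i < k" "j < k" "t \<in> TT" "i' < k" "j' < k" "t' \<in> TT"
  and eq: "entry_degree T s ts i j t = entry_degree T s ts i' j' t'"
 shows "entry_degree T s' us (m i) (m j) (g i \<otimes> f t \<otimes> inv (g j)) =
     entry_degree T s' us (m i') (m j') (g i' \<otimes> f t' \<otimes> inv (g j'))"
proof -
 let ?P = "free_times T k"
 interpret P: comm_group ?P by (rule comm_group_free_times)
 interpret a: group_hom T T f by unfold_locales (rule f)
 have "(\<lambda>i. (frag_of (m i), g i)) ` {..<k} \<subseteq> carrier ?P"
  using p g by (auto simp: carrier_free_times)
 then obtain h0 where h0: "h0 \<in> hom (free_Abelian_group {..<k}) ?P"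
  "\<And>i. i \<in> {..<k} \<Longrightarrow> h0 (frag_of i) = (frag_of (m i), g i)"
  by (rule P.free_Abelian_group_universal) auto
 interpret h0: group_hom "free_Abelian_group {..<k}" ?P h0
  by (intro group_hom.intro group_hom_axioms.intro group_free_Abelian_group P.is_group h0(1))
 have at: "(0, f t) \<in> carrier ?P" if "t \<in> TT" for t using that by (simp add: carrier_free_times)
 define h where "h = (\<lambda>(a, t). h0 a \<otimes>\<^bsub>?P\<^esub> (0, f t))"
 have h: "h \<in> hom ?P ?P"
 proof (rule homI)
  fix x assume "x \<in> carrier ?P"
  then obtain a t where "x = (a, t)" "Poly_Mapping.keys a \<subseteq> {..<k}" "t \<in> TT"
   by (auto simp: carrier_free_times)
  then show "h x \<in> carrier ?P"
   using P.m_closed[OF h0.hom_closed at] by (simp add: h_def)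
 next
  fix x y assume "x \<in> carrier ?P" "y \<in> carrier ?P"
  then obtain a t b u where xy: "x = (a, t)" "y = (b, u)" "Poly_Mapping.keys a \<subseteq> {..<k}" "Poly_Mapping.keys b \<subseteq> {..<k}"
   "t \<in> TT" "u \<in> TT" by (auto simp: carrier_free_times)
  have h0ab: "h0 a \<in> carrier ?P" "h0 b \<in> carrier ?P" using h0.hom_closed xy by auto
  have swap: "A \<otimes>\<^bsub>?P\<^esub> B \<otimes>\<^bsub>?P\<^esub> (C \<otimes>\<^bsub>?P\<^esub> E) = A \<otimes>\<^bsub>?P\<^esub> C \<otimes>\<^bsub>?P\<^esub> (B \<otimes>\<^bsub>?P\<^esub> E)"
   if "A \<in> carrier ?P" "B \<in> carrier ?P" "C \<in> carrier ?P" "E \<in> carrier ?P" for A B C E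
   using that by (simp add: P.m_ac)
  have "h (x \<otimes>\<^bsub>?P\<^esub> y) = h0 (a + b) \<otimes>\<^bsub>?P\<^esub> (0, f (t \<otimes> u))"
   using xy by (simp add: h_def)
  also have "h0 (a + b) = h0 a \<otimes>\<^bsub>?P\<^esub> h0 b" using h0.hom_mult[of a b] xy by simp
  also have "(0, f (t \<otimes> u)) = (0, f t) \<otimes>\<^bsub>?P\<^esub> (0, f u)" using xy by simp
  also have "h0 a \<otimes>\<^bsub>?P\<^esub> h0 b \<otimes>\<^bsub>?P\<^esub> ((0, f t) \<otimes>\<^bsub>?P\<^esub> (0, f u)) = h x \<otimes>\<^bsub>?P\<^esub> h y"
   unfolding swap[OF h0ab at[OF xy(5)] at[OF xy(6)]] by (simp add: h_def xy)
  finally show "h (x \<otimes>\<^bsub>?P\<^esub> y) = h x \<otimes>\<^bsub>?P\<^esub> h y" .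
 qed
 interpret h: group_hom ?P ?P h by unfold_locales (rule h)
 have hdiv: "h (x \<otimes>\<^bsub>?P\<^esub> inv\<^bsub>?P\<^esub> y) = h x \<otimes>\<^bsub>?P\<^esub> inv\<^bsub>?P\<^esub> h y"
  if "x \<in> carrier ?P" "y \<in> carrier ?P" for x y using that by simp
 have hgen: "h (frag_of i, t) = (frag_of (m i), g i \<otimes> f t)" if "i < k" "t \<in> TT" for i t
  using h0(2)[of i] that by (simp add: h_def)
 have h1: "h (frag_of i, \<one>) = (frag_of (m i), g i)" if "i < k" for i
  using hgen[of i \<one>] that g by simp
 have c1: "(frag_of i, t) \<in> carrier ?P" if "i < k" "t \<in> TT" for i t
  using that by (simp add: carrier_free_times)
 have "h (block_element T ts i) = block_element T us (m i) \<otimes>\<^bsub>?P\<^esub> (0, w)" if i: "i < k" for i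
 proof -
  let ?i = "partner (length ts) i"
  have i': "?i < k" using partner_less i k by metis
  let ?t = "block_degree T ts i" and ?u = "block_degree T us (m i)"
  have tu: "?t \<in> TT" "?u \<in> TT" using block_degree_closed ts by auto
  have "block_element T ts i = (frag_of i, \<one>) \<otimes>\<^bsub>?P\<^esub> (frag_of ?i, inv ?t)"
   using tu by (simp add: block_element_def)
  then have "h (block_element T ts i) = (frag_of (m i), g i) \<otimes>\<^bsub>?P\<^esub> (frag_of (m ?i), g ?i \<otimes> f (inv ?t))"
   using h.hom_mult[OF c1 c1, of i \<one> ?i "inv ?t"] h1[OF i] hgen[OF i', of "inv ?t"] i i' tu by simp
  also have "\<dots> = (frag_of (m i) + frag_of (partner (length us) (m i)), g i \<otimes> (g ?i \<otimes> inv (f ?t)))"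
   using p(2)[OF i] tu by simp
  also have "g i \<otimes> (g ?i \<otimes> inv (f ?t)) = inv ?u \<otimes> w"
  proof -
   have cl: "g i \<in> TT" "g ?i \<in> TT" "f ?t \<in> TT" using g i i' tu by auto
   have "w \<otimes> f ?t = ?u \<otimes> (g i \<otimes> g ?i)" using rel[OF i] cl tu by (simp add: m_ac)
   then have "inv ?u \<otimes> (w \<otimes> f ?t) = g i \<otimes> g ?i" using cl tu by (simp add: m_assoc[symmetric])
   then have "(inv ?u \<otimes> w) \<otimes> f ?t = g i \<otimes> g ?i" using cl tu w by (simp add: m_assoc)
   then have "inv ?u \<otimes> w = (g i \<otimes> g ?i) \<otimes> inv (f ?t)" using cl tu w by (metis inv_closed inv_solve_right m_closed)
   then show ?thesis using cl by (simp add: m_assoc)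
  qed
  finally show ?thesis by (simp add: block_element_def)
 qed
 then have img: "\<exists>j<k. h (block_element T ts i) = block_element T us j \<otimes>\<^bsub>?P\<^esub> (0, w)" if "i < k" for i
  using that p(1) by blast
 have hd: "h (frag_of i - frag_of j, t) = (frag_of (m i) - frag_of (m j), g i \<otimes> f t \<otimes> inv (g j))"
  if "i < k" "j < k" "t \<in> TT" for i j t
 proof -
  have "(frag_of i - frag_of j, t) = (frag_of i, t) \<otimes>\<^bsub>?P\<^esub> inv\<^bsub>?P\<^esub> (frag_of j, \<one>)"
   using c1[of j \<one>] that by simp
  then have "h (frag_of i - frag_of j, t) = (frag_of (m i), g i \<otimes> f t) \<otimes>\<^bsub>?P\<^esub> inv\<^bsub>?P\<^esub> (frag_of (m j), g j)"
   using hdiv[OF c1[of i t] c1[of j \<one>]] that hgen[of i t] h1[of j] by simp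
  also have "inv\<^bsub>?P\<^esub> (frag_of (m j), g j) = (- frag_of (m j), inv (g j))"
   using c1[of "m j" "g j"] g p that by simp
  finally show ?thesis by simp
 qed
 have "(frag_of i - frag_of j - frag_of i' + frag_of j', t \<otimes> inv t') \<in> relation_subgroup T s ts"
  using entry_degree_eq_iff[OF ts(1) k(1)[symmetric] ij] eq by simp
 then have "h (frag_of i - frag_of j - frag_of i' + frag_of j', t \<otimes> inv t') \<in> relation_subgroup T s' us"
  by (rule relation_subgroup_image[OF ts k h _ img, rotated 2])
   (use w in \<open>auto simp: carrier_free_times\<close>)
 moreover have "h (frag_of i - frag_of j - frag_of i' + frag_of j', t \<otimes> inv t') =
   h (frag_of i - frag_of j, t) \<otimes>\<^bsub>?P\<^esub> inv\<^bsub>?P\<^esub> h (frag_of i' - frag_of j', t')"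
 proof -
  have c: "(frag_of i - frag_of j, t) \<in> carrier ?P" "(frag_of i' - frag_of j', t') \<in> carrier ?P"
   using entry_element_closed[of i k j t] entry_element_closed[of i' k j' t'] ij by (auto simp: entry_element_def)
  have "(frag_of i - frag_of j - frag_of i' + frag_of j', t \<otimes> inv t') =
    (frag_of i - frag_of j, t) \<otimes>\<^bsub>?P\<^esub> inv\<^bsub>?P\<^esub> (frag_of i' - frag_of j', t')"
   using c by simp
  then show ?thesis using hdiv[OF c] by simp
 qed
 moreover have "\<dots> = (frag_of (m i) - frag_of (m j) - frag_of (m i') + frag_of (m j'),
   (g i \<otimes> f t \<otimes> inv (g j)) \<otimes> inv (g i' \<otimes> f t' \<otimes> inv (g j')))"
 proof -
  have "(frag_of (m i') - frag_of (m j'), g i' \<otimes> f t' \<otimes> inv (g j')) \<in> carrier ?P"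
   using entry_element_closed[of "m i'" k "m j'" "g i' \<otimes> f t' \<otimes> inv (g j')"] ij p g by (auto simp: entry_element_def)
  then show ?thesis using hd ij by simp
 qed
 ultimately show ?thesis
  using entry_degree_eq_iff[OF ts(2) k(2)[symmetric], of "m i" "m j" "g i \<otimes> f t \<otimes> inv (g j)" "m i'" "m j'" "g i' \<otimes> f t' \<otimes> inv (g j')"]
   ij p g by simp
qed

end

section \<open>Entries, involution and homogeneous components of the matrix algebra\<close>

locale M_params = gr_div_inv T D \<phi> for T :: "'t monoid" (structure) and D :: "'t \<Rightarrow> 'd::real_algebra_1 set" and \<phi> +
 fixes q s :: nat and ds :: "'d list" and \<delta> :: real
 assumes adm: "admissible T D \<phi> q s ds \<delta>"
begin

abbreviation "k \<equiv> q + 2 * s"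
abbreviation "ts \<equiv> map (gr_deg T D) ds"
abbreviation "p \<equiv> block_coeff ds \<delta>"
abbreviation "sw \<equiv> partner q"
abbreviation "\<tau> \<equiv> block_degree T ts"
abbreviation "M \<equiv> M_alg T D \<phi> q s ds \<delta>"
abbreviation "ed \<equiv> entry_degree T s ts"

lemma len: "length ds = q" using adm by (simp add: admissible_def)

lemma k_pos: "0 < k" using adm by (auto simp: admissible_def)

lemma delta: "\<delta> = 1 \<or> \<delta> = -1" using adm by (auto simp: admissible_def)

lemma delta_sq [simp]: "\<delta> * \<delta> = 1" using delta by auto

lemma hunit_ds: "d \<in> set ds \<Longrightarrow> hunit (gr_deg T D d) d" and phi_ds: "d \<in> set ds \<Longrightarrow> \<phi> d = \<delta> *\<^sub>R d"
proof -
 assume d: "d \<in> set ds"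
 then have "d \<in> gr_units T D" using adm by (simp add: admissible_def)
 then obtain t where "hunit t d" using gr_units_iff by blast
 then show "hunit (gr_deg T D d) d" using gr_deg_eq by simp
 show "\<phi> d = \<delta> *\<^sub>R d" using d adm by (simp add: admissible_def)
qed

lemma ts_closed: "set ts \<subseteq> TT"
 using hunit_ds by (auto simp: hunit_def)

lemma ts_k: "length ts + 2 * s = k" using len by simp

lemma sw_less: "i < k \<Longrightarrow> sw i < k" by (rule partner_less)

lemma hunit_p: "hunit (\<tau> i) (p i)"
 using hunit_ds[of "ds ! i"] delta hunit_of_real[of \<delta>] by (auto simp: block_coeff_def block_degree_def)

text \<open>Entrywise form of the fact that \<Phi> is hermitian or skew-hermitian according to
  \<delta>.\<close>

lemma phi_p: "\<phi> (p i) = \<delta> *\<^sub>R p (sw i)"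
proof (cases rule: partner_cases[of i q])
 case 1
 then show ?thesis using phi_ds[of "ds ! i"] len by (simp add: block_coeff_def)
next
 case (2 m)
 then show ?thesis using len by (auto simp: block_coeff_def of_real_def phi_scale elim: oddE)
qed

lemma M_simps:
 "carrier M = carrier_mat k k" "monoid.mult M = (*)" "ring.add M = (+)" "one M = 1\<^sub>m k"
 "ring.zero M = 0\<^sub>m k k" "smult M = (\<lambda>r X. map_mat (scaleR r) X)" "grading_group M = Gtilde T s ts"
 by (simp_all add: M_alg_def Let_def ring_mat_simps) (simp_all add: ring_mat_def)

text \<open>\<Phi> has one nonzero entry in each row and column, hence so has its inverse, and no
  sums are left in the triple product.\<close>

lemma invol_M:
 assumes X: "X \<in> carrier_mat k k"
 shows "invol M X = mat k k (\<lambda>(a, b). hinv (p (sw a)) * \<phi> (X $$ (sw b, sw a)) * p (sw b))"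
proof -
 let ?P = "Phi_mat s ds \<delta>"
 let ?Q = "mat k k (\<lambda>(a, b). if b = sw a then hinv (p b) else 0)"
 have P: "?P \<in> carrier_mat k k" "\<And>a b. a < k \<Longrightarrow> b < k \<Longrightarrow> ?P $$ (a, b) = (if b = sw a then p a else 0)"
  using Phi_mat_props[of s ds \<delta>] len by auto
 have PQ: "?P * ?Q = 1\<^sub>m k"
 proof (rule eq_matI)
  fix a b assume "a < dim_row (1\<^sub>m k :: 'd mat)" "b < dim_col (1\<^sub>m k :: 'd mat)"
  then have ab: "a < k" "b < k" by auto
  have "(?P * ?Q) $$ (a, b) = (\<Sum>l<k. ?P $$ (a, l) * ?Q $$ (l, b))"
   by (rule mult_entry) (use P ab in auto)
  also have "\<dots> = (\<Sum>l<k. if l = sw a then (if a = b then 1 else 0) else 0)"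
   by (rule sum.cong) (use P ab hunit_inv[OF hunit_p] in auto)
  finally show "(?P * ?Q) $$ (a, b) = 1\<^sub>m k $$ (a, b)" using ab sw_less by simp
 qed (use P in auto)
 have QP: "?Q * ?P = 1\<^sub>m k"
 proof (rule eq_matI)
  fix a b assume "a < dim_row (1\<^sub>m k :: 'd mat)" "b < dim_col (1\<^sub>m k :: 'd mat)"
  then have ab: "a < k" "b < k" by auto
  have "(?Q * ?P) $$ (a, b) = (\<Sum>l<k. ?Q $$ (a, l) * ?P $$ (l, b))"
   by (rule mult_entry) (use P ab in auto)
  also have "\<dots> = (\<Sum>l<k. if l = sw a then (if a = b then 1 else 0) else 0)"
   by (rule sum.cong) (use P ab hunit_inv[OF hunit_p] in auto)
  finally show "(?Q * ?P) $$ (a, b) = 1\<^sub>m k $$ (a, b)" using ab sw_less by simp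
 qed (use P in auto)
 have "inv\<^bsub>ring_mat TYPE('d) k ()\<^esub> ?P = ?Q"
  unfolding m_inv_def ring_mat_simps
 proof (rule the_equality)
  fix Y assume Y: "Y \<in> carrier_mat k k \<and> ?P * Y = 1\<^sub>m k \<and> Y * ?P = 1\<^sub>m k"
  have "Y = (?Q * ?P) * Y" using QP Y left_mult_one_mat[of Y k k] by simp
  also have "\<dots> = ?Q * (?P * Y)" by (rule assoc_mult_mat) (use P Y in auto)
  also have "\<dots> = ?Q" using Y by simp
  finally show "Y = ?Q" .
 qed (use PQ QP in auto)
 then have e: "invol M X = ?Q * map_mat \<phi> (transpose_mat X) * ?P"
  by (simp add: M_alg_def Let_def ring_mat_def)
 show ?thesis
 proof (rule eq_matI)
  fix a b assume "a < dim_row (mat k k (\<lambda>(a, b). hinv (p (sw a)) * \<phi> (X $$ (sw b, sw a)) * p (sw b)))"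
   "b < dim_col (mat k k (\<lambda>(a, b). hinv (p (sw a)) * \<phi> (X $$ (sw b, sw a)) * p (sw b)))"
  then have ab: "a < k" "b < k" by auto
  let ?X = "map_mat \<phi> (transpose_mat X)"
  have L: "(?Q * ?X) $$ (a, c) = hinv (p (sw a)) * \<phi> (X $$ (c, sw a))" if c: "c < k" for c
  proof -
   have "(?Q * ?X) $$ (a, c) = (\<Sum>l<k. ?Q $$ (a, l) * ?X $$ (l, c))"
    by (rule mult_entry) (use X ab c in auto)
   also have "\<dots> = (\<Sum>l<k. if l = sw a then hinv (p (sw a)) * \<phi> (X $$ (c, sw a)) else 0)"
    by (rule sum.cong) (use X ab c in auto)
   finally show ?thesis using ab sw_less by simp
  qed
  have "(?Q * ?X * ?P) $$ (a, b) = (\<Sum>l<k. (?Q * ?X) $$ (a, l) * ?P $$ (l, b))"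
   by (rule mult_entry) (use X P ab in auto)
  also have "\<dots> = (\<Sum>l<k. if l = sw b then hinv (p (sw a)) * \<phi> (X $$ (sw b, sw a)) * p (sw b) else 0)"
   by (rule sum.cong) (use P L ab in auto)
  finally show "invol M X $$ (a, b) = mat k k (\<lambda>(a, b). hinv (p (sw a)) * \<phi> (X $$ (sw b, sw a)) * p (sw b)) $$ (a, b)"
   using ab sw_less e by simp
 qed (use e P in auto)
qed

lemma invol_closed: "X \<in> carrier_mat k k \<Longrightarrow> invol M X \<in> carrier_mat k k"
 by (simp add: invol_M)

lemma invol_emat:
 assumes "i < k" "j < k"
 shows "invol M (emat k i j x) = emat k (sw j) (sw i) (hinv (p j) * \<phi> x * p i)"
proof (subst invol_M[OF emat_carrier], rule eq_matI)
 fix a b assume "a < dim_row (emat k (sw j) (sw i) (hinv (p j) * \<phi> x * p i))"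
  "b < dim_col (emat k (sw j) (sw i) (hinv (p j) * \<phi> x * p i))"
 then have ab: "a < k" "b < k" by (simp_all add: emat_def)
 have "a = sw j \<and> b = sw i \<longleftrightarrow> sw b = i \<and> sw a = j" by (metis partner_partner)
 then show "mat k k (\<lambda>(a, b). hinv (p (sw a)) * \<phi> (emat k i j x $$ (sw b, sw a)) * p (sw b)) $$ (a, b)
   = emat k (sw j) (sw i) (hinv (p j) * \<phi> x * p i) $$ (a, b)"
  using ab sw_less[OF ab(1)] sw_less[OF ab(2)] by (simp add: emat_entry)
qed (simp_all add: emat_def)

text \<open>In a fixed position the degree determines \<open>t\<close>, so the span in the
  definition of the components runs over at most one \<open>D t\<close>.\<close>

lemma component_iff:
 "X \<in> component M g \<longleftrightarrow> X \<in> carrier_mat k k \<and>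
  (\<forall>i<k. \<forall>j<k. X $$ (i, j) = 0 \<or> (\<exists>t\<in>TT. ed i j t = g \<and> X $$ (i, j) \<in> D t))"
proof -
 have "x \<in> span (\<Union>t\<in>{t \<in> TT. ed i j t = g}. D t) \<longleftrightarrow> x = 0 \<or> (\<exists>t\<in>TT. ed i j t = g \<and> x \<in> D t)"
  if ij: "i < k" "j < k" for i j x
 proof (cases "\<exists>t\<in>TT. ed i j t = g")
  case True
  then obtain t where t: "t \<in> TT" "ed i j t = g" by blast
  then have "{t \<in> TT. ed i j t = g} = {t}"
   using entry_degree_same_entry[OF ts_closed] ij ts_k by fastforce
  then have s: "span (\<Union>t\<in>{t \<in> TT. ed i j t = g}. D t) = D t"
   using D_subspace[OF t(1)] by (simp add: span_eq_iff)
  show ?thesis unfolding s using t \<open>{t \<in> TT. ed i j t = g} = {t}\<close> by auto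
 next
  case False
  then have "{t \<in> TT. ed i j t = g} = {}" by blast
  then have "span (\<Union>t\<in>{t \<in> TT. ed i j t = g}. D t) = {0}" by (simp only:) simp
  then show ?thesis using False by blast
 qed
 moreover have "X \<in> component M g \<longleftrightarrow> X \<in> carrier_mat k k \<and> (\<forall>i<k. \<forall>j<k.
      X $$ (i, j) \<in> span (\<Union>t\<in>{t \<in> TT. ed i j t = g}. D t))"
  by (simp add: M_alg_def Let_def ring_mat_def)
 ultimately show ?thesis by auto
qed

lemma emat_component:
 assumes "i < k" "j < k" "t \<in> TT" "x \<in> D t"
 shows "emat k i j x \<in> component M (ed i j t)"
 unfolding component_iff using assms by (auto simp: emat_def)

text \<open>For \<open>t = \<one>\<close> this is the neutral component, a product of
  \<open>k\<close> copies of \<open>D \<one>\<close>. Any diagonal position could name the degree;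
  position 0 exists because \<open>k > 0\<close>.\<close>

lemma component_diag_iff:
 assumes t: "t \<in> TT"
 shows "X \<in> component M (ed 0 0 t) \<longleftrightarrow> X \<in> carrier_mat k k \<and>
  (\<forall>i<k. X $$ (i, i) \<in> D t) \<and> (\<forall>i<k. \<forall>j<k. i \<noteq> j \<longrightarrow> X $$ (i, j) = 0)"
proof -
 have e: "ed i j u = ed 0 0 t \<longleftrightarrow> i = j \<and> u = t" if "i < k" "j < k" "u \<in> TT" for i j u
  using entry_degree_diagonal[OF ts_closed, of i s j 0 u t, unfolded ts_k] that t k_pos by blast
 have "(X $$ (i, j) = 0 \<or> (\<exists>u\<in>TT. ed i j u = ed 0 0 t \<and> X $$ (i, j) \<in> D u)) \<longleftrightarrow>
   X $$ (i, j) \<in> (if i = j then D t else {0})" if "i < k" "j < k" for i j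
  using e that t D_0[OF t] by auto
 then show ?thesis unfolding component_iff using D_0[OF t] by (auto split: if_splits)
qed

lemma ed_same: "i < k \<Longrightarrow> j < k \<Longrightarrow> t \<in> TT \<Longrightarrow> u \<in> TT \<Longrightarrow> ed i j t = ed i j u \<Longrightarrow> t = u"
 using entry_degree_same_entry[OF ts_closed, of i s j t u] ts_k by simp

lemma ed_closed: "i < k \<Longrightarrow> j < k \<Longrightarrow> t \<in> TT \<Longrightarrow> ed i j t \<in> carrier (grading_group M)"
 using entry_degree_coset(2)[OF ts_closed ts_k[symmetric]] by (simp add: M_simps)

lemma component_nonzero:
 assumes "component M g \<noteq> {\<zero>\<^bsub>M\<^esub>}"
 obtains i j t where "i < k" "j < k" "t \<in> TT" "g = ed i j t"
proof -
 have "0\<^sub>m k k \<in> component M g" by (simp add: component_iff)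
 then obtain X where X: "X \<in> component M g" "X \<noteq> 0\<^sub>m k k" using assms by (auto simp: M_simps)
 then have c: "X \<in> carrier_mat k k" by (simp add: component_iff)
 obtain i j where ij: "i < k" "j < k" "X $$ (i, j) \<noteq> 0"
 proof (rule ccontr)
  assume a: "\<not> thesis"
  have "X = 0\<^sub>m k k" by (rule eq_matI) (use c a that in auto)
  then show False using X by simp
 qed
 then show thesis using X(1) that component_iff[of X g] by blast
qed

end

section \<open>Graded automorphisms of D, twisting and congruence\<close>

context gr_div_inv
begin

definition gr_aut :: "('d \<Rightarrow> 'd) \<Rightarrow> bool" where
 "gr_aut h \<longleftrightarrow> linear h \<and> bij h \<and> (\<forall>x y. h (x * y) = h x * h y) \<and>
   (\<forall>t\<in>TT. \<exists>u\<in>TT. h ` D t = D u)"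

text \<open>The value off the carrier makes the map extensional, as elements of
  \<open>AutoGroup\<close> have to be.\<close>

definition aut_deg :: "('d \<Rightarrow> 'd) \<Rightarrow> 't \<Rightarrow> 't" where
 "aut_deg h t = (if t \<in> TT then SOME u. u \<in> TT \<and> h ` D t = D u else undefined)"

text \<open>Says that \<open>h\<close> conjugates \<phi> into \<phi> followed by an inner
  automorphism given by \<open>v\<close>; thus \<open>v\<close> measures how far \<open>h\<close> is
  from commuting with \<phi>.\<close>

definition twists :: "('d \<Rightarrow> 'd) \<Rightarrow> 'd \<Rightarrow> bool" where
 "twists h v \<longleftrightarrow> (\<exists>u. hunit u v) \<and> (\<forall>x. v * h (\<phi> x) = \<phi> (h x) * v)"

text \<open>Congruence of one-dimensional hermitian forms: \<open>d'\<close> after the change of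
  basis \<open>c\<close> is the image of \<open>d\<close> under \<open>h\<close>, rescaled by
  \<open>v\<close>.\<close>

definition linked :: "('d \<Rightarrow> 'd) \<Rightarrow> 'd \<Rightarrow> 'd \<Rightarrow> 'd \<Rightarrow> bool" where
 "linked h v d d' \<longleftrightarrow> (\<exists>u c. hunit u c \<and> \<phi> c * d' * c = v * h d)"

lemma D_eq: "s \<in> TT \<Longrightarrow> t \<in> TT \<Longrightarrow> D s = D t \<Longrightarrow> s = t"
 using ex_nonzero D_disjoint by blast

context
 fixes h assumes aut: "gr_aut h"
begin

lemma aut_linear: "linear h" and aut_bij: "bij h" and aut_mult: "h (x * y) = h x * h y"
 using aut by (simp_all add: gr_aut_def)

lemma aut_inj: "h x = h y \<longleftrightarrow> x = y"
 using aut_bij by (simp add: bij_def inj_eq)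

lemma aut_0 [simp]: "h 0 = 0" using aut_linear by (rule linear_0)
lemma aut_add: "h (x + y) = h x + h y" using aut_linear by (rule linear_add)
lemma aut_neg: "h (- x) = - h x" using aut_linear by (rule linear_neg)
lemma aut_scale: "h (r *\<^sub>R x) = r *\<^sub>R h x" using aut_linear by (rule linear_scale)
lemma aut_sum: "h (sum f A) = (\<Sum>a\<in>A. h (f a))" using aut_linear by (rule linear_sum)
lemma aut_eq_0 [simp]: "h x = 0 \<longleftrightarrow> x = 0" using aut_inj[of x 0] by simp

lemma aut_1 [simp]: "h 1 = 1"
proof -
 obtain x where x: "h x = 1" using aut_bij by (metis bij_pointE)
 have "h 1 * h x = h x" using aut_mult[of 1 x] by simp
 then show ?thesis using x by simp
qed

lemma aut_of_real [simp]: "h (of_real r) = of_real r"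
 by (simp add: of_real_def aut_scale)

lemma aut_deg_props: "t \<in> TT \<Longrightarrow> aut_deg h t \<in> TT \<and> h ` D t = D (aut_deg h t)"
proof -
 assume t: "t \<in> TT"
 then obtain u where "u \<in> TT \<and> h ` D t = D u" using aut unfolding gr_aut_def by blast
 from someI[of "\<lambda>u. u \<in> TT \<and> h ` D t = D u", OF this] show ?thesis
  using t by (simp add: aut_deg_def)
qed

lemma aut_deg_closed [simp]: "t \<in> TT \<Longrightarrow> aut_deg h t \<in> TT"
 and aut_image: "t \<in> TT \<Longrightarrow> h ` D t = D (aut_deg h t)"
 using aut_deg_props by auto

lemma aut_hunit: "hunit t x \<Longrightarrow> hunit (aut_deg h t) (h x)"
 using aut_image by (auto simp: hunit_def)

lemma aut_mem: "t \<in> TT \<Longrightarrow> x \<in> D t \<Longrightarrow> h x \<in> D (aut_deg h t)"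
 using aut_image by blast

lemma aut_deg_unique: "hunit t x \<Longrightarrow> hunit u (h x) \<Longrightarrow> aut_deg h t = u"
 using aut_hunit hunit_unique by blast

lemma aut_hinv: "hunit t x \<Longrightarrow> h (hinv x) = hinv (h x)"
 by (rule hinv_eqI[symmetric]) (simp_all add: aut_mult[symmetric] hunit_inv)

lemma aut_deg_mult:
 assumes "s \<in> TT" "t \<in> TT"
 shows "aut_deg h (s \<otimes> t) = aut_deg h s \<otimes> aut_deg h t"
proof -
 obtain x y where xy: "hunit s x" "hunit t y" using ex_hunit assms by meson
 show ?thesis
  by (rule aut_deg_unique[OF hunit_mult[OF xy]])
   (use hunit_mult[OF aut_hunit[OF xy(1)] aut_hunit[OF xy(2)]] in \<open>simp add: aut_mult\<close>)
qed

lemma aut_deg_hom: "aut_deg h \<in> hom T T"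
 by (rule homI) (auto simp: aut_deg_mult)

lemma aut_deg_inj: "inj_on (aut_deg h) TT"
proof (rule inj_onI)
 fix s t assume st: "s \<in> TT" "t \<in> TT" "aut_deg h s = aut_deg h t"
 then have "h ` D s = h ` D t" using aut_image by simp
 then have "D s = D t" using aut_bij by (metis bij_def inj_image_eq_iff)
 then show "s = t" using D_eq st by blast
qed

lemma aut_deg_bij: "bij_betw (aut_deg h) TT TT"
 by (rule bij_betw_imageI[OF aut_deg_inj])
  (rule endo_inj_surj[OF finite_carrier _ aut_deg_inj], auto)

lemma aut_deg_AutoGroup: "aut_deg h \<in> carrier (AutoGroup T)"
 using aut_deg_hom aut_deg_bij
 by (auto simp: AutoGroup_def auto_def Bij_def extensional_def aut_deg_def)

lemma aut_deg_one [simp]: "aut_deg h \<one> = \<one>"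
 using aut_deg_unique[of \<one> 1 \<one>] by simp

lemma aut_mem_iff: "t \<in> TT \<Longrightarrow> h x \<in> D (aut_deg h t) \<longleftrightarrow> x \<in> D t"
 using aut_image[of t] aut_inj by (metis image_iff)

end

end

section \<open>Structure of an equivalence of matrix algebras\<close>

locale M_iso = A: M_params T D \<phi> q s ds \<delta> + B: M_params T D \<phi> q' s' ds' \<delta>'
 for T :: "'t monoid" (structure) and D :: "'t \<Rightarrow> 'd::real_algebra_1 set" and \<phi>
  and q s ds \<delta> q' s' ds' \<delta>'
begin

text \<open>Once the diagonal idempotents are known to be permuted, the corner at index 0 gives
  \<psi>, the images of the first column of matrix units give the base changes \<open>c\<close>, and
  compatibility with the involutions gives \<open>v\<close>.\<close>

lemma M_iso_structure:
 assumes "gr_inv_equivalent A.M B.M"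
 obtains \<psi> v w c where "A.gr_aut \<psi>" "A.twists \<psi> v" "bij_betw w {..<A.k} {..<B.k}"
  "\<And>i. i < A.k \<Longrightarrow> w (A.sw i) = B.sw (w i)"
  "\<And>i. i < A.k \<Longrightarrow> \<exists>u. A.hunit u (c i)"
  "\<And>i. i < A.k \<Longrightarrow> \<phi> (c i) * B.p (w i) * c (A.sw i) = v * \<psi> (A.p i)"
proof -
 let ?k = A.k and ?k' = B.k
 obtain f where f: "f \<in> ring_iso A.M B.M"
  and f_props: "(\<forall>r. \<forall>x\<in>carrier A.M. f (r \<odot>\<^bsub>A.M\<^esub> x) = r \<odot>\<^bsub>B.M\<^esub> f x) \<and>
   (\<forall>x\<in>carrier A.M. f (invol A.M x) = invol B.M (f x)) \<and>
   (\<forall>g\<in>carrier (grading_group A.M). component A.M g \<noteq> {\<zero>\<^bsub>A.M\<^esub>} \<longrightarrow>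
    (\<exists>h\<in>carrier (grading_group B.M). f ` component A.M g = component B.M h))"
  using assms unfolding gr_inv_equivalent_def by blast
 have fs: "f (map_mat (scaleR r) x) = map_mat (scaleR r) (f x)"
  and fi: "f (invol A.M x) = invol B.M (f x)" if "x \<in> carrier_mat ?k ?k" for r x
  using f_props that by (simp_all add: A.M_simps B.M_simps)
 have fc: "\<exists>h. f ` component A.M g = component B.M h"
  if "g \<in> carrier (grading_group A.M)" "component A.M g \<noteq> {0\<^sub>m ?k ?k}" for g
  using f_props that unfolding A.M_simps(5) by blast
 have f_cl: "x \<in> carrier_mat ?k ?k \<Longrightarrow> f x \<in> carrier_mat ?k' ?k'"
  and f_mult: "x \<in> carrier_mat ?k ?k \<Longrightarrow> y \<in> carrier_mat ?k ?k \<Longrightarrow> f (x * y) = f x * f y"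
  and f_add: "x \<in> carrier_mat ?k ?k \<Longrightarrow> y \<in> carrier_mat ?k ?k \<Longrightarrow> f (x + y) = f x + f y"
  and f_one: "f (1\<^sub>m ?k) = 1\<^sub>m ?k'"
  and f_bij: "bij_betw f (carrier_mat ?k ?k) (carrier_mat ?k' ?k')" for x y
  using f by (auto simp: ring_iso_def Ring.ring_hom_def A.M_simps B.M_simps)
 have f_inj: "f x = f y \<longleftrightarrow> x = y" if "x \<in> carrier_mat ?k ?k" "y \<in> carrier_mat ?k ?k" for x y
  using f_bij that by (auto simp: bij_betw_def inj_on_def)
 have f_0: "f (0\<^sub>m ?k ?k) = 0\<^sub>m ?k' ?k'"
 proof -
  have z: "map_mat (scaleR 0) x = 0\<^sub>m n n" if "x \<in> carrier_mat n n" for n and x :: "'d mat"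
   by (rule eq_matI) (use that in auto)
  show ?thesis using fs[of "0\<^sub>m ?k ?k" 0] z[of "0\<^sub>m ?k ?k" ?k] z[OF f_cl, of "0\<^sub>m ?k ?k"] by simp
 qed
 have comp_ed: "\<exists>h. f ` component A.M (A.ed i j t) = component B.M h"
  if ij: "i < ?k" "j < ?k" and t: "t \<in> A.TT" for i j t
 proof (rule fc)
  show "A.ed i j t \<in> carrier (grading_group A.M)" using A.ed_closed that by blast
  obtain x where x: "x \<in> D t" "x \<noteq> 0" using A.ex_nonzero t by blast
  have "emat ?k i j x \<in> component A.M (A.ed i j t)" using A.emat_component that x by blast
  moreover have "emat ?k i j x \<noteq> 0\<^sub>m ?k ?k" using emat_entry[of i ?k j i j x] ij x by auto
  ultimately show "component A.M (A.ed i j t) \<noteq> {0\<^sub>m ?k ?k}" by blast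
 qed
 define Re where "Re = component A.M (A.ed 0 0 \<one>)"
 define Se where "Se = component B.M (B.ed 0 0 \<one>)"
 \<comment> \<open>\<open>f\<close> matches components without a map of degrees; the image of the
   neutral component is identified by the identity matrix in it.\<close>
 have fRe: "f ` Re = Se"
 proof -
  obtain h where h: "f ` Re = component B.M h"
   using comp_ed[OF A.k_pos A.k_pos A.one_closed] by (auto simp: Re_def)
  have "1\<^sub>m ?k \<in> Re" unfolding Re_def A.component_diag_iff[OF A.one_closed] by simp
  then have "f (1\<^sub>m ?k) \<in> f ` Re" by (rule imageI)
  then have "1\<^sub>m ?k' \<in> component B.M h" unfolding f_one h .
  then have "1\<^sub>m ?k' $$ (0, 0) = (0::'d) \<or> (\<exists>t\<in>A.TT. B.ed 0 0 t = h \<and> 1\<^sub>m ?k' $$ (0, 0) \<in> D t)"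
   using B.k_pos unfolding B.component_iff by blast
  then obtain t where t: "t \<in> A.TT" "B.ed 0 0 t = h" "1 \<in> D t"
   using B.k_pos by auto
  have "t = \<one>" using A.D_disjoint[OF t(1) A.one_closed t(3)] A.one_mem by simp
  then show ?thesis using h t by (simp add: Se_def)
 qed
 define E where "E i = emat ?k i i (1::'d)" for i
 define E' where "E' i = emat ?k' i i (1::'d)" for i
 have Ec [simp]: "E i \<in> carrier_mat ?k ?k" "E' i \<in> carrier_mat ?k' ?k'" for i
  by (simp_all add: E_def E'_def)
 have E_Re: "E i \<in> Re" if "i < ?k" for i
  unfolding Re_def A.component_diag_iff[OF A.one_closed] using that by (auto simp: E_def emat_entry)
 have E_Se: "E' i \<in> Se" if "i < ?k'" for i
  unfolding Se_def B.component_diag_iff[OF A.one_closed] using that by (auto simp: E'_def emat_entry)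
 have E_ne: "E i \<noteq> 0\<^sub>m ?k ?k" if "i < ?k" for i
  using that emat_entry[of i ?k i i i "1::'d"] by (auto simp: E_def)
 have E'_ne: "E' i \<noteq> 0\<^sub>m ?k' ?k'" if "i < ?k'" for i
  using that emat_entry[of i ?k' i i i "1::'d"] by (auto simp: E'_def)
 have EE: "E i * E j = (if i = j then E i else 0\<^sub>m ?k ?k)" if "i < ?k" "j < ?k" for i j
  unfolding E_def using that by (simp add: emat_mult)
 have EE': "E' i * E' j = (if i = j then E' i else 0\<^sub>m ?k' ?k')" if "i < ?k'" "j < ?k'" for i j
  unfolding E'_def using that by (simp add: emat_mult)
 have diag_mult: "(X * Y) $$ (a, b) = (if a = b then X $$ (a, a) * Y $$ (a, a) else 0)"
  if "a < n" "b < n" and X: "X \<in> carrier_mat n n" "\<And>i j. i < n \<Longrightarrow> j < n \<Longrightarrow> i \<noteq> j \<Longrightarrow> X $$ (i, j) = 0"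
   and Y: "Y \<in> carrier_mat n n" "\<And>i j. i < n \<Longrightarrow> j < n \<Longrightarrow> i \<noteq> j \<Longrightarrow> Y $$ (i, j) = 0" for X Y :: "'d mat" and n a b
 proof -
  have "(X * Y) $$ (a, b) = (\<Sum>l<n. X $$ (a, l) * Y $$ (l, b))" by (rule mult_entry) (use that in auto)
  also have "\<dots> = (\<Sum>l<n. if l = a then (if a = b then X $$ (a, a) * Y $$ (a, a) else 0) else 0)"
   by (rule sum.cong) (use that in auto)
  finally show ?thesis using that by simp
 qed
 \<comment> \<open>Nonzero elements of \<open>D \<one>\<close> are invertible, so diagonal
   idempotents of neutral degree have entries 0 and 1 only.\<close>
 have idem: "y = 0 \<or> y = 1" if "y \<in> D \<one>" "y * y = y" for y
 proof (cases "y = 0")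
  case False
  then have "A.hunit \<one> y" using that by (simp add: A.hunit_def)
  then show ?thesis using A.hunit_inv2(2)[of \<one> y y] A.hunit_inv(2)[of \<one> y] that by simp
 qed simp
 have Re_idem: "\<exists>a<n. X $$ (a, a) = 1"
  if X: "X \<in> carrier_mat n n" "\<And>i. i < n \<Longrightarrow> X $$ (i, i) \<in> D \<one>" "\<And>i j. i < n \<Longrightarrow> j < n \<Longrightarrow> i \<noteq> j \<Longrightarrow> X $$ (i, j) = 0"
   and "X * X = X" "X \<noteq> 0\<^sub>m n n" for X n
 proof (rule ccontr)
  assume a: "\<not> ?thesis"
  have "X $$ (i, i) = 0" if i: "i < n" for i
   using idem[OF X(2)[OF i]] diag_mult[OF i i X(1,3) X(1,3)] \<open>X * X = X\<close> a i by auto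
  then have "X $$ (i, j) = 0" if "i < n" "j < n" for i j using X(3)[of i j] that by (cases "i = j") auto
  then have "X = 0\<^sub>m n n" by (intro eq_matI) (use X(1) in auto)
  then show False using that by simp
 qed
 \<comment> \<open>The preimage \<open>Y\<close> of \<open>E' a\<close> is a diagonal idempotent
   with some entry 1, say at \<open>i\<close>. Then \<open>E i\<close> lies below \<open>Y\<close>,
   so its image is a nonzero idempotent below \<open>E' a\<close> and must equal it.\<close>
 have prim: "\<exists>i<?k. f (E i) = E' a" if a: "a < ?k'" for a
 proof -
  have "E' a \<in> f ` Re" using E_Se[OF a] fRe by simp
  then obtain Y where Y: "Y \<in> Re" "f Y = E' a" by (metis imageE)
  then have Yc: "Y \<in> carrier_mat ?k ?k" "\<And>i. i < ?k \<Longrightarrow> Y $$ (i, i) \<in> D \<one>"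
   "\<And>i j. i < ?k \<Longrightarrow> j < ?k \<Longrightarrow> i \<noteq> j \<Longrightarrow> Y $$ (i, j) = 0"
   unfolding Re_def A.component_diag_iff[OF A.one_closed] by auto
  have "f (Y * Y) = f Y" using f_mult Yc Y EE' a by simp
  then have "Y * Y = Y" using f_inj Yc by simp
  moreover have "Y \<noteq> 0\<^sub>m ?k ?k" using Y f_0 E'_ne[OF a] by auto
  ultimately obtain i where i: "i < ?k" "Y $$ (i, i) = 1" using Re_idem[OF Yc] by blast
  have "Y * E i = E i"
  proof (rule eq_matI)
   fix x y assume "x < dim_row (E i)" "y < dim_col (E i)"
   then have xy: "x < ?k" "y < ?k" by (auto simp: E_def emat_def)
   have Eo: "\<And>x y. x < ?k \<Longrightarrow> y < ?k \<Longrightarrow> x \<noteq> y \<Longrightarrow> E i $$ (x, y) = 0" by (auto simp: E_def emat_entry)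
   show "(Y * E i) $$ (x, y) = E i $$ (x, y)"
    using diag_mult[OF xy Yc(1,3) Ec(1) Eo] i xy by (auto simp: E_def emat_entry)
  qed (use Yc in \<open>auto simp: E_def emat_def\<close>)
  then have e1: "f (E i) = E' a * f (E i)" using f_mult[OF Yc(1) Ec(1)] Y by metis
  have "f (E i) \<in> Se" using fRe E_Re i by blast
  then have fE: "f (E i) \<in> carrier_mat ?k' ?k'" "\<And>x y. x < ?k' \<Longrightarrow> y < ?k' \<Longrightarrow> x \<noteq> y \<Longrightarrow> f (E i) $$ (x, y) = 0"
   "\<And>x. x < ?k' \<Longrightarrow> f (E i) $$ (x, x) \<in> D \<one>"
   unfolding Se_def B.component_diag_iff[OF A.one_closed] by auto
  have Eo: "\<And>x y. x < ?k' \<Longrightarrow> y < ?k' \<Longrightarrow> x \<noteq> y \<Longrightarrow> E' a $$ (x, y) = 0" by (auto simp: E'_def emat_entry)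
  have z: "f (E i) $$ (x, x) = 0" if "x < ?k'" "x \<noteq> a" for x
  proof -
   have "f (E i) $$ (x, x) = (E' a * f (E i)) $$ (x, x)" using e1 by simp
   also have "\<dots> = E' a $$ (x, x) * f (E i) $$ (x, x)"
    using diag_mult[OF that(1) that(1) Ec(2) Eo fE(1,2)] by simp
   finally show ?thesis using that a by (simp add: E'_def emat_entry)
  qed
  have "f (E i) * f (E i) = f (E i)" using f_mult[OF Ec(1) Ec(1), of i i] EE[of i i] i by simp
  moreover have "f (E i) \<noteq> 0\<^sub>m ?k' ?k'" using E_ne[OF i(1)] f_inj[of "E i" "0\<^sub>m ?k ?k"] f_0 by auto
  ultimately obtain x where "x < ?k'" "f (E i) $$ (x, x) = 1" using Re_idem[OF fE(1,3,2)] by blast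
  then have "f (E i) $$ (a, a) = 1" using z by (cases "x = a") auto
  then have "f (E i) = E' a"
   by (intro eq_matI) (use fE z a in \<open>auto simp: E'_def emat_entry\<close>, auto simp: emat_def)
  then show ?thesis using i by blast
 qed
 \<comment> \<open>Conversely the image of \<open>E i\<close> has an entry 1 at some
   \<open>a\<close>; the \<open>E j\<close> that maps to \<open>E' a\<close> then does not
   annihilate \<open>E i\<close>, so \<open>j = i\<close>.\<close>
 have "\<exists>a<?k'. f (E i) = E' a" if i: "i < ?k" for i
 proof -
  have "f (E i) \<in> Se" using fRe E_Re i by blast
  then have fE: "f (E i) \<in> carrier_mat ?k' ?k'" "\<And>x. x < ?k' \<Longrightarrow> f (E i) $$ (x, x) \<in> D \<one>"
   "\<And>x y. x < ?k' \<Longrightarrow> y < ?k' \<Longrightarrow> x \<noteq> y \<Longrightarrow> f (E i) $$ (x, y) = 0"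
   unfolding Se_def B.component_diag_iff[OF A.one_closed] by auto
  have "f (E i) * f (E i) = f (E i)" using f_mult[OF Ec(1) Ec(1), of i i] EE[of i i] i by simp
  moreover have "f (E i) \<noteq> 0\<^sub>m ?k' ?k'" using E_ne[OF i] f_inj[of "E i" "0\<^sub>m ?k ?k"] f_0 by auto
  ultimately obtain a where a: "a < ?k'" "f (E i) $$ (a, a) = 1" using Re_idem[OF fE] by blast
  obtain j where j: "j < ?k" "f (E j) = E' a" using prim a by blast
  have Eo: "\<And>x y. x < ?k' \<Longrightarrow> y < ?k' \<Longrightarrow> x \<noteq> y \<Longrightarrow> E' a $$ (x, y) = 0" by (auto simp: E'_def emat_entry)
  have "(E' a * f (E i)) $$ (a, a) = 1"
   using diag_mult[OF a(1) a(1) Ec(2) Eo fE(1,3)] a by (simp add: E'_def emat_entry)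
  then have "f (E j * E i) \<noteq> 0\<^sub>m ?k' ?k'" using f_mult[OF Ec(1) Ec(1), of j i] j a by auto
  then have "j = i" using EE[of j i] j i f_0 by (auto split: if_splits)
  then show ?thesis using j a by blast
 qed
 then obtain w where w: "\<And>i. i < ?k \<Longrightarrow> w i < ?k' \<and> f (E i) = E' (w i)" by metis
 have E'_inj: "a = b" if "a < ?k'" "b < ?k'" "E' a = E' b" for a b
  using that EE'[of a b] E'_ne[of a] EE'[of a a] by (auto split: if_splits)
 have E_inj: "a = b" if "a < ?k" "b < ?k" "E a = E b" for a b
  using that EE[of a b] E_ne[of a] EE[of a a] by (auto split: if_splits)
 have w_bij: "bij_betw w {..<?k} {..<?k'}"
 proof (rule bij_betw_imageI)
  show "inj_on w {..<?k}"
   by (rule inj_onI) (metis E_inj Ec(1) w f_inj lessThan_iff)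
  show "w ` {..<?k} = {..<?k'}"
  proof (intro equalityI subsetI)
   fix a assume "a \<in> {..<?k'}"
   then obtain i where "i < ?k" "f (E i) = E' a" using prim by auto
   then have "a = w i" using E'_inj[of a "w i"] w \<open>a \<in> _\<close> by auto
   then show "a \<in> w ` {..<?k}" using \<open>i < ?k\<close> by auto
  qed (use w in auto)
 qed
 \<comment> \<open>Peirce coordinates: by \<open>femat\<close> below, \<open>f\<close> takes
   position \<open>(i, j)\<close> to position \<open>(w i, w j)\<close>, and \<open>F i j\<close> is
   the induced map of entries.\<close>
 define F where "F i j x = f (emat ?k i j x) $$ (w i, w j)" for i j x
 have femat: "f (emat ?k i j x) = emat ?k' (w i) (w j) (F i j x)" if ij: "i < ?k" "j < ?k" for i j x
 proof -
  have "E i * emat ?k i j x * E j = emat ?k i j x"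
   unfolding E_def using emat_sandwich[of "emat ?k i j x" ?k i j] ij by (simp add: emat_entry)
  then have "f (emat ?k i j x) = f (E i * emat ?k i j x * E j)" by simp
  also have "\<dots> = f (E i) * f (emat ?k i j x) * f (E j)"
   using f_mult[of "E i * emat ?k i j x" "E j"] f_mult[of "E i" "emat ?k i j x"] by (simp add: mult_carrier_mat[of _ ?k ?k _ ?k])
  also have "\<dots> = emat ?k' (w i) (w j) (F i j x)"
   unfolding F_def using w ij emat_sandwich[OF f_cl[OF emat_carrier], of "w i" "w j" i j x] by (simp add: E'_def)
  finally show ?thesis .
 qed
 have F_eqI: "F i j x = y" if "i < ?k" "j < ?k" "f (emat ?k i j x) = emat ?k' (w i) (w j) y" for i j x y
  using that femat emat_eq_iff w by metis
 have F_mult: "F i l (x * y) = F i j x * F j l y" if "i < ?k" "j < ?k" "l < ?k" for i j l x y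
  by (rule F_eqI) (use that w f_mult[of "emat ?k i j x" "emat ?k j l y"] in \<open>simp_all add: emat_mult femat\<close>)
 have F_add: "F i j (x + y) = F i j x + F i j y" if "i < ?k" "j < ?k" for i j x y
  by (rule F_eqI) (use that f_add[of "emat ?k i j x" "emat ?k i j y"] in \<open>simp_all add: emat_add femat\<close>)
 have emat_scale: "emat n i j (r *\<^sub>R x) = map_mat (scaleR r) (emat n i j x)" for n i j r and x :: 'd
  by (rule eq_matI) (auto simp: emat_def)
 have F_scale: "F i j (r *\<^sub>R x) = r *\<^sub>R F i j x" if "i < ?k" "j < ?k" for i j x r
  by (rule F_eqI) (use that fs[of "emat ?k i j x" r] in \<open>simp_all add: emat_scale femat\<close>)
 have F_inj: "x = y" if "i < ?k" "j < ?k" "F i j x = F i j y" for i j x y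
  using that femat[of i j x] femat[of i j y] f_inj[of "emat ?k i j x" "emat ?k i j y"] emat_eq_iff by (metis emat_carrier)
 have F_one: "F i i 1 = 1" if "i < ?k" for i
  by (rule F_eqI) (use that w in \<open>simp_all flip: E_def E'_def\<close>)
 have F_0: "F i j 0 = 0" if "i < ?k" "j < ?k" for i j using F_scale[of i j 0 0] that by simp
 have F_deg: "\<exists>u\<in>A.TT. \<forall>x\<in>D t. F i j x \<in> D u" if ij: "i < ?k" "j < ?k" and t: "t \<in> A.TT" for i j t
 proof -
  obtain h where h: "f ` component A.M (A.ed i j t) = component B.M h" using comp_ed ij t by blast
  have mem: "F i j x = 0 \<or> (\<exists>u\<in>A.TT. B.ed (w i) (w j) u = h \<and> F i j x \<in> D u)" if "x \<in> D t" for x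
  proof -
   have "emat ?k' (w i) (w j) (F i j x) \<in> component B.M h"
    using h A.emat_component[OF ij t that] femat[OF ij] by (metis image_eqI)
   then show ?thesis unfolding B.component_iff using w ij by (metis emat_entry)
  qed
  obtain x where x: "x \<in> D t" "x \<noteq> 0" using A.ex_nonzero t by blast
  have "F i j x \<noteq> 0" using F_inj[OF ij, of x 0] F_0[OF ij] x by auto
  then obtain u where u: "u \<in> A.TT" "B.ed (w i) (w j) u = h" using mem x by blast
  have "F i j y \<in> D u" if "y \<in> D t" for y
   using mem[OF that] u B.ed_same[of "w i" "w j"] w ij by (metis A.D_0)
  then show ?thesis using u by blast
 qed
 note k0 = A.k_pos
 define \<psi> where "\<psi> = F 0 0"
 have lin: "linear \<psi>" by (rule linearI) (simp_all add: \<psi>_def F_add[OF k0 k0] F_scale[OF k0 k0])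
 have \<psi>_mult: "\<psi> (x * y) = \<psi> x * \<psi> y" for x y by (simp add: \<psi>_def F_mult[OF k0 k0 k0])
 have surj: "\<exists>X. X \<in> carrier_mat ?k ?k \<and> f X = emat ?k' (w 0) (w 0) y \<and> \<psi> (X $$ (0, 0)) = y" for y
 proof -
  have "emat ?k' (w 0) (w 0) y \<in> f ` carrier_mat ?k ?k"
   unfolding bij_betw_imp_surj_on[OF f_bij] by (rule emat_carrier)
  then obtain X where "emat ?k' (w 0) (w 0) y = f X" "X \<in> carrier_mat ?k ?k" by (rule imageE)
  then have X: "X \<in> carrier_mat ?k ?k" "f X = emat ?k' (w 0) (w 0) y" by simp_all
  have "f (emat ?k 0 0 (X $$ (0, 0))) = f (E 0 * X * E 0)"
   using emat_sandwich[OF X(1), of 0 0] k0 by (simp add: E_def)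
  also have "\<dots> = E' (w 0) * f X * E' (w 0)"
   using f_mult[of "E 0 * X" "E 0"] f_mult[of "E 0" X] X w[OF k0] by (simp add: mult_carrier_mat[of _ ?k ?k _ ?k])
  also have "\<dots> = emat ?k' (w 0) (w 0) y"
   using emat_sandwich[of "f X" ?k' "w 0" "w 0"] X w[OF k0] by (simp add: E'_def emat_entry)
  finally have "\<psi> (X $$ (0, 0)) = y" unfolding \<psi>_def using F_eqI k0 by blast
  then show ?thesis using X by blast
 qed
 have aut: "A.gr_aut \<psi>"
  unfolding A.gr_aut_def
 proof (intro conjI ballI allI)
  show "bij \<psi>"
  proof (rule bijI)
   show "inj \<psi>" unfolding \<psi>_def by (rule injI) (rule F_inj[OF k0 k0])
   show "surj \<psi>" unfolding surj_def using surj by metis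
  qed
 next
  fix t assume t: "t \<in> A.TT"
  obtain h where h: "f ` component A.M (A.ed 0 0 t) = component B.M h" using comp_ed k0 t by blast
  obtain u where u: "u \<in> A.TT" "\<forall>x\<in>D t. \<psi> x \<in> D u" using F_deg[OF k0 k0 t] by (auto simp: \<psi>_def)
  obtain x where x: "x \<in> D t" "x \<noteq> 0" using A.ex_nonzero t by blast
  have nz: "\<psi> x \<noteq> 0" using F_inj[OF k0 k0, of x 0] F_0[OF k0 k0] x by (auto simp: \<psi>_def)
  have "emat ?k' (w 0) (w 0) (\<psi> x) \<in> component B.M h"
   using h A.emat_component[OF k0 k0 t x(1)] femat[OF k0 k0] unfolding \<psi>_def by (metis image_eqI)
  then obtain u' where u': "u' \<in> A.TT" "B.ed (w 0) (w 0) u' = h" "\<psi> x \<in> D u'"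
   unfolding B.component_iff using w[OF k0] nz by (metis emat_entry)
  have "u' = u" using A.D_disjoint u u' x nz by blast
  then have hu: "h = B.ed (w 0) (w 0) u" using u' by simp
  have "D u \<subseteq> \<psi> ` D t"
  proof
   fix y assume y: "y \<in> D u"
   obtain X where X: "X \<in> carrier_mat ?k ?k" "f X = emat ?k' (w 0) (w 0) y" "\<psi> (X $$ (0, 0)) = y"
    using surj by blast
   have "emat ?k' (w 0) (w 0) y \<in> component B.M h"
    unfolding hu using B.emat_component w[OF k0] u y by blast
   then have "f X \<in> f ` component A.M (A.ed 0 0 t)" using h X by simp
   then obtain Z where "Z \<in> component A.M (A.ed 0 0 t)" "f X = f Z" by blast
   then have "X \<in> component A.M (A.ed 0 0 t)" using f_inj X A.component_iff by metis
   then have "X $$ (0, 0) \<in> D t" unfolding A.component_diag_iff[OF t] using k0 by blast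
   then show "y \<in> \<psi> ` D t" using X by blast
  qed
  then show "\<exists>u\<in>A.TT. \<psi> ` D t = D u" using u by blast
 qed (use lin \<psi>_mult in auto)
 \<comment> \<open>Inserting index 0 by \<open>F_mult\<close> on both sides reduces every
   \<open>F i j\<close> to \<psi> and these elements; this is \<open>F_eq\<close>.\<close>
 define c where "c i = F i 0 1" for i
 have c_inv: "c i * F 0 i 1 = 1" "F 0 i 1 * c i = 1" if "i < ?k" for i
  using that k0 F_mult[of i 0 i 1 1] F_mult[of 0 i 0 1 1] F_one by (simp_all add: c_def)
 have hinv_c: "hinv (c i) = F 0 i 1" if "i < ?k" for i
  using c_inv[OF that] by (rule hinv_eqI)
 have c_unit: "\<exists>u. A.hunit u (c i)" if i: "i < ?k" for i
 proof -
  obtain u where "u \<in> A.TT" "c i \<in> D u" using F_deg[OF i k0 A.one_closed] A.one_mem by (auto simp: c_def)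
  moreover have "c i \<noteq> 0" using c_inv[OF i] by auto
  ultimately show ?thesis by (auto simp: A.hunit_def)
 qed
 have F_eq: "F i j x = c i * \<psi> x * hinv (c j)" if "i < ?k" "j < ?k" for i j x
  using F_mult[of i 0 j 1 x] F_mult[of 0 0 j x 1] that k0 by (simp add: c_def \<psi>_def hinv_c[unfolded c_def] mult.assoc)
 \<comment> \<open>Compatibility with the involutions on matrix units. Equality of positions yields
   commutation with the partner maps, equality of entries yields the equation for
   \<open>v\<close>.\<close>
 have star: "emat ?k' (w (A.sw j)) (w (A.sw i)) (F (A.sw j) (A.sw i) (hinv (A.p j) * \<phi> x * A.p i)) =
    emat ?k' (B.sw (w j)) (B.sw (w i)) (hinv (B.p (w j)) * \<phi> (F i j x) * B.p (w i))"
  if ij: "i < ?k" "j < ?k" for i j x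
 proof -
  have "f (invol A.M (emat ?k i j x)) = invol B.M (f (emat ?k i j x))" by (rule fi) simp
  then show ?thesis
   unfolding A.invol_emat[OF ij] femat[OF ij] using femat[OF A.sw_less[OF ij(2)] A.sw_less[OF ij(1)]]
    B.invol_emat[of "w i" "w j"] w ij by metis
 qed
 have comm: "w (A.sw i) = B.sw (w i)" if i: "i < ?k" for i
 proof -
  have "hinv (A.p i) * \<phi> 1 * A.p i = 1" using A.hunit_inv[OF A.hunit_p] by simp
  then have "F (A.sw i) (A.sw i) (hinv (A.p i) * \<phi> 1 * A.p i) \<noteq> 0" using F_one[OF A.sw_less[OF i]] by simp
  then show ?thesis using emat_eq_D[OF star[OF i i, of 1]] w A.sw_less[OF i] by metis
 qed
 \<comment> \<open>The desired equation solved for \<open>v\<close> at index \<open>i\<close>. The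
   relation \<open>m\<close> proved next, taken at \<open>x = 1\<close>, shows that the result does
   not depend on \<open>i\<close>.\<close>
 define m where "m i = \<phi> (c i) * B.p (w i) * c (A.sw i) * hinv (\<psi> (A.p i))" for i
 have m: "m j * \<psi> (\<phi> x) = \<phi> (\<psi> x) * m i" if ij: "i < ?k" "j < ?k" for i j x
 proof -
  have si: "A.sw i < ?k" "A.sw j < ?k" using A.sw_less ij by auto
  obtain ci cj si' sj' where hc: "A.hunit ci (c i)" "A.hunit cj (c j)" "A.hunit si' (c (A.sw i))" "A.hunit sj' (c (A.sw j))"
   using c_unit ij si by meson
  have hp: "A.hunit (A.aut_deg \<psi> (A.\<tau> l)) (\<psi> (A.p l))" for l using A.aut_hunit[OF aut A.hunit_p] .
  have eq: "F (A.sw j) (A.sw i) (hinv (A.p j) * \<phi> x * A.p i) = hinv (B.p (w j)) * \<phi> (F i j x) * B.p (w i)"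
  proof -
   have "B.sw (w j) < ?k'" "B.sw (w i) < ?k'" using B.sw_less w ij by auto
   then show ?thesis
    using star[OF ij, of x] comm ij by (simp add: emat_eq_iff)
  qed
  have "\<phi> (F i j x) = hinv (\<phi> (c j)) * \<phi> (\<psi> x) * \<phi> (c i)"
   using F_eq[OF ij] A.phi_hinv[OF hc(2)] by (simp add: A.phi_mult mult.assoc)
  moreover have "F (A.sw j) (A.sw i) (hinv (A.p j) * \<phi> x * A.p i) =
    c (A.sw j) * hinv (\<psi> (A.p j)) * \<psi> (\<phi> x) * \<psi> (A.p i) * hinv (c (A.sw i))"
   unfolding F_eq[OF si(2,1)] using A.aut_hinv[OF aut A.hunit_p] by (simp add: \<psi>_mult mult.assoc)
  ultimately have e: "c (A.sw j) * hinv (\<psi> (A.p j)) * \<psi> (\<phi> x) * \<psi> (A.p i) * hinv (c (A.sw i)) =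
    hinv (B.p (w j)) * (hinv (\<phi> (c j)) * \<phi> (\<psi> x) * \<phi> (c i)) * B.p (w i)" using eq by simp
  have "m j * \<psi> (\<phi> x) = \<phi> (c j) * B.p (w j) *
    (c (A.sw j) * hinv (\<psi> (A.p j)) * \<psi> (\<phi> x) * \<psi> (A.p i) * hinv (c (A.sw i))) * (c (A.sw i) * hinv (\<psi> (A.p i)))"
   unfolding m_def
   by (simp add: mult.assoc A.hunit_inv2[OF hc(3)] A.hunit_inv[OF hp])
  also have "\<dots> = \<phi> (\<psi> x) * m i"
   unfolding e m_def
   by (simp add: mult.assoc A.hunit_inv2[OF B.hunit_p] A.hunit_inv2[OF A.hunit_phi[OF hc(2)]])
  finally show ?thesis .
 qed
 have m0: "m i = m 0" if "i < ?k" for i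
  using m[OF that k0, of 1] A.aut_1[OF aut] by simp
 have "\<exists>u. A.hunit u (m 0)"
 proof -
  obtain a b where "A.hunit a (c 0)" "A.hunit b (c (A.sw 0))" using c_unit k0 A.sw_less by meson
  from A.hunit_mult[OF A.hunit_mult[OF A.hunit_mult[OF A.hunit_phi[OF this(1)] B.hunit_p] this(2)] A.hunit_hinv[OF A.aut_hunit[OF aut A.hunit_p]], of "w 0" 0]
  show ?thesis unfolding m_def by blast
 qed
 then have tw: "A.twists \<psi> (m 0)" unfolding A.twists_def using m[OF k0 k0] by simp
 have eqn: "\<phi> (c i) * B.p (w i) * c (A.sw i) = m 0 * \<psi> (A.p i)" if "i < ?k" for i
 proof -
  have "m i * \<psi> (A.p i) = \<phi> (c i) * B.p (w i) * c (A.sw i)"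
   unfolding m_def using A.hunit_inv[OF A.aut_hunit[OF aut A.hunit_p]] by (simp add: mult.assoc)
  then show ?thesis using m0[OF that] by simp
 qed
 show thesis using that[OF aut tw w_bij] comm c_unit eqn by blast
qed

end

section \<open>Construction of an equivalence from data on D\<close>

context M_iso
begin

text \<open>The equivalence applies \<psi> entrywise, permutes positions by \<pi> and conjugates by
  the diagonal matrix of the \<open>c i\<close>. The equations \<open>eqn\<close> make it compatible
  with the involutions, and their degrees make it compatible with the gradings.\<close>

lemma M_iso_of_structure:
 assumes k: "A.k = B.k" and aut: "A.gr_aut \<psi>" and tw: "A.twists \<psi> v"
  and bij: "bij_betw \<pi> {..<A.k} {..<A.k}"
  and comm: "\<And>i. i < A.k \<Longrightarrow> \<pi> (A.sw i) = B.sw (\<pi> i)"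
  and unit: "\<And>i. i < A.k \<Longrightarrow> \<exists>u. A.hunit u (c i)"
  and eqn: "\<And>i. i < A.k \<Longrightarrow> \<phi> (c i) * B.p (\<pi> i) * c (A.sw i) = v * \<psi> (A.p i)"
 shows "gr_inv_equivalent A.M B.M"
proof -
 let ?k = A.k and ?\<alpha> = "A.aut_deg \<psi>"
 define \<rho> where "\<rho> = inv_into {..<?k} \<pi>"
 define \<psi>' where "\<psi>' = inv_into UNIV \<psi>"
 have \<pi>_less: "\<pi> i < ?k" if "i < ?k" for i using bij that by (auto dest: bij_betwE)
 have \<rho>_less: "\<rho> a < ?k" if "a < ?k" for a
  using bij_betwE[OF bij_betw_inv_into[OF bij]] that by (auto simp: \<rho>_def)
 have \<rho>\<pi>: "\<rho> (\<pi> i) = i" if "i < ?k" for i using bij_betw_inv_into_left[OF bij] that by (simp add: \<rho>_def)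
 have \<pi>\<rho>: "\<pi> (\<rho> a) = a" if "a < ?k" for a using bij_betw_inv_into_right[OF bij] that by (simp add: \<rho>_def)
 have \<rho>_bij: "bij_betw \<rho> {..<?k} {..<?k}" unfolding \<rho>_def by (rule bij_betw_inv_into[OF bij])
 have B_less: "B.sw a < ?k" if "a < ?k" for a using B.sw_less that k by simp
 have \<rho>sw: "\<rho> (B.sw a) = A.sw (\<rho> a)" if "a < ?k" for a
  using comm[OF \<rho>_less[OF that]] \<pi>\<rho>[OF that] \<rho>\<pi>[OF A.sw_less[OF \<rho>_less[OF that]]] by simp
 have \<psi>\<psi>': "\<psi> (\<psi>' x) = x" and \<psi>'\<psi>: "\<psi>' (\<psi> x) = x" for x
  using A.aut_bij[OF aut] by (simp_all add: \<psi>'_def bij_is_surj surj_f_inv_f bij_is_inj inv_f_f)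
 obtain \<gamma> where \<gamma>: "\<And>i. i < ?k \<Longrightarrow> A.hunit (\<gamma> i) (c i)" using unit by metis
 have \<gamma>c: "\<gamma> i \<in> A.TT" if "i < ?k" for i using \<gamma>[OF that] by (rule A.hunitD)
 obtain w where w: "A.hunit w v" using tw by (auto simp: A.twists_def)
 have wc: "w \<in> A.TT" using w by (rule A.hunitD)
 have twist: "v * \<psi> (\<phi> x) = \<phi> (\<psi> x) * v" for x using tw by (simp add: A.twists_def)
 have ci: "c i * hinv (c i) = 1" "hinv (c i) * c i = 1" "c i * (hinv (c i) * x) = x" "hinv (c i) * (c i * x) = x"
  if "i < ?k" for i x using A.hunit_inv[OF \<gamma>[OF that]] A.hunit_inv2[OF \<gamma>[OF that]] by auto
 \<comment> \<open>Degrees in \<open>eqn\<close> give exactly the hypothesis \<open>rel\<close> of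
   \<open>entry_degree_transfer\<close>, with \<open>w\<close> the degree of
   \<open>v\<close>.\<close>
 have rel: "\<gamma> i \<otimes> B.\<tau> (\<pi> i) \<otimes> \<gamma> (A.sw i) = w \<otimes> ?\<alpha> (A.\<tau> i)" if i: "i < ?k" for i
 proof (rule A.hunit_unique)
  show "A.hunit (w \<otimes> ?\<alpha> (A.\<tau> i)) (v * \<psi> (A.p i))"
   by (rule A.hunit_mult[OF w A.aut_hunit[OF aut A.hunit_p]])
  have "A.hunit (\<gamma> i \<otimes> B.\<tau> (\<pi> i) \<otimes> \<gamma> (A.sw i)) (\<phi> (c i) * B.p (\<pi> i) * c (A.sw i))"
   by (intro A.hunit_mult A.hunit_phi \<gamma> i A.sw_less B.hunit_p)
  then show "A.hunit (\<gamma> i \<otimes> B.\<tau> (\<pi> i) \<otimes> \<gamma> (A.sw i)) (v * \<psi> (A.p i))" using eqn[OF i] by simp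
 qed
 define \<alpha>' where "\<alpha>' = inv_into A.TT ?\<alpha>"
 have \<alpha>'c: "\<alpha>' t \<in> A.TT" if "t \<in> A.TT" for t
  using bij_betwE[OF bij_betw_inv_into[OF A.aut_deg_bij[OF aut]]] that by (simp add: \<alpha>'_def)
 have \<alpha>\<alpha>': "?\<alpha> (\<alpha>' t) = t" if "t \<in> A.TT" for t
  using bij_betw_inv_into_right[OF A.aut_deg_bij[OF aut]] that by (simp add: \<alpha>'_def)
 have \<alpha>'\<alpha>: "\<alpha>' (?\<alpha> t) = t" if "t \<in> A.TT" for t
  using bij_betw_inv_into_left[OF A.aut_deg_bij[OF aut]] that by (simp add: \<alpha>'_def)
 have \<alpha>'m: "\<alpha>' (s \<otimes> t) = \<alpha>' s \<otimes> \<alpha>' t" if "s \<in> A.TT" "t \<in> A.TT" for s t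
  using \<alpha>'\<alpha>[of "\<alpha>' s \<otimes> \<alpha>' t"] A.aut_deg_mult[OF aut, of "\<alpha>' s" "\<alpha>' t"] that \<alpha>\<alpha>' \<alpha>'c by simp
 have \<alpha>'hom: "\<alpha>' \<in> hom T T" by (rule homI) (auto simp: \<alpha>'c \<alpha>'m)
 interpret a': group_hom T T \<alpha>' by unfold_locales (rule \<alpha>'hom)
 have \<tau>c: "A.\<tau> i \<in> A.TT" "B.\<tau> i \<in> A.TT" for i
  using A.hunitD(1)[OF A.hunit_p] A.hunitD(1)[OF B.hunit_p] by auto
 let ?d = "\<lambda>i j t. \<gamma> i \<otimes> ?\<alpha> t \<otimes> inv (\<gamma> j)"
 have dc: "?d i j t \<in> A.TT" if "i < ?k" "j < ?k" "t \<in> A.TT" for i j t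
  using that \<gamma>c A.aut_deg_closed[OF aut] by simp
 have ts_len: "length A.ts = q" "length B.ts = q'" using A.len B.len by simp_all
 \<comment> \<open>Both directions matter: the image of a component has to lie in one component and
   also to exhaust it.\<close>
 have K: "A.ed i j t = A.ed i' j' t' \<longleftrightarrow> B.ed (\<pi> i) (\<pi> j) (?d i j t) = B.ed (\<pi> i') (\<pi> j') (?d i' j' t')"
  if ij: "i < ?k" "j < ?k" "t \<in> A.TT" "i' < ?k" "j' < ?k" "t' \<in> A.TT" for i j t i' j' t'
 proof
  assume "A.ed i j t = A.ed i' j' t'"
  show "B.ed (\<pi> i) (\<pi> j) (?d i j t) = B.ed (\<pi> i') (\<pi> j') (?d i' j' t')"
   by (rule A.entry_degree_transfer[OF A.ts_closed B.ts_closed A.ts_k B.ts_k[folded k] \<pi>_less _ A.aut_deg_hom[OF aut] \<gamma>c wc _ ij])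
    (use comm rel ts_len \<open>A.ed i j t = A.ed i' j' t'\<close> in auto)
 next
  assume B: "B.ed (\<pi> i) (\<pi> j) (?d i j t) = B.ed (\<pi> i') (\<pi> j') (?d i' j' t')"
  \<comment> \<open>Degree shifts of the inverse data: \<open>rel\<close> solved for the inverse
    matching \<rho> and the inverse degree map.\<close>
  let ?g = "\<lambda>a. inv (\<alpha>' (\<gamma> (\<rho> a)))"
  have "A.ed (\<rho> (\<pi> i)) (\<rho> (\<pi> j)) (?g (\<pi> i) \<otimes> \<alpha>' (?d i j t) \<otimes> inv (?g (\<pi> j))) =
    A.ed (\<rho> (\<pi> i')) (\<rho> (\<pi> j')) (?g (\<pi> i') \<otimes> \<alpha>' (?d i' j' t') \<otimes> inv (?g (\<pi> j')))"
  proof (rule A.entry_degree_transfer[OF B.ts_closed A.ts_closed B.ts_k[folded k] A.ts_k \<rho>_less _ \<alpha>'hom _ _ _ _ _ _ _ _ _ B])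
   show "\<rho> (partner (length B.ts) a) = partner (length A.ts) (\<rho> a)" if "a < ?k" for a
    using \<rho>sw[OF that] ts_len by simp
   show "?g a \<in> A.TT" if "a < ?k" for a using \<gamma>c \<rho>_less \<alpha>'c that by simp
   show "inv (\<alpha>' w) \<in> A.TT" using wc \<alpha>'c by simp
   show "?g a \<otimes> A.\<tau> (\<rho> a) \<otimes> ?g (partner (length B.ts) a) = inv (\<alpha>' w) \<otimes> \<alpha>' (B.\<tau> a)" if a: "a < ?k" for a
   proof -
    let ?i = "\<rho> a"
    have i: "?i < ?k" "A.sw ?i < ?k" using \<rho>_less[OF a] A.sw_less by auto
    have cl: "\<alpha>' (\<gamma> ?i) \<in> A.TT" "\<alpha>' (\<gamma> (A.sw ?i)) \<in> A.TT" "\<alpha>' w \<in> A.TT" "\<alpha>' (B.\<tau> a) \<in> A.TT"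
     using \<alpha>'c \<gamma>c i wc \<tau>c by auto
    have "\<alpha>' (\<gamma> ?i \<otimes> B.\<tau> a \<otimes> \<gamma> (A.sw ?i)) = \<alpha>' (w \<otimes> ?\<alpha> (A.\<tau> ?i))"
     using rel[OF i(1)] \<pi>\<rho>[OF a] by simp
    then have e: "\<alpha>' (\<gamma> ?i) \<otimes> \<alpha>' (B.\<tau> a) \<otimes> \<alpha>' (\<gamma> (A.sw ?i)) = \<alpha>' w \<otimes> A.\<tau> ?i"
     using \<gamma>c i wc \<tau>c A.aut_deg_closed[OF aut] \<alpha>'\<alpha> \<alpha>'m by simp
    have "inv (\<alpha>' w) \<otimes> \<alpha>' (B.\<tau> a) = inv (\<alpha>' (\<gamma> ?i)) \<otimes> A.\<tau> ?i \<otimes> inv (\<alpha>' (\<gamma> (A.sw ?i)))"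
    proof -
     have "inv (\<alpha>' (\<gamma> ?i)) \<otimes> A.\<tau> ?i \<otimes> inv (\<alpha>' (\<gamma> (A.sw ?i))) =
       inv (\<alpha>' (\<gamma> ?i)) \<otimes> (inv (\<alpha>' w) \<otimes> (\<alpha>' w \<otimes> A.\<tau> ?i)) \<otimes> inv (\<alpha>' (\<gamma> (A.sw ?i)))"
      using cl \<tau>c by (simp add: A.m_assoc[symmetric])
     also have "\<dots> = inv (\<alpha>' w) \<otimes> \<alpha>' (B.\<tau> a) \<otimes> (inv (\<alpha>' (\<gamma> ?i)) \<otimes> \<alpha>' (\<gamma> ?i)) \<otimes> (\<alpha>' (\<gamma> (A.sw ?i)) \<otimes> inv (\<alpha>' (\<gamma> (A.sw ?i))))"
      unfolding e[symmetric] using cl by (simp only: A.m_ac A.inv_closed A.m_closed)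
     finally show ?thesis using cl by simp
    qed
    then show ?thesis using \<rho>sw[OF a] ts_len by simp
   qed
  qed (use ij \<pi>_less dc in auto)
  moreover have "?g (\<pi> i) \<otimes> \<alpha>' (?d i j t) \<otimes> inv (?g (\<pi> j)) = t" if "i < ?k" "j < ?k" "t \<in> A.TT" for i j t
  proof -
   have cl: "\<alpha>' (\<gamma> i) \<in> A.TT" "\<alpha>' (\<gamma> j) \<in> A.TT" using that \<alpha>'c \<gamma>c by auto
   have "\<alpha>' (?d i j t) = \<alpha>' (\<gamma> i) \<otimes> t \<otimes> inv (\<alpha>' (\<gamma> j))"
    using that \<gamma>c A.aut_deg_closed[OF aut] \<alpha>'\<alpha> by (simp add: \<alpha>'m)
   then show ?thesis using cl that \<rho>\<pi> by (simp add: A.m_assoc) (simp add: A.m_assoc[symmetric])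
  qed
  ultimately show "A.ed i j t = A.ed i' j' t'" using ij \<rho>\<pi> by simp
 qed
 define f where "f X = mat ?k ?k (\<lambda>(a, b). c (\<rho> a) * \<psi> (X $$ (\<rho> a, \<rho> b)) * hinv (c (\<rho> b)))" for X
 define g where "g Y = mat ?k ?k (\<lambda>(i, j). \<psi>' (hinv (c i) * Y $$ (\<pi> i, \<pi> j) * c j))" for Y
 have f_entry: "f X $$ (a, b) = c (\<rho> a) * \<psi> (X $$ (\<rho> a, \<rho> b)) * hinv (c (\<rho> b))" if "a < ?k" "b < ?k" for X a b
  using that by (simp add: f_def)
 have f_cl: "f X \<in> carrier_mat ?k ?k" and g_cl: "g X \<in> carrier_mat ?k ?k" for X by (simp_all add: f_def g_def)
 have fg: "f (g Y) = Y" if Y: "Y \<in> carrier_mat ?k ?k" for Y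
 proof (rule eq_matI)
  fix a b assume "a < dim_row Y" "b < dim_col Y"
  then have ab: "a < ?k" "b < ?k" using Y by auto
  show "f (g Y) $$ (a, b) = Y $$ (a, b)"
   using ab \<rho>_less[OF ab(1)] \<rho>_less[OF ab(2)]
   by (simp add: f_entry g_def \<psi>\<psi>' \<pi>\<rho> mult.assoc ci)
 qed (use Y f_cl in auto)
 have gf: "g (f X) = X" if X: "X \<in> carrier_mat ?k ?k" for X
 proof (rule eq_matI)
  fix i j assume "i < dim_row X" "j < dim_col X"
  then have ij: "i < ?k" "j < ?k" using X by auto
  show "g (f X) $$ (i, j) = X $$ (i, j)"
   using ij \<pi>_less[OF ij(1)] \<pi>_less[OF ij(2)]
   by (simp add: f_entry g_def \<psi>'\<psi> \<rho>\<pi> mult.assoc ci)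
 qed (use X g_cl in auto)
 have f_bij: "bij_betw f (carrier_mat ?k ?k) (carrier_mat ?k ?k)"
  by (rule bij_betwI[where g = g]) (use f_cl g_cl fg gf in auto)
 have f_mult: "f (X * Y) = f X * f Y" if X: "X \<in> carrier_mat ?k ?k" and Y: "Y \<in> carrier_mat ?k ?k" for X Y
 proof (rule eq_matI)
  fix a b assume "a < dim_row (f X * f Y)" "b < dim_col (f X * f Y)"
  then have ab: "a < ?k" "b < ?k" by (simp_all add: f_def)
  note r = \<rho>_less[OF ab(1)] \<rho>_less[OF ab(2)]
  have "(f X * f Y) $$ (a, b) = (\<Sum>l<?k. f X $$ (a, l) * f Y $$ (l, b))"
   by (rule mult_entry) (use f_cl ab in auto)
  also have "\<dots> = (\<Sum>l<?k. c (\<rho> a) * (\<psi> (X $$ (\<rho> a, \<rho> l)) * \<psi> (Y $$ (\<rho> l, \<rho> b))) * hinv (c (\<rho> b)))"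
   by (rule sum.cong) (use ab \<rho>_less in \<open>auto simp: f_entry mult.assoc ci\<close>)
  also have "\<dots> = (\<Sum>l<?k. c (\<rho> a) * (\<psi> (X $$ (\<rho> a, l)) * \<psi> (Y $$ (l, \<rho> b))) * hinv (c (\<rho> b)))"
   by (rule sum.reindex_bij_betw[OF \<rho>_bij])
  also have "\<dots> = c (\<rho> a) * \<psi> ((X * Y) $$ (\<rho> a, \<rho> b)) * hinv (c (\<rho> b))"
   unfolding mult_entry[OF X Y r] by (simp add: A.aut_sum[OF aut] A.aut_mult[OF aut] sum_distrib_left sum_distrib_right)
  finally show "f (X * Y) $$ (a, b) = (f X * f Y) $$ (a, b)" using ab by (simp add: f_entry)
 qed (simp_all add: f_def)
 have f_add: "f (X + Y) = f X + f Y" if X: "X \<in> carrier_mat ?k ?k" and Y: "Y \<in> carrier_mat ?k ?k" for X Y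
  by (rule eq_matI) (use X Y \<rho>_less in \<open>auto simp: f_def A.aut_add[OF aut] algebra_simps\<close>)
 have f_one: "f (1\<^sub>m ?k) = 1\<^sub>m ?k"
 proof (rule eq_matI)
  fix a b assume "a < dim_row (1\<^sub>m ?k :: 'd mat)" "b < dim_col (1\<^sub>m ?k :: 'd mat)"
  then have ab: "a < ?k" "b < ?k" by auto
  have "\<rho> a = \<rho> b \<longleftrightarrow> a = b" using \<pi>\<rho> ab by metis
  then show "f (1\<^sub>m ?k) $$ (a, b) = 1\<^sub>m ?k $$ (a, b)"
   using ab \<rho>_less ci A.aut_1[OF aut] A.aut_0[OF aut] by (auto simp: f_entry)
 qed (use f_cl in auto)
 have f_scale: "f (map_mat (scaleR r) X) = map_mat (scaleR r) (f X)" if X: "X \<in> carrier_mat ?k ?k" for r X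
  by (rule eq_matI) (use X \<rho>_less in \<open>auto simp: f_def A.aut_scale[OF aut]\<close>)
 \<comment> \<open>\<open>eqn\<close> at \<open>i\<close> and at \<open>j\<close> expresses the
   entries of the target form through those of the source; the twisting relation then moves
   \<open>v\<close> across, and all base changes cancel.\<close>
 have star: "c (A.sw j) * \<psi> (hinv (A.p j) * \<phi> x * A.p i) * hinv (c (A.sw i)) =
   hinv (B.p (\<pi> j)) * \<phi> (c i * \<psi> x * hinv (c j)) * B.p (\<pi> i)" if ij: "i < ?k" "j < ?k" for i j x
 proof -
  note hp = A.aut_hunit[OF aut A.hunit_p]
  note si = A.sw_less[OF ij(1)] and sj = A.sw_less[OF ij(2)]
  note hi = A.hunit_phi[OF \<gamma>[OF ij(1)]] and hj = A.hunit_phi[OF \<gamma>[OF ij(2)]]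
  have pi: "B.p (\<pi> i) = hinv (\<phi> (c i)) * (v * (\<psi> (A.p i) * hinv (c (A.sw i))))"
  proof -
   have "hinv (\<phi> (c i)) * (v * (\<psi> (A.p i) * hinv (c (A.sw i)))) =
    hinv (\<phi> (c i)) * ((\<phi> (c i) * B.p (\<pi> i) * c (A.sw i)) * hinv (c (A.sw i)))"
    unfolding eqn[OF ij(1)] by (simp add: mult.assoc)
   then show ?thesis by (simp add: mult.assoc A.hunit_inv2[OF hi] ci[OF si])
  qed
  have pj: "hinv (B.p (\<pi> j)) = c (A.sw j) * hinv (\<psi> (A.p j)) * hinv v * \<phi> (c j)"
  proof (rule hinv_eqI)
   have B1: "\<phi> (c j) * B.p (\<pi> j) = v * \<psi> (A.p j) * hinv (c (A.sw j))"
    using eqn[OF ij(2)] ci[OF sj] by (metis mult.assoc mult.right_neutral)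
   have "c (A.sw j) * hinv (\<psi> (A.p j)) * hinv v * \<phi> (c j) * B.p (\<pi> j) =
    c (A.sw j) * hinv (\<psi> (A.p j)) * hinv v * (v * \<psi> (A.p j) * hinv (c (A.sw j)))"
    unfolding B1[symmetric] by (simp add: mult.assoc)
   also have "\<dots> = 1" by (simp add: mult.assoc A.hunit_inv2[OF w] A.hunit_inv2[OF hp] ci[OF sj])
   finally show "c (A.sw j) * hinv (\<psi> (A.p j)) * hinv v * \<phi> (c j) * B.p (\<pi> j) = 1" .
   have "B.p (\<pi> j) * (c (A.sw j) * hinv (\<psi> (A.p j)) * hinv v * \<phi> (c j)) =
     hinv (\<phi> (c j)) * (\<phi> (c j) * B.p (\<pi> j) * c (A.sw j)) * hinv (\<psi> (A.p j)) * hinv v * \<phi> (c j)"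
    by (simp add: mult.assoc A.hunit_inv2[OF hj])
   also have "\<dots> = 1" unfolding eqn[OF ij(2)]
    by (simp add: mult.assoc A.hunit_inv2[OF hp] A.hunit_inv2[OF w] A.hunit_inv[OF hj])
   finally show "B.p (\<pi> j) * (c (A.sw j) * hinv (\<psi> (A.p j)) * hinv v * \<phi> (c j)) = 1" .
  qed
  have tx: "\<phi> (\<psi> x) * (v * y) = v * (\<psi> (\<phi> x) * y)" for y
   using twist[of x] by (simp add: mult.assoc[symmetric])
  show ?thesis
   unfolding pi pj
   by (simp add: A.aut_mult[OF aut] A.aut_hinv[OF aut A.hunit_p] A.phi_mult A.phi_hinv[OF \<gamma>[OF ij(2)]]
    mult.assoc A.hunit_inv2[OF hi] A.hunit_inv2[OF hj] tx A.hunit_inv2[OF w])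
 qed
 have f_invol: "f (invol A.M X) = invol B.M (f X)" if X: "X \<in> carrier_mat ?k ?k" for X
 proof (rule eq_matI)
  have Bk: "f X \<in> carrier_mat B.k B.k" using f_cl k by simp
  fix a b assume "a < dim_row (invol B.M (f X))" "b < dim_col (invol B.M (f X))"
  then have ab: "a < ?k" "b < ?k" using B.invol_closed[OF Bk] k by auto
  note r = \<rho>_less[OF ab(1)] \<rho>_less[OF ab(2)]
  note sr = A.sw_less[OF r(1)] A.sw_less[OF r(2)]
  note sab = B_less[OF ab(1)] B_less[OF ab(2)]
  have "f (invol A.M X) $$ (a, b) = c (\<rho> a) * \<psi> (hinv (A.p (A.sw (\<rho> a))) * \<phi> (X $$ (A.sw (\<rho> b), A.sw (\<rho> a))) * A.p (A.sw (\<rho> b))) * hinv (c (\<rho> b))"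
   using ab r by (simp add: f_entry A.invol_M[OF X])
  also have "\<dots> = hinv (B.p (B.sw a)) * \<phi> (c (A.sw (\<rho> b)) * \<psi> (X $$ (A.sw (\<rho> b), A.sw (\<rho> a))) * hinv (c (A.sw (\<rho> a)))) * B.p (B.sw b)"
   using star[OF sr(2,1)] comm[OF r(1)] comm[OF r(2)] \<pi>\<rho>[OF ab(1)] \<pi>\<rho>[OF ab(2)] by simp
  also have "\<dots> = invol B.M (f X) $$ (a, b)"
   using ab sab \<rho>sw[OF ab(1)] \<rho>sw[OF ab(2)] k by (simp add: B.invol_M[OF Bk] f_entry)
  finally show "f (invol A.M X) $$ (a, b) = invol B.M (f X) $$ (a, b)" .
 qed (use f_cl[of "invol A.M X"] B.invol_closed[of "f X"] f_cl[of X] k in auto)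
 have f_comp: "\<exists>h\<in>carrier (grading_group B.M). f ` component A.M g' = component B.M h"
  if g': "g' \<in> carrier (grading_group A.M)" "component A.M g' \<noteq> {\<zero>\<^bsub>A.M\<^esub>}" for g'
 proof -
  obtain i0 j0 t0 where 0: "i0 < ?k" "j0 < ?k" "t0 \<in> A.TT" "g' = A.ed i0 j0 t0"
   using A.component_nonzero[OF g'(2)] by blast
  define h where "h = B.ed (\<pi> i0) (\<pi> j0) (?d i0 j0 t0)"
  have hc: "h \<in> carrier (grading_group B.M)"
   unfolding h_def using B.ed_closed[of "\<pi> i0" "\<pi> j0"] \<pi>_less 0 dc k by simp
  have to: "f X \<in> component B.M h" if X: "X \<in> component A.M g'" for X
   unfolding B.component_iff
  proof (intro conjI allI impI)
   show "f X \<in> carrier_mat B.k B.k" using f_cl k by simp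
   fix a b assume "a < B.k" "b < B.k"
   then have ab: "a < ?k" "b < ?k" using k by auto
   note r = \<rho>_less[OF ab(1)] \<rho>_less[OF ab(2)]
   show "f X $$ (a, b) = 0 \<or> (\<exists>t\<in>A.TT. B.ed a b t = h \<and> f X $$ (a, b) \<in> D t)"
   proof (cases "X $$ (\<rho> a, \<rho> b) = 0")
    case True
    then show ?thesis using ab A.aut_0[OF aut] by (simp add: f_entry)
   next
    case False
    then obtain t where t: "t \<in> A.TT" "A.ed (\<rho> a) (\<rho> b) t = g'" "X $$ (\<rho> a, \<rho> b) \<in> D t"
     using X r unfolding A.component_iff by blast
    have "B.ed a b (?d (\<rho> a) (\<rho> b) t) = h"
     using K[OF r t(1) 0(1-3)] t 0 ab \<pi>\<rho> by (simp add: h_def)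
    moreover have "A.hunit (?d (\<rho> a) (\<rho> b) t) (f X $$ (a, b))"
     unfolding f_entry[OF ab]
     by (intro A.hunit_mult \<gamma> r A.aut_hunit[OF aut] A.hunit_hinv) (use t False in \<open>simp add: A.hunit_def\<close>)
    ultimately show ?thesis by (auto simp: A.hunit_def)
   qed
  qed
  have bwd: "g Y \<in> component A.M g'" if Y: "Y \<in> component B.M h" for Y
   unfolding A.component_iff
  proof (intro conjI allI impI)
   show "g Y \<in> carrier_mat ?k ?k" by (rule g_cl)
   fix i j assume ij: "i < ?k" "j < ?k"
   note p = \<pi>_less[OF ij(1)] \<pi>_less[OF ij(2)]
   show "g Y $$ (i, j) = 0 \<or> (\<exists>t\<in>A.TT. A.ed i j t = g' \<and> g Y $$ (i, j) \<in> D t)"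
   proof (cases "Y $$ (\<pi> i, \<pi> j) = 0")
    case True
    then show ?thesis using ij \<psi>'\<psi>[of 0] A.aut_0[OF aut] by (simp add: g_def)
   next
    case False
    then obtain u where u: "u \<in> A.TT" "B.ed (\<pi> i) (\<pi> j) u = h" "Y $$ (\<pi> i, \<pi> j) \<in> D u"
     using Y p unfolding B.component_iff k[symmetric] by blast
    define t where "t = \<alpha>' (inv (\<gamma> i) \<otimes> u \<otimes> \<gamma> j)"
    have cl: "\<gamma> i \<in> A.TT" "\<gamma> j \<in> A.TT" using \<gamma>c ij by auto
    have t: "t \<in> A.TT" "?\<alpha> t = inv (\<gamma> i) \<otimes> u \<otimes> \<gamma> j" unfolding t_def using cl u(1) by (blast intro!: \<alpha>'c \<alpha>\<alpha>' A.m_closed A.inv_closed)+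
    have "?d i j t = u" using cl u(1) unfolding t(2) by (simp add: A.m_assoc) (simp add: A.m_assoc[symmetric])
    then have "A.ed i j t = g'" using K[OF ij t(1) 0(1-3)] u 0 by (simp add: h_def)
    moreover have "A.hunit (?\<alpha> t) (hinv (c i) * Y $$ (\<pi> i, \<pi> j) * c j)"
     unfolding t(2) by (intro A.hunit_mult A.hunit_hinv \<gamma> ij) (use u False in \<open>simp add: A.hunit_def\<close>)
    then have "\<psi>' (hinv (c i) * Y $$ (\<pi> i, \<pi> j) * c j) \<in> D t"
     using A.aut_mem_iff[OF aut t(1)] by (metis A.hunitD(2) \<psi>\<psi>')
    ultimately show ?thesis using t ij by (auto simp: g_def)
   qed
  qed
  have "f ` component A.M g' = component B.M h"
  proof (intro equalityI subsetI)
   fix Y assume Y: "Y \<in> component B.M h"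
   then have "Y \<in> carrier_mat ?k ?k" using k by (simp add: B.component_iff)
   then show "Y \<in> f ` component A.M g'" using bwd[OF Y] fg by (metis image_eqI)
  qed (use to in auto)
  then show ?thesis using hc by blast
 qed
 have "f \<in> ring_iso A.M B.M"
  unfolding ring_iso_def Ring.ring_hom_def A.M_simps B.M_simps
  using f_bij f_mult f_add f_one f_cl k by auto
 then show ?thesis
  unfolding gr_inv_equivalent_def
  by (intro bexI[of _ f] conjI allI ballI impI f_comp) (simp_all add: A.M_simps B.M_simps f_scale f_invol)
qed

end

section \<open>The criterion on the diagonal entries\<close>

context M_iso
begin

text \<open>Apply \<phi> to the equation at \<open>i\<close>: the left side turns into \<delta>'
  times the left side at the partner of \<open>i\<close>, and the twisting relation rewrites the
  right side. Comparing with the equation at the partner leaves a statement on \<open>v\<close>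
  alone.\<close>

lemma phi_twist:
 assumes aut: "A.gr_aut h" and tw: "A.twists h v"
  and s: "w (A.sw i) = B.sw (w i)"
  and eqn: "\<And>j. j \<in> {i, A.sw i} \<Longrightarrow> \<phi> (c j) * B.p (w j) * c (A.sw j) = v * h (A.p j)"
 shows "\<phi> v = (\<delta> * \<delta>') *\<^sub>R v"
proof -
 have twist: "v * h (\<phi> x) = \<phi> (h x) * v" for x using tw by (simp add: A.twists_def)
 have hp: "A.hunit (A.aut_deg h (A.\<tau> i)) (\<phi> (h (A.p i)))"
  by (intro A.hunit_phi A.aut_hunit[OF aut] A.hunit_p)
 have "\<phi> (h (A.p i)) * \<phi> v = \<phi> (v * h (A.p i))" by (simp add: A.phi_mult)
 also have "\<dots> = \<delta>' *\<^sub>R (\<phi> (c (A.sw i)) * B.p (w (A.sw i)) * c (A.sw (A.sw i)))"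
  using eqn[of i] s by (simp flip: eqn[of i] add: A.phi_mult B.phi_p mult.assoc)
 also have "\<dots> = \<delta>' *\<^sub>R (v * h (A.p (A.sw i)))" using eqn[of "A.sw i"] by simp
 also have "\<dots> = (\<delta> * \<delta>') *\<^sub>R (v * h (\<phi> (A.p i)))"
 proof -
  have "\<delta> *\<^sub>R (\<delta> *\<^sub>R A.p (A.sw i)) = A.p (A.sw i)" unfolding scaleR_scaleR A.delta_sq by simp
  then have "A.p (A.sw i) = \<delta> *\<^sub>R \<phi> (A.p i)" using A.phi_p[of i] by simp
  then show ?thesis by (simp add: A.aut_scale[OF aut] mult.commute)
 qed
 also have "\<dots> = \<phi> (h (A.p i)) * ((\<delta> * \<delta>') *\<^sub>R v)" by (simp add: twist)
 finally show ?thesis using A.hunit_inv2(2)[OF hp] by metis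
qed

theorem equivalent_iff_linked:
 "gr_inv_equivalent A.M B.M \<longleftrightarrow> q = q' \<and> s = s' \<and>
   (\<exists>h v n. A.gr_aut h \<and> A.twists h v \<and> \<phi> v = (\<delta> * \<delta>') *\<^sub>R v \<and>
    bij_betw n {..<q} {..<q} \<and> (\<forall>i<q. A.linked h v (ds ! i) (ds' ! n i)))" (is "?L \<longleftrightarrow> ?R")
proof
 assume ?L
 then obtain h v n c where *: "A.gr_aut h" "A.twists h v" "bij_betw n {..<A.k} {..<B.k}"
  "\<And>i. i < A.k \<Longrightarrow> n (A.sw i) = B.sw (n i)"
  "\<And>i. i < A.k \<Longrightarrow> \<exists>u. A.hunit u (c i)"
  "\<And>i. i < A.k \<Longrightarrow> \<phi> (c i) * B.p (n i) * c (A.sw i) = v * h (A.p i)"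
  using M_iso_structure by blast
 have k: "A.k = B.k" using bij_betw_same_card[OF *(3)] by simp
 \<comment> \<open>The matching commutes with the partner maps, hence respects their fixed points;
   this yields \<open>q = q'\<close>.\<close>
 have fixed: "n i < q' \<longleftrightarrow> i < q" if "i < A.k" for i
 proof -
  have "n (A.sw i) = n i \<longleftrightarrow> A.sw i = i"
   using bij_betw_imp_inj_on[OF *(3)] that A.sw_less[OF that] by (auto simp: inj_on_def)
  then show ?thesis using *(4)[OF that] partner_fixed by metis
 qed
 have bq: "bij_betw n {..<q} {..<q'}"
 proof (rule bij_betw_imageI)
  show "inj_on n {..<q}" using bij_betw_imp_inj_on[OF *(3)] by (rule inj_on_subset) auto
  show "n ` {..<q} = {..<q'}"
  proof (intro equalityI subsetI)
   fix a assume a: "a \<in> {..<q'}"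
   then have "a \<in> n ` {..<A.k}" using bij_betw_imp_surj_on[OF *(3)] by simp
   then obtain i where "i < A.k" "a = n i" by auto
   then show "a \<in> n ` {..<q}" using fixed a by auto
  qed (use fixed in auto)
 qed
 then have qq: "q = q'" using bij_betw_same_card by fastforce
 \<comment> \<open>One index suffices for \<open>phi_twist\<close>, and \<open>k > 0\<close>
   provides index 0 even if there are no diagonal entries.\<close>
 have "\<phi> v = (\<delta> * \<delta>') *\<^sub>R v"
  by (rule phi_twist[OF *(1,2), where w = n and c = c and i = 0]) (use A.k_pos A.sw_less[OF A.k_pos] *(4)[OF A.k_pos] *(6) in auto)
 moreover have "A.linked h v (ds ! i) (ds' ! n i)" if i: "i < q" for i
 proof -
  have ik: "i < A.k" using i by simp
  obtain u where "A.hunit u (c i)" using *(5)[OF ik] by blast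
  moreover have "A.sw i = i" using i partner_fixed by simp
  moreover have "A.p i = ds ! i" "B.p (n i) = ds' ! n i"
   using i fixed[OF ik] A.len B.len by (simp_all add: block_coeff_def)
  ultimately show ?thesis using *(6)[OF ik] unfolding A.linked_def by metis
 qed
 ultimately show ?R using *(1,2) bq qq k by (metis add_left_cancel mult_cancel1 zero_neq_numeral)
next
 assume R: ?R
 then obtain h v n where q: "q = q'" "s = s'" and *: "A.gr_aut h" "A.twists h v" "\<phi> v = (\<delta> * \<delta>') *\<^sub>R v"
  "bij_betw n {..<q} {..<q}" "\<And>i. i < q \<Longrightarrow> A.linked h v (ds ! i) (ds' ! n i)" by blast
 obtain u c where c: "\<And>i. i < q \<Longrightarrow> A.hunit (u i) (c i) \<and> \<phi> (c i) * ds' ! n i * c i = v * h (ds ! i)"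
  using *(5) unfolding A.linked_def by metis
 obtain w where w: "A.hunit w v" using *(2) by (auto simp: A.twists_def)
 define n' where "n' i = (if i < q then n i else i)" for i
 \<comment> \<open>On a hyperbolic pair the base changes 1 and \<open>v\<close> always solve the
   equations; the symmetry of \<open>v\<close> up to the sign \<open>\<delta> * \<delta>'\<close> is
   what the second index of the pair needs.\<close>
 define c' where "c' i = (if i < q then c i else if even (i - q) then 1 else v)" for i
 have pq: "n i < q" if "i < q" for i using *(4) that by (auto dest: bij_betwE)
 show ?L
 proof (rule M_iso_of_structure[OF _ *(1,2), of n' c'])
  show "A.k = B.k" using q by simp
  show "bij_betw n' {..<A.k} {..<A.k}"
  proof (rule bij_betw_imageI)
   show inj: "inj_on n' {..<A.k}"
   proof (rule inj_onI)
    fix i j assume "n' i = n' j"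
    then show "i = j" using pq[of i] pq[of j] inj_onD[OF bij_betw_imp_inj_on[OF *(4)], of i j]
     by (cases "i < q"; cases "j < q") (simp_all add: n'_def)
   qed
   show "n' ` {..<A.k} = {..<A.k}"
   proof (rule endo_inj_surj[OF _ _ inj])
    show "n' ` {..<A.k} \<subseteq> {..<A.k}"
    proof (rule image_subsetI)
     fix i assume "i \<in> {..<A.k}" then show "n' i \<in> {..<A.k}" using pq[of i] by (auto simp: n'_def)
    qed
   qed simp
  qed
  show "n' (A.sw i) = B.sw (n' i)" for i
   using pq[of i] partner_ge[of q i] partner_fixed[of q i] partner_fixed[of q "n i"] q by (auto simp: n'_def)
  show "\<exists>u. A.hunit u (c' i)" for i using c w A.hunit_1 unfolding c'_def by metis
  show "\<phi> (c' i) * B.p (n' i) * c' (A.sw i) = v * h (A.p i)" for i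
  proof (cases rule: partner_cases[of i q])
   case 1
   then show ?thesis using c[of i] pq[of i] A.len B.len q by (simp add: n'_def c'_def block_coeff_def)
  next
   case (2 m)
   show ?thesis
   proof (cases "even m")
    case True
    then show ?thesis using 2 A.len B.len q A.aut_1[OF *(1)] by (simp add: n'_def c'_def block_coeff_def)
   next
    case False
    then have m: "even (m - Suc 0)" by simp
    have "\<delta>' *\<^sub>R \<phi> v = \<delta> *\<^sub>R v"
     unfolding *(3) using B.delta_sq by (simp add: mult.commute[of \<delta>] mult.assoc[symmetric])
    then show ?thesis using 2 False m A.len B.len q
     by (simp add: n'_def c'_def block_coeff_def of_real_def A.aut_scale[OF *(1)] A.aut_1[OF *(1)])
   qed
  qed
 qed
qed

end

section \<open>Lifting isometries\<close>

lemma scaleR_pow: "(r *\<^sub>R x) ^ n = r ^ n *\<^sub>R (x :: 'd::real_algebra_1) ^ n"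
 by (induction n) (simp_all add: mult.commute)

context gr_div_inv
begin

lemma hunit_one_D: "hunit \<one> l \<longleftrightarrow> l \<in> D \<one> \<and> l \<noteq> 0"
 by (simp add: hunit_def)

lemma hunit_central: "hunit \<one> l \<Longrightarrow> l * x = x * l"
 unfolding hunit_one_D using De_comm by blast

lemma commutator:
 assumes "hunit s x" "hunit t y"
 obtains l where "hunit \<one> l" "x * y = l * (y * x)"
proof -
 have "hunit (s \<otimes> t) (x * y)" "hunit (s \<otimes> t) (y * x)"
  using hunit_mult[OF assms] hunit_mult[OF assms(2,1)] assms m_comm by (auto simp: hunit_def)
 then show thesis using ratio_unit that by metis
qed

lemma hunit_pow: "hunit t x \<Longrightarrow> hunit (t [^] (n::nat)) (x ^ n)"
proof (induction n)
 case (Suc n)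
 then show ?case using hunit_mult[OF Suc.IH[OF Suc.prems] Suc.prems] by (simp add: power_commutes)
qed simp

text \<open>Moving the factors past each other collects \<open>0 + 1 + ... + (n - 1)\<close>
  commutators. The correction depends on \<open>l\<close> alone, so it agrees for two pairs with the
  same commutator; this makes a normalisation by \<open>N\<close>-th powers multiplicative.\<close>

lemma power_mult_commutator:
 fixes a b l :: 'd
 assumes l: "\<And>x. l * x = x * l" and ab: "a * b = l * (b * a)"
 shows "a ^ n * b ^ n = l ^ (\<Sum>k<n. k) * (a * b) ^ n"
proof (induction n)
 case (Suc n)
 have lp: "l ^ m * x = x * l ^ m" for m x
 proof (induction m)
  case (Suc m)
  have "l ^ Suc m * x = l * (l ^ m * x)" by (simp add: mult.assoc)
  also have "\<dots> = x * l ^ Suc m" using Suc l by (metis mult.assoc power_Suc)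
  finally show ?case .
 qed simp
 have abn: "a * b ^ m = l ^ m * (b ^ m * a)" for m
 proof (induction m)
  case (Suc m)
  have "a * b ^ Suc m = (a * b ^ m) * b" by (simp add: power_Suc2 mult.assoc del: power_Suc)
  also have "\<dots> = l ^ m * (b ^ m * (a * b))" unfolding Suc.IH by (simp add: mult.assoc)
  also have "\<dots> = l ^ m * l * (b ^ m * (b * a))" unfolding ab using l by (metis mult.assoc)
  also have "\<dots> = l ^ Suc m * (b ^ Suc m * a)" by (simp add: power_commutes mult.assoc) (simp add: power_commutes mult.assoc[symmetric])
  finally show ?case .
 qed simp
 have "a ^ Suc n * b ^ Suc n = a ^ n * (a * b ^ n) * b"
  by (simp add: power_Suc2 mult.assoc del: power_Suc)
 also have "\<dots> = l ^ n * (a ^ n * b ^ n * (a * b))" unfolding abn using lp by (metis mult.assoc)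
 also have "\<dots> = l ^ n * l ^ (\<Sum>k<n. k) * (a * b) ^ Suc n" unfolding Suc.IH by (simp add: power_Suc2 mult.assoc del: power_Suc)
 also have "l ^ n * l ^ (\<Sum>k<n. k) = l ^ (\<Sum>k<Suc n. k)" by (simp add: power_add[symmetric] add.commute)
 finally show ?case .
qed simp

text \<open>A graph \<open>C\<close> of a partial graded automorphism up to positive scalars is enlarged one degree at a time;
 it has to contain the squares of \<open>G\<close>, since the sign of a new square can no longer be adjusted.\<close>

lemma lift_automorphism:
 assumes g: "g \<in> hom T T" "bij_betw g TT TT"
  and deg: "\<And>x y. (x, y) \<in> G \<Longrightarrow> \<exists>t. hunit t x \<and> hunit (g t) y"
  and mult: "\<And>x y x' y'. (x, y) \<in> G \<Longrightarrow> (x', y') \<in> G \<Longrightarrow> (x * x', y * y') \<in> G"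
  and inverse: "\<And>x y. (x, y) \<in> G \<Longrightarrow> (hinv x, hinv y) \<in> G"
  and total: "\<And>t. t \<in> TT \<Longrightarrow> \<exists>x y. hunit t x \<and> (x, y) \<in> G"
  and diag: "\<And>l. hunit \<one> l \<Longrightarrow> (l, l) \<in> G"
  and real: "\<And>r. r \<noteq> 0 \<Longrightarrow> (1, of_real r) \<in> G"
  and one: "\<And>y. (1, y) \<in> G \<Longrightarrow> \<exists>r. r \<noteq> 0 \<and> y = of_real r"
  and commute: "\<And>x y x' y' l. (x, y) \<in> G \<Longrightarrow> (x', y') \<in> G \<Longrightarrow> hunit \<one> l \<Longrightarrow> x * x' = l * (x' * x) \<Longrightarrow> y * y' = l * (y' * y)"
  and square: "\<And>x y. (x, y) \<in> G \<Longrightarrow> hunit \<one> (x * x) \<Longrightarrow> \<exists>r>0. y * y = r *\<^sub>R (x * x)"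
 obtains h where "gr_aut h" "\<And>t. t \<in> TT \<Longrightarrow> aut_deg h t = g t"
  "\<And>x y. (x, y) \<in> G \<Longrightarrow> \<exists>r. r \<noteq> 0 \<and> h x = r *\<^sub>R y"
proof -
 interpret a: group_hom T T g by unfold_locales (rule g)
 \<comment> \<open>The exclusion of \<open>(1, -1)\<close> makes \<open>y\<close> determined by
   \<open>x\<close> up to a positive scalar. Squares are demanded from the start so that adjoining a
   pair adds just one coset of \<open>C\<close>.\<close>
 define good where "good C \<longleftrightarrow> C \<subseteq> G \<and> (\<forall>x y x' y'. (x, y) \<in> C \<longrightarrow> (x', y') \<in> C \<longrightarrow> (x * x', y * y') \<in> C) \<and>
   (\<forall>x y. (x, y) \<in> C \<longrightarrow> (hinv x, hinv y) \<in> C) \<and> (\<forall>l. hunit \<one> l \<longrightarrow> (l, l) \<in> C) \<and>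
   (\<forall>r>0. (1, of_real r) \<in> C) \<and> (\<forall>x y. (x, y) \<in> G \<longrightarrow> (x * x, y * y) \<in> C) \<and> (1, -1) \<notin> C" for C
 have goodD: "(x, y) \<in> C \<Longrightarrow> (x, y) \<in> G" "(x, y) \<in> C \<Longrightarrow> (x', y') \<in> C \<Longrightarrow> (x * x', y * y') \<in> C"
   "(x, y) \<in> C \<Longrightarrow> (hinv x, hinv y) \<in> C" "hunit \<one> l \<Longrightarrow> (l, l) \<in> C" "r > 0 \<Longrightarrow> (1, of_real r) \<in> C"
   "(x, y) \<in> G \<Longrightarrow> (x * x, y * y) \<in> C" "(1, -1) \<notin> C" if "good C" for C x y x' y' l r
  using that unfolding good_def by blast+
 \<comment> \<open>The smallest candidate. It is closed under products because a product of two
   squares is a square up to a neutral commutator, which is the same on both sides of the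
   pair.\<close>
 define C0 where "C0 = {(l * (a * a), r *\<^sub>R (l * (b * b))) | l r a b. hunit \<one> l \<and> r > 0 \<and> (a, b) \<in> G}"
 have C0I: "(x, y) \<in> C0" if "hunit \<one> l" "r > 0" "(a, b) \<in> G" "x = l * (a * a)" "y = r *\<^sub>R (l * (b * b))" for x y l r a b
  using that unfolding C0_def by blast
 have "good C0"
  unfolding good_def
 proof (intro conjI allI impI)
  show "C0 \<subseteq> G"
  proof clarify
   fix x y assume "(x, y) \<in> C0"
   then obtain l r a b where *: "hunit \<one> l" "r > 0" "(a, b) \<in> G" "x = l * (a * a)" "y = r *\<^sub>R (l * (b * b))"
    unfolding C0_def by blast
   have "(1 * (l * (a * a)), of_real r * (l * (b * b))) \<in> G"
    using * by (intro mult real diag) auto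
   then show "(x, y) \<in> G" using * by (simp add: of_real_def)
  qed
  fix x y assume "(x, y) \<in> C0"
  then obtain l r a b where *: "hunit \<one> l" "r > 0" "(a, b) \<in> G" "x = l * (a * a)" "y = r *\<^sub>R (l * (b * b))"
   unfolding C0_def by blast
  obtain t where t: "hunit t a" "hunit (g t) b" using deg[OF *(3)] by blast
  {
   fix x' y' assume "(x', y') \<in> C0"
   then obtain l' r' a' b' where **: "hunit \<one> l'" "r' > 0" "(a', b') \<in> G" "x' = l' * (a' * a')" "y' = r' *\<^sub>R (l' * (b' * b'))"
    unfolding C0_def by blast
   obtain t' where t': "hunit t' a'" "hunit (g t') b'" using deg[OF **(3)] by blast
   obtain m where m: "hunit \<one> m" "a * a' = m * (a' * a)" using commutator[OF t(1) t'(1)] by blast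
   have m': "b * b' = m * (b' * b)" using commute[OF *(3) **(3) m] .
   have sq: "u * u * (u' * u') = m * ((u * u') * (u * u'))" if "u * u' = m * (u' * u)" for u u'
   proof -
    have "u * u * (u' * u') = u * (u * u') * u'" by (simp add: mult.assoc)
    also have "\<dots> = m * ((u * u') * (u * u'))" unfolding that using hunit_central[OF m(1), of u] that
     by (metis mult.assoc)
    finally show ?thesis .
   qed
   have shape: "l * (u * u) * (l' * (u' * u')) = l * l' * m * ((u * u') * (u * u'))" if "u * u' = m * (u' * u)" for u u'
    using sq[OF that] hunit_central[OF **(1), of "u * u"] by (metis mult.assoc)
   show "(x * x', y * y') \<in> C0"
   proof (rule C0I)
    show "hunit \<one> (l * l' * m)" using hunit_mult[OF hunit_mult[OF *(1) **(1)] m(1)] by simp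
    show "r * r' > 0" using * ** by simp
    show "(a * a', b * b') \<in> G" using mult * ** by blast
    show "x * x' = l * l' * m * (a * a' * (a * a'))" using shape[OF m(2)] * ** by simp
    show "y * y' = (r * r') *\<^sub>R (l * l' * m * (b * b' * (b * b')))" using shape[OF m'] * ** by simp
   qed
  }
  show "(hinv x, hinv y) \<in> C0"
  proof (rule C0I)
   show "hunit \<one> (hinv l)" using hunit_hinv[OF *(1)] by simp
   show "1 / r > 0" using * by simp
   show "(hinv a, hinv b) \<in> G" using inverse * by blast
   show "hinv x = hinv l * (hinv a * hinv a)"
    unfolding *(4) hinv_mult[OF *(1) hunit_mult[OF t(1) t(1)]] hinv_mult[OF t(1) t(1)]
    using hunit_central[OF hunit_hinv[OF *(1), simplified]] by simp
   have u: "hunit (\<one> \<otimes> (g t \<otimes> g t)) (l * (b * b))" by (intro hunit_mult *(1) t)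
   have "hinv y = (1 / r) *\<^sub>R hinv (l * (b * b))"
    unfolding *(5) by (rule hinv_eqI) (use hunit_inv[OF u] *(2) in auto)
   then show "hinv y = (1 / r) *\<^sub>R (hinv l * (hinv b * hinv b))"
    unfolding hinv_mult[OF *(1) hunit_mult[OF t(2) t(2)]] hinv_mult[OF t(2) t(2)]
    using hunit_central[OF hunit_hinv[OF *(1), simplified]] by simp
  qed
 next
  fix l assume "hunit \<one> l"
  then show "(l, l) \<in> C0" by (intro C0I[of l 1 1 1]) (use diag[OF hunit_1] in auto)
 next
  fix r :: real assume "r > 0"
  then show "(1, of_real r) \<in> C0" by (intro C0I[of 1 r 1 1]) (use diag[OF hunit_1] in \<open>auto simp: of_real_def\<close>)
 next
  fix x y assume "(x, y) \<in> G"
  then show "(x * x, y * y) \<in> C0" by (intro C0I[of 1 1 x y]) auto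
 next
  \<comment> \<open>By \<open>square\<close> a neutral square goes to a positive multiple of itself,
    which rules out the sign -1.\<close>
  show "(1, -1) \<notin> C0"
  proof
   assume "(1, -1) \<in> C0"
   then obtain l r a b where *: "hunit \<one> l" "r > 0" "(a, b) \<in> G" "1 = l * (a * a)" "-1 = r *\<^sub>R (l * (b * b))"
    unfolding C0_def by blast
   have "a * a = hinv l" using *(4) hunit_inv2[OF *(1)] by (metis mult.right_neutral)
   then have "hunit \<one> (a * a)" using hunit_hinv[OF *(1)] by simp
   then obtain r' where r': "r' > 0" "b * b = r' *\<^sub>R (a * a)" using square[OF *(3)] by blast
   have "(-1::'d) = (r * r') *\<^sub>R (l * (a * a))" using *(5) r' by simp
   also have "\<dots> = of_real (r * r')" using *(4) by (simp add: of_real_def)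
   finally have "of_real (-1) = (of_real (r * r') :: 'd)" by simp
   then have "-1 = r * r'" by (rule of_real_eq_iff[THEN iffD1])
   then show False using mult_pos_pos[OF *(2) r'(1)] by linarith
  qed
 qed
 define dg where "dg C = {t \<in> TT. \<exists>x y. (x, y) \<in> C \<and> hunit t x}" for C :: "('d \<times> 'd) set"
 have "card (dg C) \<le> card TT" for C
  by (rule card_mono[OF finite_carrier]) (auto simp: dg_def)
 then have "\<exists>C. good C \<and> (\<forall>B. good B \<longrightarrow> card (dg B) \<le> card (dg C))"
  using ex_has_greatest_nat[of good C0 "\<lambda>C. card (dg C)" "Suc (card TT)"] \<open>good C0\<close> by (metis le_imp_less_Suc)
 then obtain C where C: "good C" and C_max: "\<And>B. good B \<Longrightarrow> card (dg B) \<le> card (dg C)" by blast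
 note CD = goodD[OF C]
 have C_deg: "\<exists>x y. (x, y) \<in> C \<and> hunit t x" if t: "t \<in> TT" for t
 proof (rule ccontr)
  assume nt: "\<not> ?thesis"
  obtain x y where xy: "hunit t x" "(x, y) \<in> G" using total t by blast
  have hy: "hunit (g t) y" using deg[OF xy(2)] xy(1) hunit_unique by blast
  \<comment> \<open>Adjoining \<open>(x, y)\<close> keeps \<open>C\<close> good: its square is in
    \<open>C\<close> already, moving it past \<open>C\<close> costs only neutral commutators, and
    \<open>(1, -1)\<close> in the new coset would mean that degree \<open>t\<close> already occurs
    in \<open>C\<close>.\<close>
  define B where "B = C \<union> {(a * x, b * y) | a b. (a, b) \<in> C}"
  have BI: "(a * x, b * y) \<in> B" if "(a, b) \<in> C" for a b using that by (auto simp: B_def)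
  have swap: "\<exists>a' b'. (a', b') \<in> C \<and> x * a = a' * x \<and> y * b = b' * y" if ab: "(a, b) \<in> C" for a b
  proof -
   obtain s where s: "hunit s a" "hunit (g s) b" using deg[OF CD(1)[OF ab]] by blast
   obtain m where m: "hunit \<one> m" "x * a = m * (a * x)" using commutator[OF xy(1) s(1)] by blast
   have "y * b = m * (b * y)" using commute[OF xy(2) CD(1)[OF ab] m] .
   moreover have "(m * a, m * b) \<in> C" using CD(2)[OF CD(4)[OF m(1)] ab] .
   ultimately show ?thesis using m(2) by (metis mult.assoc)
  qed
  have "good B"
   unfolding good_def
  proof (intro conjI allI impI)
   show "B \<subseteq> G" using CD(1) mult xy(2) by (auto simp: B_def)
   show "(1, -1) \<notin> B"
   proof
    assume "(1, -1) \<in> B"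
    then obtain a b where ab: "(a, b) \<in> C" "1 = a * x" using CD(7) by (auto simp: B_def)
    obtain s where s: "hunit s a" using deg[OF CD(1)[OF ab(1)]] by blast
    have "x = hinv a" using hunit_inv2(2)[OF s, of x] ab(2) by simp
    then show False using nt CD(3)[OF ab(1)] xy(1) by blast
   qed
  next
   fix a b a' b' assume ab: "(a, b) \<in> B" "(a', b') \<in> B"
   consider "(a, b) \<in> C" "(a', b') \<in> C" | u v where "(a, b) \<in> C" "(u, v) \<in> C" "a' = u * x" "b' = v * y"
    | u v where "(u, v) \<in> C" "a = u * x" "b = v * y" "(a', b') \<in> C"
    | u v u' v' where "(u, v) \<in> C" "a = u * x" "b = v * y" "(u', v') \<in> C" "a' = u' * x" "b' = v' * y"
    using ab by (auto simp: B_def)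
   then show "(a * a', b * b') \<in> B"
   proof cases
    case 1
    then show ?thesis using CD(2) by (auto simp: B_def)
   next
    case 2
    then show ?thesis using BI[OF CD(2)[OF 2(1,2)]] by (simp add: mult.assoc)
   next
    case 3
    obtain w z where wz: "(w, z) \<in> C" "x * a' = w * x" "y * b' = z * y" using swap[OF 3(4)] by blast
    then show ?thesis using BI[OF CD(2)[OF 3(1) wz(1)]] 3 by (simp add: mult.assoc)
   next
    case 4
    obtain w z where wz: "(w, z) \<in> C" "x * u' = w * x" "y * v' = z * y" using swap[OF 4(4)] by blast
    have "x * (u' * x) = w * (x * x)" "y * (v' * y) = z * (y * y)" using wz by (metis mult.assoc)+
    then have "(a * a', b * b') \<in> C"
     using CD(2)[OF CD(2)[OF 4(1) wz(1)] CD(6)[OF xy(2)]] 4 by (simp add: mult.assoc)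
    then show ?thesis by (simp add: B_def)
   qed
  next
   fix a b assume "(a, b) \<in> B"
   then consider "(a, b) \<in> C" | u v where "(u, v) \<in> C" "a = u * x" "b = v * y" by (auto simp: B_def)
   then show "(hinv a, hinv b) \<in> B"
   proof cases
    case 1
    then show ?thesis using CD(3) by (auto simp: B_def)
   next
    case 2
    obtain s where s: "hunit s u" "hunit (g s) v" using deg[OF CD(1)[OF 2(1)]] by blast
    obtain w z where wz: "(w, z) \<in> C" "x * hinv u = w * x" "y * hinv v = z * y" using swap[OF CD(3)[OF 2(1)]] by blast
    have q: "(hinv (x * x), hinv (y * y)) \<in> C" by (rule CD(3)[OF CD(6)[OF xy(2)]])
    have "hinv a = hinv (x * x) * w * x"
    proof -
     have "hinv (x * x) * w * x = hinv x * (hinv x * (x * hinv u))"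
      using wz(2) hinv_mult[OF xy(1) xy(1)] by (simp add: mult.assoc)
     also have "\<dots> = hinv a" unfolding 2(2) hinv_mult[OF s(1) xy(1)] by (simp add: hunit_inv2[OF xy(1)])
     finally show ?thesis by simp
    qed
    moreover have "hinv b = hinv (y * y) * z * y"
    proof -
     have "hinv (y * y) * z * y = hinv y * (hinv y * (y * hinv v))"
      using wz(3) hinv_mult[OF hy hy] by (simp add: mult.assoc)
     also have "\<dots> = hinv b" unfolding 2(3) hinv_mult[OF s(2) hy] by (simp add: hunit_inv2[OF hy])
     finally show ?thesis by simp
    qed
    ultimately show ?thesis using BI[OF CD(2)[OF q wz(1)]] by simp
   qed
  qed (use CD(4-6) in \<open>auto simp: B_def\<close>)
  moreover have "card (dg C) < card (dg B)"
  proof (rule psubset_card_mono)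
   show "finite (dg B)" using finite_carrier by (simp add: dg_def)
   have "t \<in> dg B" using BI[OF CD(4)[OF hunit_1]] xy(1) t unfolding dg_def by (metis (mono_tags, lifting) mem_Collect_eq mult_1)
   moreover have "t \<notin> dg C" using nt by (auto simp: dg_def)
   moreover have "dg C \<subseteq> dg B" by (auto simp: dg_def B_def)
   ultimately show "dg C \<subset> dg B" by blast
  qed
  ultimately show False using C_max[of B] by simp
 qed
 define N where "N = card TT"
 have Npos: "N > 0" using finite_carrier by (auto simp: N_def card_gt_0_iff)
 have tN: "t [^] N = \<one>" if "t \<in> TT" for t
  using power_order_eq_one[OF finite_carrier that] by (simp add: N_def)
 have pos: "\<exists>r>0. y = of_real r" if "(1, y) \<in> C" for y
 proof -
  have "(1, y) \<in> G" using CD(1)[OF that] .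
  then obtain r where r: "r \<noteq> 0" "y = of_real r" using one by blast
  have "r > 0"
  proof (rule ccontr)
   assume "\<not> r > 0"
   then have "(1, of_real (- 1 / r)) \<in> C" using r by (intro CD(5)) (simp add: divide_neg_neg)
   from CD(2)[OF that this] have "(1, of_real (r * (- 1 / r))) \<in> C" using r by (metis mult_1 of_real_mult)
   then show False using CD(7) r by simp
  qed
  then show ?thesis using r by blast
 qed
 \<comment> \<open>For \<open>(x, y)\<close> in \<open>C\<close> the power \<open>x ^ N\<close> is
   neutral and \<open>y ^ N\<close> is a positive multiple of it; requiring equality selects exactly
   one \<open>y\<close> for each \<open>x\<close>.\<close>
 define C1 where "C1 = {(x, y) \<in> C. y ^ N = x ^ N}"
 have C1_ex: "\<exists>y. (x, y) \<in> C1" if x: "hunit t x" for t x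
 proof -
  obtain x0 y0 where 0: "(x0, y0) \<in> C" "hunit t x0" using C_deg[OF hunitD(1)[OF x]] by blast
  obtain l where l: "hunit \<one> l" "x = l * x0" using ratio_unit[OF 0(2) x] by blast
  define y1 where "y1 = l * y0"
  have y1: "(x, y1) \<in> C" using CD(2)[OF CD(4)[OF l(1)] 0(1)] l(2) by (simp add: y1_def)
  have "(x ^ n, y1 ^ n) \<in> C" for n
   by (induction n) (use CD(4)[OF hunit_1] CD(2)[OF y1] in auto)
  moreover have xN: "hunit \<one> (x ^ N)" using hunit_pow[OF x, of N] tN hunitD(1)[OF x] by simp
  ultimately have "(hinv (x ^ N) * x ^ N, hinv (x ^ N) * y1 ^ N) \<in> C"
   using CD(2)[OF CD(3)[OF CD(4)[OF xN]]] by blast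
  then obtain r where r: "r > 0" "hinv (x ^ N) * y1 ^ N = of_real r" using pos hunit_inv[OF xN] by auto
  then have "x ^ N * (hinv (x ^ N) * y1 ^ N) = x ^ N * of_real r" by simp
  then have e: "y1 ^ N = r *\<^sub>R x ^ N" by (simp add: hunit_inv2[OF xN] of_real_def)
  define c where "c = root N (1 / r)"
  have c: "c > 0" "c ^ N = 1 / r" using r Npos by (simp_all add: c_def)
  have "(1 * x, of_real c * y1) \<in> C" by (rule CD(2)[OF CD(5)[OF c(1)] y1])
  moreover have "(of_real c * y1) ^ N = x ^ N"
  proof -
   have "(of_real c * y1) ^ N = (c *\<^sub>R y1) ^ N" by (simp add: of_real_def)
   also have "\<dots> = c ^ N *\<^sub>R y1 ^ N" by (rule scaleR_pow)
   finally show ?thesis using c e r by simp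
  qed
  ultimately show ?thesis by (auto simp: C1_def)
 qed
 have C1_unique: "y = y'" if "(x, y) \<in> C1" "(x, y') \<in> C1" for x y y'
 proof -
  have yC: "(x, y) \<in> C" "(x, y') \<in> C" "y ^ N = y' ^ N" using that by (auto simp: C1_def)
  obtain t where t: "hunit t x" "hunit (g t) y" using deg[OF CD(1)[OF yC(1)]] by blast
  have "(hinv x * x, hinv y * y') \<in> C" by (rule CD(2)[OF CD(3)[OF yC(1)] yC(2)])
  then obtain r where r: "r > 0" "hinv y * y' = of_real r" using pos hunit_inv[OF t(1)] by auto
  then have "y * (hinv y * y') = y * of_real r" by simp
  then have e: "y' = r *\<^sub>R y" by (simp add: hunit_inv2[OF t(2)] of_real_def)
  have "r ^ N *\<^sub>R y ^ N = y ^ N" using yC(3) unfolding e scaleR_pow by simp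
  then have "(r ^ N - 1) *\<^sub>R y ^ N = 0" by (simp add: scaleR_diff_left)
  moreover have "y ^ N \<noteq> 0" using hunitD(3)[OF hunit_pow[OF t(2)]] .
  ultimately have "r ^ N = 1" by simp
  then have "r = 1" using r Npos by (metis less_imp_le power_eq_1_iff power_one power_eq_iff_eq_base zero_le_one)
  then show ?thesis using e by simp
 qed
 have C1_mult: "(x * x', y * y') \<in> C1" if "(x, y) \<in> C1" "(x', y') \<in> C1" for x y x' y'
 proof -
  have c: "(x, y) \<in> C" "(x', y') \<in> C" "y ^ N = x ^ N" "y' ^ N = x' ^ N" using that by (auto simp: C1_def)
  obtain s t where st: "hunit s x" "hunit t x'" using deg[OF CD(1)[OF c(1)]] deg[OF CD(1)[OF c(2)]] by blast
  obtain m where m: "hunit \<one> m" "x * x' = m * (x' * x)" using commutator[OF st] by blast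
  have m': "y * y' = m * (y' * y)" by (rule commute[OF CD(1)[OF c(1)] CD(1)[OF c(2)] m])
  let ?m = "m ^ (\<Sum>k<N. k)"
  have "?m * (x * x') ^ N = ?m * (y * y') ^ N"
   using power_mult_commutator[OF hunit_central[OF m(1)] m(2), of N]
    power_mult_commutator[OF hunit_central[OF m(1)] m', of N] c by simp
  then have "(x * x') ^ N = (y * y') ^ N" using hunit_inv2(2)[OF hunit_pow[OF m(1)]] by metis
  then show ?thesis using CD(2)[OF c(1,2)] by (simp add: C1_def)
 qed
 define f where "f x = (if x = 0 then 0 else THE y. (x, y) \<in> C1)" for x
 have f_eq: "f x = y" if "(x, y) \<in> C1" for x y
 proof -
  have "x \<noteq> 0" using deg CD(1) that by (auto simp: C1_def hunit_def)
  then show ?thesis using that C1_unique by (auto simp: f_def intro!: the_equality)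
 qed
 have f_C1: "(x, f x) \<in> C1" if "hunit t x" for t x using C1_ex[OF that] f_eq by metis
 have f_unit: "hunit (g t) (f x)" if "hunit t x" for t x
  using f_C1[OF that] deg CD(1) that hunit_unique by (fastforce simp: C1_def)
 have f_0 [simp]: "f 0 = 0" by (simp add: f_def)
 have f_mem: "f x \<in> D (g t)" if "x \<in> D t" "t \<in> TT" for x t
  using f_unit[of t x] that by (cases "x = 0") (auto simp: hunit_def)
 have f_mult: "f (x * y) = f x * f y" if xy: "x \<in> D s" "y \<in> D t" "s \<in> TT" "t \<in> TT" for x y s t
 proof (cases "x = 0 \<or> y = 0")
  case False
  then have "hunit s x" "hunit t y" using that by (auto simp: hunit_def)
  then show ?thesis using f_eq[OF C1_mult[OF f_C1 f_C1]] by blast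
 qed auto
 have f_De: "f l = l" if "l \<in> D \<one>" for l
  using f_eq[of l l] CD(4)[of l] that by (cases "l = 0") (auto simp: C1_def hunit_def)
 \<comment> \<open>Additivity within a component is a consequence of multiplicativity: elements of
   one degree differ by neutral factors, and \<open>f\<close> fixes these.\<close>
 have f_add: "f (x + y) = f x + f y" if xy: "x \<in> D t" "y \<in> D t" "t \<in> TT" for x y t
 proof (cases "x = 0")
  case False
  then have "hunit t x" using xy by (simp add: hunit_def)
  then obtain l where l: "l \<in> D \<one>" "y = l * x" using ratio xy by blast
  have "f (x + y) = f ((1 + l) * x)" using l by (simp add: algebra_simps)
  also have "\<dots> = (1 + l) * f x"
   using f_mult[of "1 + l" \<one> x t] f_De[of "1 + l"] l xy D_add[of \<one> 1 l] by simp
  also have "\<dots> = f x + f y" using f_mult[of l \<one> x t] f_De[of l] l xy by (simp add: algebra_simps)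
  finally show ?thesis .
 qed simp
 have f_scale: "f (r *\<^sub>R x) = r *\<^sub>R f x" if xy: "x \<in> D t" "t \<in> TT" for x t r
  unfolding scaleR_conv_of_real using f_mult[of "of_real r" \<one> x t] f_De[of "of_real r"] xy by simp
 define h where "h x = (\<Sum>t\<in>TT. f (comp x t))" for x
 have h_hom: "h x = f x" if "x \<in> D t" "t \<in> TT" for x t
 proof -
  have "h x = (\<Sum>s\<in>TT. if s = t then f x else 0)"
   unfolding h_def by (rule sum.cong) (use comp_hom[OF that] in auto)
  then show ?thesis using that finite_carrier by simp
 qed
 have lin: "linear h"
 proof (rule linearI)
  show "h (x + y) = h x + h y" for x y
   unfolding h_def sum.distrib[symmetric] by (rule sum.cong) (auto simp: comp_add f_add[OF comp_mem comp_mem])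
  show "h (r *\<^sub>R x) = r *\<^sub>R h x" for r x
   unfolding h_def scaleR_sum_right by (rule sum.cong) (auto simp: comp_scale f_scale[OF comp_mem])
 qed
 have h_mult: "h (x * y) = h x * h y" for x y
 proof -
  have "h (x * y) = h ((\<Sum>s\<in>TT. comp x s) * (\<Sum>t\<in>TT. comp y t))" by (simp add: sum_comp)
  also have "\<dots> = (\<Sum>s\<in>TT. \<Sum>t\<in>TT. h (comp x s * comp y t))"
   by (simp add: sum_product linear_sum[OF lin])
  also have "\<dots> = (\<Sum>s\<in>TT. \<Sum>t\<in>TT. f (comp x s) * f (comp y t))"
  proof (intro sum.cong refl)
   fix s t assume st: "s \<in> TT" "t \<in> TT"
   show "h (comp x s * comp y t) = f (comp x s) * f (comp y t)"
    using h_hom[OF D_mult[OF st comp_mem comp_mem]] f_mult[OF comp_mem comp_mem] st by simp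
  qed
  also have "\<dots> = h x * h y" by (simp add: h_def sum_product)
  finally show ?thesis .
 qed
 have comp_h: "comp (h x) (g t) = f (comp x t)" if t: "t \<in> TT" for x t
 proof -
  define \<beta> where "\<beta> = inv_into TT g"
  have \<beta>: "u \<in> TT \<Longrightarrow> \<beta> u \<in> TT" "u \<in> TT \<Longrightarrow> g (\<beta> u) = u" "u \<in> TT \<Longrightarrow> \<beta> (g u) = u" for u
   unfolding \<beta>_def using bij_betwE[OF bij_betw_inv_into[OF g(2)]]
    bij_betw_inv_into_right[OF g(2)] bij_betw_inv_into_left[OF g(2)] by auto
  have "(\<Sum>u\<in>TT. f (comp x (\<beta> u))) = h x"
   unfolding h_def \<beta>_def by (rule sum.reindex_bij_betw[OF bij_betw_inv_into[OF g(2)]])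
  moreover have "comp (\<Sum>u\<in>TT. f (comp x (\<beta> u))) (g t) = f (comp x (\<beta> (g t)))"
   by (rule comp_sum) (use f_mem[OF comp_mem] \<beta> t in \<open>metis, auto\<close>)
  ultimately show ?thesis using \<beta>(3)[OF t] by simp
 qed
 have f_eq_0: "x = 0" if "f x = 0" "x \<in> D t" "t \<in> TT" for x t
  using f_unit[of t x] that by (auto simp: hunit_def)
 have img: "h ` D t = D (g t)" if t: "t \<in> TT" for t
 proof (intro equalityI subsetI)
  fix y assume y: "y \<in> D (g t)"
  obtain x where x: "hunit t x" using ex_hunit[OF t] by blast
  obtain l where l: "l \<in> D \<one>" "y = l * f x" using ratio[OF f_unit[OF x] y] by blast
  have lx: "l * x \<in> D t" using D_mult[of \<one> t l x] x l t by (simp add: hunit_def)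
  have "h (l * x) = y"
   using h_hom[OF lx t] f_mult[of l \<one> x t] f_De l x t by (simp add: hunit_def)
  then show "y \<in> h ` D t" using lx by blast
 qed (use h_hom f_mem t in auto)
 have aut: "gr_aut h"
  unfolding gr_aut_def
 proof (intro conjI allI ballI bijI)
  show "inj h"
   unfolding linear_injective_0[OF lin]
  proof (intro allI impI)
   fix x assume "h x = 0"
   then have "comp x t = 0" if "t \<in> TT" for t
    using comp_h[OF that, of x] f_eq_0[OF _ comp_mem] that by simp
   then show "x = 0" using sum_comp[of x] by simp
  qed
  show "surj h"
   unfolding surj_def
  proof
   fix y
   have "comp y t \<in> range h" if t: "t \<in> TT" for t
   proof -
    obtain s where "s \<in> TT" "t = g s" using g(2) t by (metis bij_betw_imp_surj_on imageE)
    then have "comp y t \<in> h ` D s" using img comp_mem t by simp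
    then show ?thesis by blast
   qed
   moreover have "subspace (range h)" using linear_subspace_image[OF lin subspace_UNIV] .
   ultimately have "(\<Sum>t\<in>TT. comp y t) \<in> range h" by (intro subspace_sum) auto
   then show "\<exists>x. y = h x" by (metis sum_comp rangeE)
  qed
 qed (use lin h_mult img a.hom_closed in auto)
 have "aut_deg h t = g t" if t: "t \<in> TT" for t
  using D_eq[of "aut_deg h t" "g t"] aut_image[OF aut t] img[OF t] aut_deg_closed[OF aut t] t by simp
 \<comment> \<open>Two pairs of \<open>G\<close> with the same first entry differ by a real scalar,
   because of \<open>one\<close>.\<close>
 moreover have "\<exists>r. r \<noteq> 0 \<and> h x = r *\<^sub>R y" if xy: "(x, y) \<in> G" for x y
 proof -
  obtain t where t: "hunit t x" "hunit (g t) y" using deg[OF xy] by blast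
  have "(x, f x) \<in> G" using f_C1[OF t(1)] CD(1) by (auto simp: C1_def)
  then have "(hinv x * x, hinv y * f x) \<in> G" using mult inverse xy by blast
  then obtain r where r: "r \<noteq> 0" "hinv y * f x = of_real r" using one hunit_inv[OF t(1)] by auto
  then have "y * (hinv y * f x) = y * of_real r" by simp
  then have "f x = r *\<^sub>R y" by (simp add: hunit_inv2[OF t(2)] of_real_def)
  then show ?thesis using h_hom[of x t] t r by (auto simp: hunit_def)
 qed
 ultimately show thesis using that aut by blast
qed

end

section \<open>The commutation factor and its radical\<close>

context gr_div_inv
begin

lemma hunit_cancel: "hunit t w \<Longrightarrow> b * w = c * w \<longleftrightarrow> b = c"
proof
 assume w: "hunit t w" and "b * w = c * w"
 then have "b * w * hinv w = c * w * hinv w" by simp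
 then show "b = c" by (simp only: mult.assoc hunit_inv[OF w] mult_1_right)
qed simp

abbreviation \<beta> where "\<beta> \<equiv> beta T D"

lemma beta_unique:
 assumes "hunit s x" "hunit t y" "b \<in> D \<one>" "x * y = b * (y * x)" "c \<in> D \<one>" "x * y = c * (y * x)"
 shows "b = c"
proof -
 have "hunit (t \<otimes> s) (y * x)" using hunit_mult assms by blast
 then show ?thesis using assms hunit_cancel by metis
qed

lemma is_beta_valueI:
 assumes xy: "hunit s x" "hunit t y" and b: "b \<in> D \<one>" "x * y = b * (y * x)"
 shows "is_beta_value T D s t b"
 unfolding is_beta_value_def
proof (intro conjI ballI b)
 fix x' y' assume "x' \<in> D s" "y' \<in> D t"
 then obtain l m where l: "l \<in> D \<one>" "x' = l * x" "m \<in> D \<one>" "y' = m * y" using ratio xy by metis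
 have "x' * y' = l * m * (x * y)" unfolding l using De_comm[OF l(3), of x] by (metis mult.assoc)
 also have "\<dots> = b * (l * m * (y * x))" unfolding b using De_comm[OF b(1), of "l * m"] by (metis mult.assoc)
 also have "l * m * (y * x) = y' * x'" unfolding l using De_comm[OF l(1), of m] De_comm[OF l(1), of y] by (metis mult.assoc)
 finally show "x' * y' = b * (y' * x')" .
qed

lemma beta_eqI:
 assumes "hunit s x" "hunit t y" "b \<in> D \<one>" "x * y = b * (y * x)"
 shows "\<beta> s t = b"
 unfolding beta_def
proof (rule the_equality)
 show "is_beta_value T D s t b" by (rule is_beta_valueI[OF assms])
 fix c assume "is_beta_value T D s t c"
 then show "c = b" using beta_unique[OF assms, of c] assms by (auto simp: is_beta_value_def hunit_def)
qed

lemma beta_value: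
 assumes "s \<in> TT" "t \<in> TT"
 shows "is_beta_value T D s t (\<beta> s t)"
proof -
 obtain x y where xy: "hunit s x" "hunit t y" using ex_hunit assms by meson
 obtain b where b: "hunit \<one> b" "x * y = b * (y * x)" using commutator[OF xy] by blast
 then have "\<beta> s t = b" using beta_eqI[OF xy] by (simp add: hunit_def)
 then show ?thesis using is_beta_valueI[OF xy] b by (simp add: hunit_def)
qed

lemma beta_unit: "s \<in> TT \<Longrightarrow> t \<in> TT \<Longrightarrow> hunit \<one> (\<beta> s t)"
proof -
 assume st: "s \<in> TT" "t \<in> TT"
 obtain x y where xy: "hunit s x" "hunit t y" using ex_hunit st by meson
 obtain b where "hunit \<one> b" "x * y = b * (y * x)" using commutator[OF xy] by blast
 then show ?thesis using beta_eqI[OF xy, of b] by (simp add: hunit_def)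
qed

lemma beta_commute: "hunit s x \<Longrightarrow> hunit t y \<Longrightarrow> x * y = \<beta> s t * (y * x)"
 using beta_value[of s t] by (auto simp: is_beta_value_def hunit_def)

lemma beta_self [simp]: "t \<in> TT \<Longrightarrow> \<beta> t t = 1"
 using ex_hunit beta_eqI[of t _ t _ 1] by fastforce

lemma beta_mult_left:
 assumes "s \<in> TT" "t \<in> TT" "u \<in> TT"
 shows "\<beta> (s \<otimes> t) u = \<beta> s u * \<beta> t u"
proof -
 obtain x y z where h: "hunit s x" "hunit t y" "hunit u z" using ex_hunit assms by meson
 have "x * y * z = x * (\<beta> t u * (z * y))" using beta_commute[OF h(2,3)] by (simp add: mult.assoc)
 also have "\<dots> = \<beta> t u * (x * z) * y" using hunit_central[OF beta_unit[OF assms(2,3)]] by (metis mult.assoc)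
 also have "\<dots> = \<beta> t u * \<beta> s u * (z * (x * y))" using beta_commute[OF h(1,3)] by (simp add: mult.assoc)
 also have "\<beta> t u * \<beta> s u = \<beta> s u * \<beta> t u" using hunit_central[OF beta_unit[OF assms(2,3)]] .
 finally show ?thesis
  using beta_eqI[OF hunit_mult[OF h(1,2)] h(3)] hunit_mult[OF beta_unit[OF assms(1,3)] beta_unit[OF assms(2,3)]]
  by (simp add: hunit_def)
qed

lemma beta_swap: "s \<in> TT \<Longrightarrow> t \<in> TT \<Longrightarrow> \<beta> s t * \<beta> t s = 1"
proof -
 assume st: "s \<in> TT" "t \<in> TT"
 obtain x y where h: "hunit s x" "hunit t y" using ex_hunit st by meson
 have "x * y = \<beta> s t * \<beta> t s * (x * y)"
  using beta_commute[OF h] beta_commute[OF h(2,1)] by (simp add: mult.assoc)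
 then have "1 * (x * y) = \<beta> s t * \<beta> t s * (x * y)" by simp
 then show ?thesis unfolding hunit_cancel[OF hunit_mult[OF h]] by simp
qed

lemma beta_swap_eq: "s \<in> TT \<Longrightarrow> t \<in> TT \<Longrightarrow> \<beta> t s = hinv (\<beta> s t)"
 by (rule hinv_eqI[symmetric]) (simp_all add: beta_swap)

lemma beta_mult_right:
 assumes "s \<in> TT" "t \<in> TT" "u \<in> TT"
 shows "\<beta> u (s \<otimes> t) = \<beta> u s * \<beta> u t"
proof -
 have "\<beta> u (s \<otimes> t) = hinv (\<beta> s u * \<beta> t u)"
  using beta_swap_eq[of "s \<otimes> t" u] beta_mult_left assms by simp
 also have "\<dots> = \<beta> u t * \<beta> u s"
  unfolding hinv_mult[OF beta_unit[OF assms(1,3)] beta_unit[OF assms(2,3)]]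
   beta_swap_eq[OF assms(1,3)] beta_swap_eq[OF assms(2,3)] ..
 also have "\<dots> = \<beta> u s * \<beta> u t" using hunit_central[OF beta_unit[OF assms(3,2)]] .
 finally show ?thesis .
qed

lemma beta_alternating: "alternating_bicharacter T (D \<one>) \<beta>"
 unfolding alternating_bicharacter_def
 using beta_unit beta_mult_left beta_mult_right by (auto simp: hunit_def)

lemma beta_one [simp]: "t \<in> TT \<Longrightarrow> \<beta> \<one> t = 1" "t \<in> TT \<Longrightarrow> \<beta> t \<one> = 1"
proof -
 assume t: "t \<in> TT"
 then obtain y where "hunit t y" using ex_hunit by blast
 then show "\<beta> \<one> t = 1" "\<beta> t \<one> = 1" using beta_eqI[of \<one> 1 t y 1] beta_eqI[of t y \<one> 1 1] by simp_all
qed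

lemma beta_inv_left:
 assumes "s \<in> TT" "t \<in> TT" shows "\<beta> (inv s) t = \<beta> t s"
proof -
 have "\<beta> (inv s) t * \<beta> s t = 1" "\<beta> s t * \<beta> (inv s) t = 1"
  using beta_mult_left[of "inv s" s t] beta_mult_left[of s "inv s" t] assms by auto
 then have "hinv (\<beta> s t) = \<beta> (inv s) t" by (intro hinv_eqI)
 then show ?thesis using beta_swap_eq[OF assms] by simp
qed

lemma beta_inv_right: "s \<in> TT \<Longrightarrow> t \<in> TT \<Longrightarrow> \<beta> t (inv s) = \<beta> s t"
 using beta_inv_left[of s t] beta_swap_eq[of "inv s" t] beta_swap_eq[of t s] by simp

lemma beta_pow_left: "s \<in> TT \<Longrightarrow> t \<in> TT \<Longrightarrow> \<beta> (s [^] (n::nat)) t = \<beta> s t ^ n"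
 by (induction n) (simp_all add: beta_mult_left power_commutes)

lemma beta_pow_right: "s \<in> TT \<Longrightarrow> t \<in> TT \<Longrightarrow> \<beta> t (s [^] (n::nat)) = \<beta> t s ^ n"
 by (induction n) (simp_all add: beta_mult_right power_commutes)

text \<open>The right side is not simply \<open>\<beta> s t\<close>, since \<open>g\<close> may act
  on the neutral component, for instance by complex conjugation.\<close>

lemma aut_beta:
 assumes aut: "gr_aut g" and st: "s \<in> TT" "t \<in> TT"
 shows "\<beta> (aut_deg g s) (aut_deg g t) = g (\<beta> s t)"
proof -
 obtain x y where h: "hunit s x" "hunit t y" using ex_hunit st by meson
 show ?thesis
 proof (rule beta_eqI[OF aut_hunit[OF aut h(1)] aut_hunit[OF aut h(2)]])
  show "g (\<beta> s t) \<in> D \<one>" using aut_hunit[OF aut beta_unit[OF st]] by (simp add: hunit_def aut_deg_one[OF aut])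
  show "g x * g y = g (\<beta> s t) * (g y * g x)"
   using beta_commute[OF h] by (metis aut_mult[OF aut])
 qed
qed

abbreviation H where "H \<equiv> supp_center T D"

text \<open>A homogeneous element is central as soon as it commutes with all homogeneous elements,
  so the support of the centre is the radical of \<beta>.\<close>

lemma H_iff: "s \<in> H \<longleftrightarrow> s \<in> TT \<and> (\<forall>t\<in>TT. \<beta> s t = 1)"
proof (cases "s \<in> TT")
 case s: True
 then obtain x where x: "hunit s x" using ex_hunit by blast
 show ?thesis
 proof
  assume "s \<in> H"
  then obtain z where z: "z \<in> D s" "z \<in> alg_center" "z \<noteq> 0"
   using s D_0[OF s] by (auto simp: supp_center_def alg_center_def)
  show "s \<in> TT \<and> (\<forall>t\<in>TT. \<beta> s t = 1)"
  proof (intro conjI ballI s)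
   fix t assume "t \<in> TT"
   then obtain y where "hunit t y" using ex_hunit by blast
   moreover have "z * y = 1 * (y * z)" using central_comm[OF z(2), of y] by simp
   ultimately show "\<beta> s t = 1" using beta_eqI[of s z t y 1] z s by (simp add: hunit_def)
  qed
 next
  assume b: "s \<in> TT \<and> (\<forall>t\<in>TT. \<beta> s t = 1)"
  have "x \<in> alg_center"
  proof (rule centralI_hom)
   fix t y assume t: "t \<in> TT" "y \<in> D t"
   show "x * y = y * x"
   proof (cases "y = 0")
    case False
    then have "hunit t y" using t by (simp add: hunit_def)
    then show ?thesis using beta_commute[OF x] b t by simp
   qed simp
  qed
  then show "s \<in> H" using x by (auto simp: supp_center_def hunit_def)
 qed
qed (simp add: supp_center_def)

lemma H_subgroup: "subgroup H T"
proof (rule subgroupI)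
 show "H \<subseteq> TT" using H_iff by blast
 show "H \<noteq> {}" using H_iff[of \<one>] by auto
 show "inv a \<in> H" if "a \<in> H" for a
  using that beta_swap[of a] H_iff by (auto simp: beta_inv_left)
 show "a \<otimes> b \<in> H" if "a \<in> H" "b \<in> H" for a b
  using that H_iff by (simp add: beta_mult_left)
qed

lemma hunit_H_central: "hunit s x \<Longrightarrow> s \<in> H \<Longrightarrow> x \<in> alg_center"
proof (rule centralI_hom)
 fix t y assume *: "hunit s x" "s \<in> H" and t: "t \<in> TT" "y \<in> D t"
 show "x * y = y * x"
 proof (cases "y = 0")
  case False
  then have "hunit t y" using t by (simp add: hunit_def)
  then show ?thesis using beta_commute[OF *(1)] * t H_iff by simp
 qed simp
qed

lemma beta_H:
 assumes "h \<in> H" "t \<in> TT" shows "\<beta> h t = 1" "\<beta> t h = 1"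
 using assms H_iff[of h] beta_swap_eq[of h t] hinv_eqI[of 1 1] by auto

lemma aut_H: "gr_aut g \<Longrightarrow> h \<in> H \<Longrightarrow> aut_deg g h \<in> H"
proof -
 assume aut: "gr_aut g" and h: "h \<in> H"
 have hc: "h \<in> TT" using h H_iff by blast
 show ?thesis unfolding H_iff
 proof (intro conjI ballI)
  show "aut_deg g h \<in> TT" using aut_deg_closed[OF aut hc] .
  fix u assume "u \<in> TT"
  then obtain t where "t \<in> TT" "u = aut_deg g t"
   using aut_deg_bij[OF aut] by (metis bij_betw_imp_surj_on imageE)
  then show "\<beta> (aut_deg g h) u = 1" using aut_beta[OF aut hc] beta_H[OF h] aut_1[OF aut] by simp
 qed
qed

end

section \<open>Real neutral component: the quadratic forms eta and mu\<close>

locale real_neutral = gr_div_inv T D \<phi> for T :: "'t monoid" (structure) and D :: "'t \<Rightarrow> 'd::real_algebra_1 set" and \<phi> +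
 assumes De_real: "D \<one> = range of_real"
begin

lemma real_ratio:
 assumes "hunit t x" "y \<in> D t"
 obtains r where "y = r *\<^sub>R x"
 using ratio[OF assms] De_real by (metis rangeE scaleR_conv_of_real)

lemma real_ratio_unit:
 assumes "hunit t x" "hunit t y"
 obtains r where "r \<noteq> 0" "y = r *\<^sub>R x"
proof -
 obtain r where "y = r *\<^sub>R x" using real_ratio[OF assms(1)] assms(2) by (auto simp: hunit_def)
 then show thesis using that assms(2) by (auto simp: hunit_def)
qed

lemma phi_sign:
 assumes "t \<in> TT"
 obtains c where "c \<in> {1, -1}" "\<And>x. x \<in> D t \<Longrightarrow> \<phi> x = c *\<^sub>R x"
proof -
 obtain x where x: "hunit t x" using ex_hunit assms by blast
 obtain c where c: "\<phi> x = c *\<^sub>R x" using real_ratio[OF x] hunit_phi[OF x] by (auto simp: hunit_def)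
 have "x = (c * c) *\<^sub>R x" using phi_phi[of x] c by (simp add: phi_scale)
 then have "(c * c - 1) *\<^sub>R x = 0" by (simp add: scaleR_diff_left)
 then have "c * c = 1" using x by (simp add: hunit_def)
 then have "c \<in> {1, -1}" by (simp add: square_eq_1_iff)
 moreover have "\<phi> y = c *\<^sub>R y" if y: "y \<in> D t" for y
 proof -
  obtain r where "y = r *\<^sub>R x" using real_ratio[OF x y] .
  then show ?thesis using c by (simp add: phi_scale)
 qed
 ultimately show thesis using that by blast
qed

definition eta :: "'t \<Rightarrow> real" where
 "eta t = (SOME c. c \<in> {1, -1} \<and> (\<forall>x\<in>D t. \<phi> x = c *\<^sub>R x))"

lemma eta:
 assumes "t \<in> TT"
 shows "eta t = 1 \<or> eta t = -1" "x \<in> D t \<Longrightarrow> \<phi> x = eta t *\<^sub>R x"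
proof -
 have "\<exists>c. c \<in> {1, -1} \<and> (\<forall>x\<in>D t. \<phi> x = c *\<^sub>R x)" using phi_sign[OF assms] by metis
 from someI_ex[OF this] show "eta t = 1 \<or> eta t = -1" "x \<in> D t \<Longrightarrow> \<phi> x = eta t *\<^sub>R x"
  unfolding eta_def by blast+
qed

lemma eta_sq: "t \<in> TT \<Longrightarrow> eta t * eta t = 1"
 using eta(1) by fastforce

lemma eta_eqI: "hunit t x \<Longrightarrow> \<phi> x = c *\<^sub>R x \<Longrightarrow> eta t = c"
 using eta(2)[of t x] by (auto simp: hunit_def)

text \<open>\<phi> reverses products, so the signs \<open>eta\<close> multiply up to a commutator:
  they form a quadratic form with polarisation \<beta>. In particular \<beta> takes only the values
  1 and -1.\<close>

lemma eta_mult: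
 assumes "s \<in> TT" "t \<in> TT"
 shows "of_real (eta (s \<otimes> t)) = of_real (eta s * eta t) * \<beta> s t"
proof -
 obtain x y where h: "hunit s x" "hunit t y" using ex_hunit assms by meson
 have xy: "hunit (t \<otimes> s) (y * x)" using hunit_mult h by blast
 have e: "\<phi> (y * x) = (eta s * eta t) *\<^sub>R (x * y)"
  unfolding phi_mult eta(2)[OF hunitD(1,2)[OF h(1)]] eta(2)[OF hunitD(1,2)[OF h(2)]] by simp
 have "\<phi> (y * x) = eta (s \<otimes> t) *\<^sub>R (y * x)" using eta(2)[of "t \<otimes> s" "y * x"] xy m_comm assms by (simp add: hunit_def)
 then have "of_real (eta (s \<otimes> t)) * (y * x) = (of_real (eta s * eta t) * \<beta> s t) * (y * x)"
  using e beta_commute[OF h] by (simp add: scaleR_conv_of_real mult.assoc)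
 then show ?thesis unfolding hunit_cancel[OF xy] .
qed

lemma beta_real:
 assumes "s \<in> TT" "t \<in> TT"
 shows "\<beta> s t = of_real (eta s * eta t * eta (s \<otimes> t))"
proof -
 have "of_real (eta s * eta t) * of_real (eta (s \<otimes> t)) = of_real ((eta s * eta s) * (eta t * eta t)) * \<beta> s t"
  unfolding eta_mult[OF assms] by (simp add: mult.assoc[symmetric] of_real_mult[symmetric] del: of_real_mult) (simp add: mult_ac)
 then show ?thesis using eta_sq assms by (simp add: mult.assoc)
qed

lemma beta_sign: "s \<in> TT \<Longrightarrow> t \<in> TT \<Longrightarrow> \<beta> s t = 1 \<or> \<beta> s t = -1"
 using eta(1)[of s] eta(1)[of t] eta(1)[of "s \<otimes> t"] by (auto simp: beta_real)

lemma beta_sq: "s \<in> TT \<Longrightarrow> t \<in> TT \<Longrightarrow> \<beta> s t * \<beta> s t = 1"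
 using beta_sign by fastforce

lemma beta_sym: "s \<in> TT \<Longrightarrow> t \<in> TT \<Longrightarrow> \<beta> s t = \<beta> t s"
 by (simp add: beta_real m_comm mult.commute)

text \<open>As \<beta> has values 1 and -1, squares have degrees in its radical and are central;
  they are symmetric because \<phi> acts on a component by a sign. Symmetric central elements are
  real, of neutral degree. This makes \<open>T\<close> an elementary abelian 2-group.\<close>

lemma square_real:
 assumes "hunit t x"
 shows "t \<otimes> t = \<one>" "\<exists>r. r \<noteq> 0 \<and> x * x = of_real r"
proof -
 have t: "t \<in> TT" using assms by (simp add: hunit_def)
 have c: "x * x \<in> alg_center"
 proof (rule hunit_H_central[OF hunit_mult[OF assms assms]])
  show "t \<otimes> t \<in> H" unfolding H_iff using t beta_sq by (simp add: beta_mult_left)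
 qed
 have f: "\<phi> (x * x) = x * x"
  using eta(2)[OF t hunitD(2)[OF assms]] eta_sq[OF t] by (simp add: phi_mult)
 have "t \<otimes> t \<in> TT" "x * x \<in> D (t \<otimes> t)" "x * x \<noteq> 0"
  using hunit_mult[OF assms assms] by (auto simp: hunit_def)
 then show "t \<otimes> t = \<one>" "\<exists>r. r \<noteq> 0 \<and> x * x = of_real r"
  using center_phi_hom[OF _ _ f c] by blast+
qed

lemma T_sq: "t \<in> TT \<Longrightarrow> t \<otimes> t = \<one>"
 using ex_hunit square_real by blast

lemma power_part_2: "power_part T 2 = {\<one>}"
 unfolding power_part_def using T_sq by (auto simp: numeral_2_eq_2 intro: exI[of _ \<one>])

lemma mu_props:
 assumes "t \<in> TT"
 shows "is_mu_value D t (mu D t)" "mu D t = 1 \<or> mu D t = -1" "hunit t x \<Longrightarrow> \<exists>r>0. x * x = of_real (mu D t * r)"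
proof -
 obtain x where x: "hunit t x" using ex_hunit assms by blast
 obtain r where r: "r \<noteq> 0" "x * x = of_real r" using square_real(2)[OF x] by blast
 have v: "is_mu_value D t (sgn r)"
  unfolding is_mu_value_def
 proof (intro conjI ballI impI)
  show "sgn r \<in> {1, -1}" using r by (auto simp: sgn_if)
  fix y assume y: "y \<in> D t" "y \<noteq> 0"
  then obtain c where c: "y = c *\<^sub>R x" using real_ratio[OF x] by blast
  have "y * y = (c * c) *\<^sub>R of_real r" using c r by simp
  also have "\<dots> = of_real (sgn r * (c * c * \<bar>r\<bar>))" using r by (simp add: of_real_def sgn_if mult_ac)
  finally show "\<exists>s>0. y * y = of_real (sgn r * s)"
   using r c y by (intro exI[of _ "c * c * \<bar>r\<bar>"]) (auto simp: zero_less_mult_iff)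
 qed
 have "mu D t = sgn r"
  unfolding mu_def
 proof (rule the_equality[of "is_mu_value D t", OF v])
  fix m assume m: "is_mu_value D t m"
  then obtain s where "s > 0" "x * x = of_real (m * s)" using x by (auto simp: is_mu_value_def hunit_def)
  then have "r = m * s" using r by (metis of_real_eq_iff)
  then show "m = sgn r" using m \<open>s > 0\<close> by (auto simp: is_mu_value_def sgn_if)
 qed
 then show mv: "is_mu_value D t (mu D t)" using v by simp
 then show "mu D t = 1 \<or> mu D t = -1" "hunit t x \<Longrightarrow> \<exists>r>0. x * x = of_real (mu D t * r)" for x
  by (auto simp: is_mu_value_def hunit_def)
qed

lemma mu_eqI:
 assumes "hunit t x" "x * x = of_real (m * r)" "r > 0" "m = 1 \<or> m = -1"
 shows "mu D t = m"
proof -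
 obtain s where s: "s > 0" "x * x = of_real (mu D t * s)" using mu_props(3)[of t x] assms by (auto simp: hunit_def)
 then have "mu D t * s = m * r" using assms by (metis of_real_eq_iff)
 then show ?thesis using mu_props(2)[of t] assms s by (auto simp: hunit_def)
qed

lemma mu_sq: "t \<in> TT \<Longrightarrow> mu D t * mu D t = 1"
 using mu_props(2) by fastforce

lemma mu_mult:
 assumes "s \<in> TT" "t \<in> TT"
 shows "of_real (mu D (s \<otimes> t)) = of_real (mu D s * mu D t) * \<beta> s t"
proof -
 obtain x y where h: "hunit s x" "hunit t y" using ex_hunit assms by meson
 obtain a where a: "a > 0" "x * x = of_real (mu D s * a)" using mu_props(3)[OF assms(1) h(1)] by blast
 obtain b where b: "b > 0" "y * y = of_real (mu D t * b)" using mu_props(3)[OF assms(2) h(2)] by blast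
 define e where "e = eta s * eta t * eta (s \<otimes> t)"
 have be: "\<beta> s t = of_real e" using beta_real assms by (simp add: e_def)
 have e: "e = 1 \<or> e = -1" using eta(1)[of s] eta(1)[of t] eta(1)[of "s \<otimes> t"] assms by (auto simp: e_def)
 have ee: "e * e = 1" using e by auto
 have "y * x = \<beta> s t * (x * y)" using beta_commute[OF h(2,1)] beta_sym assms by simp
 then have "x * y * (x * y) = of_real e * (x * (x * y) * y)"
 proof -
  assume yx: "y * x = \<beta> s t * (x * y)"
  have "x * y * (x * y) = x * (y * x) * y" by (simp only: mult.assoc)
  also have "\<dots> = e *\<^sub>R (x * (x * y) * y)" unfolding yx be by (simp flip: scaleR_conv_of_real)
  finally show ?thesis by (simp add: scaleR_conv_of_real)
 qed
 also have "\<dots> = of_real e * (x * x) * (y * y)" by (simp add: mult.assoc)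
 also have "\<dots> = of_real (mu D s * mu D t * e * (a * b))" using a b by (simp add: mult_ac flip: of_real_mult)
 finally have "mu D (s \<otimes> t) = mu D s * mu D t * e"
  using mu_eqI[OF hunit_mult[OF h]] a b e mu_props(2)[OF assms(1)] mu_props(2)[OF assms(2)] by fastforce
 then show ?thesis by (simp add: be)
qed

lemma aut_mu:
 assumes aut: "gr_aut h" and t: "t \<in> TT"
 shows "mu D (aut_deg h t) = mu D t"
proof -
 obtain x where x: "hunit t x" using ex_hunit t by blast
 obtain s where s: "s > 0" "x * x = of_real (mu D t * s)" using mu_props(3)[OF t x] by blast
 have "h x * h x = of_real (mu D t * s)" using s by (metis aut_mult[OF aut] aut_of_real[OF aut])
 then show ?thesis using mu_eqI[OF aut_hunit[OF aut x]] s mu_props(2)[OF t] by blast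
qed

text \<open>A map that preserves \<mu> preserves its polarisation \<beta>. The graph fed to
  \<open>lift_automorphism\<close> consists of all pairs of homogeneous units of corresponding
  degrees: commutators match by \<beta>, and signs of squares match by \<mu>.\<close>

lemma lift_isometry:
 assumes f: "f \<in> hom T T" "bij_betw f TT TT"
  and mu: "\<And>t. t \<in> TT \<Longrightarrow> mu D (f t) = mu D t"
 obtains g where "gr_aut g" "\<And>t. t \<in> TT \<Longrightarrow> aut_deg g t = f t"
proof -
 interpret a: group_hom T T f by unfold_locales (rule f)
 have beta: "\<beta> (f s) (f t) = \<beta> s t" if st: "s \<in> TT" "t \<in> TT" for s t
 proof -
  have ms: "of_real (mu D s * mu D t) * of_real (mu D s * mu D t) = (1 :: 'd)"
  proof -
   have "(mu D s * mu D t) * (mu D s * mu D t) = (mu D s * mu D s) * (mu D t * mu D t)" by simp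
   then show ?thesis using mu_sq st by (simp flip: of_real_mult)
  qed
  have "of_real (mu D s * mu D t) * \<beta> s t = of_real (mu D s * mu D t) * \<beta> (f s) (f t)"
   using mu_mult[OF st] mu_mult[of "f s" "f t"] mu[of s] mu[of t] mu[of "s \<otimes> t"] st by simp
  then have "of_real (mu D s * mu D t) * (of_real (mu D s * mu D t) * \<beta> s t) =
   of_real (mu D s * mu D t) * (of_real (mu D s * mu D t) * \<beta> (f s) (f t))" by simp
  then show ?thesis using ms by (simp only: mult.assoc[symmetric]) simp
 qed
 let ?G = "{(x, y). \<exists>t. hunit t x \<and> hunit (f t) y}"
 show thesis
 proof (rule lift_automorphism[OF f, of ?G])
  show "(x * x', y * y') \<in> ?G" if "(x, y) \<in> ?G" "(x', y') \<in> ?G" for x y x' y'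
  proof -
   obtain s t where st: "hunit s x" "hunit (f s) y" "hunit t x'" "hunit (f t) y'" using \<open>(x, y) \<in> ?G\<close> \<open>(x', y') \<in> ?G\<close> by blast
   have "hunit (f (s \<otimes> t)) (y * y')" using hunit_mult[OF st(2,4)] st(1,3) by (simp add: hunit_def)
   then show ?thesis using hunit_mult[OF st(1,3)] by blast
  qed
  show "(hinv x, hinv y) \<in> ?G" if xy: "(x, y) \<in> ?G" for x y
  proof -
   obtain s where st: "hunit s x" "hunit (f s) y" using xy by blast
   have "hunit (f (inv s)) (hinv y)" using hunit_hinv[OF st(2)] st(1) by (simp add: hunit_def)
   then show ?thesis using hunit_hinv[OF st(1)] by blast
  qed
  show "\<exists>x y. hunit t x \<and> (x, y) \<in> ?G" if "t \<in> TT" for t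
  proof -
   obtain x y where "hunit t x" "hunit (f t) y" using ex_hunit[of t] ex_hunit[of "f t"] \<open>t \<in> TT\<close> by auto
   then show ?thesis by blast
  qed
  show "(l, l) \<in> ?G" if "hunit \<one> l" for l using that by auto
  show "(1, of_real r) \<in> ?G" if "r \<noteq> 0" for r using hunit_of_real[OF that] hunit_1 by (auto intro!: exI[of _ \<one>])
  show "\<exists>r. r \<noteq> 0 \<and> y = of_real r" if y: "(1, y) \<in> ?G" for y
  proof -
   obtain t where t: "hunit t 1" "hunit (f t) y" using y by blast
   have "t = \<one>" using hunit_unique[OF hunit_1 t(1)] .
   then have "hunit \<one> y" using t by simp
   then show ?thesis using De_real by (auto simp: hunit_def)
  qed
  show "y * y' = l * (y' * y)"
   if h: "(x, y) \<in> ?G" "(x', y') \<in> ?G" "hunit \<one> l" "x * x' = l * (x' * x)" for x y x' y' l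
  proof -
   obtain s t where st: "hunit s x" "hunit (f s) y" "hunit t x'" "hunit (f t) y'" using h by blast
   have "l = \<beta> s t" using beta_eqI[OF st(1,3) _ h(4)] h(3) by (simp add: hunit_def)
   then show ?thesis using beta_commute[OF st(2,4)] beta st(1,3) by (simp add: hunit_def)
  qed
  show "\<exists>r>0. y * y = r *\<^sub>R (x * x)" if xy: "(x, y) \<in> ?G" for x y
  proof -
   obtain t where t: "hunit t x" "hunit (f t) y" using xy by blast
   have tc: "t \<in> TT" using t by (simp add: hunit_def)
   obtain a where a: "a > 0" "x * x = of_real (mu D t * a)" using mu_props(3)[OF tc t(1)] by blast
   obtain b where b: "b > 0" "y * y = of_real (mu D t * b)" using mu_props(3)[OF _ t(2)] mu[OF tc] tc by auto
   have "y * y = (b / a) *\<^sub>R (x * x)" using a b by (simp add: scaleR_conv_of_real flip: of_real_mult)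
   then show ?thesis using a b by (intro exI[of _ "b / a"]) simp
  qed
 qed (use that in auto)
qed

end

section \<open>The centre\<close>

lemma iso_complex_not_real: "iso_complex S \<Longrightarrow> S \<noteq> range (of_real :: real \<Rightarrow> 'd::real_algebra_1)"
proof
 assume "iso_complex S" and S: "S = range (of_real :: real \<Rightarrow> 'd)"
 then obtain f :: "'d \<Rightarrow> complex" where f: "bij_betw f S UNIV" "f 1 = 1" "\<And>r x. x \<in> S \<Longrightarrow> f (r *\<^sub>R x) = r *\<^sub>R f x"
  unfolding iso_complex_def by blast
 have "\<i> \<in> f ` S" using bij_betw_imp_surj_on[OF f(1)] by simp
 then obtain x where x: "\<i> = f x" "x \<in> S" by (rule imageE)
 then obtain r where "x = r *\<^sub>R 1" using S by (auto simp: of_real_def)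
 moreover have "(1::'d) \<in> S" using S by (metis of_real_1 rangeI)
 ultimately have "\<i> = r *\<^sub>R 1" using f(2,3) x by metis
 then show False by (simp add: complex_eq_iff)
qed

lemma iso_split_not_real: "iso_split_complex S \<Longrightarrow> S \<noteq> range (of_real :: real \<Rightarrow> 'd::real_algebra_1)"
proof
 assume "iso_split_complex S" and S: "S = range (of_real :: real \<Rightarrow> 'd)"
 then obtain f g :: "'d \<Rightarrow> real" where b: "bij_betw (\<lambda>x. (f x, g x)) S UNIV"
  and h: "\<And>h. h \<in> {f, g} \<Longrightarrow> h 1 = 1 \<and> (\<forall>r. \<forall>x\<in>S. h (r *\<^sub>R x) = r * h x)"
  unfolding iso_split_complex_def by meson
 have "(0, 1) \<in> (\<lambda>x. (f x, g x)) ` S" using bij_betw_imp_surj_on[OF b] by simp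
 then obtain x where x: "f x = 0" "g x = 1" "x \<in> S" by auto
 then obtain r where r: "x = r *\<^sub>R 1" using S by (auto simp: of_real_def)
 have "(1::'d) \<in> S" using S by (metis of_real_1 rangeI)
 then have "f x = r" "g x = r" using h[of f] h[of g] r by auto
 then show False using x by simp
qed

context gr_div_inv
begin

context
 fixes z :: 'd and e :: real
 assumes z: "z \<noteq> 0" "\<phi> z = - z" "z * z = of_real e"
  and K: "K = {of_real a + b *\<^sub>R z | a b. True}"
begin

lemma center_coords:
 assumes "of_real a + b *\<^sub>R z = of_real a' + b' *\<^sub>R z" shows "a = a'" "b = b'"
proof -
 have "\<phi> (of_real a + b *\<^sub>R z) = \<phi> (of_real a' + b' *\<^sub>R z)" using assms by simp
 then have "of_real a - b *\<^sub>R z = of_real a' - b' *\<^sub>R z" by (simp add: phi_add phi_scale z(2))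
 moreover have sum_diff: "(x + y) + (x - y) = x + x" for x y :: 'd by simp
 ultimately have "(of_real a + of_real a :: 'd) = of_real a' + of_real a'"
  using assms sum_diff[of "of_real a" "b *\<^sub>R z"] sum_diff[of "of_real a'" "b' *\<^sub>R z"] by metis
 then have "(of_real (2 * a) :: 'd) = of_real (2 * a')" unfolding mult_2 of_real_add .
 then have "2 * a = 2 * a'" by (rule of_real_eq_iff[THEN iffD1])
 then show a: "a = a'" by simp
 then have "(b - b') *\<^sub>R z = 0" using assms by (simp add: scaleR_diff_left)
 then show "b = b'" using z(1) by simp
qed

lemma center_cong: "(1::'d) \<in> alg_center"
 using real_center[of 1] by simp

definition coord :: "'d \<Rightarrow> real \<times> real" where
 "coord x = (THE w. x = of_real (fst w) + snd w *\<^sub>R z)"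

lemma coord_eq [simp]: "coord (of_real a + b *\<^sub>R z) = (a, b)"
 unfolding coord_def
proof (rule the_equality)
 fix w assume "of_real a + b *\<^sub>R z = of_real (fst w) + snd w *\<^sub>R z"
 from center_coords[OF this] show "w = (a, b)" by (simp add: prod_eq_iff)
qed simp

lemma center_obtain:
 assumes "x \<in> alg_center"
 obtains a b where "x = of_real a + b *\<^sub>R z"
 using assms K by blast

lemma center_prod: "(of_real a + b *\<^sub>R z) * (of_real c + d *\<^sub>R z) = of_real (a * c + e * b * d) + (a * d + b * c) *\<^sub>R z"
proof -
 have "(b *\<^sub>R z) * (d *\<^sub>R z) = of_real (e * b * d)" using z(3) by (simp add: of_real_def mult_ac)
 then show ?thesis by (simp add: algebra_simps of_real_def scaleR_add_left)
qed

lemma center_sum: "(of_real a + b *\<^sub>R z) + (of_real c + d *\<^sub>R z) = of_real (a + c) + (b + d) *\<^sub>R z"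
 by (simp add: algebra_simps)

lemma center_scal: "r *\<^sub>R (of_real a + b *\<^sub>R z) = of_real (r * a) + (r * b) *\<^sub>R z"
 by (simp add: algebra_simps of_real_def)

lemma coord_1: "coord 1 = (1, 0)"
 using coord_eq[of 1 0] by simp

lemma coord_bij: "bij_betw coord alg_center UNIV"
proof (rule bij_betwI[where g = "\<lambda>(a, b). of_real a + b *\<^sub>R z"])
 show "(\<lambda>(a, b). of_real a + b *\<^sub>R z) \<in> UNIV \<rightarrow> alg_center" using K by auto
 show "(case coord x of (a, b) \<Rightarrow> of_real a + b *\<^sub>R z) = x" if x: "x \<in> alg_center" for x
  using center_obtain[OF x] by fastforce
qed auto

lemma center_iso_complex:
 assumes "e = -1" shows "iso_complex K"
 unfolding iso_complex_def
proof (intro exI[of _ "\<lambda>x. Complex (fst (coord x)) (snd (coord x))"] conjI ballI allI)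
 have c: "bij_betw (\<lambda>(a, b). Complex a b) UNIV UNIV"
  by (rule bij_betwI[where g = "\<lambda>w. (Re w, Im w)"]) auto
 from bij_betw_trans[OF coord_bij c]
 show "bij_betw (\<lambda>x. Complex (fst (coord x)) (snd (coord x))) alg_center UNIV"
  by (simp add: o_def case_prod_beta)
 show "Complex (fst (coord 1)) (snd (coord 1)) = 1" by (simp add: coord_1 one_complex.code)
 fix x y :: 'd assume "x \<in> alg_center" "y \<in> alg_center"
 then obtain a b c d where xy: "x = of_real a + b *\<^sub>R z" "y = of_real c + d *\<^sub>R z" using center_obtain by metis
 show "Complex (fst (coord (x + y))) (snd (coord (x + y))) = Complex (fst (coord x)) (snd (coord x)) + Complex (fst (coord y)) (snd (coord y))"
  unfolding xy center_sum coord_eq by (simp add: complex_eq_iff)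
 show "Complex (fst (coord (x * y))) (snd (coord (x * y))) = Complex (fst (coord x)) (snd (coord x)) * Complex (fst (coord y)) (snd (coord y))"
  unfolding xy center_prod coord_eq using assms by (simp add: complex_eq_iff)
next
 fix r and x :: 'd assume "x \<in> alg_center"
 then obtain a b where x: "x = of_real a + b *\<^sub>R z" using center_obtain by metis
 show "Complex (fst (coord (r *\<^sub>R x))) (snd (coord (r *\<^sub>R x))) = r *\<^sub>R Complex (fst (coord x)) (snd (coord x))"
  unfolding x center_scal coord_eq by (simp add: complex_eq_iff)
qed

lemma center_iso_split:
 assumes "e = 1" shows "iso_split_complex K"
 unfolding iso_split_complex_def
\<comment> \<open>The two projections evaluate \<open>z\<close> at 1 and at -1, the square roots of
  \<open>e = 1\<close>.\<close>
proof (rule exI[of _ "\<lambda>x. fst (coord x) + snd (coord x)"],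
  rule exI[of _ "\<lambda>x. fst (coord x) - snd (coord x)"], intro conjI ballI)
 have c: "bij_betw (\<lambda>(a, b). (a + b, a - b :: real)) UNIV UNIV"
  by (rule bij_betwI[where g = "\<lambda>(u, v). ((u + v) / 2, (u - v) / 2)"]) (auto simp: field_simps)
 from bij_betw_trans[OF coord_bij c]
 show "bij_betw (\<lambda>x. (fst (coord x) + snd (coord x), fst (coord x) - snd (coord x))) alg_center UNIV"
  by (simp add: o_def case_prod_beta)
next
 fix h assume h: "h \<in> {\<lambda>x. fst (coord x) + snd (coord x), \<lambda>x. fst (coord x) - snd (coord x)}"
 obtain w :: real where w: "w * w = 1" "\<And>x. h x = fst (coord x) + w * snd (coord x)"
  using h that[of 1] that[of "-1"] by auto
 have hz: "h (of_real a + b *\<^sub>R z) = a + w * b" for a b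
  unfolding w(2) coord_eq by simp
 show "h 1 = 1" unfolding w(2) coord_1 by simp
 {
  fix x y :: 'd assume "x \<in> alg_center" "y \<in> alg_center"
  then obtain a b c d where xy: "x = of_real a + b *\<^sub>R z" "y = of_real c + d *\<^sub>R z" using center_obtain by metis
  show "h (x + y) = h x + h y" unfolding xy center_sum hz by (simp add: algebra_simps)
  have "(w * b) * (w * d) = b * d" using w(1) by (metis mult.assoc mult.commute mult_1)
  then show "h (x * y) = h x * h y" unfolding xy center_prod hz assms by (simp add: algebra_simps)
 }
 show "\<forall>r. \<forall>x\<in>alg_center. h (r *\<^sub>R x) = r * h x"
 proof (intro allI ballI)
  fix r and x :: 'd assume "x \<in> alg_center"
  then obtain a b where x: "x = of_real a + b *\<^sub>R z" using center_obtain by metis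
  show "h (r *\<^sub>R x) = r * h x" unfolding x center_scal hz by (simp add: algebra_simps)
 qed
qed

lemma z_center: "z \<in> alg_center"
proof -
 have "z = of_real 0 + 1 *\<^sub>R z" by simp
 then show ?thesis using K by blast
qed

text \<open>A homomorphism to the reals would send \<open>z\<close> to a real square root of
  -1.\<close>

lemma center_not_split:
 assumes "e = -1" shows "\<not> iso_split_complex K"
proof
 assume "iso_split_complex K"
 then obtain f g :: "'d \<Rightarrow> real" where fg: "\<forall>h\<in>{f, g}. h 1 = 1 \<and>
   (\<forall>x\<in>alg_center. \<forall>y\<in>alg_center. h (x + y) = h x + h y \<and> h (x * y) = h x * h y) \<and>
   (\<forall>r. \<forall>x\<in>alg_center. h (r *\<^sub>R x) = r * h x)"
  unfolding iso_split_complex_def by (elim exE conjE)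
 have f: "f 1 = 1" "\<And>x y. x \<in> alg_center \<Longrightarrow> y \<in> alg_center \<Longrightarrow> f (x * y) = f x * f y"
  "\<And>r x. x \<in> alg_center \<Longrightarrow> f (r *\<^sub>R x) = r * f x"
  using fg by simp_all
 have "f (z * z) = -1" unfolding z(3) of_real_def f(3)[OF center_cong] f(1) assms by simp
 then have "f z * f z = -1" using f(2)[OF z_center z_center] by simp
 then show False by (metis not_one_le_zero zero_le_square neg_0_le_iff_le neg_le_0_iff_le)
qed

text \<open>In the complex numbers 1 has only the square roots 1 and -1, but \<open>z\<close> is
  skew while these are symmetric.\<close>

lemma center_not_complex:
 assumes "e = 1" shows "\<not> iso_complex K"
proof
 assume "iso_complex K"
 then obtain f :: "'d \<Rightarrow> complex" where f: "bij_betw f alg_center UNIV" "f 1 = 1"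
  "\<And>x y. x \<in> alg_center \<Longrightarrow> y \<in> alg_center \<Longrightarrow> f (x * y) = f x * f y"
  "\<And>r x. x \<in> alg_center \<Longrightarrow> f (r *\<^sub>R x) = r *\<^sub>R f x"
  unfolding iso_complex_def by blast
 have "f (z * z) = 1" unfolding z(3) of_real_def f(4)[OF center_cong] f(2) assms by simp
 then have "f z * f z = 1" using f(3)[OF z_center z_center] by simp
 then have "f z = 1 \<or> f z = -1" by (simp add: square_eq_1_iff)
 moreover have "f (-1) = -1" using f(4)[OF center_cong, of "-1"] f(2) by simp
 ultimately have "f z = f 1 \<or> f z = f (-1)" using f(2) by simp
 moreover have "(-1 :: 'd) \<in> alg_center" using center_scale[OF center_cong, of "-1"] by simp
 ultimately have "z = 1 \<or> z = -1"
  using bij_betw_imp_inj_on[OF f(1)] z_center center_cong by (auto simp: inj_on_def)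
 then show False using z(1,2) by (auto simp: phi_neg)
qed

end

lemma center_real_case:
 assumes "K = range of_real"
 shows "D \<one> = range of_real" "\<not> iso_complex K" "\<not> iso_split_complex K"
  "\<not> iso_complex (D \<one>)" "H = {\<one>}"
proof -
 have "D \<one> \<subseteq> range of_real" using De_center unfolding assms .
 then show De: "D \<one> = range of_real" by auto
 show "\<not> iso_complex K" "\<not> iso_split_complex K" "\<not> iso_complex (D \<one>)"
  using iso_complex_not_real iso_split_not_real assms De by metis+
 show "H = {\<one>}"
 proof (intro equalityI subsetI)
  fix s assume s: "s \<in> H"
  then obtain x where x: "hunit s x" using ex_hunit H_iff by blast
  then have "x \<in> D \<one>" using hunit_H_central[OF x s] assms De by simp
  then show "s \<in> {\<one>}" using D_disjoint[of s \<one> x] x by (simp add: hunit_def)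
 qed (use subgroup.one_closed[OF H_subgroup] in auto)
qed

text \<open>The degree \<open>f\<close> and the square \<open>e\<close> of the skew central element
  separate the cases: \<open>e = 1\<close> is the split centre, \<open>e = -1\<close> the complex
  one, with complex neutral component if \<open>f = \<one>\<close> and real neutral component
  otherwise.\<close>

lemma center_nonreal_case:
 assumes "K \<noteq> range of_real"
 obtains f z e where "hunit f z" "z \<in> alg_center" "\<phi> z = - z" "e = 1 \<or> e = -1"
  "z * z = of_real e" "H = {\<one>, f}" "f \<noteq> \<one> \<Longrightarrow> D \<one> = range of_real" "f = \<one> \<Longrightarrow> D \<one> = alg_center \<and> e = -1"
  "e = -1 \<Longrightarrow> iso_complex K \<and> \<not> iso_split_complex K"
  "e = 1 \<Longrightarrow> iso_split_complex K \<and> \<not> iso_complex K"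
proof -
 obtain f z e where *: "hunit f z" "z \<in> alg_center" "\<phi> z = - z" "e \<in> {1, -1}"
  "z * z = of_real e" "K = {of_real a + b *\<^sub>R z | a b. True}"
  "f \<noteq> \<one> \<or> e = -1" by (rule center_cases[OF assms])
 have zn: "z \<noteq> 0" and fc: "f \<in> TT" and zf: "z \<in> D f" using *(1) by (auto simp: hunit_def)
 have Hf: "H = {\<one>, f}"
 proof (intro equalityI subsetI)
  fix s assume s: "s \<in> H"
  then have sc: "s \<in> TT" using H_iff by blast
  then obtain x where x: "hunit s x" using ex_hunit by blast
  then obtain a b where ab: "x = of_real a + b *\<^sub>R z" using hunit_H_central[OF x s] *(6) by blast
  show "s \<in> {\<one>, f}"
  proof (rule ccontr)
   assume n: "s \<notin> {\<one>, f}"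
   have "comp x s = comp (of_real a) s + b *\<^sub>R comp z s" unfolding ab using sc by (simp add: comp_add comp_scale)
   also have "\<dots> = 0" using comp_hom[of "of_real a" \<one> s] comp_hom[OF zf fc sc] n sc by simp
   finally show False using comp_hom[of x s s] x by (simp add: hunit_def)
  qed
 next
  fix s assume "s \<in> {\<one>, f}"
  then show "s \<in> H" using subgroup.one_closed[OF H_subgroup] fc zf zn *(2) by (auto simp: supp_center_def)
 qed
 have De1: "D \<one> = range of_real" if f: "f \<noteq> \<one>"
 proof (intro equalityI subsetI)
  fix x assume x: "x \<in> D \<one>"
  then obtain a b where ab: "x = of_real a + b *\<^sub>R z" using De_center *(6) by blast
  have "comp x f = comp (of_real a) f + b *\<^sub>R comp z f" unfolding ab using fc by (simp add: comp_add comp_scale)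
  then have "b *\<^sub>R z = 0" using comp_hom[OF x, of f] comp_hom[of "of_real a" \<one> f] comp_hom[OF zf fc fc] f fc by simp
  then have "b = 0" using zn by simp
  then show "x \<in> range of_real" using ab by simp
 qed auto
 have De2: "D \<one> = alg_center" if f: "f = \<one>"
 proof (intro equalityI subsetI)
  fix x :: 'd assume "x \<in> alg_center"
  then obtain a b where ab: "x = of_real a + b *\<^sub>R z" using *(6) by blast
  show "x \<in> D \<one>" unfolding ab by (intro D_add D_scale) (use zf f in auto)
 qed (use De_center in auto)
 show thesis
  by (rule that[OF *(1,2,3) _ *(5) Hf De1])
   (use *(4,7) De2 center_iso_complex[OF zn *(3,5,6)] center_iso_split[OF zn *(3,5,6)]
    center_not_split[OF zn *(3,5,6)] center_not_complex[OF zn *(3,5,6)] in auto)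
qed

end

section \<open>Signs and signature\<close>

text \<open>The laws of an action are demanded only on \<open>V\<close>: the maps that act are
  meaningful on a carrier and need not form an action on the whole type.\<close>

lemma multiset_orbit_eq_iff:
 assumes closed: "\<And>a v. a \<in> carrier A \<Longrightarrow> v \<in> V \<Longrightarrow> act a v \<in> V"
  and one: "\<exists>e\<in>carrier A. \<forall>v\<in>V. act e v = v"
  and comp: "\<And>a b. a \<in> carrier A \<Longrightarrow> b \<in> carrier A \<Longrightarrow> \<exists>c\<in>carrier A. \<forall>v\<in>V. act c v = act a (act b v)"
  and inverse: "\<And>a. a \<in> carrier A \<Longrightarrow> \<exists>b\<in>carrier A. \<forall>v\<in>V. act b (act a v) = v"
  and M: "set_mset M \<subseteq> V" and N: "set_mset N \<subseteq> V"
 shows "multiset_orbit A act M = multiset_orbit A act N \<longleftrightarrow> (\<exists>a\<in>carrier A. N = image_mset (act a) M)"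
proof
 assume eq: "multiset_orbit A act M = multiset_orbit A act N"
 obtain e where e: "e \<in> carrier A" "\<forall>v\<in>V. act e v = v" using one by blast
 then have "image_mset (act e) N = N" using N by (simp add: image_mset_cong[of N "act e" id] subset_iff)
 then have "N \<in> multiset_orbit A act N" using e unfolding multiset_orbit_def orbit_def by force
 then have "N \<in> multiset_orbit A act M" using eq by simp
 then show "\<exists>a\<in>carrier A. N = image_mset (act a) M" unfolding multiset_orbit_def orbit_def by blast
next
 assume "\<exists>a\<in>carrier A. N = image_mset (act a) M"
 then obtain a where a: "a \<in> carrier A" "N = image_mset (act a) M" by blast
 obtain b where b: "b \<in> carrier A" "\<forall>v\<in>V. act b (act a v) = v" using inverse[OF a(1)] by blast
 have bN: "image_mset (act b) N = M"
  unfolding a(2) image_mset.compositionality using b(2) M by (simp add: image_mset_cong[of M "act b \<circ> act a" id] subset_iff)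
 have mono: "multiset_orbit A act X \<subseteq> multiset_orbit A act Y"
  if c: "c \<in> carrier A" "X = image_mset (act c) Y" "set_mset Y \<subseteq> V" for c X Y
 proof
  fix Z assume "Z \<in> multiset_orbit A act X"
  then obtain g where g: "g \<in> carrier A" "Z = image_mset (act g) X" unfolding multiset_orbit_def orbit_def by blast
  obtain d where d: "d \<in> carrier A" "\<forall>v\<in>V. act d v = act g (act c v)" using comp[OF g(1) c(1)] by blast
  have "Z = image_mset (act d) Y"
   unfolding g(2) c(2) image_mset.compositionality by (rule image_mset_cong) (use d(2) c(3) in auto)
  then show "Z \<in> multiset_orbit A act Y" using d(1) unfolding multiset_orbit_def orbit_def by blast
 qed
 show "multiset_orbit A act M = multiset_orbit A act N"
  using mono[OF b(1) bN[symmetric] N] mono[OF a M] by blast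
qed

lemma mset_image_nth:
 assumes "bij_betw p {..<n} {..<n}" "length xs = n" "length ys = n"
  and "\<And>i. i < n \<Longrightarrow> g (ys ! p i) = f (xs ! i)"
 shows "mset (map g ys) = mset (map f xs)"
proof -
 have m: "mset (map h zs) = image_mset (\<lambda>i. h (zs ! i)) (mset_set {..<n})" if "length zs = n" for h zs
 proof -
  have "map h zs = map (\<lambda>i. h (zs ! i)) [0..<n]" using that by (simp add: list_eq_iff_nth_eq)
  then show ?thesis by (simp add: mset_set_upto_eq_mset_upto)
 qed
 have "mset (map g ys) = image_mset (\<lambda>i. g (ys ! i)) (mset_set (p ` {..<n}))"
  using m assms bij_betw_imp_surj_on by metis
 also have "\<dots> = image_mset (\<lambda>i. g (ys ! p i)) (mset_set {..<n})"
  using bij_betw_imp_inj_on[OF assms(1)] by (simp add: image_mset_mset_set[symmetric] image_mset.compositionality o_def)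
 also have "\<dots> = image_mset (\<lambda>i. f (xs ! i)) (mset_set {..<n})"
  by (rule image_mset_cong) (use assms(4) in auto)
 finally show ?thesis using m assms by metis
qed

lemma mset_map_eq_bij:
 assumes "mset (map f xs) = mset (map g ys)"
 obtains w where "bij_betw w {..<length xs} {..<length xs}"
  "\<And>i. i < length xs \<Longrightarrow> f (xs ! i) = g (ys ! w i)"
proof -
 obtain p where p: "p permutes {..<length ys}" "permute_list p (map g ys) = map f xs"
  using mset_eq_permutation[OF assms] by auto
 have len: "length xs = length ys" using mset_eq_length[OF assms] by simp
 have "f (xs ! i) = g (ys ! p i)" if i: "i < length xs" for i
 proof -
  have pi: "p i < length ys" using permutes_in_image[OF p(1), of i] i len by simp
  have "map f xs ! i = permute_list p (map g ys) ! i" using p by simp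
  also have "\<dots> = map g ys ! p i" using p(1) i len by (intro permute_list_nth) auto
  finally show ?thesis using i pi by simp
 qed
 then show thesis using that permutes_imp_bij[OF p(1)] len by metis
qed

lemma length_filter_bij:
 assumes "bij_betw p {..<n} {..<n}" "length xs = n" "length ys = n"
  and "\<And>i. i < n \<Longrightarrow> P (xs ! i) \<longleftrightarrow> Q (ys ! p i)"
 shows "length (filter P xs) = length (filter Q ys)"
proof -
 have "bij_betw p {i. i < n \<and> P (xs ! i)} {i. i < n \<and> Q (ys ! i)}"
 proof (rule bij_betw_subset[OF assms(1)])
  show "p ` {i. i < n \<and> P (xs ! i)} = {i. i < n \<and> Q (ys ! i)}"
  proof (intro equalityI subsetI)
   fix j assume j: "j \<in> {i. i < n \<and> Q (ys ! i)}"
   then have "j \<in> p ` {..<n}" using bij_betw_imp_surj_on[OF assms(1)] by simp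
   then show "j \<in> p ` {i. i < n \<and> P (xs ! i)}" using assms(4) j by auto
  qed (use assms(4) bij_betwE[OF assms(1)] in auto)
 qed auto
 then show ?thesis using bij_betw_same_card assms by (fastforce simp: length_filter_conv_card)
qed

lemma count_mset_map: "count (mset (map f xs)) a = length (filter (\<lambda>x. f x = a) xs)"
 by (induction xs) auto

lemma length_filter_split:
 assumes "\<And>x. x \<in> set xs \<Longrightarrow> f x = v \<longleftrightarrow> P x \<or> N x" "\<And>x. x \<in> set xs \<Longrightarrow> \<not> (P x \<and> N x)"
 shows "length (filter (\<lambda>x. f x = v) xs) = length (filter P xs) + length (filter N xs)"
 using assms by (induction xs) auto

lemma length_filter_class:
 assumes "\<And>x. x \<in> set xs \<Longrightarrow> P x \<Longrightarrow> f x = v0"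
 shows "length (filter (\<lambda>x. f x = v \<and> P x) xs) = (if v = v0 then length (filter P xs) else 0)"
 using assms by (induction xs) auto

lemma length_filter_cases:
 "length (filter (\<lambda>x. f x = v) xs) = length (filter (\<lambda>x. f x = v \<and> P x) xs) + length (filter (\<lambda>x. f x = v \<and> \<not> P x) xs)"
 by (induction xs) auto

text \<open>If the class \<open>v0\<close> carries a sign and the two lists have the same unsigned difference of
 numbers of signs, then one of the two ways of comparing signs matches the lists completely.\<close>

lemma sign_matching:
 fixes u :: "'a \<Rightarrow> 'v" and u' :: "'c \<Rightarrow> 'v"
 assumes key: "mset (map u xs) = mset (map u' ys)"
  and P: "\<And>x. x \<in> set xs \<Longrightarrow> u x = v0 \<longleftrightarrow> P x \<or> N x" "\<And>x. x \<in> set xs \<Longrightarrow> \<not> (P x \<and> N x)"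
  and P': "\<And>x. x \<in> set ys \<Longrightarrow> u' x = v0 \<longleftrightarrow> P' x \<or> N' x" "\<And>x. x \<in> set ys \<Longrightarrow> \<not> (P' x \<and> N' x)"
  and sig: "\<bar>int (length (filter P xs)) - int (length (filter N xs))\<bar> =
       \<bar>int (length (filter P' ys)) - int (length (filter N' ys))\<bar>"
 obtains b p where "bij_betw p {..<length xs} {..<length xs}"
  "\<And>i. i < length xs \<Longrightarrow> u (xs ! i) = u' (ys ! p i)"
  "\<And>i. i < length xs \<Longrightarrow> P (xs ! i) \<longleftrightarrow> (if b then P' else N') (ys ! p i)"
proof -
 have c: "length (filter (\<lambda>x. u x = v) xs) = length (filter (\<lambda>x. u' x = v) ys)" for v
  using arg_cong[OF key, of "\<lambda>M. count M v"] by (simp only: count_mset_map)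
 have tot: "length (filter P xs) + length (filter N xs) = length (filter P' ys) + length (filter N' ys)"
  using length_filter_split[of xs u v0 P N, OF P] length_filter_split[of ys u' v0 P' N', OF P'] c[of v0] by simp
 \<comment> \<open>The totals in class \<open>v0\<close> agree, so equality of the unsigned
   differences leaves two options: as many \<open>P\<close> as \<open>P'\<close>, or as many
   \<open>P\<close> as \<open>N'\<close>.\<close>
 define b where "b \<longleftrightarrow> length (filter P xs) = length (filter P' ys)"
 define Q where "Q = (if b then P' else N')"
 have Q: "length (filter P xs) = length (filter Q ys)" using sig tot by (auto simp: Q_def b_def)
 have Qv: "Q x \<Longrightarrow> x \<in> set ys \<Longrightarrow> u' x = v0" for x using P'(1) by (auto simp: Q_def split: if_splits)
 \<comment> \<open>Refining the key by the sign keeps the multisets equal, since the sign varies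
   only within class \<open>v0\<close>.\<close>
 have "mset (map (\<lambda>x. (u x, P x)) xs) = mset (map (\<lambda>x. (u' x, Q x)) ys)"
 proof (rule multiset_eqI)
  fix vb :: "'v \<times> bool"
  obtain v t where vb: "vb = (v, t)" by fastforce
  have 1: "length (filter (\<lambda>x. u x = v \<and> P x) xs) = length (filter (\<lambda>x. u' x = v \<and> Q x) ys)"
   using length_filter_class[of xs P u v0 v] length_filter_class[of ys Q u' v0 v] P(1) Qv Q by auto
  have 2: "length (filter (\<lambda>x. u x = v \<and> \<not> P x) xs) = length (filter (\<lambda>x. u' x = v \<and> \<not> Q x) ys)"
   using length_filter_cases[of u v xs P] length_filter_cases[of u' v ys Q] 1 c[of v] by auto
  show "count (mset (map (\<lambda>x. (u x, P x)) xs)) vb = count (mset (map (\<lambda>x. (u' x, Q x)) ys)) vb"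
   unfolding count_mset_map vb using 1 2 by (cases t) auto
 qed
 then obtain p where "bij_betw p {..<length xs} {..<length xs}"
  "\<And>i. i < length xs \<Longrightarrow> (u (xs ! i), P (xs ! i)) = (u' (ys ! p i), Q (ys ! p i))"
  by (rule mset_map_eq_bij) blast
 then show thesis using that[of p b] by (simp add: Q_def)
qed

section \<open>Hermitian norms as positive elements\<close>

context gr_div_inv
begin

text \<open>The elements congruent to 1. Under the positivity convention this is the common meaning
  of counting for the positive part of the signature: with real neutral component the norms are
  exactly the positive reals.\<close>

definition norm_form :: "'d \<Rightarrow> bool" where
 "norm_form d \<longleftrightarrow> (\<exists>u e. hunit u e \<and> d = e * \<phi> e)"

lemma norm_formI: "hunit u e \<Longrightarrow> norm_form (e * \<phi> e)"
 by (auto simp: norm_form_def)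

lemma norm_form_scale: "norm_form d \<Longrightarrow> r > 0 \<Longrightarrow> norm_form (r *\<^sub>R d)"
proof -
 assume "norm_form d" and r: "r > 0"
 then obtain u e where e: "hunit u e" "d = e * \<phi> e" by (auto simp: norm_form_def)
 have "r *\<^sub>R d = (sqrt r *\<^sub>R e) * \<phi> (sqrt r *\<^sub>R e)" using r by (simp add: e phi_scale)
 then show ?thesis using norm_formI[OF hunit_scale[OF e(1), of "sqrt r"]] r by simp
qed

lemma pow2: "t \<in> TT \<Longrightarrow> t [^] (2::nat) = t \<otimes> t"
 by (simp add: numeral_2_eq_2)

lemma power_part_2_iff: "t \<in> P2 \<longleftrightarrow> (\<exists>s\<in>TT. t = s \<otimes> s)"
 unfolding power_part_def mem_Collect_eq using pow2 by metis

lemma norm_form_deg: "norm_form d \<Longrightarrow> hunit t d \<Longrightarrow> t \<in> P2"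
proof -
 assume "norm_form d" "hunit t d"
 then obtain u e where e: "hunit u e" "d = e * \<phi> e" by (auto simp: norm_form_def)
 then have "t = u \<otimes> u" using hunit_mult[OF e(1) hunit_phi[OF e(1)]] hunit_unique \<open>hunit t d\<close> by metis
 then show ?thesis using e(1) by (auto simp: power_part_2_iff hunit_def)
qed

lemma P2_subgroup: "subgroup (P2) T"
proof (rule subgroupI)
 show "P2 \<subseteq> TT" by (auto simp: power_part_2_iff)
 show "P2 \<noteq> {}" using power_part_2_iff[of "\<one> \<otimes> \<one>"] by blast
 show "inv a \<in> P2" if "a \<in> P2" for a
  using that by (auto simp: power_part_2_iff inv_mult_group)
 show "a \<otimes> b \<in> P2" if ab: "a \<in> P2" "b \<in> P2" for a b
 proof -
  obtain s t where st: "s \<in> TT" "t \<in> TT" "a = s \<otimes> s" "b = t \<otimes> t" using ab by (auto simp: power_part_2_iff)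
  then have "a \<otimes> b = (s \<otimes> t) \<otimes> (s \<otimes> t)" by (simp add: m_ac)
  then show ?thesis using st by (auto simp: power_part_2_iff)
 qed
qed

text \<open>The ratio of two homogeneous elements of the same degree that are both symmetric, or both skew,
 is a symmetric element of \<open>D \<one>\<close>, hence real.\<close>

lemma same_sign_ratio:
 assumes "hunit t x" "hunit t y" "\<phi> x = c *\<^sub>R x" "\<phi> y = c *\<^sub>R y" "c \<noteq> 0"
 obtains r where "r \<noteq> 0" "y = r *\<^sub>R x"
proof -
 obtain l where l: "hunit \<one> l" "y = l * x" using ratio_unit[OF assms(1,2)] by blast
 have "c *\<^sub>R (l * x) = \<phi> (l * x)" using assms(4) unfolding l(2) by simp
 also have "\<dots> = c *\<^sub>R (x * \<phi> l)" by (simp only: phi_mult assms(3) mult_scaleR_left)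
 also have "x * \<phi> l = \<phi> l * x" by (rule hunit_central[OF hunit_phi[OF l(1)], symmetric])
 finally have "c *\<^sub>R (l * x) = c *\<^sub>R (\<phi> l * x)" .
 then have "l * x = \<phi> l * x" using assms(5) by simp
 then have "\<phi> l = l" unfolding hunit_cancel[OF assms(1)] by simp
 then obtain r where "r \<noteq> 0" "l = of_real r" using center_phi_hom(2)[of \<one> l] De_center l(1) by (auto simp: hunit_def)
 then show thesis using that l by (simp add: scaleR_conv_of_real)
qed

text \<open>A square degree contains a norm, and symmetric elements of one degree are real multiples
  of each other.\<close>

lemma symmetric_square_degree:
 assumes d: "hunit t d" "\<phi> d = d" and t: "t \<in> P2"
 shows "norm_form d \<or> norm_form (- d)"
proof -
 obtain s where s: "s \<in> TT" "t = s \<otimes> s" using t power_part_2_iff by blast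
 obtain e where e: "hunit s e" using ex_hunit s by blast
 have n: "hunit t (e * \<phi> e)" using hunit_mult[OF e hunit_phi[OF e]] s by simp
 obtain r where r: "r \<noteq> 0" "d = r *\<^sub>R (e * \<phi> e)"
  using same_sign_ratio[OF n d(1), of 1] d(2) by (auto simp: phi_mult)
 show ?thesis
 proof (cases "r > 0")
  case True
  then show ?thesis using norm_form_scale[OF norm_formI[OF e]] r by simp
 next
  case False
  then show ?thesis using norm_form_scale[OF norm_formI[OF e], of "- r"] r by simp
 qed
qed

text \<open>With \<open>y = h e\<close> and \<open>v = g * \<phi> g\<close> the twisting relation
  gives \<open>v * h d = (y * g) * \<phi> (y * g)\<close>, again a norm, and congruence by
  \<open>c\<close> preserves norms.\<close>

lemma norm_form_transfer:
 assumes aut: "gr_aut h" and tw: "twists h v" and v: "norm_form v" and lk: "linked h v d d'" and d: "norm_form d"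
 shows "norm_form d'"
proof -
 obtain s e where e: "hunit s e" "d = e * \<phi> e" using d by (auto simp: norm_form_def)
 obtain w g where g: "hunit w g" "v = g * \<phi> g" using v by (auto simp: norm_form_def)
 obtain u c where c: "hunit u c" "\<phi> c * d' * c = v * h d" using lk by (auto simp: linked_def)
 obtain uv where uv: "hunit uv v" using tw by (auto simp: twists_def)
 have twist: "v * h (\<phi> x) = \<phi> (h x) * v" for x using tw by (simp add: twists_def)
 let ?y = "h e"
 have y: "hunit (aut_deg h s) ?y" by (rule aut_hunit[OF aut e(1)])
 obtain l where l: "hunit \<one> l" "\<phi> ?y = l * ?y" using ratio_unit[OF y hunit_phi[OF y]] by blast
 obtain b where b: "hunit \<one> b" "v * ?y = b * (?y * v)" using commutator[OF uv y] by blast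
 \<comment> \<open>\<open>b\<close> moves \<open>v\<close> to the right of \<open>?y\<close>, the
   twisting relation turns \<open>h (\<phi> e)\<close> into \<open>\<phi> ?y\<close>, and the same
   \<open>b\<close> brings \<open>v\<close> back between \<open>?y\<close> and
   \<open>\<phi> ?y\<close>. Writing \<open>\<phi> ?y\<close> as \<open>l * ?y\<close> makes this
   last exchange possible.\<close>
 have "v * (?y * h (\<phi> e)) = b * (?y * (v * h (\<phi> e)))" using b(2) by (metis mult.assoc)
 also have "\<dots> = b * (?y * (l * ?y * v))" unfolding twist l(2) ..
 also have "\<dots> = b * (l * (?y * (?y * v)))" using hunit_central[OF l(1), of ?y] by (metis mult.assoc)
 also have "\<dots> = l * (?y * (b * (?y * v)))" using hunit_central[OF b(1)] by (metis mult.assoc)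
 also have "\<dots> = ?y * v * \<phi> ?y" unfolding b(2)[symmetric] l(2) using hunit_central[OF l(1)] by (metis mult.assoc)
 finally have "v * h d = (?y * g) * \<phi> (?y * g)"
  by (simp add: e(2) aut_mult[OF aut] phi_mult g(2) mult.assoc)
 moreover have yg: "hunit (aut_deg h s \<otimes> w) (?y * g)" by (rule hunit_mult[OF y g(1)])
 ultimately have "\<phi> c * d' * c = (?y * g) * \<phi> (?y * g)" using c(2) by simp
 then have "hinv (\<phi> c) * (\<phi> c * d' * c) * hinv c = hinv (\<phi> c) * ((?y * g) * \<phi> (?y * g)) * hinv c" by simp
 then have "d' = (hinv (\<phi> c) * (?y * g)) * (\<phi> (?y * g) * hinv c)"
  by (simp add: mult.assoc hunit_inv2[OF hunit_phi[OF c(1)]] hunit_inv[OF c(1)])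
 also have "\<phi> (?y * g) * hinv c = \<phi> (hinv (\<phi> c) * (?y * g))"
  using phi_hinv[OF hunit_phi[OF c(1)]] by (simp add: phi_mult)
 finally show ?thesis using norm_formI[OF hunit_mult[OF hunit_hinv[OF hunit_phi[OF c(1)]] yg]] by metis
qed

lemma linked_neg: "gr_aut h \<Longrightarrow> linked h (- v) d d' \<longleftrightarrow> linked h v d (- d')"
 "gr_aut h \<Longrightarrow> linked h v (- d) d' \<longleftrightarrow> linked h v d (- d')"
proof -
 assume aut: "gr_aut h"
 have *: "a = - b \<longleftrightarrow> - a = b" for a b :: 'd by auto
 show "linked h (- v) d d' \<longleftrightarrow> linked h v d (- d')" "linked h v (- d) d' \<longleftrightarrow> linked h v d (- d')"
  unfolding linked_def by (simp_all add: aut_neg[OF aut] *)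
qed

lemma twists_neg: "gr_aut h \<Longrightarrow> twists h v \<Longrightarrow> twists h (- v)"
 by (auto simp: twists_def intro: hunit_neg)

text \<open>\<phi> preserves degrees, so congruence by an element of degree \<open>r\<close> changes
  a degree by the square of \<open>r\<close>.\<close>

lemma linked_degree:
 assumes aut: "gr_aut h" and v: "hunit u v" and lk: "linked h v d d'" and d: "hunit t d" "hunit t' d'"
 obtains r where "r \<in> TT" "r \<otimes> r \<otimes> t' = u \<otimes> aut_deg h t"
proof -
 obtain r c where c: "hunit r c" "\<phi> c * d' * c = v * h d" using lk by (auto simp: linked_def)
 have "hunit (r \<otimes> t' \<otimes> r) (v * h d)" unfolding c(2)[symmetric] by (intro hunit_mult hunit_phi c d)
 then have "u \<otimes> aut_deg h t = r \<otimes> t' \<otimes> r" using hunit_unique[OF hunit_mult[OF v aut_hunit[OF aut d(1)]]] by simp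
 then show thesis using that[of r] c(1) d(2) by (simp add: hunit_def m_ac)
qed

end

section \<open>Consequences of the positivity convention\<close>

locale positive_inv = gr_div_inv T D \<phi> for T :: "'t monoid" (structure) and D :: "'t \<Rightarrow> 'd::real_algebra_1 set" and \<phi> +
 assumes positive: "\<And>t x. hunit t x \<Longrightarrow> t \<otimes> t = \<one> \<Longrightarrow> \<exists>r>0. x * \<phi> x = of_real r"
begin

text \<open>If \<open>e * \<phi> e\<close> is the negative of \<open>g * \<phi> g\<close>, then
  \<open>x = hinv e * g\<close> has degree of order at most 2 and \<open>x * \<phi> x = -1\<close>,
  against positivity.\<close>

lemma norm_form_exclusive: "norm_form d \<Longrightarrow> \<not> norm_form (- d)"
proof
 assume "norm_form d" "norm_form (- d)"
 then obtain u e w g where e: "hunit u e" "d = e * \<phi> e" and g: "hunit w g" "- d = g * \<phi> g"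
  by (auto simp: norm_form_def)
 have uw: "u \<otimes> u = w \<otimes> w"
  using hunit_unique[OF hunit_mult[OF g(1) hunit_phi[OF g(1)]]] hunit_neg[OF hunit_mult[OF e(1) hunit_phi[OF e(1)]]] e(2) g(2)
  by metis
 have cl: "u \<in> TT" "w \<in> TT" using e g by (auto simp: hunit_def)
 let ?x = "hinv e * g"
 have x: "hunit (inv u \<otimes> w) ?x" by (intro hunit_mult hunit_hinv e g)
 have "(inv u \<otimes> w) \<otimes> (inv u \<otimes> w) = inv (u \<otimes> u) \<otimes> (w \<otimes> w)" using cl by (simp add: m_ac inv_mult_group)
 then have "(inv u \<otimes> w) \<otimes> (inv u \<otimes> w) = \<one>" using uw cl by simp
 then obtain r where r: "r > 0" "?x * \<phi> ?x = of_real r" using positive[OF x] by blast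
 have "?x * \<phi> ?x = hinv e * (g * \<phi> g) * hinv (\<phi> e)" by (simp add: phi_mult phi_hinv[OF e(1)] mult.assoc)
 also have "\<dots> = - (hinv e * (e * \<phi> e) * hinv (\<phi> e))" using e(2) g(2)[symmetric] by simp
 also have "\<dots> = of_real (-1)" by (simp add: mult.assoc hunit_inv[OF e(1)] hunit_inv[OF hunit_phi[OF e(1)]])
 finally have "r = -1" using r(2) of_real_eq_iff by metis
 then show False using r(1) by simp
qed

lemma norm_form_real:
 assumes d: "hunit t d" "norm_form d" and t: "t = \<one>" and sq: "\<And>t. t \<in> TT \<Longrightarrow> t \<otimes> t = \<one>"
 shows "pos_real d"
proof -
 obtain u e where e: "hunit u e" "d = e * \<phi> e" using d by (auto simp: norm_form_def)
 then show ?thesis using positive[OF e(1)] sq by (auto simp: pos_real_def hunit_def)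
qed

lemma pos_real_norm_form: "pos_real d \<Longrightarrow> norm_form d"
proof -
 assume "pos_real d"
 then obtain r where "r > 0" "d = r *\<^sub>R (1 * \<phi> 1)" by (auto simp: pos_real_def of_real_def)
 then show ?thesis using norm_form_scale[OF norm_formI[OF hunit_1]] by simp
qed

lemma neg_real_iff: "neg_real d \<longleftrightarrow> pos_real (- d)"
proof
 assume "neg_real d"
 then obtain r where "r < 0" "d = of_real r" by (auto simp: neg_real_def)
 then show "pos_real (- d)" by (auto simp: pos_real_def intro!: exI[of _ "- r"])
next
 assume "pos_real (- d)"
 then obtain r where "r > 0" "- d = of_real r" by (auto simp: pos_real_def)
 then have "- r < 0 \<and> d = of_real (- r)" by (metis minus_minus neg_less_0_iff_less of_real_minus)
 then show "neg_real d" unfolding neg_real_def by blast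
qed

text \<open>Solving \<open>c * d * \<phi> c = r\<close> for \<open>d\<close> gives \<open>r\<close>
  times the norm of \<open>hinv c\<close>. Conversely a norm of \<open>e\<close> is normalised by
  \<open>c = hinv e\<close>, which has the degree that \<open>counts_as\<close> asks for.\<close>

lemma counts_as_iff:
 assumes d: "hunit t d"
 shows "counts_as T D \<phi> pos_real d \<longleftrightarrow> norm_form d" "counts_as T D \<phi> neg_real d \<longleftrightarrow> norm_form (- d)"
proof -
 have td: "deg d = t" by (rule gr_deg_eq[OF d])
 have pos: "norm_form x" if sc: "s \<in> TT" "c \<in> D s" "c \<noteq> 0" "pos_real (c * x * \<phi> c)" for s c x
 proof -
  have c: "hunit s c" using sc by (simp add: hunit_def)
  obtain r where r: "r > 0" "c * x * \<phi> c = of_real r" using sc by (auto simp: pos_real_def)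
  have "hinv c * (c * x * \<phi> c) * hinv (\<phi> c) = hinv c * of_real r * hinv (\<phi> c)" using r by simp
  then have "x = r *\<^sub>R (hinv c * \<phi> (hinv c))"
   by (simp add: mult.assoc hunit_inv2[OF c] hunit_inv[OF hunit_phi[OF c]] phi_hinv[OF c] of_real_def)
  then show ?thesis using norm_form_scale[OF norm_formI[OF hunit_hinv[OF c]] r(1)] by simp
 qed
 have neg: "t \<in> P2 \<and> (\<exists>s\<in>TT. s \<otimes> s = inv t \<and> (\<exists>c\<in>D s. c \<noteq> 0 \<and> pos_real (c * x * \<phi> c)))"
  if x: "norm_form x" "hunit t x" for x
 proof -
  obtain u e where e: "hunit u e" "x = e * \<phi> e" using x by (auto simp: norm_form_def)
  have u: "u \<in> TT" using e by (simp add: hunit_def)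
  have "hunit (u \<otimes> u) x" using hunit_mult[OF e(1) hunit_phi[OF e(1)]] e(2) by simp
  then have t: "t = u \<otimes> u" using hunit_unique x(2) by blast
  have "hinv e * x * \<phi> (hinv e) = of_real 1"
   by (simp add: e(2) phi_hinv[OF e(1)] mult.assoc hunit_inv2[OF e(1)] hunit_inv[OF hunit_phi[OF e(1)]])
  then have "pos_real (hinv e * x * \<phi> (hinv e))" unfolding pos_real_def by (intro exI[of _ 1]) simp
  moreover have "inv u \<otimes> inv u = inv t" using u t by (simp add: inv_mult_group)
  ultimately show ?thesis
   using hunit_hinv[OF e(1)] norm_form_deg[OF x] by (auto simp: hunit_def intro!: bexI[of _ "inv u"])
 qed
 show "counts_as T D \<phi> pos_real d \<longleftrightarrow> norm_form d"
  unfolding counts_as_def td using pos neg[OF _ d] by blast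
 show "counts_as T D \<phi> neg_real d \<longleftrightarrow> norm_form (- d)"
  unfolding counts_as_def td neg_real_iff using pos[of _ _ "- d"] neg[OF _ hunit_neg[OF d]] by auto
qed

text \<open>Write \<open>w\<close> as the degree of \<open>y = h x\<close>, where \<open>x\<close>
  also has degree of order at most 2. Both \<open>x * \<phi> x\<close> and
  \<open>y * \<phi> y\<close> are positive, and by the twisting relation \<beta> of \<open>w\<close>
  and \<open>u\<close> is their quotient. A positive real with square 1 is 1.\<close>

lemma twist_orthogonal:
 assumes aut: "gr_aut h" and tw: "twists h v" and v: "hunit u v" and w: "w \<in> TT" "w \<otimes> w = \<one>"
 shows "\<beta> u w = 1"
proof -
 obtain s where s: "s \<in> TT" "aut_deg h s = w" using aut_deg_bij[OF aut] w(1) by (metis bij_betw_imp_surj_on imageE)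
 have "aut_deg h (s \<otimes> s) = aut_deg h \<one>" using s w aut_deg_mult[OF aut s(1) s(1)] aut_deg_one[OF aut] by simp
 then have ss: "s \<otimes> s = \<one>" using aut_deg_inj[OF aut] s(1) by (auto simp: inj_on_def)
 obtain x where x: "hunit s x" using ex_hunit[OF s(1)] by blast
 let ?y = "h x"
 have y: "hunit w ?y" using aut_hunit[OF aut x] s by simp
 obtain r where r: "r > 0" "x * \<phi> x = of_real r" using positive[OF x ss] by blast
 obtain r' where r': "r' > 0" "?y * \<phi> ?y = of_real r'" using positive[OF y w(2)] by blast
 have uc: "u \<in> TT" using v by (simp add: hunit_def)
 have "\<beta> w u * (v * of_real r) = \<beta> w u * (v * (?y * h (\<phi> x)))"
  using r(2) aut_mult[OF aut, of x "\<phi> x"] aut_of_real[OF aut] by simp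
 also have "\<dots> = (\<beta> w u * (v * ?y)) * h (\<phi> x)" by (simp add: mult.assoc)
 also have "\<dots> = ?y * (v * h (\<phi> x))" unfolding beta_commute[OF y v, symmetric] by (rule mult.assoc)
 also have "\<dots> = (?y * \<phi> ?y) * v" using tw by (simp add: twists_def mult.assoc)
 also have "\<dots> = of_real r' * v" using r' by simp
 finally have "(of_real r * \<beta> w u) * v = of_real r' * v" by (simp add: of_real_def)
 then have "of_real r * \<beta> w u = of_real r'" unfolding hunit_cancel[OF v] .
 then have "of_real (1/r) * (of_real r * \<beta> w u) = of_real (1/r) * of_real r'" by simp
 then have b: "\<beta> w u = of_real (r' / r)" using r(1) by (simp add: mult.assoc[symmetric] flip: of_real_mult)
 have "\<beta> w u * \<beta> w u = 1" using beta_mult_left[OF w(1) w(1) uc] w uc by simp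
 then have "(r' / r) * (r' / r) = 1" unfolding b by (metis of_real_1 of_real_eq_iff of_real_mult)
 then have "r' / r = 1 \<or> r' / r = -1" by (simp only: square_eq_1_iff)
 moreover have "r' / r > 0" using r(1) r'(1) by simp
 ultimately have "r' / r = 1" by linarith
 then have "\<beta> w u = 1" using b by simp
 then show ?thesis using beta_swap_eq[OF w(1) uc] hinv_eqI[of 1 1] by simp
qed

end

section \<open>Signatures and the matching of diagonal entries\<close>

context gr_div_inv
begin

lemma equivalent_iff:
 assumes "adm q s ds e" "adm q' s' ds' e'"
 shows "M_equiv q s ds e q' s' ds' e' \<longleftrightarrow> q = q' \<and> s = s' \<and>
   (\<exists>h v p. gr_aut h \<and> twists h v \<and> \<phi> v = (e * e') *\<^sub>R v \<and>
    bij_betw p {..<q} {..<q} \<and> (\<forall>i<q. linked h v (ds ! i) (ds' ! p i)))"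
proof -
 interpret I: M_iso T D \<phi> q s ds e q' s' ds' e'
  by unfold_locales (use assms in auto)
 show ?thesis by (rule I.equivalent_iff_linked)
qed

lemma admissible_facts:
 assumes "adm q s ds e"
 shows "length ds = q" "e = 1 \<or> e = -1" "d \<in> set ds \<Longrightarrow> hunit (deg d) d" "d \<in> set ds \<Longrightarrow> \<phi> d = e *\<^sub>R d"
  "K \<noteq> range of_real \<Longrightarrow> e = 1"
proof -
 interpret A: M_params T D \<phi> q s ds e by unfold_locales (use assms in auto)
 show "length ds = q" "e = 1 \<or> e = -1" "d \<in> set ds \<Longrightarrow> hunit (deg d) d" "d \<in> set ds \<Longrightarrow> \<phi> d = e *\<^sub>R d"
  using A.len A.delta A.hunit_ds A.phi_ds by auto
 show "K \<noteq> range of_real \<Longrightarrow> e = 1" using assms by (simp add: admissible_def)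
qed

lemma aut_power_part:
 assumes aut: "gr_aut h" and t: "t \<in> TT"
 shows "aut_deg h t \<in> P2 \<longleftrightarrow> t \<in> P2"
proof
 assume "aut_deg h t \<in> P2"
 then obtain s where s: "s \<in> TT" "aut_deg h t = s \<otimes> s" using power_part_2_iff by blast
 obtain r where r: "r \<in> TT" "s = aut_deg h r" using aut_deg_bij[OF aut] s(1) by (metis bij_betw_imp_surj_on imageE)
 have "aut_deg h t = aut_deg h (r \<otimes> r)" using s(2) r aut_deg_mult[OF aut r(1) r(1)] by simp
 then have "t = r \<otimes> r" using aut_deg_inj[OF aut] t r(1) by (auto simp: inj_on_def)
 then show "t \<in> P2" using r(1) power_part_2_iff by blast
next
 assume "t \<in> P2"
 then obtain s where s: "s \<in> TT" "t = s \<otimes> s" using power_part_2_iff by blast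
 show "aut_deg h t \<in> P2"
  unfolding power_part_2_iff s(2) aut_deg_mult[OF aut s(1) s(1)]
  by (rule bexI[OF refl aut_deg_closed[OF aut s(1)]])
qed

end

context positive_inv
begin

lemma norm_form_1: "norm_form 1"
 using norm_formI[OF hunit_1] by simp

text \<open>One direction is \<open>norm_form_transfer\<close>. For the other, a norm
  \<open>d'\<close> has square degree, hence so has \<open>d\<close>, and \<open>d\<close> or
  \<open>- d\<close> is a norm; it is not \<open>- d\<close>, since that would make
  \<open>- d'\<close> a norm as well.\<close>

lemma norm_form_linked_iff:
 assumes aut: "gr_aut h" and tw: "twists h v" and v: "norm_form v" and lk: "linked h v d d'"
  and d: "hunit t d" "\<phi> d = d" and d': "hunit t' d'"
 shows "norm_form d \<longleftrightarrow> norm_form d'"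
proof
 assume "norm_form d" then show "norm_form d'" using norm_form_transfer[OF aut tw v lk] by blast
next
 assume n: "norm_form d'"
 obtain u where u: "hunit u v" using tw by (auto simp: twists_def)
 obtain r where r: "r \<in> TT" "r \<otimes> r \<otimes> t' = u \<otimes> aut_deg h t" by (rule linked_degree[OF aut u lk d(1) d'])
 have cl: "t \<in> TT" "t' \<in> TT" "u \<in> TT" "aut_deg h t \<in> TT"
  using d d' u aut_deg_closed[OF aut] by (auto simp: hunit_def)
 have P: "t' \<in> P2" "u \<in> P2" "r \<otimes> r \<in> P2"
  using norm_form_deg[OF n d'] norm_form_deg[OF v u] r power_part_2_iff by auto
 have "aut_deg h t = inv u \<otimes> (r \<otimes> r \<otimes> t')" unfolding r(2) using cl by (simp add: m_assoc[symmetric])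
 then have "aut_deg h t \<in> P2"
  using P subgroup.m_closed[OF P2_subgroup] subgroup.m_inv_closed[OF P2_subgroup] by simp
 then have "t \<in> P2" using aut_power_part[OF aut cl(1)] by simp
 then have "norm_form d \<or> norm_form (- d)" using symmetric_square_degree d by blast
 moreover have "\<not> norm_form (- d)"
 proof
  assume "norm_form (- d)"
  moreover have "linked h v (- d) (- d')" using lk linked_neg(2)[OF aut] by simp
  ultimately have "norm_form (- d')" using norm_form_transfer[OF aut tw v] by blast
  then show False using n norm_form_exclusive by blast
 qed
 ultimately show "norm_form d" by blast
qed

text \<open>The signature of all cases in uniform terms; \<open>signature_eq\<close> makes the
  connection.\<close>

definition sign_diff :: "'d list \<Rightarrow> int" where
 "sign_diff ds = \<bar>int (length (filter norm_form ds)) - int (length (filter (\<lambda>d. norm_form (- d)) ds))\<bar>"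

text \<open>If \<open>v\<close> is a norm, positive entries correspond to positive entries; if
  \<open>- v\<close> is a norm, the two signs are exchanged. The absolute value in the signature
  accounts for the second possibility.\<close>

lemma linked_sign_diff:
 assumes aut: "gr_aut h" and tw: "twists h v" and v: "norm_form v \<or> norm_form (- v)"
  and bij: "bij_betw p {..<q} {..<q}" and len: "length ds = q" "length ds' = q"
  and lk: "\<And>i. i < q \<Longrightarrow> linked h v (ds ! i) (ds' ! p i)"
  and d: "\<And>d. d \<in> set ds \<Longrightarrow> (\<exists>t. hunit t d) \<and> \<phi> d = d" and d': "\<And>d. d \<in> set ds' \<Longrightarrow> \<exists>t. hunit t d"
 shows "sign_diff ds = sign_diff ds'"
proof -
 have mem: "ds ! i \<in> set ds" "ds' ! p i \<in> set ds'" if "i < q" for i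
  using len that bij_betwE[OF bij] by auto
 have iff: "norm_form x \<longleftrightarrow> norm_form y"
  if "twists h w" "norm_form w" "linked h w x y" "\<exists>t. hunit t x" "\<phi> x = x" "\<exists>t. hunit t y" for w x y
  using norm_form_linked_iff[OF aut] that by blast
 have neg: "(\<exists>t. hunit t (- x)) \<longleftrightarrow> (\<exists>t. hunit t x)" for x
  using hunit_neg[of _ x] hunit_neg[of _ "- x"] by auto
 show ?thesis
 proof (cases "norm_form v")
  case True
  have "norm_form (ds ! i) \<longleftrightarrow> norm_form (ds' ! p i)" "norm_form (- ds ! i) \<longleftrightarrow> norm_form (- ds' ! p i)" if i: "i < q" for i
   using iff[OF tw True lk[OF i]] iff[OF tw True, of "- ds ! i" "- ds' ! p i"] lk[OF i] linked_neg(2)[OF aut, of v "ds ! i" "- ds' ! p i"]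
    d[OF mem(1)[OF i]] d'[OF mem(2)[OF i]] neg by (simp_all add: phi_neg)
  then show ?thesis unfolding sign_diff_def
   using length_filter_bij[OF bij len, of norm_form norm_form] length_filter_bij[OF bij len, of "\<lambda>d. norm_form (- d)" "\<lambda>d. norm_form (- d)"]
   by simp
 next
  case False
  then have nv: "norm_form (- v)" using v by blast
  note tw' = twists_neg[OF aut tw]
  have l': "linked h (- v) (ds ! i) (- ds' ! p i)" "linked h (- v) (- ds ! i) (ds' ! p i)" if i: "i < q" for i
   using lk[OF i] linked_neg[OF aut] by simp_all
  have "norm_form (ds ! i) \<longleftrightarrow> norm_form (- ds' ! p i)" "norm_form (- ds ! i) \<longleftrightarrow> norm_form (ds' ! p i)" if i: "i < q" for i
   using iff[OF tw' nv l'(1)[OF i]] iff[OF tw' nv l'(2)[OF i]]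
    d[OF mem(1)[OF i]] d'[OF mem(2)[OF i]] neg by (simp_all add: phi_neg)
  then show ?thesis unfolding sign_diff_def
   using length_filter_bij[OF bij len, of norm_form "\<lambda>d. norm_form (- d)"] length_filter_bij[OF bij len, of "\<lambda>d. norm_form (- d)" norm_form]
   by simp
 qed
qed

text \<open>The image of \<open>d\<close> and a congruent copy of \<open>d'\<close> have the same
  degree and the same symmetry, so they are real multiples of each other; a square root in the base
  change absorbs all of the factor but its sign.\<close>

lemma linked_up_to_sign:
 assumes aut: "gr_aut g" and comm: "\<And>x. g (\<phi> x) = \<phi> (g x)"
  and d: "hunit t d" "\<phi> d = e *\<^sub>R d" and d': "hunit t' d'" "\<phi> d' = e *\<^sub>R d'" and e: "e \<noteq> 0"
  and r: "r \<in> TT" "aut_deg g t = r \<otimes> r \<otimes> t'"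
 shows "linked g 1 d d' \<or> linked g (- 1) d d'"
proof -
 obtain c where c: "hunit r c" using ex_hunit r by blast
 have t': "t' \<in> TT" using d' by (simp add: hunit_def)
 have "r \<otimes> t' \<otimes> r = aut_deg g t" using r t' by (simp add: m_ac)
 then have h: "hunit (aut_deg g t) (\<phi> c * d' * c)"
  using hunit_mult[OF hunit_mult[OF hunit_phi[OF c] d'(1)] c] by simp
 have "\<phi> (\<phi> c * d' * c) = e *\<^sub>R (\<phi> c * d' * c)" by (simp add: phi_mult d' mult.assoc)
 moreover have "\<phi> (g d) = e *\<^sub>R g d" using comm[of d] d by (simp add: aut_scale[OF aut])
 ultimately obtain x where x: "x \<noteq> 0" "g d = x *\<^sub>R (\<phi> c * d' * c)"
  using same_sign_ratio[OF h aut_hunit[OF aut d(1)] _ _ e] by metis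
 define c' where "c' = sqrt \<bar>x\<bar> *\<^sub>R c"
 have c': "hunit r c'" using hunit_scale[OF c] x by (simp add: c'_def)
 have "\<phi> c' * d' * c' = \<bar>x\<bar> *\<^sub>R (\<phi> c * d' * c)" by (simp add: c'_def phi_scale)
 also have "\<dots> = (if x > 0 then 1 else - 1) * g d" using x by simp
 finally show ?thesis using c' unfolding linked_def by (cases "x > 0") auto
qed

text \<open>Multiply the base change by an element \<open>x\<close> of degree \<open>w\<close>,
  which anticommutes with \<open>h d\<close>. As \<open>\<phi> x * x\<close> is positive,
  \<open>\<phi> x * h d * x\<close> is a negative multiple of \<open>h d\<close>. Suitable
  \<open>w\<close> come from \<open>beta_minus\<close> and
  \<open>torsion_nontrivial\<close>.\<close>

lemma linked_flip:
 assumes aut: "gr_aut h" and lk: "linked h v d d'" and d: "hunit t d" and v: "\<And>x. v * x = x * v"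
  and w: "w \<in> TT" "w \<otimes> w = \<one>" "\<beta> w (aut_deg h t) = -1"
 shows "linked h (- v) d d'"
proof -
 obtain u c where c: "hunit u c" "\<phi> c * d' * c = v * h d" using lk by (auto simp: linked_def)
 obtain x where x: "hunit w x" using ex_hunit w by blast
 obtain r where r: "r > 0" "x * \<phi> x = of_real r" using positive[OF x w(2)] by blast
 have xx: "\<phi> x * x = of_real r"
  using D_comm[OF w(1), of x "\<phi> x"] x hunit_phi[OF x] r by (simp add: hunit_def)
 have "x * h d = - (h d * x)" using beta_commute[OF x aut_hunit[OF aut d]] w(3) by simp
 then have a: "h d * x = - (x * h d)" by simp
 define c' where "c' = (1 / sqrt r) *\<^sub>R (c * x)"
 have c': "hunit (u \<otimes> w) c'" unfolding c'_def by (intro hunit_scale hunit_mult c x) (use r in simp)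
 have "\<phi> c' * d' * c' = (1 / r) *\<^sub>R (\<phi> x * (\<phi> c * d' * c) * x)"
  using r by (simp add: c'_def phi_scale phi_mult mult.assoc)
 also have "\<phi> x * (\<phi> c * d' * c) * x = v * (\<phi> x * (h d * x))" unfolding c(2) using v by (metis mult.assoc)
 also have "\<dots> = - (v * (\<phi> x * x * h d))" unfolding a by (simp add: mult.assoc)
 also have "(1 / r) *\<^sub>R \<dots> = (- v) * h d" unfolding xx using r by (simp add: of_real_def)
 finally show ?thesis using c' unfolding linked_def by blast
qed

text \<open>Entries of nonsquare degree have no definite sign by \<open>linked_flip\<close>. Those
  of square degree are matched with their signs by \<open>sign_matching\<close>, either all
  preserved or all reversed, and \<open>v\<close> is 1 or -1 accordingly. In the skew case no entry
  has square degree, so there are no signs to match.\<close>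

lemma linked_matching:
 assumes aut: "gr_aut g" and comm: "\<And>x. g (\<phi> x) = \<phi> (g x)"
  and adm: "adm q s ds e" "adm q s ds' e"
  and key: "mset (map (\<lambda>d. P2 #> aut_deg g (deg d)) ds) =
       mset (map (\<lambda>d. P2 #> deg d) ds')"
  and flip: "\<And>d. d \<in> set ds \<Longrightarrow> deg d \<notin> P2 \<Longrightarrow>
    \<exists>w\<in>TT. w \<otimes> w = \<one> \<and> \<beta> w (aut_deg g (deg d)) = -1"
  and sig: "e = 1 \<Longrightarrow> sign_diff ds = sign_diff ds'"
  and skew: "\<And>d. e = -1 \<Longrightarrow> d \<in> set ds \<union> set ds' \<Longrightarrow> deg d \<notin> P2"
 shows "M_equiv q s ds e q s ds' e"
proof -
  note A = admissible_facts[OF adm(1)] and B = admissible_facts[OF adm(2)]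
 have h: "hunit (deg d) d" "\<phi> d = e *\<^sub>R d" "deg d \<in> TT" if "d \<in> set ds \<union> set ds'" for d
  using that A(3,4) B(3,4) by (auto simp: hunit_def)
 have cls: "deg d \<in> P2 \<longleftrightarrow> norm_form d \<or> norm_form (- d)" if d: "d \<in> set ds \<union> set ds'" for d
 proof (cases "e = 1")
  case True
  then show ?thesis
   using symmetric_square_degree[OF h(1)[OF d]] h(2)[OF d] norm_form_deg[OF _ h(1)[OF d]] norm_form_deg[OF _ hunit_neg[OF h(1)[OF d]]] by auto
 next
  case False
  then have "e = -1" using A(2) by simp
  then show ?thesis
   using skew[OF _ d] norm_form_deg[OF _ h(1)[OF d]] norm_form_deg[OF _ hunit_neg[OF h(1)[OF d]]] by blast
 qed
 have sig': "\<bar>int (length (filter norm_form ds)) - int (length (filter (\<lambda>d. norm_form (- d)) ds))\<bar> =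
       \<bar>int (length (filter norm_form ds')) - int (length (filter (\<lambda>d. norm_form (- d)) ds'))\<bar>"
 proof (cases "e = 1")
  case True
  then show ?thesis using sig by (simp add: sign_diff_def)
 next
  case False
  then have "e = -1" using A(2) by simp
  then have "\<not> norm_form d \<and> \<not> norm_form (- d)" if "d \<in> set ds \<union> set ds'" for d
   using cls[OF that] skew[OF _ that] by blast
  then have "filter norm_form ds = []" "filter (\<lambda>d. norm_form (- d)) ds = []"
   "filter norm_form ds' = []" "filter (\<lambda>d. norm_form (- d)) ds' = []" by (auto simp: filter_empty_conv)
  then show ?thesis by simp
 qed
 have k1: "P2 #> aut_deg g (deg d) = P2 \<longleftrightarrow> norm_form d \<or> norm_form (- d)" if "d \<in> set ds" for d
  using coset_eq_self[OF P2_subgroup, of "aut_deg g (deg d)"] cls[of d] that h(3)[of d]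
   aut_power_part[OF aut, of "deg d"] aut_deg_closed[OF aut] by auto
 have k2: "P2 #> deg d = P2 \<longleftrightarrow> norm_form d \<or> norm_form (- d)" if "d \<in> set ds'" for d
  using coset_eq_self[OF P2_subgroup, of "deg d"] cls[of d] that h(3)[of d] by auto
 obtain b p where p: "bij_betw p {..<length ds} {..<length ds}"
  "\<And>i. i < length ds \<Longrightarrow> P2 #> aut_deg g (deg (ds ! i)) = P2 #> deg (ds' ! p i)"
  "\<And>i. i < length ds \<Longrightarrow> norm_form (ds ! i) \<longleftrightarrow> (if b then norm_form else (\<lambda>d. norm_form (- d))) (ds' ! p i)"
  by (rule sign_matching[OF key k1 _ k2 _ sig']) (use norm_form_exclusive in auto)
 define v :: 'd where "v = (if b then 1 else - 1)"
 have tw1: "twists g 1" unfolding twists_def using comm by (auto intro!: exI[of _ \<one>])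
 have tw: "twists g v" using tw1 twists_neg[OF aut tw1] by (simp add: v_def)
 have "linked g v (ds ! i) (ds' ! p i)" if i: "i < q" for i
 proof -
  let ?d = "ds ! i" and ?d' = "ds' ! p i"
  have il: "i < length ds" using i A(1) by simp
  have pil: "p i < length ds'" using bij_betwE[OF p(1)] il A(1) B(1) by auto
  have m: "?d \<in> set ds" "?d' \<in> set ds'" using il pil by auto
  let ?t = "deg ?d" and ?t' = "deg ?d'"
  have cl: "?t \<in> TT" "?t' \<in> TT" "aut_deg g ?t \<in> TT" using h(3) m aut_deg_closed[OF aut] by auto
  have "aut_deg g ?t \<otimes> inv ?t' \<in> P2"
   using p(2)[OF il] coset_eq_iff[OF P2_subgroup cl(3,2)] by simp
  then obtain r where r: "r \<in> TT" "aut_deg g ?t \<otimes> inv ?t' = r \<otimes> r" using power_part_2_iff by blast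
  then have r': "aut_deg g ?t = r \<otimes> r \<otimes> ?t'" using cl by (metis inv_solve_right' m_closed)
  have dn: "e \<noteq> 0" using A(2) by auto
  have l1: "linked g 1 ?d ?d' \<or> linked g (- 1) ?d ?d'"
   by (rule linked_up_to_sign[OF aut comm _ _ _ _ dn r(1) r']) (use h m in auto)
  show ?thesis
  proof (cases "?t \<in> P2")
   case False
   then obtain w where w: "w \<in> TT" "w \<otimes> w = \<one>" "\<beta> w (aut_deg g ?t) = -1" using flip m by blast
   have hd: "hunit ?t ?d" using h m by auto
   have f: "linked g x ?d ?d' \<Longrightarrow> linked g (- x) ?d ?d'" if "x = 1 \<or> x = - 1" for x
    by (rule linked_flip[OF aut _ hd _ w]) (use that in auto)
   have "linked g 1 ?d ?d' \<and> linked g (- 1) ?d ?d'" using l1 f[of 1] f[of "- 1"] unfolding minus_minus by blast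
   then show ?thesis by (simp add: v_def)
  next
   case True
   then have "e \<noteq> -1" using skew m by blast
   then have e: "e = 1" using A(2) by simp
   have hd: "hunit ?t ?d" "\<phi> ?d = ?d" "hunit ?t' ?d'" using h m e by auto
   have "norm_form ?d \<or> norm_form (- ?d)" using cls[of ?d] True m by simp
   \<comment> \<open>For a square degree only one of the links with 1 and -1 can exist. The norms
     decide which, and the matching \<open>p\<close> was chosen to agree with this.\<close>
   have one: "linked g 1 ?d ?d' \<Longrightarrow> norm_form ?d \<longleftrightarrow> norm_form ?d'"
    using norm_form_linked_iff[OF aut tw1 norm_form_1 _ hd] by blast
   have mone: "linked g (- 1) ?d ?d' \<Longrightarrow> norm_form ?d \<longleftrightarrow> norm_form (- ?d')"
    using norm_form_linked_iff[OF aut tw1 norm_form_1 _ hd(1,2) hunit_neg[OF hd(3)]] linked_neg(1)[OF aut, of 1] by simp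
   have ex: "norm_form ?d' \<or> norm_form (- ?d')"
    using k2[OF m(2)] k1[OF m(1)] p(2)[OF il] \<open>norm_form ?d \<or> norm_form (- ?d)\<close> by simp
   show ?thesis
    using l1 one mone p(3)[OF il] ex norm_form_exclusive[of ?d'] by (auto simp: v_def split: if_splits)
  qed
 qed
 moreover have "\<phi> v = (e * e) *\<^sub>R v" using A(2) by (auto simp: v_def phi_neg)
 ultimately show ?thesis
  unfolding equivalent_iff[OF adm] using aut tw p(1) A(1) by auto
qed

text \<open>With real neutral component the only square degree is the neutral one, where norms are
  the positive reals; otherwise \<open>counts_as\<close> already describes norms.\<close>

lemma signature_eq:
 assumes ns: "\<not> iso_split_complex K"
  and d: "\<And>d. d \<in> set ds \<Longrightarrow> (\<exists>t. hunit t d)"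
  and neutral: "\<not> iso_complex (D \<one>) \<Longrightarrow> D \<one> = range of_real"
 shows "signature T D \<phi> 1 ds = Some (sign_diff ds)"
proof (cases "iso_complex (D \<one>)")
 case True
 have "filter (counts_as T D \<phi> pos_real) ds = filter norm_form ds"
  "filter (counts_as T D \<phi> neg_real) ds = filter (\<lambda>d. norm_form (- d)) ds"
  by (rule filter_cong; use counts_as_iff d in blast)+
 then show ?thesis using True ns by (simp add: signature_def signature_complex_def sign_diff_def)
next
 case False
 interpret R: real_neutral T D \<phi> by unfold_locales (rule neutral[OF False])
 have e: "pos_real x \<longleftrightarrow> norm_form x" if x: "hunit t x" for t x
 proof
  assume n: "norm_form x"
  have "t = \<one>" using norm_form_deg[OF n x] R.power_part_2 by simp
  then show "pos_real x" using norm_form_real[OF x n] R.T_sq by blast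
 qed (rule pos_real_norm_form)
 have "filter pos_real ds = filter norm_form ds" "filter neg_real ds = filter (\<lambda>d. norm_form (- d)) ds"
  unfolding neg_real_iff by (rule filter_cong[OF refl], use e d hunit_neg in blast)+
 then show ?thesis using False ns by (simp add: signature_def signature_real_def sign_diff_def)
qed

end

section \<open>Real neutral component\<close>

context gr_div_inv
begin

lemma coset_multiset_eq: "degs N ds = mset (map (\<lambda>d. N #> deg d) ds)"
 by (simp add: coset_multiset_def)

lemma coset_multiset_carrier:
 assumes "\<And>d. d \<in> set ds \<Longrightarrow> hunit (deg d) d"
 shows "set_mset (degs N ds) \<subseteq> carrier (T Mod N)"
proof -
 have "deg d \<in> TT" if "d \<in> set ds" for d using assms[OF that] by (simp add: hunit_def)
 then show ?thesis unfolding coset_multiset_eq subset_iff carrier_FactGroup by auto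
qed

lemma T_group: "group T" by (rule is_group)

text \<open>Shared by the cases in which the group consists of automorphisms of \<open>T\<close> and
  acts on cosets; in the other cases the group lives on the quotient itself.\<close>

lemma orbit_coset_action:
 assumes N: "subgroup N T"
  and A: "carrier A \<subseteq> carrier (AutoGroup T)" "(\<lambda>x\<in>TT. x) \<in> carrier A"
   "\<And>h g. h \<in> carrier A \<Longrightarrow> g \<in> carrier A \<Longrightarrow> compose TT h g \<in> carrier A"
   "\<And>h. h \<in> carrier A \<Longrightarrow> restrict (inv_into TT h) TT \<in> carrier A"
   "\<And>h. h \<in> carrier A \<Longrightarrow> h ` N = N"
  and d: "\<And>d. d \<in> set ds \<union> set ds' \<Longrightarrow> hunit (deg d) d"
 shows "multiset_orbit A coset_action (degs N ds) = multiset_orbit A coset_action (degs N ds') \<longleftrightarrow>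
   (\<exists>h\<in>carrier A. degs N ds' = mset (map (\<lambda>d. N #> h (deg d)) ds))"
proof -
 have hom: "h \<in> hom T T" if "h \<in> carrier A" for h using A(1) that by (auto simp: AutoGroup_iff)
 have app: "h t \<in> TT" if "h \<in> carrier A" "t \<in> TT" for h t
  by (rule AutoGroup_apply(1)[OF subsetD[OF A(1) that(1)] that(2)])
 have act: "coset_action h (N #> t) = N #> h t" if "h \<in> carrier A" "t \<in> TT" for h t
  by (rule coset_image[OF N hom[OF that(1)] A(5)[OF that(1)] that(2)])
 have "multiset_orbit A coset_action (degs N ds) = multiset_orbit A coset_action (degs N ds') \<longleftrightarrow>
   (\<exists>h\<in>carrier A. degs N ds' = image_mset (coset_action h) (degs N ds))"
 proof (rule multiset_orbit_eq_iff[where V = "carrier (T Mod N)"])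
  show "coset_action a X \<in> carrier (T Mod N)" if "a \<in> carrier A" "X \<in> carrier (T Mod N)" for a X
  proof -
   note aX = that
   obtain t where t: "t \<in> TT" "X = N #> t" using aX(2) unfolding carrier_FactGroup by blast
   have "coset_action a X = N #> a t" using act[OF aX(1) t(1)] t by simp
   then show ?thesis unfolding carrier_FactGroup using app[OF aX(1) t(1)] by blast
  qed
  show "\<exists>e\<in>carrier A. \<forall>X\<in>carrier (T Mod N). coset_action e X = X"
  proof (rule bexI[OF _ A(2)], rule ballI)
   fix X assume "X \<in> carrier (T Mod N)"
   then obtain t where "t \<in> TT" "X = N #> t" unfolding carrier_FactGroup by blast
   then show "coset_action (\<lambda>x\<in>TT. x) X = X" using act[OF A(2)] by simp
  qed
  show "\<exists>c\<in>carrier A. \<forall>X\<in>carrier (T Mod N). coset_action c X = coset_action a (coset_action b X)"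
   if ab: "a \<in> carrier A" "b \<in> carrier A" for a b
  proof (rule bexI[OF _ A(3)[OF ab]], rule ballI)
   fix X assume "X \<in> carrier (T Mod N)"
   then obtain t where t: "t \<in> TT" "X = N #> t" unfolding carrier_FactGroup by blast
   then show "coset_action (compose TT a b) X = coset_action a (coset_action b X)"
    using act[OF A(3)[OF ab] t(1)] act[OF ab(2) t(1)] act[OF ab(1) app[OF ab(2) t(1)]] by (simp add: compose_eq)
  qed
  show "\<exists>b\<in>carrier A. \<forall>X\<in>carrier (T Mod N). coset_action b (coset_action a X) = X" if a: "a \<in> carrier A" for a
  proof (rule bexI[OF _ A(4)[OF a]], rule ballI)
   fix X assume "X \<in> carrier (T Mod N)"
   then obtain t where t: "t \<in> TT" "X = N #> t" unfolding carrier_FactGroup by blast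
   have "inv_into TT a (a t) = t" using AutoGroup_apply(3)[OF subsetD[OF A(1) a] t(1)] .
   then show "coset_action (restrict (inv_into TT a) TT) (coset_action a X) = X"
    using act[OF a t(1)] act[OF A(4)[OF a] app[OF a t(1)]] t app[OF a t(1)] by simp
  qed
 qed (use coset_multiset_carrier d in auto)
 also have "\<dots> \<longleftrightarrow> (\<exists>h\<in>carrier A. degs N ds' = mset (map (\<lambda>d. N #> h (deg d)) ds))"
 proof (rule bex_cong[OF refl])
  fix h assume h: "h \<in> carrier A"
  have "image_mset (coset_action h) (degs N ds) = mset (map (\<lambda>d. coset_action h (N #> deg d)) ds)"
   by (simp add: coset_multiset_eq image_mset.compositionality o_def)
  also have "map (\<lambda>d. coset_action h (N #> deg d)) ds = map (\<lambda>d. N #> h (deg d)) ds"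
   by (rule map_cong[OF refl]) (use act[OF h] d in \<open>auto simp: hunit_def\<close>)
  finally show "(degs N ds' = image_mset (coset_action h) (degs N ds)) \<longleftrightarrow>
    (degs N ds' = mset (map (\<lambda>d. N #> h (deg d)) ds))" by simp
 qed
 finally show ?thesis .
qed

lemma induced_biform_eq:
 assumes "s \<in> TT" "t \<in> TT"
 shows "induced_biform \<beta> (H #> s) (H #> t) = \<beta> s t"
proof -
 have b: "\<beta> x y = \<beta> s t" if xy: "x \<in> H #> s" "y \<in> H #> t" for x y
 proof -
  obtain h h' where h: "h \<in> H" "x = h \<otimes> s" "h' \<in> H" "y = h' \<otimes> t" using xy by (auto simp: r_coset_def)
  then have c: "h \<in> TT" "h' \<in> TT" using H_iff by auto
  show ?thesis using h c assms beta_H[OF h(1)] beta_H[OF h(3)] by (simp add: beta_mult_left beta_mult_right)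
 qed
 have "{\<beta> x y | x y. x \<in> H #> s \<and> y \<in> H #> t} = {\<beta> s t}"
  using b rcos_self[OF assms(1) H_subgroup] rcos_self[OF assms(2) H_subgroup] by blast
 then show ?thesis by (simp add: induced_biform_def)
qed

lemma induced_alternating:
 "alternating_bicharacter (T Mod H) (D \<one>) (induced_biform \<beta>)" "nondegenerate (T Mod H) (induced_biform \<beta>)"
proof -
 note ib = induced_biform_eq and FM = FactGroup_mult[OF H_subgroup]
 show "alternating_bicharacter (T Mod H) (D \<one>) (induced_biform \<beta>)"
  unfolding alternating_bicharacter_def
 proof (intro conjI ballI)
  fix X Y assume "X \<in> carrier (T Mod H)" "Y \<in> carrier (T Mod H)"
  then obtain s t where st: "s \<in> TT" "X = H #> s" "t \<in> TT" "Y = H #> t" unfolding carrier_FactGroup by metis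
  show "induced_biform \<beta> X Y \<in> D \<one> - {0}" unfolding st ib[OF st(1,3)] using beta_unit[OF st(1,3)] by (simp add: hunit_def)
  fix Z assume "Z \<in> carrier (T Mod H)"
  then obtain u where u: "u \<in> TT" "Z = H #> u" unfolding carrier_FactGroup by metis
  show "induced_biform \<beta> (X \<otimes>\<^bsub>T Mod H\<^esub> Y) Z = induced_biform \<beta> X Z * induced_biform \<beta> Y Z"
   "induced_biform \<beta> Z (X \<otimes>\<^bsub>T Mod H\<^esub> Y) = induced_biform \<beta> Z X * induced_biform \<beta> Z Y"
   unfolding st u FM[OF st(1,3)] using st u by (simp_all add: ib beta_mult_left beta_mult_right del: mult_FactGroup)
 next
  fix X assume "X \<in> carrier (T Mod H)"
  then obtain s where st: "s \<in> TT" "X = H #> s" unfolding carrier_FactGroup by metis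
  show "induced_biform \<beta> X X = 1" unfolding st ib[OF st(1,1)] using st by simp
 qed
 show "nondegenerate (T Mod H) (induced_biform \<beta>)"
  unfolding nondegenerate_def
 proof (intro ballI impI)
  fix X assume X: "X \<in> carrier (T Mod H)" and all: "\<forall>Y\<in>carrier (T Mod H). induced_biform \<beta> X Y = 1"
  obtain s where s: "s \<in> TT" "X = H #> s" using X unfolding carrier_FactGroup by metis
  have "\<beta> s t = 1" if t: "t \<in> TT" for t
   using all ib[OF s(1) t] s t carrier_FactGroup by metis
  then have "s \<in> H" using H_iff s by blast
  then show "X = \<one>\<^bsub>T Mod H\<^esub>" using s coset_join2 H_subgroup by simp
 qed
qed

lemma aut_commutes_hom:
 assumes aut: "gr_aut g" and h: "\<And>t x. t \<in> TT \<Longrightarrow> x \<in> D t \<Longrightarrow> v * g (\<phi> x) = \<phi> (g x) * v"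
 shows "v * g (\<phi> x) = \<phi> (g x) * v"
proof -
 have "v * g (\<phi> (\<Sum>t\<in>TT. comp x t)) = (\<Sum>t\<in>TT. v * g (\<phi> (comp x t)))"
  by (simp add: phi_sum aut_sum[OF aut] sum_distrib_left)
 also have "\<dots> = (\<Sum>t\<in>TT. \<phi> (g (comp x t)) * v)"
  by (rule sum.cong) (use h comp_mem in auto)
 also have "\<dots> = \<phi> (g (\<Sum>t\<in>TT. comp x t)) * v"
  by (simp add: phi_sum aut_sum[OF aut] sum_distrib_right)
 finally show ?thesis by (simp add: sum_comp)
qed

lemma aut_H_image: "gr_aut h \<Longrightarrow> aut_deg h ` H = H"
proof (rule endo_inj_surj)
 assume aut: "gr_aut h"
 show "finite H" using finite_carrier subgroup.subset[OF H_subgroup] finite_subset by blast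
 show "aut_deg h ` H \<subseteq> H" using aut_H[OF aut] by blast
 show "inj_on (aut_deg h) H" using aut_deg_inj[OF aut] subgroup.subset[OF H_subgroup] inj_on_subset by blast
qed

end

context real_neutral
begin

lemma linked_degree_real:
 assumes "gr_aut h" "hunit u v" "linked h v d d'" "hunit t d" "hunit t' d'"
 shows "t' = u \<otimes> aut_deg h t"
proof -
 obtain r where r: "r \<in> TT" "r \<otimes> r \<otimes> t' = u \<otimes> aut_deg h t" by (rule linked_degree[OF assms])
 then show ?thesis using T_sq assms(5) by (simp add: hunit_def)
qed

lemma center_twist_real:
 assumes "hunit u v" "u \<in> H" "\<phi> v = v"
 shows "u = \<one>"
 using center_phi_hom(1)[of u v] hunit_H_central[OF assms(1,2)] assms by (auto simp: hunit_def)

lemma beta_minus: "s \<in> TT \<Longrightarrow> s \<notin> H \<Longrightarrow> \<exists>w\<in>TT. w \<otimes> w = \<one> \<and> \<beta> w s = -1"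
 using H_iff[of s] beta_sign beta_sym T_sq by metis

end

section \<open>Real neutral component under the positivity convention\<close>

locale real_positive = real_neutral T D \<phi> + positive_inv T D \<phi>
 for T :: "'t monoid" (structure) and D :: "'t \<Rightarrow> 'd::real_algebra_1 set" and \<phi>
begin

text \<open>On \<open>D t\<close> the product \<open>x * \<phi> x\<close> is \<open>eta t\<close>
  times the square of \<open>x\<close>, and by convention it is positive.\<close>

lemma eta_mu:
 assumes t: "t \<in> TT"
 shows "eta t = mu D t"
proof -
 obtain x where x: "hunit t x" using ex_hunit t by blast
 obtain r where r: "r > 0" "x * \<phi> x = of_real r" using positive[OF x T_sq[OF t]] by blast
 have "\<phi> x = eta t *\<^sub>R x" using eta(2)[OF t] x by (simp add: hunit_def)
 then have "eta t *\<^sub>R (x * x) = of_real r" using r(2) by simp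
 then have "eta t *\<^sub>R (eta t *\<^sub>R (x * x)) = eta t *\<^sub>R of_real r" by simp
 then have "x * x = of_real (eta t * r)" using eta_sq[OF t] by (simp add: of_real_def)
 from mu_eqI[OF x this r(1) eta(1)[OF t]] show ?thesis by simp
qed

text \<open>On each component \<phi> is multiplication by \<open>eta\<close>, which equals
  \<open>mu\<close> here, and \<open>mu\<close> is invariant under graded automorphisms.\<close>

lemma aut_commutes:
 assumes aut: "gr_aut h"
 shows "h (\<phi> x) = \<phi> (h x)"
proof -
 have "1 * h (\<phi> x) = \<phi> (h x) * 1"
 proof (rule aut_commutes_hom[OF aut])
  fix t x assume t: "t \<in> TT" "x \<in> D t"
  have "\<phi> (h x) = eta (aut_deg h t) *\<^sub>R h x" by (rule eta(2)) (use t aut_mem[OF aut] aut_deg_closed[OF aut] in auto)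
  also have "\<dots> = h (\<phi> x)"
   using eta(2)[OF t] eta_mu t aut_mu[OF aut t(1)] aut_deg_closed[OF aut t(1)] by (simp add: aut_scale[OF aut])
  finally show "1 * h (\<phi> x) = \<phi> (h x) * 1" by simp
 qed
 then show ?thesis by simp
qed

text \<open>Combines invariance of \<open>mu\<close> with \<open>lift_isometry\<close>; the degree
  map of the lift is equal to \<open>g\<close> as a function because both are extensional.\<close>

lemma ex_aut_deg_iff: "(\<exists>h. gr_aut h \<and> P (aut_deg h)) \<longleftrightarrow> (\<exists>g\<in>carrier (Aut_form T (mu D)). P g)"
proof
 assume "\<exists>h. gr_aut h \<and> P (aut_deg h)"
 then obtain h where p: "gr_aut h" "P (aut_deg h)" by blast
 then have "aut_deg h \<in> carrier (Aut_form T (mu D))"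
  using aut_deg_AutoGroup aut_mu by (auto simp: Aut_form_iff)
 then show "\<exists>g\<in>carrier (Aut_form T (mu D)). P g" using p by blast
next
 assume "\<exists>g\<in>carrier (Aut_form T (mu D)). P g"
 then obtain g where a: "g \<in> hom T T" "g \<in> extensional TT" "bij_betw g TT TT"
   "\<And>t. t \<in> TT \<Longrightarrow> mu D (g t) = mu D t" "P g" by (auto simp: Aut_form_iff AutoGroup_iff)
 obtain h where p: "gr_aut h" "\<And>t. t \<in> TT \<Longrightarrow> aut_deg h t = g t"
  using lift_isometry[OF a(1,3,4)] by blast
 have "aut_deg h = g"
 proof
  fix t show "aut_deg h t = g t"
   using p(2) a(2) by (cases "t \<in> TT") (auto simp: aut_deg_def extensional_def)
 qed
 then show "\<exists>h. gr_aut h \<and> P (aut_deg h)" using p a(5) by blast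
qed

text \<open>Serves the real and the complex centre alike. They differ in the radical
  \<open>H\<close>, and \<open>hu\<close> and \<open>hd\<close> state what is required of it: a
  twisting element or a diagonal entry with degree in \<open>H\<close> has neutral degree.\<close>

lemma equivalent_iff_degrees:
 assumes adm: "adm q s ds e" "adm q' s' ds' e'"
  and hu: "\<And>u v. hunit u v \<Longrightarrow> u \<in> H \<Longrightarrow> \<phi> v = (e * e') *\<^sub>R v \<Longrightarrow> u = \<one>"
  and hd: "\<And>d. d \<in> set ds \<Longrightarrow> deg d \<in> H \<Longrightarrow> deg d = \<one>"
 shows "M_equiv q s ds e q' s' ds' e' \<longleftrightarrow>
  q = q' \<and> s = s' \<and> e = e' \<and> (e = 1 \<longrightarrow> sign_diff ds = sign_diff ds') \<and>
  (\<exists>a\<in>carrier (Aut_form T (mu D)). mset (map (deg) ds') = mset (map (\<lambda>d. a (deg d)) ds))"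
  (is "?L \<longleftrightarrow> ?R")
proof
 note A = admissible_facts[OF adm(1)] and B = admissible_facts[OF adm(2)]
 assume ?L
 then obtain g v p where q: "q = q'" "s = s'" and aut: "gr_aut g" and tw: "twists g v" and pv: "\<phi> v = (e * e') *\<^sub>R v"
  and p: "bij_betw p {..<q} {..<q}" and lk: "\<And>i. i < q \<Longrightarrow> linked g v (ds ! i) (ds' ! p i)"
  unfolding equivalent_iff[OF adm] by blast
 obtain u where u: "hunit u v" using tw by (auto simp: twists_def)
 have uc: "u \<in> TT" using u by (simp add: hunit_def)
 \<comment> \<open>\<open>T\<close> has exponent 2, so orthogonality to all elements of order at
   most 2 puts \<open>u\<close> into the radical.\<close>
 have "u \<in> H" using twist_orthogonal[OF aut tw u] T_sq H_iff uc by blast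
 from hu[OF u this pv] have u1: "u = \<one>" .
 then obtain r where r: "v = of_real r" "r \<noteq> 0" using u De_real by (auto simp: hunit_def)
 then have "1 *\<^sub>R v = (e * e') *\<^sub>R v" using pv by (metis phi_of_real scaleR_one)
 then have "e * e' = 1" using u by (auto simp only: scaleR_cancel_right hunit_def)
 then have e: "e = e'" using A(2) B(2) by auto
 have vv: "norm_form v \<or> norm_form (- v)"
 proof (rule symmetric_square_degree[OF u])
  show "\<phi> v = v" using r by simp
  show "u \<in> P2" unfolding u1 power_part_2 by simp
 qed
 have "sign_diff ds = sign_diff ds'" if "e = 1"
  by (rule linked_sign_diff[OF aut tw vv p A(1) _ lk]) (use A B q that e in auto)
 moreover have "mset (map (deg) ds') = mset (map (\<lambda>d. aut_deg g (deg d)) ds)"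
 proof (rule mset_image_nth[OF p A(1)])
  fix i assume i: "i < q"
  then have m: "ds ! i \<in> set ds" "ds' ! p i \<in> set ds'" using A(1) B(1) q bij_betwE[OF p] by auto
  show "deg (ds' ! p i) = aut_deg g (deg (ds ! i))"
   using linked_degree_real[OF aut u lk[OF i] A(3)[OF m(1)] B(3)[OF m(2)]] u1 aut_deg_closed[OF aut] A(3)[OF m(1)]
   by (simp add: hunit_def)
 qed (use B q in simp)
 ultimately show ?R using ex_aut_deg_iff[of "\<lambda>a. mset (map (deg) ds') = mset (map (\<lambda>d. a (deg d)) ds)"]
  aut q e by blast
next
 note A = admissible_facts[OF adm(1)] and B = admissible_facts[OF adm(2)]
 assume R: ?R
 then obtain g where aut: "gr_aut g" and key: "mset (map (deg) ds') = mset (map (\<lambda>d. aut_deg g (deg d)) ds)"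
  using ex_aut_deg_iff[of "\<lambda>a. mset (map (deg) ds') = mset (map (\<lambda>d. a (deg d)) ds)"] by blast
 have q: "q' = q" "s' = s" "e' = e" using R by auto
 \<comment> \<open>Neutral elements are real, hence symmetric, so none of them is a skew entry. As
   the neutral degree is the only square, this is the condition \<open>skew\<close> of
   \<open>linked_matching\<close>.\<close>
 have neut: "deg d \<noteq> \<one>" if "e = -1" "d \<in> set ds \<union> set ds'" for d
 proof
  assume "deg d = \<one>"
  moreover have "hunit (deg d) d" "\<phi> d = - d" using A(3,4) B(3,4) that q by auto
  ultimately show False using De_real by (auto simp: hunit_def)
 qed
 show ?L unfolding q
 proof (rule linked_matching[OF aut aut_commutes[OF aut] adm(1) adm(2)[unfolded q]])
  have "mset (map (\<lambda>d. P2 #> aut_deg g (deg d)) ds) =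
    image_mset (\<lambda>t. P2 #> t) (mset (map (\<lambda>d. aut_deg g (deg d)) ds))"
   by (simp add: image_mset.compositionality o_def)
  also have "\<dots> = mset (map (\<lambda>d. P2 #> deg d) ds')"
   unfolding key[symmetric] by (simp add: image_mset.compositionality o_def)
  finally show "mset (map (\<lambda>d. P2 #> aut_deg g (deg d)) ds) = \<dots>" .
  fix d assume d: "d \<in> set ds" "deg d \<notin> P2"
  have c: "deg d \<in> TT" using A(3)[OF d(1)] by (simp add: hunit_def)
  have "deg d \<notin> H" using d hd power_part_2 by blast
  moreover have "deg d \<in> H" if "aut_deg g (deg d) \<in> H"
  proof -
   have "aut_deg g (deg d) \<in> aut_deg g ` H" using that aut_H_image[OF aut] by simp
   then obtain h where "aut_deg g (deg d) = aut_deg g h" "h \<in> H" by (rule imageE)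
   then show ?thesis using aut_deg_inj[OF aut] c H_iff by (metis inj_on_eq_iff)
  qed
  ultimately show "\<exists>w\<in>TT. w \<otimes> w = \<one> \<and> \<beta> w (aut_deg g (deg d)) = -1"
   using beta_minus aut_deg_closed[OF aut c] by blast
 qed (use R neut power_part_2 in auto)
qed

lemma signature_eq_iff:
 assumes adm: "adm q s ds e" "adm q' s' ds' e" and ns: "\<not> iso_split_complex K"
 shows "signature T D \<phi> e ds = signature T D \<phi> e ds' \<longleftrightarrow> (e = 1 \<longrightarrow> sign_diff ds = sign_diff ds')"
proof (cases "e = 1")
 case True
 have "signature T D \<phi> 1 ds = Some (sign_diff ds)" "signature T D \<phi> 1 ds' = Some (sign_diff ds')"
  by (rule signature_eq[OF ns]; use admissible_facts(3) adm De_real in blast)+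
 then show ?thesis using True by simp
qed (simp add: signature_def)

lemma classified_real:
 assumes K: "K = range of_real"
 shows "M_classified_by T D \<phi> {\<one>} (Aut_form T (mu D)) coset_action"
 unfolding M_classified_by_def
proof (intro conjI allI impI)
 note K' = center_real_case[OF K]
 show N: "subgroup {\<one>} T" by (rule triv_subgroup)
 show "elementary_abelian_2 (T Mod {\<one>})" by (rule elementary_abelian_FactGroup[OF N]) (use T_sq in simp)
 fix q s ds y q' s' ds' y'
 assume adm: "adm q s ds y" "adm q' s' ds' y'"
 note A = admissible_facts[OF adm(1)] and B = admissible_facts[OF adm(2)]
 have inj: "{\<one>} #> s = {\<one>} #> t \<longleftrightarrow> s = t" if "s \<in> TT" "t \<in> TT" for s t
  using that by (simp add: r_coset_def)
 have orb: "multiset_orbit (Aut_form T (mu D)) coset_action (degs {\<one>} ds) =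
    multiset_orbit (Aut_form T (mu D)) coset_action (degs {\<one>} ds') \<longleftrightarrow>
   (\<exists>h\<in>carrier (Aut_form T (mu D)). degs {\<one>} ds' = mset (map (\<lambda>d. {\<one>} #> h (deg d)) ds))"
 proof (rule orbit_coset_action[OF N _ Aut_form_group_like[OF T_group]])
  show "h ` {\<one>} = {\<one>}" if "h \<in> carrier (Aut_form T (mu D))" for h
   using that by (auto simp: Aut_form_iff AutoGroup_iff intro: hom_one[OF _ T_group T_group])
 qed (use A(3) B(3) Aut_form_iff in blast)+
 also have "\<dots> \<longleftrightarrow> (\<exists>h\<in>carrier (Aut_form T (mu D)). mset (map (deg) ds') = mset (map (\<lambda>d. h (deg d)) ds))"
 proof (rule bex_cong[OF refl])
  fix h assume a: "h \<in> carrier (Aut_form T (mu D))"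
  have c: "h t \<in> TT" if "t \<in> TT" for t using AutoGroup_apply(1)[of h T t] a that Aut_form_iff by blast
  have "inj_on (\<lambda>t. {\<one>} #> t) TT" by (rule inj_onI) (use inj in blast)
  \<comment> \<open>Cosets of the trivial subgroup are singletons, and \<open>the_elem\<close>
    recovers the degree from them.\<close>
  have m: "image_mset (\<lambda>t. {\<one>} #> t) M = image_mset (\<lambda>t. {\<one>} #> t) N \<longleftrightarrow> M = N"
   if "set_mset M \<subseteq> TT" "set_mset N \<subseteq> TT" for M N
  proof
   assume e: "image_mset (\<lambda>t. {\<one>} #> t) M = image_mset (\<lambda>t. {\<one>} #> t) N"
   have g: "image_mset the_elem (image_mset (\<lambda>t. {\<one>} #> t) M) = M" if "set_mset M \<subseteq> TT" for M
    unfolding image_mset.compositionality o_def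
    by (rule trans[OF image_mset_cong[where g = "\<lambda>t. t"]]) (use that in \<open>auto simp: r_coset_def\<close>)
   show "M = N" using g that e by metis
  qed simp
  have "degs {\<one>} ds' = image_mset (\<lambda>t. {\<one>} #> t) (mset (map (deg) ds'))"
   by (simp add: coset_multiset_eq image_mset.compositionality o_def)
  moreover have "mset (map (\<lambda>d. {\<one>} #> h (deg d)) ds) = image_mset (\<lambda>t. {\<one>} #> t) (mset (map (\<lambda>d. h (deg d)) ds))"
   by (simp add: image_mset.compositionality o_def)
  ultimately show "degs {\<one>} ds' = mset (map (\<lambda>d. {\<one>} #> h (deg d)) ds) \<longleftrightarrow>
    mset (map (deg) ds') = mset (map (\<lambda>d. h (deg d)) ds)"
   using m[of "mset (map (deg) ds')" "mset (map (\<lambda>d. h (deg d)) ds)"] A(3) B(3) c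
   by (auto simp: hunit_def)
 qed
 finally have orb': "multiset_orbit (Aut_form T (mu D)) coset_action (degs {\<one>} ds) =
    multiset_orbit (Aut_form T (mu D)) coset_action (degs {\<one>} ds') \<longleftrightarrow> \<dots>" .
 show "M_equiv q s ds y q' s' ds' y' \<longleftrightarrow>
      q = q' \<and> s = s' \<and> y = y' \<and>
      signature T D \<phi> y ds = signature T D \<phi> y' ds' \<and>
      multiset_orbit (Aut_form T (mu D)) coset_action (degs {\<one>} ds) =
      multiset_orbit (Aut_form T (mu D)) coset_action (degs {\<one>} ds')"
  unfolding orb' using equivalent_iff_degrees[OF adm] K'(5) signature_eq_iff[OF adm(1) _ K'(3)] adm(2) by auto
qed

end

section \<open>Complex centre with real neutral component\<close>

context gr_div_inv
begin

text \<open>The two elements of a coset of \<open>H\<close> are told apart by \<chi>, so the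
  requirement that \<chi> of the image be \<omega> singles out one lift of
  \<open>a (H #> t)\<close>. There are two sign functions because over the split centre the signs on
  the target are shifted by a translation; over the complex centre both are
  \<open>mu\<close>.\<close>

lemma lift_coset_automorphism:
 assumes f: "f \<noteq> \<one>" "H = {\<one>, f}" and a: "a \<in> carrier (AutoGroup (T Mod H))"
  and \<chi>: "\<And>x. x \<in> TT \<Longrightarrow> \<chi> x = 1 \<or> \<chi> x = -1" "\<And>x. x \<in> TT \<Longrightarrow> \<chi> (f \<otimes> x) = - \<chi> x"
  and \<omega>: "\<And>x. x \<in> TT \<Longrightarrow> \<omega> x = 1 \<or> \<omega> x = -1" "\<And>x. x \<in> TT \<Longrightarrow> \<omega> (f \<otimes> x) = - \<omega> x"
  and mult: "\<And>s t x y. s \<in> TT \<Longrightarrow> t \<in> TT \<Longrightarrow> x \<in> TT \<Longrightarrow> y \<in> TT \<Longrightarrow>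
   a (H #> s) = H #> x \<Longrightarrow> a (H #> t) = H #> y \<Longrightarrow> \<chi> x = \<omega> s \<Longrightarrow> \<chi> y = \<omega> t \<Longrightarrow> \<chi> (x \<otimes> y) = (\<omega> (s \<otimes> t) :: real)"
 obtains h where "h \<in> carrier (AutoGroup T)" "\<And>t. t \<in> TT \<Longrightarrow> a (H #> t) = H #> h t"
  "\<And>t. t \<in> TT \<Longrightarrow> \<chi> (h t) = \<omega> t"
proof -
 have fc: "f \<in> TT" using f H_iff by blast
 have \<chi>n: "\<chi> x \<noteq> 0" if "x \<in> TT" for x using \<chi>(1)[OF that] by auto
 have \<omega>n: "\<omega> x \<noteq> 0" if "x \<in> TT" for x using \<omega>(1)[OF that] by auto
 have cos: "H #> s = H #> t \<longleftrightarrow> s = t \<or> s = f \<otimes> t" if "s \<in> TT" "t \<in> TT" for s t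
 proof -
  have "H #> s = H #> t \<longleftrightarrow> s \<otimes> inv t = \<one> \<or> s \<otimes> inv t = f" using coset_eq_iff[OF H_subgroup that] f by simp
  then show ?thesis using that fc by (metis inv_solve_right' l_one one_closed)
 qed
 have ac: "a (H #> t) \<in> carrier (T Mod H)" if "t \<in> TT" for t
  using AutoGroup_apply(1)[OF a] carrier_FactGroup that by blast
 have ex: "\<exists>u. u \<in> TT \<and> a (H #> t) = H #> u \<and> \<chi> u = \<omega> t" if t: "t \<in> TT" for t
 proof -
  obtain w where w: "w \<in> TT" "a (H #> t) = H #> w" using ac[OF t] carrier_FactGroup by metis
  have "H #> (f \<otimes> w) = H #> w" using cos w fc by simp
  then show ?thesis using w fc \<chi>(1,2)[OF w(1)] \<omega>(1)[OF t] by (metis m_closed minus_minus)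
 qed
 define h where "h t = (if t \<in> TT then SOME u. u \<in> TT \<and> a (H #> t) = H #> u \<and> \<chi> u = \<omega> t else undefined)" for t
 have al: "h t \<in> TT" "a (H #> t) = H #> h t" "\<chi> (h t) = \<omega> t" if "t \<in> TT" for t
  using someI_ex[OF ex[OF that]] that by (auto simp: h_def)
 have uniq: "u = h t" if "t \<in> TT" "u \<in> TT" "a (H #> t) = H #> u" "\<chi> u = \<omega> t" for u t
 proof -
  have "u = h t \<or> u = f \<otimes> h t" using cos[OF that(2) al(1)[OF that(1)]] that al(2) by simp
  moreover have "u \<noteq> f \<otimes> h t"
   using \<chi>(2)[OF al(1)[OF that(1)]] \<omega>n[OF that(1)] that al(3)[OF that(1)] by auto
  ultimately show ?thesis by simp
 qed
 have ah: "a \<in> hom (T Mod H) (T Mod H)" "inj_on a (carrier (T Mod H))" using a by (auto simp: AutoGroup_iff bij_betw_def)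
 have HC: "H #> t \<in> carrier (T Mod H)" if "t \<in> TT" for t using that carrier_FactGroup by blast
 have "h (s \<otimes> t) = h s \<otimes> h t" if st: "s \<in> TT" "t \<in> TT" for s t
 proof (rule uniq[symmetric])
  have "a (H #> (s \<otimes> t)) = a ((H #> s) \<otimes>\<^bsub>T Mod H\<^esub> (H #> t))" using FactGroup_mult[OF H_subgroup st] by simp
  also have "\<dots> = a (H #> s) \<otimes>\<^bsub>T Mod H\<^esub> a (H #> t)" by (rule hom_mult[OF ah(1) HC HC]) (use st in auto)
  also have "\<dots> = H #> (h s \<otimes> h t)" unfolding al(2)[OF st(1)] al(2)[OF st(2)] by (rule FactGroup_mult[OF H_subgroup]) (use al st in auto)
  finally show "a (H #> (s \<otimes> t)) = H #> (h s \<otimes> h t)" .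
  show "\<chi> (h s \<otimes> h t) = \<omega> (s \<otimes> t)" by (rule mult) (use al st in auto)
 qed (use al st in auto)
 then have hom: "h \<in> hom T T" using al by (intro homI) auto
 have inj: "inj_on h TT"
 proof (rule inj_onI)
  fix s t assume st: "s \<in> TT" "t \<in> TT" "h s = h t"
  then have "a (H #> s) = a (H #> t)" using al by simp
  then have "H #> s = H #> t" using ah(2) HC st by (metis inj_onD)
  then have "s = t \<or> s = f \<otimes> t" using cos st by blast
  moreover have "s \<noteq> f \<otimes> t" using \<omega>(2)[OF st(2)] al(3)[OF st(1)] al(3)[OF st(2)] st(3) \<omega>n[OF st(2)] by auto
  ultimately show "s = t" by blast
 qed
 have "bij_betw h TT TT"
  by (rule bij_betw_imageI[OF inj endo_inj_surj[OF finite_carrier _ inj]]) (use al in auto)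
 then have "h \<in> carrier (AutoGroup T)" using hom by (auto simp: AutoGroup_iff extensional_def h_def)
 then show thesis using that al by blast
qed

end

context real_positive
begin

text \<open>Here \<open>mu D f = -1\<close>, so every coset of \<open>H\<close> contains exactly one
  element with value 1, and the degrees of the symmetric diagonal entries are these representatives.
  Hence multisets of degrees and of their cosets carry the same information, and isometries of the
  induced form lift to isometries of \<mu>.\<close>

lemma classified_complex_real_neutral:
 assumes ns: "\<not> iso_split_complex K" and nr: "K \<noteq> range of_real"
  and z: "hunit f z" "\<phi> z = - z" "z * z = -1" and f: "f \<noteq> \<one>" "H = {\<one>, f}"
 shows "M_classified_by T D \<phi> H (Aut_biform (T Mod H) (induced_biform \<beta>)) (\<lambda>l. l)"
 unfolding M_classified_by_def
proof (intro conjI allI impI)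
 let ?V = "T Mod H" and ?A = "Aut_biform (T Mod H) (induced_biform \<beta>)"
 show "subgroup H T" by (rule H_subgroup)
 show "elementary_abelian_2 ?V" by (rule elementary_abelian_FactGroup[OF H_subgroup]) (use T_sq subgroup.one_closed[OF H_subgroup] in simp)
 fix q s ds n q' s' ds' n'
 assume adm: "adm q s ds n" "adm q' s' ds' n'"
 note A = admissible_facts[OF adm(1)] and B = admissible_facts[OF adm(2)]
 have d1: "n = 1" "n' = 1" using A(5) B(5) nr by auto
 have fc: "f \<in> TT" using z by (simp add: hunit_def)
 have muf: "mu D f = -1" by (rule mu_eqI[OF z(1), of _ 1]) (use z in simp_all)
 have Hf: "f \<in> H" using f by simp
 have mux: "mu D (f \<otimes> x) = - mu D x" if x: "x \<in> TT" for x
 proof -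
  have "(of_real (mu D (f \<otimes> x)) :: 'd) = of_real (- mu D x)" using mu_mult[OF fc x] beta_H[OF Hf x] muf by simp
  then show ?thesis by (simp only: of_real_eq_iff)
 qed
 have mud: "mu D (deg d) = 1" if "d \<in> set ds \<union> set ds'" for d
 proof -
  have "hunit (deg d) d" "\<phi> d = 1 *\<^sub>R d" using that A(3,4) B(3,4) d1 by auto
  then show ?thesis using eta_eqI[of "deg d" d 1] eta_mu[of "deg d"] by (simp add: hunit_def)
 qed
 have dc: "deg d \<in> TT" if "d \<in> set ds \<union> set ds'" for d using that A(3) B(3) by (auto simp: hunit_def)
 have HC: "H #> t \<in> carrier ?V" if "t \<in> TT" for t using that carrier_FactGroup by blast
 have V: "group ?V" using FactGroup_comm[OF H_subgroup] by (simp add: comm_group_def)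
 have cl: "a X \<in> carrier ?V" if "a \<in> carrier ?A" "X \<in> carrier ?V" for a X
  using AutoGroup_apply(1)[of a ?V X] that Aut_biform_iff by blast
 have orb: "multiset_orbit ?A (\<lambda>l. l) (degs H ds) = multiset_orbit ?A (\<lambda>l. l) (degs H ds') \<longleftrightarrow>
   (\<exists>a\<in>carrier ?A. degs H ds' = image_mset a (degs H ds))"
 proof (rule multiset_orbit_eq_iff[where V = "carrier ?V"])
  show "\<exists>e\<in>carrier ?A. \<forall>v\<in>carrier ?V. e v = v" using Aut_biform_group_like(1)[OF V] by (rule bexI[rotated]) simp
  show "\<exists>c\<in>carrier ?A. \<forall>v\<in>carrier ?V. c v = a (b v)" if "a \<in> carrier ?A" "b \<in> carrier ?A" for a b
   using Aut_biform_group_like(2)[OF V that] by (rule bexI[rotated]) (simp add: compose_eq)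
  show "\<exists>b\<in>carrier ?A. \<forall>v\<in>carrier ?V. b (a v) = v" if a: "a \<in> carrier ?A" for a
  proof (rule bexI[OF _ Aut_biform_group_like(3)[OF V a]], rule ballI)
   fix v assume v: "v \<in> carrier ?V"
   have "a \<in> carrier (AutoGroup ?V)" using a Aut_biform_iff by blast
   from AutoGroup_apply(3)[OF this v] show "restrict (inv_into (carrier ?V) a) (carrier ?V) (a v) = v" using cl[OF a v] by simp
  qed
  show "set_mset (degs H ds) \<subseteq> carrier ?V" using A(3) by (rule coset_multiset_carrier)
  show "set_mset (degs H ds') \<subseteq> carrier ?V" using B(3) by (rule coset_multiset_carrier)
 qed (rule cl)
 have eqv: "M_equiv q s ds n q' s' ds' n' \<longleftrightarrow>
  q = q' \<and> s = s' \<and> n = n' \<and> (n = 1 \<longrightarrow> sign_diff ds = sign_diff ds') \<and>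
  (\<exists>l\<in>carrier (Aut_form T (mu D)). mset (map (deg) ds') = mset (map (\<lambda>d. l (deg d)) ds))"
 proof (rule equivalent_iff_degrees[OF adm])
  show "u = \<one>" if "hunit u v" "u \<in> H" "\<phi> v = (n * n') *\<^sub>R v" for u v
   using center_twist_real[OF that(1,2)] that(3) d1 by simp
  show "deg d = \<one>" if "d \<in> set ds" "deg d \<in> H" for d
   using mud[of d] that f muf by auto
 qed
 have "(\<exists>l\<in>carrier (Aut_form T (mu D)). mset (map (deg) ds') = mset (map (\<lambda>d. l (deg d)) ds)) \<longleftrightarrow>
   (\<exists>a\<in>carrier ?A. degs H ds' = image_mset a (degs H ds))"
 proof
  assume "\<exists>l\<in>carrier (Aut_form T (mu D)). mset (map (deg) ds') = mset (map (\<lambda>d. l (deg d)) ds)"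
  then obtain h where aut: "gr_aut h" and key: "mset (map (deg) ds') = mset (map (\<lambda>d. aut_deg h (deg d)) ds)"
   using ex_aut_deg_iff[of "\<lambda>l. mset (map (deg) ds') = mset (map (\<lambda>d. l (deg d)) ds)"] by blast
  let ?a = "restrict (coset_action (aut_deg h)) (carrier ?V)"
  have act: "?a (H #> t) = H #> aut_deg h t" if "t \<in> TT" for t
   using coset_image[OF H_subgroup aut_deg_hom[OF aut] aut_H_image[OF aut] that] HC[OF that] by simp
  have "?a \<in> carrier ?A"
   unfolding Aut_biform_iff
  proof (intro conjI ballI)
   show "?a \<in> carrier (AutoGroup ?V)" by (rule induced_AutoGroup[OF H_subgroup aut_deg_AutoGroup[OF aut] aut_H_image[OF aut]])
   fix X Y assume "X \<in> carrier ?V" "Y \<in> carrier ?V"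
   then obtain s t where st: "s \<in> TT" "X = H #> s" "t \<in> TT" "Y = H #> t" unfolding carrier_FactGroup by metis
   have "h (\<beta> s t) = \<beta> s t" unfolding beta_real[OF st(1,3)] by (rule aut_of_real[OF aut])
   then show "induced_biform \<beta> (?a X) (?a Y) = induced_biform \<beta> X Y"
    unfolding st(2,4) act[OF st(1)] act[OF st(3)]
    using induced_biform_eq st aut_deg_closed[OF aut] aut_beta[OF aut] by simp
  qed
  moreover have "degs H ds' = image_mset ?a (degs H ds)"
  proof -
   have "degs H ds' = image_mset (\<lambda>t. H #> t) (mset (map (deg) ds'))"
    by (simp add: coset_multiset_eq image_mset.compositionality o_def)
   also have "\<dots> = mset (map (\<lambda>d. H #> aut_deg h (deg d)) ds)"
    unfolding key by (simp add: image_mset.compositionality o_def)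
   also have "\<dots> = mset (map (\<lambda>d. ?a (H #> deg d)) ds)"
    by (rule arg_cong[of _ _ mset], rule map_cong[OF refl], rule act[symmetric]) (use dc in auto)
   finally show ?thesis by (simp add: coset_multiset_eq image_mset.compositionality o_def)
  qed
  ultimately show "\<exists>a\<in>carrier ?A. degs H ds' = image_mset a (degs H ds)" by blast
 next
  assume "\<exists>a\<in>carrier ?A. degs H ds' = image_mset a (degs H ds)"
  then obtain a where a: "a \<in> carrier (AutoGroup ?V)" and ab: "\<And>X Y. X \<in> carrier ?V \<Longrightarrow> Y \<in> carrier ?V \<Longrightarrow> induced_biform \<beta> (a X) (a Y) = induced_biform \<beta> X Y"
   and key: "degs H ds' = image_mset a (degs H ds)"
   unfolding Bex_def Aut_biform_iff by blast
  obtain l where al: "l \<in> carrier (AutoGroup T)" "\<And>t. t \<in> TT \<Longrightarrow> a (H #> t) = H #> l t"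
   "\<And>t. t \<in> TT \<Longrightarrow> mu D (l t) = mu D t"
  proof (rule lift_coset_automorphism[where f = f and a = a and \<chi> = "mu D" and \<omega> = "mu D", OF f a mu_props(2) mux mu_props(2) mux])
   fix s t x y assume st: "s \<in> TT" "t \<in> TT" "x \<in> TT" "y \<in> TT"
    "a (H #> s) = H #> x" "a (H #> t) = H #> y" "mu D x = mu D s" "mu D y = mu D t"
   have "\<beta> x y = \<beta> s t" using ab[OF HC[OF st(1)] HC[OF st(2)]] st induced_biform_eq by simp
   then have "(of_real (mu D (x \<otimes> y)) :: 'd) = of_real (mu D (s \<otimes> t))" using mu_mult st by simp
   then show "mu D (x \<otimes> y) = mu D (s \<otimes> t)" by (simp only: of_real_eq_iff)
  qed (blast intro: that)+
  have alc: "l t \<in> TT" if "t \<in> TT" for t using AutoGroup_apply(1)[OF al(1) that] .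
  \<comment> \<open>The section of the projection to T/H with values in the elements on which
    \<open>mu\<close> is 1.\<close>
  define g where "g X = (THE u. u \<in> X \<and> mu D u = 1)" for X
  have g: "g (H #> t) = t" if t: "t \<in> TT" "mu D t = 1" for t
   unfolding g_def
  proof (rule the_equality)
   show "t \<in> H #> t \<and> mu D t = 1" using t rcos_self[OF t(1) H_subgroup] by simp
   fix u assume "u \<in> H #> t \<and> mu D u = 1"
   moreover have "H #> t = {\<one> \<otimes> t, f \<otimes> t}" unfolding f(2) by (auto simp: r_coset_def)
   ultimately show "u = t" using mux[OF t(1)] t by auto
  qed
  have "mset (map (deg) ds') = mset (map (\<lambda>d. g (H #> deg d)) ds')"
   by (rule arg_cong[of _ _ mset], rule map_cong[OF refl], rule g[symmetric]) (use mud dc in auto)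
  also have "\<dots> = image_mset g (degs H ds')" by (simp add: coset_multiset_eq image_mset.compositionality o_def)
  also have "\<dots> = mset (map (\<lambda>d. g (a (H #> deg d))) ds)" unfolding key by (simp add: coset_multiset_eq image_mset.compositionality o_def)
  also have "\<dots> = mset (map (\<lambda>d. l (deg d)) ds)"
  proof (rule arg_cong[of _ _ mset], rule map_cong[OF refl])
   fix d assume "d \<in> set ds"
   then have "deg d \<in> TT" "mu D (deg d) = 1" using dc mud by auto
   then show "g (a (H #> deg d)) = l (deg d)" using al g alc by simp
  qed
  finally show "\<exists>l\<in>carrier (Aut_form T (mu D)). mset (map (deg) ds') = mset (map (\<lambda>d. l (deg d)) ds)"
   using al by (auto simp: Aut_form_iff)
 qed
 then show "M_equiv q s ds n q' s' ds' n' \<longleftrightarrow>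
      q = q' \<and> s = s' \<and> n = n' \<and>
      signature T D \<phi> n ds = signature T D \<phi> n' ds' \<and>
      multiset_orbit ?A (\<lambda>l. l) (degs H ds) =
      multiset_orbit ?A (\<lambda>l. l) (degs H ds')"
  unfolding orb eqv using signature_eq_iff[OF adm(1) _ ns] adm(2) d1 by auto
qed

end

section \<open>Split centre and the affine action\<close>

lemma orbit_affine_iff:
 assumes V: "comm_group V" and M: "set_mset M \<subseteq> carrier V" "set_mset N \<subseteq> carrier V"
 shows "multiset_orbit (semidirect V (Aut_form V m)) (affine_action V) M =
   multiset_orbit (semidirect V (Aut_form V m)) (affine_action V) N \<longleftrightarrow>
   (\<exists>w\<in>carrier V. \<exists>a\<in>carrier (Aut_form V m). N = image_mset (\<lambda>v. w \<otimes>\<^bsub>V\<^esub> a v) M)"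
proof -
 interpret V: abelian_grading V by (rule abelian_grading.intro[OF V])
 have G: "group V" by (rule V.is_group)
 let ?A = "Aut_form V m"
 have C: "carrier (semidirect V ?A) = carrier V \<times> carrier ?A" by (simp add: semidirect_def)
 have AG: "a \<in> carrier (AutoGroup V)" if "a \<in> carrier ?A" for a using that Aut_form_iff by blast
 have hm: "a (x \<otimes>\<^bsub>V\<^esub> y) = a x \<otimes>\<^bsub>V\<^esub> a y" if "a \<in> carrier ?A" "x \<in> carrier V" "y \<in> carrier V" for a x y
  using AG[OF that(1)] that by (auto simp: V.AutoGroup_iff hom_mult)
 have cl: "a x \<in> carrier V" if "a \<in> carrier ?A" "x \<in> carrier V" for a x
  by (rule AutoGroup_apply(1)[OF AG[OF that(1)] that(2)])
 have "multiset_orbit (semidirect V ?A) (affine_action V) M = multiset_orbit (semidirect V ?A) (affine_action V) N \<longleftrightarrow>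
   (\<exists>c\<in>carrier (semidirect V ?A). N = image_mset (affine_action V c) M)"
 proof (rule multiset_orbit_eq_iff[where V = "carrier V", OF _ _ _ _ M])
  show "affine_action V c v \<in> carrier V" if "c \<in> carrier (semidirect V ?A)" "v \<in> carrier V" for c v
   using that cl by (auto simp: C affine_action_def)
  show "\<exists>e\<in>carrier (semidirect V ?A). \<forall>v\<in>carrier V. affine_action V e v = v"
   using Aut_form_group_like(1)[OF G, of m] by (intro bexI[of _ "(\<one>\<^bsub>V\<^esub>, \<lambda>x\<in>carrier V. x)"]) (auto simp: C affine_action_def)
  show "\<exists>c\<in>carrier (semidirect V ?A). \<forall>v\<in>carrier V. affine_action V c v = affine_action V a (affine_action V b v)"
   if ab: "a \<in> carrier (semidirect V ?A)" "b \<in> carrier (semidirect V ?A)" for a b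
  proof -
   obtain u f w g where a: "a = (u, f)" "u \<in> carrier V" "f \<in> carrier ?A" and b: "b = (w, g)" "w \<in> carrier V" "g \<in> carrier ?A"
    using ab unfolding C by blast
   show ?thesis
    by (rule bexI[of _ "(u \<otimes>\<^bsub>V\<^esub> f w, compose (carrier V) f g)"])
     (use a b cl hm Aut_form_group_like(2)[OF G a(3) b(3)] in \<open>auto simp: C affine_action_def compose_eq V.m_assoc\<close>)
  qed
  show "\<exists>b\<in>carrier (semidirect V ?A). \<forall>v\<in>carrier V. affine_action V b (affine_action V a v) = v"
   if "a \<in> carrier (semidirect V ?A)" for a
  proof -
   obtain u f where a: "a = (u, f)" "u \<in> carrier V" "f \<in> carrier ?A" using \<open>a \<in> carrier (semidirect V ?A)\<close> unfolding C by blast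
   let ?g = "restrict (inv_into (carrier V) f) (carrier V)"
   have g: "?g \<in> carrier ?A" by (rule Aut_form_group_like(3)[OF G a(3)])
   have gf: "?g (f v) = v" if "v \<in> carrier V" for v
    using AutoGroup_apply(3)[OF AG[OF a(3)] that] cl[OF a(3) that] by simp
   show ?thesis
   proof (rule bexI[of _ "(inv\<^bsub>V\<^esub> (?g u), ?g)"], rule ballI)
    fix v assume v: "v \<in> carrier V"
    have "?g (u \<otimes>\<^bsub>V\<^esub> f v) = ?g u \<otimes>\<^bsub>V\<^esub> v" using hm[OF g a(2) cl[OF a(3) v]] gf[OF v] by simp
    then show "affine_action V (inv\<^bsub>V\<^esub> (?g u), ?g) (affine_action V a v) = v"
     using cl[OF g a(2)] v by (simp add: affine_action_def a(1) V.m_assoc[symmetric] del: restrict_apply)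
   qed (use g cl[OF g a(2)] in \<open>simp add: C del: restrict_apply\<close>)
  qed
 qed
 also have "\<dots> \<longleftrightarrow> (\<exists>w\<in>carrier V. \<exists>a\<in>carrier ?A. N = image_mset (\<lambda>v. w \<otimes>\<^bsub>V\<^esub> a v) M)"
  unfolding C by (auto simp: affine_action_def)
 finally show ?thesis .
qed

context real_neutral
begin

lemma induced_form_eq:
 assumes mu: "\<And>h. h \<in> H \<Longrightarrow> mu D h = 1" and t: "t \<in> TT"
 shows "induced_form (mu D) (H #> t) = mu D t"
proof -
 have m: "mu D x = mu D t" if x: "x \<in> H #> t" for x
 proof -
  obtain h where h: "h \<in> H" "x = h \<otimes> t" using x by (auto simp: r_coset_def)
  then have "(of_real (mu D x) :: 'd) = of_real (mu D t)" using mu_mult[of h t] t beta_H[OF h(1) t] mu[OF h(1)] H_iff by simp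
  then show ?thesis by (simp only: of_real_eq_iff)
 qed
 have "mu D ` (H #> t) = {mu D t}" using m rcos_self[OF t H_subgroup] by blast
 then show ?thesis by (simp add: induced_form_def)
qed

lemma induced_quadratic_form:
 assumes mu: "\<And>h. h \<in> H \<Longrightarrow> mu D h = 1"
 shows "quadratic_form (T Mod H) (induced_biform \<beta>) (induced_form (mu D))"
proof -
 have s: "induced_biform \<beta> X Y \<in> {1, - 1} - {0}" if XY: "X \<in> carrier (T Mod H)" "Y \<in> carrier (T Mod H)" for X Y
 proof -
  obtain s t where "s \<in> TT" "X = H #> s" "t \<in> TT" "Y = H #> t" using XY unfolding carrier_FactGroup by metis
  then show ?thesis using induced_biform_eq beta_sign[of s t] by auto
 qed
 have "alternating_bicharacter (T Mod H) {1, -1} (induced_biform \<beta>)"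
  using induced_alternating(1) s unfolding alternating_bicharacter_def by blast
 moreover have "induced_form (mu D) X \<in> {1, -1}" if X: "X \<in> carrier (T Mod H)" for X
 proof -
  obtain s where "s \<in> TT" "X = H #> s" using X unfolding carrier_FactGroup by metis
  then show ?thesis using induced_form_eq[OF mu] mu_props(2)[of s] by auto
 qed
 moreover have "of_real (induced_form (mu D) (X \<otimes>\<^bsub>T Mod H\<^esub> Y)) = of_real (induced_form (mu D) X * induced_form (mu D) Y) * induced_biform \<beta> X Y"
  if XY: "X \<in> carrier (T Mod H)" "Y \<in> carrier (T Mod H)" for X Y
 proof -
  obtain s t where st: "s \<in> TT" "X = H #> s" "t \<in> TT" "Y = H #> t" using XY unfolding carrier_FactGroup by metis
  have e: "induced_form (mu D) (H #> x) = mu D x" if "x \<in> TT" for x by (rule induced_form_eq[OF mu that])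
  show ?thesis unfolding st(2,4) FactGroup_mult[OF H_subgroup st(1,3)] e[OF st(1)] e[OF st(3)]
    induced_biform_eq[OF st(1,3)] e[OF m_closed[OF st(1,3)]] by (rule mu_mult[OF st(1,3)])
 qed
 ultimately show ?thesis unfolding quadratic_form_def by blast
qed

lemma quadratic_form_mu: "quadratic_form T \<beta> (mu D)"
 unfolding quadratic_form_def
proof (intro conjI ballI)
 have "\<beta> s t \<in> {1, - 1} - {0}" if "s \<in> TT" "t \<in> TT" for s t
  using beta_sign[OF that] by auto
 then show "alternating_bicharacter T {1, -1} \<beta>" using beta_alternating unfolding alternating_bicharacter_def by blast
qed (use mu_props(2) mu_mult in auto)

text \<open>Both factors are quadratic forms with polarisation \<beta>, so their product is a
  character of \<open>T\<close>. Without the positivity convention it may be nontrivial; over the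
  split centre it is -1 at \<open>f\<close>.\<close>

definition eta_mu_sign :: "'t \<Rightarrow> real" where
 "eta_mu_sign t = eta t * mu D t"

lemma eta_mu_sign:
 assumes "s \<in> TT" "t \<in> TT"
 shows "eta_mu_sign (s \<otimes> t) = eta_mu_sign s * eta_mu_sign t" "eta_mu_sign t = 1 \<or> eta_mu_sign t = -1"
proof -
 have "(of_real (eta_mu_sign (s \<otimes> t)) :: 'd) = of_real (eta (s \<otimes> t)) * of_real (mu D (s \<otimes> t))"
  by (simp add: eta_mu_sign_def)
 also have "\<dots> = of_real (eta s * eta t) * (\<beta> s t * (of_real (mu D s * mu D t) * \<beta> s t))"
  unfolding eta_mult[OF assms] mu_mult[OF assms] by (simp add: mult.assoc)
 also have "\<beta> s t * (of_real (mu D s * mu D t) * \<beta> s t) = of_real (mu D s * mu D t) * (\<beta> s t * \<beta> s t)"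
  using beta_sign[OF assms] by auto
 finally have "(of_real (eta_mu_sign (s \<otimes> t)) :: 'd) = of_real (eta s * eta t * (mu D s * mu D t))"
  unfolding beta_sq[OF assms] by simp
 also have "eta s * eta t * (mu D s * mu D t) = eta_mu_sign s * eta_mu_sign t" by (simp add: eta_mu_sign_def)
 finally have "(of_real (eta_mu_sign (s \<otimes> t)) :: 'd) = of_real (eta_mu_sign s * eta_mu_sign t)" .
 then show "eta_mu_sign (s \<otimes> t) = eta_mu_sign s * eta_mu_sign t" by (simp only: of_real_eq_iff)
 show "eta_mu_sign t = 1 \<or> eta_mu_sign t = -1"
  using eta(1)[OF assms(2)] mu_props(2)[OF assms(2)] by (auto simp: eta_mu_sign_def)
qed

definition beta_sgn :: "'t \<Rightarrow> 't \<Rightarrow> real" where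
 "beta_sgn s t = eta s * eta t * eta (s \<otimes> t)"

lemma beta_sgn: "s \<in> TT \<Longrightarrow> t \<in> TT \<Longrightarrow> \<beta> s t = of_real (beta_sgn s t)"
 unfolding beta_sgn_def by (rule beta_real)

lemma beta_sgn_eqI: "s \<in> TT \<Longrightarrow> t \<in> TT \<Longrightarrow> \<beta> s t = of_real r \<Longrightarrow> beta_sgn s t = r"
 using beta_sgn[of s t] by (simp only: of_real_eq_iff)

lemma beta_sgn_cases: "s \<in> TT \<Longrightarrow> t \<in> TT \<Longrightarrow> beta_sgn s t = 1 \<or> beta_sgn s t = -1"
 using eta(1)[of s] eta(1)[of t] eta(1)[of "s \<otimes> t"] by (auto simp: beta_sgn_def)

lemma beta_sgn_mult: "s \<in> TT \<Longrightarrow> t \<in> TT \<Longrightarrow> u \<in> TT \<Longrightarrow> beta_sgn (s \<otimes> t) u = beta_sgn s u * beta_sgn t u"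
 by (rule beta_sgn_eqI) (simp_all add: beta_mult_left beta_sgn[symmetric])

text \<open>A positive factor is absorbed by a real square root. For a negative one, congruence by
  the central skew \<open>z\<close> supplies the sign, as \<open>\<phi> z * z = -1\<close>. Hence no
  signature survives over a split centre.\<close>

lemma split_center_link:
 assumes z: "hunit f z" "\<phi> z = - z" "z * z = 1" "z \<in> alg_center" and xy: "hunit t x" "hunit t y"
 shows "\<exists>u c. hunit u c \<and> \<phi> c * y * c = x"
proof -
 obtain r where r: "r \<noteq> 0" "x = r *\<^sub>R y" using real_ratio_unit[OF xy(2,1)] by blast
 show ?thesis
 proof (cases "r > 0")
  case True
  have "hunit \<one> (sqrt r *\<^sub>R 1)" using True by (intro hunit_scale) auto
  moreover have "\<phi> (sqrt r *\<^sub>R 1) * y * (sqrt r *\<^sub>R 1) = x" using True r(2) by (simp add: phi_scale)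
  ultimately show ?thesis by blast
 next
  case False
  have "hunit f (sqrt (- r) *\<^sub>R z)" using False r z by (intro hunit_scale) auto
  moreover have "y * z = z * y" by (rule central_comm[OF z(4), symmetric])
  then have "z * y * z = y" using z(3) by (metis mult.assoc mult_1)
  then have "\<phi> (sqrt (- r) *\<^sub>R z) * y * (sqrt (- r) *\<^sub>R z) = x" using False r by (simp add: phi_scale z(2))
  ultimately show ?thesis by blast
 qed
qed

text \<open>The degree of the twisting element gives the translation, and the degree map of the
  graded automorphism gives the linear part, which preserves \<mu>. Conversely a translation and a
  linear part have to be realised together, since twisting by \<open>v\<close> ties the automorphism
  to the degree of \<open>v\<close>.\<close>

lemma classified_split_complex:
 assumes sp: "iso_split_complex K" and nr: "K \<noteq> range of_real"
  and z: "hunit f z" "\<phi> z = - z" "z * z = 1" "z \<in> alg_center" and f: "f \<noteq> \<one>" "H = {\<one>, f}"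
 shows "M_classified_by T D \<phi> H (semidirect (T Mod H) (Aut_form (T Mod H) (induced_form (mu D)))) (affine_action (T Mod H))"
  "h \<in> H \<Longrightarrow> mu D h = 1"
proof -
 let ?V = "T Mod H" and ?\<mu> = "induced_form (mu D)"
 have fc: "f \<in> TT" using z by (simp add: hunit_def)
 have Hf: "f \<in> H" using f by simp
 have muf: "mu D f = 1" by (rule mu_eqI[OF z(1), of _ 1]) (use z in simp_all)
 have mu1: "mu D \<one> = 1" by (rule mu_eqI[OF hunit_1, of _ 1]) simp_all
 have muH: "mu D h = 1" if "h \<in> H" for h using that muf mu1 f by auto
 then show "h \<in> H \<Longrightarrow> mu D h = 1" .
 have etaf: "eta f = -1" using eta_eqI[OF z(1), of "-1"] z(2) by simp
 have etax: "eta (f \<otimes> x) = - eta x" if x: "x \<in> TT" for x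
 proof -
  have "(of_real (eta (f \<otimes> x)) :: 'd) = of_real (- eta x)" using eta_mult[OF fc x] beta_H[OF Hf x] etaf by simp
  then show ?thesis by (simp only: of_real_eq_iff)
 qed
 have emx: "eta_mu_sign (f \<otimes> x) = - eta_mu_sign x" if x: "x \<in> TT" for x
  using eta_mu_sign(1)[OF fc x] by (simp add: eta_mu_sign_def[of f] etaf muf)
 have ife: "?\<mu> (H #> t) = mu D t" if "t \<in> TT" for t by (rule induced_form_eq[OF muH that])
 have HC: "H #> t \<in> carrier ?V" if "t \<in> TT" for t using that carrier_FactGroup by blast
 have V: "comm_group ?V" by (rule FactGroup_comm[OF H_subgroup])
 have cos: "s = t \<or> s = f \<otimes> t" if st: "H #> s = H #> t" "s \<in> TT" "t \<in> TT" for s t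
 proof -
  have "s \<otimes> inv t = \<one> \<or> s \<otimes> inv t = f" using coset_eq_iff[OF H_subgroup st(2,3)] f st(1) by simp
  then show ?thesis using st fc by (metis inv_solve_right' l_one one_closed)
 qed
 show "M_classified_by T D \<phi> H (semidirect ?V (Aut_form ?V ?\<mu>)) (affine_action ?V)"
  unfolding M_classified_by_def
 proof (intro conjI allI impI)
  show "subgroup H T" by (rule H_subgroup)
  show "elementary_abelian_2 ?V" by (rule elementary_abelian_FactGroup[OF H_subgroup]) (use T_sq subgroup.one_closed[OF H_subgroup] in simp)
  fix q s ds e q' s' ds' e'
  assume adm: "adm q s ds e" "adm q' s' ds' e'"
  note A = admissible_facts[OF adm(1)] and B = admissible_facts[OF adm(2)]
  have d1: "e = 1" "e' = 1" using A(5) B(5) nr by auto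
  have dh: "hunit (deg d) d" "\<phi> d = d" if "d \<in> set ds \<union> set ds'" for d using that A(3,4) B(3,4) d1 by auto
  have dc: "deg d \<in> TT" if "d \<in> set ds \<union> set ds'" for d using dh(1)[OF that] by (simp add: hunit_def)
  have sub: "set_mset (degs H ds) \<subseteq> carrier ?V" "set_mset (degs H ds') \<subseteq> carrier ?V"
   by (rule coset_multiset_carrier[OF A(3)], assumption) (rule coset_multiset_carrier[OF B(3)], assumption)
  have "M_equiv q s ds e q' s' ds' e' \<longleftrightarrow> q = q' \<and> s = s' \<and>
   (\<exists>w\<in>carrier ?V. \<exists>a\<in>carrier (Aut_form ?V ?\<mu>). degs H ds' = image_mset (\<lambda>v. w \<otimes>\<^bsub>?V\<^esub> a v) (degs H ds))"
   (is "?L \<longleftrightarrow> ?R")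
  proof
   assume ?L
   then obtain g v p where q: "q = q'" "s = s'" and aut: "gr_aut g" and tw: "twists g v" and pv: "\<phi> v = (e * e') *\<^sub>R v"
    and p: "bij_betw p {..<q} {..<q}" and lk: "\<And>i. i < q \<Longrightarrow> linked g v (ds ! i) (ds' ! p i)"
    unfolding equivalent_iff[OF adm] by blast
   obtain u where u: "hunit u v" using tw by (auto simp: twists_def)
   have uc: "u \<in> TT" using u by (simp add: hunit_def)
   let ?a = "restrict (coset_action (aut_deg g)) (carrier ?V)"
   have act: "?a (H #> t) = H #> aut_deg g t" if "t \<in> TT" for t
    using coset_image[OF H_subgroup aut_deg_hom[OF aut] aut_H_image[OF aut] that] HC[OF that] by simp
   have "?a \<in> carrier (Aut_form ?V ?\<mu>)"
    unfolding Aut_form_iff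
   proof (intro conjI ballI)
    show "?a \<in> carrier (AutoGroup ?V)" by (rule induced_AutoGroup[OF H_subgroup aut_deg_AutoGroup[OF aut] aut_H_image[OF aut]])
    fix X assume "X \<in> carrier ?V"
    then obtain t where t: "t \<in> TT" "X = H #> t" unfolding carrier_FactGroup by metis
    show "?\<mu> (?a X) = ?\<mu> X" unfolding t(2) act[OF t(1)] ife[OF t(1)]
      ife[OF aut_deg_closed[OF aut t(1)]] by (rule aut_mu[OF aut t(1)])
   qed
   moreover have "degs H ds' = image_mset (\<lambda>X. (H #> u) \<otimes>\<^bsub>?V\<^esub> ?a X) (degs H ds)"
   proof -
    have "mset (map (\<lambda>d. H #> deg d) ds') = mset (map (\<lambda>d. (H #> u) \<otimes>\<^bsub>?V\<^esub> ?a (H #> deg d)) ds)"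
    proof (rule mset_image_nth[OF p A(1)])
     fix i assume i: "i < q"
     then have m: "ds ! i \<in> set ds" "ds' ! p i \<in> set ds'" using A(1) B(1) q bij_betwE[OF p] by auto
     have c: "deg (ds ! i) \<in> TT" using dc m by blast
     show "H #> deg (ds' ! p i) = (H #> u) \<otimes>\<^bsub>?V\<^esub> ?a (H #> deg (ds ! i))"
      unfolding linked_degree_real[OF aut u lk[OF i] A(3)[OF m(1)] B(3)[OF m(2)]] act[OF c]
      by (rule FactGroup_mult[OF H_subgroup uc aut_deg_closed[OF aut c], symmetric])
    qed (use B q in simp)
    then show ?thesis by (simp only: coset_multiset_eq mset_map image_mset.compositionality o_def)
   qed
   ultimately show ?R using q HC[OF uc] by blast
  next
   assume R: ?R
   then obtain w a where w: "w \<in> carrier ?V" and a: "a \<in> carrier (AutoGroup ?V)" and am: "\<And>X. X \<in> carrier ?V \<Longrightarrow> ?\<mu> (a X) = ?\<mu> X"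
    and key: "degs H ds' = image_mset (\<lambda>v. w \<otimes>\<^bsub>?V\<^esub> a v) (degs H ds)"
    unfolding Bex_def Aut_form_iff by blast
   have q: "q' = q" "s' = s" using R by auto
   obtain w0 where w0: "w0 \<in> TT" "w = H #> w0" using w unfolding carrier_FactGroup by blast
   have "H #> (f \<otimes> w0) = H #> w0" using coset_eq_iff[OF H_subgroup _ w0(1)] fc w0(1) Hf by (simp add: m_assoc)
   \<comment> \<open>Of the two elements of the coset \<open>w\<close> one has
     \<open>eta = 1\<close>, so that elements of its degree are symmetric, as the twisting element
     must be.\<close>
   then obtain u where u: "u \<in> TT" "w = H #> u" "eta u = 1"
    using w0 etax[OF w0(1)] eta(1)[OF w0(1)] fc by (metis m_closed minus_minus)
   have aH: "\<exists>x\<in>TT. a (H #> t) = H #> x" if "t \<in> TT" for t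
    using AutoGroup_apply(1)[OF a HC[OF that]] unfolding carrier_FactGroup .
   \<comment> \<open>Twisting by degree \<open>u\<close> requires
     \<open>eta (l t) * beta_sgn (l t) u = eta t\<close>. Multiplied by \<open>mu\<close>, which
     \<open>l\<close> preserves, this compares two characters of \<open>T\<close> with value -1 at
     \<open>f\<close>, as the lifting lemma wants.\<close>
   obtain l where al: "l \<in> carrier (AutoGroup T)" "\<And>t. t \<in> TT \<Longrightarrow> a (H #> t) = H #> l t"
    "\<And>t. t \<in> TT \<Longrightarrow> eta_mu_sign (l t) * beta_sgn (l t) u = eta_mu_sign t"
   proof (rule lift_coset_automorphism[where f = f and a = a and \<chi> = "\<lambda>x. eta_mu_sign x * beta_sgn x u" and \<omega> = eta_mu_sign, OF f a])
    fix x assume x: "x \<in> TT"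
    show "eta_mu_sign x * beta_sgn x u = 1 \<or> eta_mu_sign x * beta_sgn x u = - 1"
     using eta_mu_sign(2)[OF x x] beta_sgn_cases[OF x u(1)] by auto
    have "beta_sgn f u = 1" by (rule beta_sgn_eqI[OF fc u(1)]) (use beta_H[OF Hf u(1)] in simp)
    then show "eta_mu_sign (f \<otimes> x) * beta_sgn (f \<otimes> x) u = - (eta_mu_sign x * beta_sgn x u)"
     using emx[OF x] beta_sgn_mult[OF fc x u(1)] by simp
   next
    fix s t x y assume st: "s \<in> TT" "t \<in> TT" "x \<in> TT" "y \<in> TT"
     "eta_mu_sign x * beta_sgn x u = eta_mu_sign s" "eta_mu_sign y * beta_sgn y u = eta_mu_sign t"
    show "eta_mu_sign (x \<otimes> y) * beta_sgn (x \<otimes> y) u = eta_mu_sign (s \<otimes> t)"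
     unfolding eta_mu_sign(1)[OF st(1,2)] eta_mu_sign(1)[OF st(3,4)] beta_sgn_mult[OF st(3,4) u(1)] st(5,6)[symmetric]
     by (simp add: mult_ac)
   next
    show "eta_mu_sign x = 1 \<or> eta_mu_sign x = - 1" if "x \<in> TT" for x using eta_mu_sign(2)[OF that that] .
   qed (blast intro: that emx)+
   have alc: "l t \<in> TT" if "t \<in> TT" for t using AutoGroup_apply(1)[OF al(1) that] .
   have mal: "mu D (l t) = mu D t" if t: "t \<in> TT" for t
    using am[OF HC[OF t]] unfolding al(2)[OF t] ife[OF t] ife[OF alc[OF t]] .
   have ealt: "eta (l t) * beta_sgn (l t) u = eta t" if t: "t \<in> TT" for t
    using al(3)[OF t] mal[OF t] mu_props(2)[OF t] by (auto simp: eta_mu_sign_def)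
   obtain g where aut: "gr_aut g" and pal: "\<And>t. t \<in> TT \<Longrightarrow> aut_deg g t = l t"
    using lift_isometry[of l] al(1) mal unfolding AutoGroup_iff by blast
   obtain v where v: "hunit u v" using ex_hunit u by blast
   then have pv: "\<phi> v = v" using eta(2)[OF u(1), of v] u(3) by (simp add: hunit_def)
   have pvx: "v * g (\<phi> x) = \<phi> (g x) * v" if tx: "t \<in> TT" "x \<in> D t" for t x
   proof (cases "x = 0")
    case False
    then have hx: "hunit t x" using tx by (simp add: hunit_def)
    have hp: "hunit (l t) (g x)" using aut_hunit[OF aut hx] pal[OF tx(1)] by simp
    have "\<phi> (g x) * v = eta (l t) *\<^sub>R (g x * v)" using eta(2)[OF alc[OF tx(1)]] hp by (simp add: hunit_def)
    also have "g x * v = beta_sgn (l t) u *\<^sub>R (v * g x)"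
     using beta_commute[OF hp v] beta_sgn[OF alc[OF tx(1)] u(1)] by (simp add: of_real_def)
    also have "eta (l t) *\<^sub>R (beta_sgn (l t) u *\<^sub>R (v * g x)) = v * g (\<phi> x)"
     using ealt[OF tx(1)] eta(2)[OF tx] by (simp add: aut_scale[OF aut])
    finally show ?thesis by simp
   qed (simp add: aut_0[OF aut])
   have tw: "twists g v" unfolding twists_def by (intro conjI exI[of _ u] allI v aut_commutes_hom[OF aut pvx])
   have "mset (map (\<lambda>d. w \<otimes>\<^bsub>?V\<^esub> a (H #> deg d)) ds) = mset (map (\<lambda>d. H #> deg d) ds')"
    using key by (simp only: coset_multiset_eq mset_map image_mset.compositionality o_def)
   then obtain p where p: "bij_betw p {..<length ds} {..<length ds}"
    "\<And>i. i < length ds \<Longrightarrow> w \<otimes>\<^bsub>?V\<^esub> a (H #> deg (ds ! i)) = H #> deg (ds' ! p i)"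
    by (rule mset_map_eq_bij) blast
   have "linked g v (ds ! i) (ds' ! p i)" if i: "i < q" for i
   proof -
    let ?d = "ds ! i" and ?d' = "ds' ! p i"
    have m: "?d \<in> set ds" "?d' \<in> set ds'" using i A(1) B(1) q bij_betwE[OF p(1)] by auto
    let ?t = "deg ?d" and ?t' = "deg ?d'"
    have c: "?t \<in> TT" "?t' \<in> TT" using dc m by auto
    have h: "hunit ?t ?d" "hunit ?t' ?d'" "\<phi> ?d = ?d" "\<phi> ?d' = ?d'" using dh m by auto
    have hv: "hunit (u \<otimes> l ?t) (v * g ?d)" using hunit_mult[OF v aut_hunit[OF aut h(1)]] pal[OF c(1)] by simp
    have uc: "u \<otimes> l ?t \<in> TT" using hv by (simp add: hunit_def)
    have "\<phi> (v * g ?d) = v * g ?d" using tw h(3) pv by (simp add: phi_mult twists_def) metis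
    then have e1: "eta (u \<otimes> l ?t) = 1" using eta_eqI[OF hv, of 1] by simp
    have e2: "eta ?t' = 1" using eta_eqI[OF h(2), of 1] h(4) by simp
    have "H #> (u \<otimes> l ?t) = H #> ?t'"
     using p(2)[of i] i A(1) FactGroup_mult[OF H_subgroup u(1) alc[OF c(1)]] unfolding al(2)[OF c(1)] u(2) by simp
    \<comment> \<open>The coset leaves two candidates, and multiplication by \<open>f\<close> would
      change the value of \<open>eta\<close>.\<close>
    then have "u \<otimes> l ?t = ?t'" using cos[OF _ uc c(2)] e1 e2 etax[OF c(2)] by auto
    then show ?thesis unfolding linked_def using split_center_link[OF z hv] h(2) by simp
   qed
   then show ?L unfolding equivalent_iff[OF adm] using q aut tw pv d1 p(1) A(1) by auto
  qed
  then show "M_equiv q s ds e q' s' ds' e' \<longleftrightarrow>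
      q = q' \<and> s = s' \<and> e = e' \<and>
      signature T D \<phi> e ds = signature T D \<phi> e' ds' \<and>
      multiset_orbit (semidirect ?V (Aut_form ?V ?\<mu>)) (affine_action ?V) (degs H ds) =
      multiset_orbit (semidirect ?V (Aut_form ?V ?\<mu>)) (affine_action ?V) (degs H ds')"
   unfolding orbit_affine_iff[OF V sub] using d1 sp by (simp add: signature_def)
 qed
qed

end

section \<open>The flag\<close>

locale nondegenerate_support = gr_div_inv T D \<phi>
 for T :: "'t monoid" (structure) and D :: "'t \<Rightarrow> 'd::real_algebra_1 set" and \<phi> +
 assumes H_trivial: "supp_center T D = {\<one>}"
begin

abbreviation "tor \<equiv> torsion_part T"
abbreviation "tor2 n \<equiv> torsion_part T (2 ^ n)"
abbreviation "V \<equiv> flag_space T"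

lemma nondegenerate_eq:
 assumes "s \<in> TT" "t \<in> TT" "\<And>u. u \<in> TT \<Longrightarrow> \<beta> s u = \<beta> t u"
 shows "s = t"
proof -
 have "\<beta> (s \<otimes> inv t) u = 1" if u: "u \<in> TT" for u
  using assms u beta_swap[OF u assms(2)] beta_swap[OF assms(2) u] by (simp add: beta_mult_left beta_inv_left)
 then have "s \<otimes> inv t \<in> H" using H_iff assms by auto
 then have "s \<otimes> inv t = \<one>" using H_trivial by simp
 then show ?thesis using assms by (metis inv_equality inv_inv inv_closed)
qed

definition perp :: "'t set \<Rightarrow> 't set" where
 "perp B = {x \<in> TT. \<forall>b\<in>B. \<beta> x b = 1}"

lemma perp_subgroup: "B \<subseteq> TT \<Longrightarrow> subgroup (perp B) T"
proof (rule subgroupI)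
 assume B: "B \<subseteq> TT"
 show "perp B \<subseteq> TT" by (auto simp: perp_def)
 have "\<one> \<in> perp B" using B by (auto simp: perp_def)
 then show "perp B \<noteq> {}" by blast
 show "x \<otimes> y \<in> perp B" if "x \<in> perp B" "y \<in> perp B" for x y
  using that B by (auto simp: perp_def beta_mult_left subset_iff)
 show "inv x \<in> perp B" if x: "x \<in> perp B" for x
 proof -
  have "\<beta> (inv x) b = 1" if b: "b \<in> B" for b
   using beta_swap[of x b] beta_inv_left[of x b] x b B by (auto simp: perp_def)
  then show ?thesis using x by (auto simp: perp_def)
 qed
qed

text \<open>Translation by \<open>c\<close> multiplies the sum by \<open>\<beta> x c\<close>. The
  sum lies in \<open>D \<one>\<close>, where nonzero elements are invertible, so it vanishes unless
  the character is trivial on \<open>B\<close>.\<close>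

lemma character_sum:
 assumes B: "subgroup B T" and x: "x \<in> TT"
 shows "(\<Sum>b\<in>B. \<beta> x b) = (if \<forall>b\<in>B. \<beta> x b = 1 then of_nat (card B) else 0)"
proof (cases "\<forall>b\<in>B. \<beta> x b = 1")
 case False
 then obtain c where c: "c \<in> B" "\<beta> x c \<noteq> 1" by blast
 note BT = subgroup.subset[OF B]
 have cT: "c \<in> TT" using c BT by blast
 have "(\<Sum>b\<in>B. \<beta> x b) = (\<Sum>b\<in>B. \<beta> x (c \<otimes> b))"
 proof (rule sum.reindex_bij_witness[of _ "\<lambda>b. c \<otimes> b" "\<lambda>b. inv c \<otimes> b"])
  fix b assume b: "b \<in> B"
  then have "b \<in> TT" using BT by blast
  then show "c \<otimes> (inv c \<otimes> b) = b" "inv c \<otimes> (c \<otimes> b) = b"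
   using cT by (simp_all add: m_assoc[symmetric])
  show "inv c \<otimes> b \<in> B" "c \<otimes> b \<in> B" using B c b by (simp_all add: subgroup.m_closed subgroup.m_inv_closed)
 qed (use BT cT in \<open>auto simp: m_assoc[symmetric]\<close>)
 also have "\<dots> = \<beta> x c * (\<Sum>b\<in>B. \<beta> x b)"
  unfolding sum_distrib_left by (rule sum.cong[OF refl], rule beta_mult_right) (use BT x cT in auto)
 finally have e: "(\<Sum>b\<in>B. \<beta> x b) = \<beta> x c * (\<Sum>b\<in>B. \<beta> x b)" .
 have "(\<Sum>b\<in>B. \<beta> x b) \<in> D \<one>"
  using D_subspace[OF one_closed] by (rule subspace_sum) (use beta_unit[OF x] BT in \<open>auto simp: hunit_def\<close>)
 then have "(\<Sum>b\<in>B. \<beta> x b) = 0"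
  using hunit_cancel[of \<one> "\<Sum>b\<in>B. \<beta> x b" 1 "\<beta> x c"] e c(2) by (auto simp: hunit_one_D)
 then show ?thesis using False by (simp only: if_False)
qed simp

text \<open>Sum \<beta> over pairs from \<open>TT\<close> and \<open>B\<close> in both orders: by
  \<open>character_sum\<close> one order counts the complement of \<open>B\<close>, the other only
  sees the trivial element. The equation holds in \<open>D\<close> and descends to numbers because
  \<open>D\<close> has characteristic 0.\<close>

lemma card_perp:
 assumes B: "subgroup B T"
 shows "card (perp B) * card B = card TT"
proof -
 note BT = subgroup.subset[OF B]
 have fB: "finite B" using BT finite_carrier finite_subset by blast
 have "(of_nat (card (perp B) * card B) :: 'd) = (\<Sum>x\<in>perp B. of_nat (card B))" by simp
 also have "\<dots> = (\<Sum>x\<in>TT. \<Sum>b\<in>B. \<beta> x b)"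
 proof (rule sum.mono_neutral_cong_left[OF finite_carrier])
  show "perp B \<subseteq> TT" by (auto simp: perp_def)
 qed (auto simp: character_sum[OF B] perp_def)
 also have "\<dots> = (\<Sum>b\<in>B. \<Sum>x\<in>TT. \<beta> x b)" by (rule sum.swap)
 also have "\<dots> = (\<Sum>b\<in>B. if b = \<one> then of_nat (card TT) else 0)"
 proof (rule sum.cong[OF refl])
  fix b assume "b \<in> B"
  then have b: "b \<in> TT" using BT by blast
  have "(\<Sum>x\<in>TT. \<beta> x b) = (\<Sum>x\<in>TT. \<beta> b x)"
   by (rule sum.reindex_bij_witness[of _ "\<lambda>x. inv x" "\<lambda>x. inv x"]) (use b beta_inv_right in auto)
  also have "\<dots> = (if \<forall>x\<in>TT. \<beta> b x = 1 then of_nat (card TT) else 0)"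
   by (rule character_sum[OF subgroup_self b])
  also have "(\<forall>x\<in>TT. \<beta> b x = 1) \<longleftrightarrow> b = \<one>" using H_iff[of b] b unfolding H_trivial by auto
  finally show "(\<Sum>x\<in>TT. \<beta> x b) = (if b = \<one> then of_nat (card TT) else 0)" .
 qed
 also have "\<dots> = of_nat (card TT)" using fB subgroup.one_closed[OF B] by simp
 finally show ?thesis by (simp only: of_nat_eq_iff)
qed

text \<open>One inclusion is immediate, and two uses of \<open>card_perp\<close> show that the
  cardinalities agree.\<close>

lemma perp_perp:
 assumes B: "subgroup B T"
 shows "perp (perp B) = B"
proof -
 note BT = subgroup.subset[OF B]
 have sub: "perp B \<subseteq> TT" by (auto simp: perp_def)
 have inc: "B \<subseteq> perp (perp B)"
 proof
  fix b assume b: "b \<in> B"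
  have "\<beta> b x = 1" if "x \<in> perp B" for x using beta_swap[of x b] that b BT by (auto simp: perp_def)
  then show "b \<in> perp (perp B)" using b BT by (auto simp: perp_def)
 qed
 have "card (perp (perp B)) * card (perp B) = card B * card (perp B)"
  using card_perp[OF perp_subgroup[OF BT]] card_perp[OF B] by (simp add: mult.commute)
 moreover have "card (perp B) \<noteq> 0"
  using subgroup.one_closed[OF perp_subgroup[OF BT]] finite_subset[OF sub finite_carrier] by auto
 ultimately have "card (perp (perp B)) = card B" by simp
 moreover have "finite (perp (perp B))" using finite_carrier by (rule rev_finite_subset) (auto simp: perp_def)
 ultimately show ?thesis using card_subset_eq[OF _ inc] by simp
qed

lemma power_part_subgroup: "subgroup (power_part T n) T"
proof (rule subgroupI)
 show "power_part T n \<subseteq> TT" by (auto simp: power_part_def)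
 show "power_part T n \<noteq> {}" by (auto simp: power_part_def)
 show "inv x \<in> power_part T n" if x: "x \<in> power_part T n" for x
 proof -
  obtain t where "t \<in> TT" "x = t [^] n" using x by (auto simp: power_part_def)
  then have "inv x = (inv t) [^] n" "inv t \<in> TT" by (simp_all add: nat_pow_inv)
  then show ?thesis unfolding power_part_def by blast
 qed
 show "x \<otimes> y \<in> power_part T n" if xy: "x \<in> power_part T n" "y \<in> power_part T n" for x y
 proof -
  obtain s t where st: "s \<in> TT" "x = s [^] n" "t \<in> TT" "y = t [^] n" using xy by (auto simp: power_part_def)
  then have "x \<otimes> y = (s \<otimes> t) [^] n" by (simp add: nat_pow_distrib)
  then show ?thesis using st unfolding power_part_def by blast
 qed
qed

text \<open>Moving the exponent from one argument of \<beta> to the other shows that the complement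
  of the powers is the torsion; taking complements once more reverses this.\<close>

lemma perp_torsion: "perp (tor n) = power_part T n"
proof -
 have "perp (power_part T n) = tor n"
 proof (intro equalityI subsetI)
  fix x assume x: "x \<in> perp (power_part T n)"
  then have xc: "x \<in> TT" by (simp add: perp_def)
  have "x [^] n = \<one>"
  proof (rule nondegenerate_eq)
   fix u assume u: "u \<in> TT"
   then have "\<beta> x (u [^] n) = 1" using x by (auto simp: perp_def power_part_def)
   then show "\<beta> (x [^] n) u = \<beta> \<one> u" using u xc by (simp add: beta_pow_left beta_pow_right)
  qed (use xc in auto)
  then show "x \<in> tor n" using xc by (simp add: torsion_part_def)
 next
  fix x assume "x \<in> tor n"
  then have x: "x \<in> TT" "x [^] n = \<one>" by (auto simp: torsion_part_def)
  have "\<beta> x (u [^] n) = 1" if u: "u \<in> TT" for u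
   using beta_pow_left[OF x(1) u, of n] beta_pow_right[OF u x(1), of n] x u by simp
  then show "x \<in> perp (power_part T n)" using x by (auto simp: perp_def power_part_def)
 qed
 then show ?thesis using perp_perp[OF power_part_subgroup, of n] by simp
qed

text \<open>By \<open>perp_torsion\<close> a nonsquare is not orthogonal to the 2-torsion, and
  \<beta> with an element of order 2 has square 1. This provides the \<open>w\<close> of
  \<open>linked_flip\<close>.\<close>

lemma torsion_nontrivial:
 assumes t: "t \<in> TT" "t \<notin> P2"
 shows "\<exists>w\<in>TT. w \<otimes> w = \<one> \<and> \<beta> w t = -1"
proof -
 obtain w where w: "w \<in> tor 2" "\<beta> t w \<noteq> 1"
  using t perp_torsion[of 2] by (auto simp: perp_def)
 then have wc: "w \<in> TT" "w \<otimes> w = \<one>" by (auto simp: torsion_part_def pow2)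
 have "\<beta> w t * \<beta> w t = 1" using beta_mult_left[OF wc(1) wc(1) t(1)] wc t by simp
 then have e: "(\<beta> w t - 1) * (\<beta> w t + 1) = 0" by (simp add: algebra_simps)
 have "\<beta> w t \<noteq> 1" using w(2) beta_swap[OF wc(1) t(1)] by auto
 then have "hunit \<one> (\<beta> w t - 1)" using beta_unit[OF wc(1) t(1)] D_diff[OF one_closed, of "\<beta> w t" 1]
  by (auto simp: hunit_one_D)
 then have "\<beta> w t + 1 = 0" using e hunit_inv2(2) by (metis mult_zero_right)
 then show ?thesis using wc by (metis eq_neg_iff_add_eq_0)
qed

end

section \<open>Symplectic forms on the quotients of the flag\<close>

context nondegenerate_support
begin

lemma flag_space_grading: "abelian_grading (V)"
 unfolding flag_space_def by (intro abelian_grading.intro FactGroup_comm P2_subgroup)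

lemma torsion_subgroup: "subgroup (tor n) T"
proof (rule subgroupI)
 show "tor n \<subseteq> TT" by (auto simp: torsion_part_def)
 have "\<one> \<in> tor n" by (simp add: torsion_part_def)
 then show "tor n \<noteq> {}" by blast
qed (auto simp: torsion_part_def nat_pow_inv nat_pow_distrib)

lemma torsion_carrier: "t \<in> tor n \<Longrightarrow> t \<in> TT"
 by (simp add: torsion_part_def)

lemma square_P2: "t \<in> TT \<Longrightarrow> t \<otimes> t \<in> P2"
 using power_part_2_iff by blast

lemma P2_coset_square:
 assumes "s \<in> TT" "y \<in> TT"
 shows "P2 #> (y \<otimes> y \<otimes> s) = P2 #> s" "P2 #> (s \<otimes> (y \<otimes> y)) = P2 #> s"
proof -
 have "y \<otimes> y \<otimes> s \<otimes> inv s \<in> P2" using assms square_P2 by (simp add: m_assoc)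
 then show "P2 #> (y \<otimes> y \<otimes> s) = P2 #> s" using coset_eq_iff[OF P2_subgroup] assms by simp
 then show "P2 #> (s \<otimes> (y \<otimes> y)) = P2 #> s" using assms by (simp add: m_comm)
qed

lemma P2_coset_eq:
 assumes "s \<in> TT" "t \<in> TT"
 shows "P2 #> s = P2 #> t \<longleftrightarrow> (\<exists>y\<in>TT. s = t \<otimes> (y \<otimes> y))"
proof
 assume "P2 #> s = P2 #> t"
 then have "s \<otimes> inv t \<in> P2" using coset_eq_iff[OF P2_subgroup assms] by simp
 then obtain y where y: "y \<in> TT" "s \<otimes> inv t = y \<otimes> y" using power_part_2_iff by blast
 then have "s = t \<otimes> (y \<otimes> y)" using assms by (metis inv_solve_right' m_closed m_comm)
 then show "\<exists>y\<in>TT. s = t \<otimes> (y \<otimes> y)" using y by blast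
qed (use assms P2_coset_square in auto)

lemma flag_carrier: "X \<in> carrier (V) \<longleftrightarrow> (\<exists>t\<in>TT. X = P2 #> t)"
 unfolding flag_space_def by (rule carrier_FactGroup)

lemma flag_mult: "s \<in> TT \<Longrightarrow> t \<in> TT \<Longrightarrow> (P2 #> s) \<otimes>\<^bsub>V\<^esub> (P2 #> t) = P2 #> (s \<otimes> t)"
 unfolding flag_space_def by (rule FactGroup_mult[OF P2_subgroup])

lemma flag_part_iff:
 assumes "s \<in> TT"
 shows "P2 #> s \<in> flag_part T i \<longleftrightarrow> (\<exists>x\<in>tor2 i. P2 #> s = P2 #> x)"
 by (auto simp: flag_part_def)

lemma flag_part_subgroup: "subgroup (flag_part T i) (V)"
proof -
 interpret V: abelian_grading "V" by (rule flag_space_grading)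
 interpret q: group_hom T "V" "\<lambda>t. P2 #> t"
  by unfold_locales (auto intro!: homI simp: flag_mult flag_carrier)
 show ?thesis unfolding flag_part_def by (rule q.subgroup_img_is_subgroup[OF torsion_subgroup])
qed

lemma flag_class_eq:
 assumes "s \<in> TT" "t \<in> TT"
 shows "flag_class T i s = flag_class T i t \<longleftrightarrow>
  (\<exists>x\<in>tor2 (i - 1). \<exists>y\<in>TT. s = x \<otimes> t \<otimes> (y \<otimes> y))"
proof -
 interpret V: abelian_grading "V" by (rule flag_space_grading)
 have c: "P2 #> s \<in> carrier (V)" "P2 #> t \<in> carrier (V)" using assms flag_carrier by blast+
 have "flag_class T i s = flag_class T i t \<longleftrightarrow>
   (P2 #> s) \<otimes>\<^bsub>V\<^esub> inv\<^bsub>V\<^esub> (P2 #> t) \<in> flag_part T (i - 1)"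
  unfolding flag_class_def by (rule V.coset_eq_iff[OF flag_part_subgroup c])
 also have "\<dots> \<longleftrightarrow> (\<exists>x\<in>tor2 (i - 1). (P2 #> s) \<otimes>\<^bsub>V\<^esub> inv\<^bsub>V\<^esub> (P2 #> t) = P2 #> x)"
  by (auto simp: flag_part_def)
 also have "\<dots> \<longleftrightarrow> (\<exists>x\<in>tor2 (i - 1). P2 #> s = P2 #> (x \<otimes> t))"
 proof (rule bex_cong[OF refl])
  fix x assume x: "x \<in> tor2 (i - 1)"
  have xc: "P2 #> x \<in> carrier (V)" using torsion_carrier[OF x] flag_carrier by blast
  show "(P2 #> s) \<otimes>\<^bsub>V\<^esub> inv\<^bsub>V\<^esub> (P2 #> t) = P2 #> x \<longleftrightarrow> P2 #> s = P2 #> (x \<otimes> t)"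
   unfolding flag_mult[OF torsion_carrier[OF x] assms(2), symmetric] using c xc by (metis V.inv_solve_right')
 qed
 also have "\<dots> \<longleftrightarrow> (\<exists>x\<in>tor2 (i - 1). \<exists>y\<in>TT. s = x \<otimes> t \<otimes> (y \<otimes> y))"
  by (rule bex_cong[OF refl], rule P2_coset_eq) (use assms torsion_carrier in auto)
 finally show ?thesis .
qed

lemma pow_double: "t \<in> TT \<Longrightarrow> i \<ge> 1 \<Longrightarrow> (t \<otimes> t) [^] ((2::nat) ^ (i - 1)) = t [^] ((2::nat) ^ i)"
proof -
 assume t: "t \<in> TT" and i: "i \<ge> 1"
 have e: "(2::nat) ^ i = 2 * 2 ^ (i - 1)" using i by (cases i) auto
 have "t \<otimes> t = t [^] (2::nat)" using pow2[OF t] by simp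
 then show "(t \<otimes> t) [^] ((2::nat) ^ (i - 1)) = t [^] ((2::nat) ^ i)" unfolding e using t by (simp add: nat_pow_pow)
qed

abbreviation bpow :: "nat \<Rightarrow> 't \<Rightarrow> 't \<Rightarrow> 'd" where
 "bpow i s t \<equiv> \<beta> s t ^ (2 ^ (i - 1))"

lemma bpow_mult:
 assumes "s \<in> TT" "t \<in> TT" "u \<in> TT"
 shows "bpow i (s \<otimes> t) u = bpow i s u * bpow i t u" "bpow i u (s \<otimes> t) = bpow i u s * bpow i u t"
proof -
 show "bpow i (s \<otimes> t) u = bpow i s u * bpow i t u"
  unfolding beta_pow_right[OF assms(3) m_closed[OF assms(1,2)], symmetric] beta_pow_right[OF assms(3,1), symmetric]
   beta_pow_right[OF assms(3,2), symmetric] using assms by (simp add: beta_mult_left)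
 show "bpow i u (s \<otimes> t) = bpow i u s * bpow i u t"
  unfolding beta_pow_left[OF assms(3) m_closed[OF assms(1,2)], symmetric] beta_pow_left[OF assms(3,1), symmetric]
   beta_pow_left[OF assms(3,2), symmetric] using assms by (simp add: beta_mult_right)
qed

lemma bpow_torsion:
 assumes "s \<in> tor2 (i - 1)" "t \<in> TT"
 shows "bpow i s t = 1" "bpow i t s = 1"
proof -
 show "bpow i s t = 1" using assms by (simp add: beta_pow_left[symmetric] torsion_part_def)
 show "bpow i t s = 1" using assms by (simp add: beta_pow_right[symmetric] torsion_part_def)
qed

text \<open>The square can be moved from \<open>y\<close> to \<open>s\<close>, and the square of
  \<open>s\<close> is killed by the exponent \<open>2 ^ (i - 1)\<close>.\<close>

lemma bpow_square:
 assumes "i \<ge> 1" "s \<in> tor2 i" "y \<in> TT"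
 shows "bpow i s (y \<otimes> y) = 1" "bpow i (y \<otimes> y) s = 1"
proof -
 have sc: "s \<in> TT" using assms(2) by (rule torsion_carrier)
 have ss: "(s \<otimes> s) [^] ((2::nat) ^ (i - 1)) = \<one>" using pow_double[OF sc assms(1)] assms(2) by (simp add: torsion_part_def)
 have "bpow i s (y \<otimes> y) = bpow i (s \<otimes> s) y" using bpow_mult sc assms by simp
 also have "\<dots> = 1" using beta_pow_left[of "s \<otimes> s" y "2 ^ (i - 1)"] sc assms ss by simp
 finally show "bpow i s (y \<otimes> y) = 1" .
 have "bpow i (y \<otimes> y) s = bpow i y (s \<otimes> s)" using bpow_mult sc assms by simp
 also have "\<dots> = 1" using beta_pow_right[of "s \<otimes> s" y "2 ^ (i - 1)"] sc assms ss by simp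
 finally show "bpow i (y \<otimes> y) s = 1" .
qed

lemma sign_of_square:
 assumes "hunit \<one> l" "l * l = 1"
 shows "l = 1 \<or> l = -1"
proof (rule ccontr)
 assume n: "\<not> (l = 1 \<or> l = -1)"
 have e: "(l - 1) * (l + 1) = 0" using assms(2) by (simp add: algebra_simps)
 have "hunit \<one> (l - 1)" using assms n D_diff[OF one_closed, of l 1] by (auto simp: hunit_one_D)
 then have "l + 1 = 0" using e hunit_inv2(2) by (metis mult_zero_right)
 then show False using n by (metis eq_neg_iff_add_eq_0)
qed

lemma bpow_sign:
 assumes "i \<ge> 1" "s \<in> tor2 i" "t \<in> TT"
 shows "bpow i s t = 1 \<or> bpow i s t = -1"
proof (rule sign_of_square)
 have sc: "s \<in> TT" using assms(2) by (rule torsion_carrier)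
 have "hunit (\<one> [^] ((2::nat) ^ (i - 1))) (bpow i s t)" using hunit_pow beta_unit sc assms(3) by blast
 then show "hunit \<one> (bpow i s t)" by simp
 show "bpow i s t * bpow i s t = 1" using bpow_square(1)[OF assms] bpow_mult(2) sc assms(3) by simp
qed

text \<open>Within a class, representatives differ by torsion of the previous level and by squares,
  and the form is blind to both.\<close>

lemma bpow_class:
 assumes i: "i \<ge> 1" and s: "s \<in> tor2 i" "s' \<in> tor2 i" "flag_class T i s' = flag_class T i s"
  and t: "t \<in> tor2 i" "t' \<in> tor2 i" "flag_class T i t' = flag_class T i t"
 shows "bpow i s' t' = bpow i s t"
proof -
 have c: "s \<in> TT" "s' \<in> TT" "t \<in> TT" "t' \<in> TT" using s t torsion_carrier by auto
 obtain x y where x: "x \<in> tor2 (i - 1)" "y \<in> TT" "s' = x \<otimes> s \<otimes> (y \<otimes> y)"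
  using flag_class_eq[OF c(2,1)] s(3) by blast
 obtain z w where z: "z \<in> tor2 (i - 1)" "w \<in> TT" "t' = z \<otimes> t \<otimes> (w \<otimes> w)"
  using flag_class_eq[OF c(4,3)] t(3) by blast
 have xz: "x \<in> TT" "z \<in> TT" using x z torsion_carrier by auto
 have "bpow i s' t' = bpow i (x \<otimes> s) t' * bpow i (y \<otimes> y) t'" unfolding x(3) by (rule bpow_mult) (use c x xz in auto)
 also have "bpow i (y \<otimes> y) t' = 1" by (rule bpow_square(2)[OF i t(2) x(2)])
 also have "bpow i (x \<otimes> s) t' = bpow i x t' * bpow i s t'" by (rule bpow_mult) (use c x xz in auto)
 also have "bpow i x t' = 1" by (rule bpow_torsion(1)[OF x(1) c(4)])
 also have "bpow i s t' = bpow i s (z \<otimes> t) * bpow i s (w \<otimes> w)" unfolding z(3) by (rule bpow_mult) (use c z xz in auto)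
 also have "bpow i s (w \<otimes> w) = 1" by (rule bpow_square(1)[OF i s(1) z(2)])
 also have "bpow i s (z \<otimes> t) = bpow i s z * bpow i s t" by (rule bpow_mult) (use c z xz in auto)
 also have "bpow i s z = 1" by (rule bpow_torsion(2)[OF z(1) c(1)])
 finally show ?thesis by simp
qed

lemma flag_form_eq:
 assumes i: "i \<ge> 1" and s: "s \<in> tor2 i" and t: "t \<in> tor2 i"
 shows "flag_form T D i (flag_class T i s) (flag_class T i t) = bpow i s t"
proof -
 have "{beta T D s' t' ^ (2 ^ (i - 1)) | s' t'. s' \<in> tor2 i \<and> t' \<in> tor2 i \<and>
   flag_class T i s' = flag_class T i s \<and> flag_class T i t' = flag_class T i t} = {bpow i s t}"
  using bpow_class[OF i s _ _ t] s t by blast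
 then show ?thesis by (simp add: flag_form_def)
qed

lemma flag_quotient_carrier: "X \<in> carrier (flag_quotient T i) \<longleftrightarrow> (\<exists>s\<in>tor2 i. X = flag_class T i s)"
 by (auto simp: flag_quotient_def FactGroup_def RCOSETS_def flag_part_def flag_class_def r_coset_def)

lemma flag_quotient_mult:
 assumes "s \<in> TT" "t \<in> TT"
 shows "flag_class T i s \<otimes>\<^bsub>flag_quotient T i\<^esub> flag_class T i t = flag_class T i (s \<otimes> t)"
proof -
 interpret V: abelian_grading "V" by (rule flag_space_grading)
 have c: "P2 #> s \<in> carrier (V)" "P2 #> t \<in> carrier (V)" using assms flag_carrier by blast+
 have "flag_class T i s \<otimes>\<^bsub>flag_quotient T i\<^esub> flag_class T i t = flag_class T i s \<otimes>\<^bsub>V Mod flag_part T (i - 1)\<^esub> flag_class T i t"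
  by (simp add: flag_quotient_def FactGroup_def set_mult_def)
 also have "\<dots> = flag_class T i (s \<otimes> t)"
  unfolding flag_class_def V.FactGroup_mult[OF flag_part_subgroup c] flag_mult[OF assms] ..
 finally show ?thesis .
qed

lemma flag_class_one: "flag_class T i \<one> = \<one>\<^bsub>flag_quotient T i\<^esub>"
proof -
 interpret V: abelian_grading "V" by (rule flag_space_grading)
 have "P2 #> \<one> = \<one>\<^bsub>V\<^esub>"
  using coset_eq_self[OF P2_subgroup one_closed] subgroup.one_closed[OF P2_subgroup] FactGroup_one[of P2]
  by (simp add: flag_space_def)
 then show ?thesis using V.coset_mult_one[of "flag_part T (i - 1)"] subgroup.subset[OF flag_part_subgroup]
  by (simp add: flag_class_def flag_quotient_def)
qed

lemma flag_symplectic: "flag_forms_symplectic T D"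
 unfolding flag_forms_symplectic_def
proof (intro allI impI conjI ballI)
 fix i assume "nontrivial_step T i"
 then have i: "i \<ge> 1" by (simp add: nontrivial_step_def)
 let ?F = "flag_form T D i" and ?Q = "flag_quotient T i" and ?c = "flag_class T i"
 note ff = flag_form_eq[OF i]
 show "?F (?c s) (?c t) = bpow i s t" if "s \<in> tor2 i" "t \<in> tor2 i" for s t
  using ff that .
 note tm = subgroup.m_closed[OF torsion_subgroup]
 show "alternating_bicharacter ?Q {1, -1} ?F"
  unfolding alternating_bicharacter_def
 proof (intro conjI ballI)
  fix X Y assume XY: "X \<in> carrier ?Q" "Y \<in> carrier ?Q"
  then obtain s t where st: "s \<in> tor2 i" "X = ?c s" "t \<in> tor2 i" "Y = ?c t"
   unfolding flag_quotient_carrier by metis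
  note c = torsion_carrier[OF st(1)] torsion_carrier[OF st(3)]
  show "?F X Y \<in> {1, -1} - {0}" unfolding st(2,4) ff[OF st(1,3)] using bpow_sign[OF i st(1) c(2)] by auto
  fix Z assume "Z \<in> carrier ?Q"
  then obtain u where u: "u \<in> tor2 i" "Z = ?c u" unfolding flag_quotient_carrier by metis
  note cu = torsion_carrier[OF u(1)]
  show "?F (X \<otimes>\<^bsub>?Q\<^esub> Y) Z = ?F X Z * ?F Y Z"
   unfolding st(2,4) u(2) flag_quotient_mult[OF c] ff[OF st(1) u(1)] ff[OF st(3) u(1)] ff[OF tm[OF st(1,3)] u(1)]
   by (rule bpow_mult(1)[OF c cu])
  show "?F Z (X \<otimes>\<^bsub>?Q\<^esub> Y) = ?F Z X * ?F Z Y"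
   unfolding st(2,4) u(2) flag_quotient_mult[OF c] ff[OF u(1) st(1)] ff[OF u(1) st(3)] ff[OF u(1) tm[OF st(1,3)]]
   by (rule bpow_mult(2)[OF c cu])
 next
  fix X assume "X \<in> carrier ?Q"
  then obtain s where s: "s \<in> tor2 i" "X = ?c s" unfolding flag_quotient_carrier by metis
  show "?F X X = 1" unfolding s(2) ff[OF s(1,1)] using torsion_carrier[OF s(1)] by simp
 qed
 show "nondegenerate ?Q ?F"
  unfolding nondegenerate_def
 proof (intro ballI impI)
  fix X assume X: "X \<in> carrier ?Q" and all: "\<forall>Y\<in>carrier ?Q. ?F X Y = 1"
  obtain s where s: "s \<in> tor2 i" "X = ?c s" using X unfolding flag_quotient_carrier by metis
  have sc: "s \<in> TT" using torsion_carrier[OF s(1)] .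
  have "\<beta> (s [^] ((2::nat) ^ (i - 1))) t = 1" if t: "t \<in> tor2 i" for t
  proof -
   have "?F X (?c t) = 1" using all t flag_quotient_carrier by blast
   then show ?thesis unfolding s(2) ff[OF s(1) t] using beta_pow_left[OF sc torsion_carrier[OF t]] by simp
  qed
  \<comment> \<open>By duality this power of \<open>s\<close> is the \<open>2 ^ i\<close>-th power
    of some \<open>y\<close>. Dividing \<open>s\<close> by the square of \<open>y\<close> leaves an
    element killed by \<open>2 ^ (i - 1)\<close>, so the class of \<open>s\<close> is
    trivial.\<close>
  then have "s [^] ((2::nat) ^ (i - 1)) \<in> perp (tor2 i)" using sc by (auto simp: perp_def)
  then obtain y where y: "y \<in> TT" "s [^] ((2::nat) ^ (i - 1)) = y [^] ((2::nat) ^ i)"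
   unfolding perp_torsion power_part_def by blast
  define x where "x = s \<otimes> inv (y \<otimes> y)"
  have xc: "x \<in> TT" using sc y by (simp add: x_def)
  have "x [^] ((2::nat) ^ (i - 1)) = s [^] ((2::nat) ^ (i - 1)) \<otimes> inv ((y \<otimes> y) [^] ((2::nat) ^ (i - 1)))"
   using sc y by (simp add: x_def nat_pow_distrib nat_pow_inv)
  also have "\<dots> = \<one>" using pow_double[OF y(1) i] y by simp
  finally have "x \<in> tor2 (i - 1)" using xc by (simp add: torsion_part_def)
  moreover have "s = x \<otimes> \<one> \<otimes> (y \<otimes> y)" using sc y by (simp add: x_def m_assoc)
  ultimately have "?c s = ?c \<one>" using flag_class_eq[OF sc one_closed] y(1) by blast
  then show "X = \<one>\<^bsub>?Q\<^esub>" using s flag_class_one by simp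
 qed
qed

end

section \<open>The stabilizer of the flag and of its forms\<close>

context nondegenerate_support
begin

text \<open>Membership in the stabilizer, read on representatives in \<open>T\<close>. The trivial
  steps of the flag, on which the definition imposes nothing, are included.\<close>

lemma flag_stabilizer_facts:
 assumes g: "h \<in> flag_stabilizer T D"
 shows "h \<in> carrier (AutoGroup (V))"
  "t \<in> tor2 i \<Longrightarrow> t' \<in> TT \<Longrightarrow> h (P2 #> t) = P2 #> t' \<Longrightarrow> \<exists>x\<in>tor2 i. P2 #> t' = P2 #> x"
  "i \<ge> 1 \<Longrightarrow> s \<in> tor2 i \<Longrightarrow> s' \<in> tor2 i \<Longrightarrow> h (P2 #> s) = P2 #> s' \<Longrightarrow>
   t \<in> tor2 i \<Longrightarrow> t' \<in> tor2 i \<Longrightarrow> h (P2 #> t) = P2 #> t' \<Longrightarrow> bpow i s' t' = bpow i s t"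
proof -
 interpret V: abelian_grading "V" by (rule flag_space_grading)
 show A: "h \<in> carrier (AutoGroup (V))" using g by (simp add: flag_stabilizer_def)
 have img: "h ` flag_part T i = flag_part T i" for i using g by (simp add: flag_stabilizer_def)
 show "\<exists>x\<in>tor2 i. P2 #> t' = P2 #> x"
  if "t \<in> tor2 i" "t' \<in> TT" "h (P2 #> t) = P2 #> t'"
 proof -
  have "P2 #> t \<in> flag_part T i" using that(1) by (auto simp: flag_part_def)
  then have "P2 #> t' \<in> flag_part T i" using img[of i] that(3) by (metis imageI)
  then show ?thesis using flag_part_iff[OF that(2)] by blast
 qed
 assume i: "i \<ge> 1" and s: "s \<in> tor2 i" "s' \<in> tor2 i" "h (P2 #> s) = P2 #> s'"
   and t: "t \<in> tor2 i" "t' \<in> tor2 i" "h (P2 #> t) = P2 #> t'"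
 show "bpow i s' t' = bpow i s t"
 proof (cases "nontrivial_step T i")
  case True
  have cl: "h ` flag_class T i x = flag_class T i x'" if x: "x \<in> tor2 i" "h (P2 #> x) = P2 #> x'" for x x'
  proof -
   have "P2 #> x \<in> carrier (V)" using torsion_carrier[OF x(1)] flag_carrier by blast
   then show ?thesis
    using V.coset_image[OF flag_part_subgroup[of "i - 1"] _ img[of "i - 1"], of "P2 #> x"] A x(2)
    by (simp add: flag_class_def coset_action_def V.AutoGroup_iff)
  qed
  have "flag_form T D i (h ` flag_class T i s) (h ` flag_class T i t) = flag_form T D i (flag_class T i s) (flag_class T i t)"
  proof -
   have "\<forall>X\<in>carrier (flag_quotient T i). \<forall>Y\<in>carrier (flag_quotient T i).
      flag_form T D i (h ` X) (h ` Y) = flag_form T D i X Y" using g True by (simp add: flag_stabilizer_def)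
   moreover have "flag_class T i s \<in> carrier (flag_quotient T i)" "flag_class T i t \<in> carrier (flag_quotient T i)"
    unfolding flag_quotient_carrier using s(1) t(1) by blast+
   ultimately show ?thesis by blast
  qed
  then show ?thesis unfolding cl[OF s(1,3)] cl[OF t(1,3)] flag_form_eq[OF i s(2) t(2)] flag_form_eq[OF i s(1) t(1)] .
 next
  case False
  \<comment> \<open>A trivial step has a single class, so the form is constant there.\<close>
  have "flag_class T i x = flag_class T i \<one>" if x: "x \<in> tor2 i" for x
  proof -
   have "P2 #> x \<in> flag_part T (i - 1)" using False i x by (auto simp: nontrivial_step_def flag_part_def)
   then have "P2 #> x \<in> flag_part T (i - 1)" "P2 #> x \<in> carrier (V)"
    using subgroup.subset[OF flag_part_subgroup] by auto
   then have "flag_class T i x = flag_part T (i - 1)"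
    unfolding flag_class_def using V.coset_eq_self[OF flag_part_subgroup] by blast
   also have "\<dots> = flag_class T i \<one>" by (simp add: flag_class_one flag_quotient_def)
   finally show ?thesis .
  qed
  then have "bpow i x y = bpow i \<one> \<one>" if "x \<in> tor2 i" "y \<in> tor2 i" for x y
   using bpow_class[OF i _ that(1) _ _ that(2)] subgroup.one_closed[OF torsion_subgroup] that by blast
  then show ?thesis using s t by metis
 qed
qed

lemma torsion_image:
 assumes a: "g \<in> carrier (AutoGroup T)"
 shows "g ` tor n = tor n"
proof -
 have h: "g \<in> hom T T" "inj_on g TT" using a by (auto simp: AutoGroup_iff bij_betw_def)
 interpret h: group_hom T T g by unfold_locales (rule h(1))
 have sub: "tor n \<subseteq> TT" by (auto simp: torsion_part_def)
 show ?thesis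
 proof (rule endo_inj_surj)
  show "finite (tor n)" using sub finite_carrier finite_subset by blast
  show "inj_on g (tor n)" using h(2) sub inj_on_subset by blast
  show "g ` tor n \<subseteq> tor n" by (auto simp: torsion_part_def h.hom_nat_pow[symmetric])
 qed
qed

lemma P2_image:
 assumes a: "g \<in> carrier (AutoGroup T)"
 shows "g ` P2 = P2"
proof -
 have h: "g \<in> hom T T" "inj_on g TT" using a by (auto simp: AutoGroup_iff bij_betw_def)
 interpret h: group_hom T T g by unfold_locales (rule h(1))
 show ?thesis
 proof (rule endo_inj_surj)
  show "finite P2" using subgroup.subset[OF P2_subgroup] finite_carrier finite_subset by blast
  show "inj_on g P2" using h(2) subgroup.subset[OF P2_subgroup] inj_on_subset by blast
  show "g ` P2 \<subseteq> P2"
  proof (rule image_subsetI)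
   fix x assume "x \<in> P2"
   then obtain y where "y \<in> TT" "x = y \<otimes> y" using power_part_2_iff by blast
   then show "g x \<in> P2" using square_P2[of "g y"] by simp
  qed
 qed
qed

text \<open>Only the powers \<open>bpow\<close> have to be preserved, not \<beta> itself; this
  admits degree maps of automorphisms that conjugate the neutral component.\<close>

lemma flag_stabilizerI:
 assumes a: "h \<in> carrier (AutoGroup T)"
  and b: "\<And>i s t. i \<ge> 1 \<Longrightarrow> s \<in> tor2 i \<Longrightarrow> t \<in> tor2 i \<Longrightarrow> bpow i (h s) (h t) = bpow i s t"
 shows "restrict (coset_action h) (carrier (V)) \<in> flag_stabilizer T D"
  and "t \<in> TT \<Longrightarrow> restrict (coset_action h) (carrier (V)) (P2 #> t) = P2 #> h t"
proof -
 interpret V: abelian_grading "V" by (rule flag_space_grading)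
 let ?a = "restrict (coset_action h) (carrier (V))"
 have hom: "h \<in> hom T T" using a by (simp add: AutoGroup_iff)
 have act: "?a (P2 #> t) = P2 #> h t" if t: "t \<in> TT" for t
 proof -
  have "P2 #> t \<in> carrier (V)" using t flag_carrier by blast
  then show ?thesis using coset_image[OF P2_subgroup hom P2_image[OF a] t] by simp
 qed
 then show "t \<in> TT \<Longrightarrow> ?a (P2 #> t) = P2 #> h t" .
 have A: "?a \<in> carrier (AutoGroup (V))"
  unfolding flag_space_def by (rule induced_AutoGroup[OF P2_subgroup a P2_image[OF a]])
 have img: "?a ` flag_part T i = flag_part T i" for i
 proof -
  have "?a ` flag_part T i = (\<lambda>t. P2 #> h t) ` tor2 i"
   unfolding flag_part_def image_image by (rule image_cong[OF refl]) (use act torsion_carrier in blast)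
  also have "\<dots> = (\<lambda>t. P2 #> t) ` h ` tor2 i" by (simp add: image_image)
  finally show ?thesis unfolding torsion_image[OF a] flag_part_def .
 qed
 have cl: "?a ` flag_class T i x = flag_class T i (h x)" if x: "x \<in> TT" for i x
 proof -
  have "P2 #> x \<in> carrier (V)" using x flag_carrier by blast
  then show ?thesis
   using V.coset_image[OF flag_part_subgroup[of "i - 1"] _ img[of "i - 1"], of "P2 #> x"] A act[OF x]
   by (simp add: flag_class_def coset_action_def V.AutoGroup_iff del: restrict_apply)
 qed
 show "?a \<in> flag_stabilizer T D"
  unfolding flag_stabilizer_def
 proof (intro CollectI conjI allI impI ballI A img)
  fix i X Y assume "nontrivial_step T i" and XY: "X \<in> carrier (flag_quotient T i)" "Y \<in> carrier (flag_quotient T i)"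
  then have i: "i \<ge> 1" by (simp add: nontrivial_step_def)
  obtain s t where st: "s \<in> tor2 i" "X = flag_class T i s" "t \<in> tor2 i" "Y = flag_class T i t"
   using XY unfolding flag_quotient_carrier by metis
  have m: "h s \<in> tor2 i" "h t \<in> tor2 i" using torsion_image[OF a, of "2 ^ i"] st by blast+
  show "flag_form T D i (?a ` X) (?a ` Y) = flag_form T D i X Y"
   unfolding st(2,4) cl[OF torsion_carrier[OF st(1)]] cl[OF torsion_carrier[OF st(3)]] flag_form_eq[OF i m] flag_form_eq[OF i st(1,3)]
   by (rule b[OF i st(1,3)])
 qed
qed

text \<open>\<open>z\<close> is a primitive root of unity of order \<open>2 ^ Suc m\<close>. Descend
  by squaring: if the square of \<open>w\<close> is a power of the square of \<open>z\<close>, then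
  \<open>w\<close> is the corresponding power of \<open>z\<close> up to sign, and -1 is itself a
  power of \<open>z\<close>.\<close>

lemma root_of_unity_power:
 assumes "hunit \<one> z" "hunit \<one> w" "z ^ (2 ^ m) = -1" "w ^ (2 ^ Suc m) = 1"
 shows "\<exists>k. w = z ^ k"
 using assms
proof (induction m arbitrary: z w)
 case 0
 then have "z = -1" "w = 1 \<or> w = -1" using sign_of_square[of w] by (simp_all add: power2_eq_square)
 then show ?case by (metis power_0 power_one_right)
next
 case (Suc m)
 have sq: "x ^ (2 ^ Suc l) = (x * x) ^ (2 ^ l)" for x :: 'd and l by (simp add: power_mult power2_eq_square)
 have "\<exists>k. w * w = (z * z) ^ k"
 proof (rule Suc.IH)
  show "hunit \<one> (z * z)" "hunit \<one> (w * w)"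
   using hunit_mult[OF Suc.prems(1,1)] hunit_mult[OF Suc.prems(2,2)] by simp_all
  show "(z * z) ^ 2 ^ m = - 1" using Suc.prems(3) unfolding sq .
  show "(w * w) ^ 2 ^ Suc m = 1" using Suc.prems(4) unfolding sq[of w "Suc m"] .
 qed
 then obtain k where k: "w * w = (z * z) ^ k" by blast
 have zk: "hunit \<one> (z ^ k)" using hunit_pow[OF Suc.prems(1), of k] by simp
 define q where "q = w * hinv (z ^ k)"
 have hk: "hunit \<one> (hinv (z ^ k))" using hunit_hinv[OF zk] by simp
 have hq: "hunit \<one> q" using hunit_mult[OF Suc.prems(2) hk] by (simp add: q_def)
 have "(z * z) ^ k = z ^ k * z ^ k" by (simp add: power_mult_distrib power_commuting_commutes flip: power_add power_mult power2_eq_square) (simp add: mult_2 mult.commute power_mult[symmetric])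
 then have kk: "w * w = z ^ k * z ^ k" using k by simp
 have "q * q = (w * w) * (hinv (z ^ k) * hinv (z ^ k))"
  unfolding q_def using hunit_central[OF hk, of w] by (metis mult.assoc)
 also have "\<dots> = 1" unfolding kk using hunit_inv[OF zk] by (metis mult.assoc mult_1)
 finally have "q = 1 \<or> q = -1" using sign_of_square[OF hq] by blast
 moreover have "w = q * z ^ k" unfolding q_def using hunit_inv[OF zk] by (simp add: mult.assoc)
 ultimately have "w = z ^ k \<or> w = z ^ (2 ^ Suc m + k)" using Suc.prems(3) by (auto simp: power_add)
 then show ?case by blast
qed

lemma bpow_swap:
 assumes c: "a \<in> TT" "b \<in> TT" and ab: "bpow n a b = -1"
 shows "bpow n b a = -1"
proof -
 have "bpow n a b * bpow n b a = \<beta> a (b [^] ((2::nat) ^ (n - 1))) * \<beta> (b [^] ((2::nat) ^ (n - 1))) a"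
  using c by (simp add: beta_pow_left beta_pow_right)
 also have "\<dots> = 1" using c by (intro beta_swap) auto
 finally have "- bpow n b a = 1" unfolding ab by simp
 then show ?thesis by (metis minus_minus)
qed

text \<open>By \<open>ab\<close> the values \<open>\<beta> a b\<close> and
  \<open>\<beta> b a\<close> are primitive roots of unity of order \<open>2 ^ n\<close>, so \<beta>
  of \<open>r\<close> with \<open>b\<close> and with \<open>a\<close> are powers of them. Dividing
  \<open>r\<close> by the corresponding powers of \<open>a\<close> and \<open>b\<close> leaves the
  orthogonal part. The exponents are recorded because \<open>partial_lift_extend\<close> needs their
  parity.\<close>

lemma hyperbolic_split:
 assumes n: "n \<ge> 1" and a: "a \<in> tor2 n" and b: "b \<in> tor2 n" and ab: "bpow n a b = -1"
  and r: "r \<in> TT"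
 obtains i j r' where "r' \<in> TT" "r = a [^] (i::nat) \<otimes> b [^] (j::nat) \<otimes> r'" "\<beta> r' a = 1" "\<beta> r' b = 1"
  "\<And>s. s \<in> TT \<Longrightarrow> \<beta> a s = 1 \<Longrightarrow> \<beta> b s = 1 \<Longrightarrow> \<beta> r s = 1 \<Longrightarrow> \<beta> r' s = 1"
  "\<beta> r b = \<beta> a b ^ i" "\<beta> r a = \<beta> b a ^ j"
proof -
 note c = torsion_carrier[OF a] torsion_carrier[OF b]
 obtain m where m: "n = Suc m" using n by (cases n) auto
 have tor: "x ^ 2 ^ Suc m = 1" if "x = \<beta> r y" "y \<in> tor2 n" for x y
  using beta_pow_right[OF torsion_carrier[OF that(2)] r, of "2 ^ n"] that r unfolding m by (simp add: torsion_part_def)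
 have ba: "bpow n b a = -1" by (rule bpow_swap[OF c ab])
 obtain i where i: "\<beta> r b = \<beta> a b ^ i"
  using root_of_unity_power[OF beta_unit[OF c] beta_unit[OF r c(2)], of m] ab tor[OF refl b] unfolding m by auto
 obtain j where j: "\<beta> r a = \<beta> b a ^ j"
  using root_of_unity_power[OF beta_unit[OF c(2,1)] beta_unit[OF r c(1)], of m] ba tor[OF refl a] unfolding m by auto
 define r' where "r' = r \<otimes> inv (a [^] i \<otimes> b [^] j)"
 have aij: "a [^] i \<otimes> b [^] j \<in> TT" using c by simp
 have rc: "r' \<in> TT" using c r by (simp add: r'_def)
 have rr: "r = a [^] i \<otimes> b [^] j \<otimes> r'" unfolding r'_def m_lcomm[OF aij r inv_closed[OF aij]] using aij r by simp
 have bexp: "\<beta> r s = \<beta> a s ^ i * \<beta> b s ^ j * \<beta> r' s" if "s \<in> TT" for s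
  using that c rc by (subst rr) (simp add: beta_mult_left beta_pow_left)
 have cancel: "l = 1" if "hunit \<one> k" "k = k * l" for k l
 proof -
  have "hinv k * k = hinv k * (k * l)" using that(2) by simp
  then show "l = 1" using hunit_inv(2)[OF that(1)] hunit_inv2(2)[OF that(1)] by simp
 qed
 show thesis
 proof (rule that[OF rc rr])
  have hp: "hunit \<one> (x ^ k)" if "hunit \<one> x" for x and k :: nat using hunit_pow[OF that, of k] by simp
  show "\<beta> r' a = 1" using bexp[OF c(1)] c j cancel[OF hp[OF beta_unit[OF c(2,1)], of j]] by simp
  show "\<beta> r' b = 1" using bexp[OF c(2)] c i cancel[OF hp[OF beta_unit[OF c], of i]] by simp
  show "\<beta> r' s = 1" if "s \<in> TT" "\<beta> a s = 1" "\<beta> b s = 1" "\<beta> r s = 1" for s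
   using bexp[OF that(1)] that by simp
 qed (fact i j)+
qed

lemma beta_hyperbolic:
 assumes "x \<in> TT" "y \<in> TT" "a \<in> TT" "b \<in> TT"
  and "\<beta> a x = 1" "\<beta> a y = 1" "\<beta> b x = 1" "\<beta> b y = 1"
 shows "\<beta> (x \<otimes> a [^] (i::nat) \<otimes> b [^] (j::nat)) (y \<otimes> a [^] (k::nat) \<otimes> b [^] (l::nat)) =
   \<beta> x y * (\<beta> b a ^ j) ^ k * (\<beta> a b ^ i) ^ l"
proof -
 have "\<beta> x a = 1" "\<beta> x b = 1" using assms beta_swap[of a x] beta_swap[of b x] by auto
 then show ?thesis using assms by (simp add: beta_mult_left beta_mult_right beta_pow_left beta_pow_right)
qed

end

section \<open>Partial lifts of a flag isometry\<close>

context nondegenerate_support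
begin

definition orth_fst :: "('t \<times> 't) set \<Rightarrow> 't \<Rightarrow> bool" where
 "orth_fst R r \<longleftrightarrow> r \<in> TT \<and> (\<forall>p\<in>R. \<beta> r (fst p) = 1)"

definition orth_snd :: "('t \<times> 't) set \<Rightarrow> 't \<Rightarrow> bool" where
 "orth_snd R r \<longleftrightarrow> r \<in> TT \<and> (\<forall>p\<in>R. \<beta> r (snd p) = 1)"

text \<open>The graph of an isometry between two orthogonal summands of \<open>T\<close> that lifts \<open>\<gamma>\<close>, such that \<open>\<gamma>\<close> matches
 the orthogonal complements, the first of which is a \<open>2\<close>-group.\<close>

definition partial_lift :: "('t set \<Rightarrow> 't set) \<Rightarrow> ('t \<times> 't) set \<Rightarrow> bool" where
 "partial_lift \<gamma> R \<longleftrightarrow> R \<subseteq> TT \<times> TT \<and> (\<one>, \<one>) \<in> R \<and>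
   (\<forall>x x' y y'. (x, x') \<in> R \<longrightarrow> (y, y') \<in> R \<longrightarrow> (x \<otimes> y, x' \<otimes> y') \<in> R \<and> \<beta> x' y' = \<beta> x y) \<and>
   (\<forall>x x'. (x, x') \<in> R \<longrightarrow> \<gamma> (P2 #> x) = P2 #> x') \<and>
   (\<forall>t\<in>TT. \<exists>x x' r. (x, x') \<in> R \<and> orth_fst R r \<and> t = x \<otimes> r) \<and>
   (\<forall>t\<in>TT. \<exists>x x' r. (x, x') \<in> R \<and> orth_snd R r \<and> t = x' \<otimes> r) \<and>
   (\<forall>x. orth_fst R x \<longrightarrow> (\<exists>x'. orth_snd R x' \<and> \<gamma> (P2 #> x) = P2 #> x')) \<and>
   (\<exists>m. \<forall>x. orth_fst R x \<longrightarrow> x [^] ((2::nat) ^ m) = \<one>)"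

context
 fixes \<gamma> R assumes g: "\<gamma> \<in> flag_stabilizer T D" and R: "partial_lift \<gamma> R"
begin

lemma R_closed: "(x, x') \<in> R \<Longrightarrow> x \<in> TT" "(x, x') \<in> R \<Longrightarrow> x' \<in> TT"
 and R_one: "(\<one>, \<one>) \<in> R"
 and R_mult: "(x, x') \<in> R \<Longrightarrow> (y, y') \<in> R \<Longrightarrow> (x \<otimes> y, x' \<otimes> y') \<in> R"
 and R_beta: "(x, x') \<in> R \<Longrightarrow> (y, y') \<in> R \<Longrightarrow> \<beta> x' y' = \<beta> x y"
 and R_coset: "(x, x') \<in> R \<Longrightarrow> \<gamma> (P2 #> x) = P2 #> x'"
 and R_match: "orth_fst R x \<Longrightarrow> \<exists>x'. orth_snd R x' \<and> \<gamma> (P2 #> x) = P2 #> x'"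
 and R_two: "\<exists>m. \<forall>x. orth_fst R x \<longrightarrow> x [^] ((2::nat) ^ m) = \<one>"
 using R unfolding partial_lift_def by blast+

lemma R_split_fst:
 assumes "t \<in> TT" obtains x x' r where "(x, x') \<in> R" "orth_fst R r" "t = x \<otimes> r"
 using R assms unfolding partial_lift_def by blast

lemma R_split_snd:
 assumes "t \<in> TT" obtains x x' r where "(x, x') \<in> R" "orth_snd R r" "t = x' \<otimes> r"
 using R assms unfolding partial_lift_def by blast

lemma orth_closed: "orth_fst R r \<Longrightarrow> r \<in> TT" "orth_snd R r \<Longrightarrow> r \<in> TT"
 by (simp_all add: orth_fst_def orth_snd_def)

lemma orth_beta:
 assumes "(x, x') \<in> R"
 shows "orth_fst R r \<Longrightarrow> \<beta> r x = 1" "orth_fst R r \<Longrightarrow> \<beta> x r = 1"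
  "orth_snd R r \<Longrightarrow> \<beta> r x' = 1" "orth_snd R r \<Longrightarrow> \<beta> x' r = 1"
proof -
 show a: "\<beta> r x = 1" if "orth_fst R r" using that assms by (auto simp: orth_fst_def)
 show b: "\<beta> r x' = 1" if "orth_snd R r" using that assms by (auto simp: orth_snd_def)
 show "\<beta> x r = 1" if "orth_fst R r" using a[OF that] beta_swap[OF orth_closed(1)[OF that] R_closed(1)[OF assms]] by simp
 show "\<beta> x' r = 1" if "orth_snd R r" using b[OF that] beta_swap[OF orth_closed(2)[OF that] R_closed(2)[OF assms]] by simp
qed

lemma orth_snd_mult: "orth_snd R r \<Longrightarrow> orth_snd R s \<Longrightarrow> orth_snd R (r \<otimes> s)"
 unfolding orth_snd_def using R_closed(2) by (auto simp: beta_mult_left) (metis mult_1 snd_conv)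

lemma orth_snd_pow: "orth_snd R r \<Longrightarrow> orth_snd R (r [^] (n::nat))"
 unfolding orth_snd_def using R_closed(2) by (auto simp: beta_pow_left)

lemma R_pow: "(x, x') \<in> R \<Longrightarrow> (x [^] (n::nat), x' [^] n) \<in> R"
 by (induction n) (auto simp: R_one R_mult)

text \<open>By \<open>kr\<close> and the choice of \<open>r\<close>, the element \<open>k'\<close>
  is orthogonal to the range of \<open>R\<close>; as a member of the range it is orthogonal to the
  complement. Together these generate \<open>T\<close>.\<close>

lemma R_snd_trivial:
 assumes k: "(k, k') \<in> R" and r: "orth_snd R r" and kr: "\<And>s s'. (s, s') \<in> R \<Longrightarrow> \<beta> (k' \<otimes> r) s' = 1"
 shows "k' = \<one>"
proof (rule nondegenerate_eq)
 note c = R_closed(2)[OF k] orth_closed(2)[OF r]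
 fix u assume u: "u \<in> TT"
 obtain s s' v where s: "(s, s') \<in> R" "orth_snd R v" "u = s' \<otimes> v" using R_split_snd[OF u] .
 have "\<beta> k' s' * \<beta> r s' = 1" using kr[OF s(1)] c R_closed(2)[OF s(1)] by (simp add: beta_mult_left)
 then have "\<beta> k' s' = 1" using orth_beta(3)[OF s(1) r] by simp
 then show "\<beta> k' u = \<beta> \<one> u" unfolding s(3) using c orth_beta(4)[OF k s(2)] R_closed(2)[OF s(1)] orth_closed(2)[OF s(2)]
  by (simp add: beta_mult_right)
qed (use R_closed[OF k] in auto)

text \<open>The flag provides a torsion representative of the image coset,
  \<open>partial_lift\<close> one in the complement, and they differ by a square. Projecting the
  torsion representative to the complement changes neither its coset nor the bound on its
  order.\<close>

lemma orth_lift: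
 assumes x: "orth_fst R x" "x \<in> tor2 n"
 obtains x' where "orth_snd R x'" "x' \<in> tor2 n" "\<gamma> (P2 #> x) = P2 #> x'"
proof -
 obtain x1 where x1: "orth_snd R x1" "\<gamma> (P2 #> x) = P2 #> x1" using R_match[OF x(1)] by blast
 obtain c where c: "c \<in> tor2 n" "P2 #> x1 = P2 #> c"
  using flag_stabilizer_facts(2)[OF g x(2) orth_closed(2)[OF x1(1)] x1(2)] by blast
 note cT = torsion_carrier[OF c(1)]
 obtain y where y: "y \<in> TT" "x1 = c \<otimes> (y \<otimes> y)" using P2_coset_eq[OF orth_closed(2)[OF x1(1)] cT] c(2) by blast
 obtain p p' r where p: "(p, p') \<in> R" "orth_snd R r" "c = p' \<otimes> r" using R_split_snd[OF cT] .
 obtain q q' w where q: "(q, q') \<in> R" "orth_snd R w" "y = q' \<otimes> w" using R_split_snd[OF y(1)] .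
 note cl = R_closed(2)[OF p(1)] R_closed(2)[OF q(1)] orth_closed(2)[OF p(2)] orth_closed(2)[OF q(2)]
 have k: "(p \<otimes> (q \<otimes> q), p' \<otimes> (q' \<otimes> q')) \<in> R" by (intro R_mult p q)
 have e: "x1 = p' \<otimes> (q' \<otimes> q') \<otimes> (r \<otimes> (w \<otimes> w))" unfolding y(2) p(3) q(3) using cl by (simp add: m_ac)
 have "p' \<otimes> (q' \<otimes> q') = \<one>"
  by (rule R_snd_trivial[OF k, of "r \<otimes> (w \<otimes> w)"])
   (use orth_beta(3)[OF _ x1(1)] in \<open>auto simp: e[symmetric] intro!: orth_snd_mult p q\<close>)
 then have "x1 = r \<otimes> (w \<otimes> w)" unfolding e using cl by simp
 then have "P2 #> x1 = P2 #> r" using P2_coset_square(2) cl by simp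
 moreover have "p' [^] ((2::nat) ^ n) \<otimes> r [^] ((2::nat) ^ n) = \<one>"
  using c(1) cl by (simp add: p(3) torsion_part_def nat_pow_distrib)
 moreover from this have "p' [^] ((2::nat) ^ n) = \<one>"
  by (intro R_snd_trivial[OF R_pow[OF p(1)] orth_snd_pow[OF p(2), of "2 ^ n"]]) (use R_closed in auto)
 ultimately have "r \<in> tor2 n" "\<gamma> (P2 #> x) = P2 #> r" using cl x1(2) by (simp_all add: torsion_part_def)
 then show thesis using that p(2) by blast
qed

lemma coset_odd_power:
 assumes "b \<in> TT" "odd k"
 shows "P2 #> b [^] (k::nat) = P2 #> b"
proof -
 obtain j where j: "k = Suc (j + j)" using assms(2) by (metis oddE mult_2 Suc_eq_plus1)
 have "b [^] k = (b [^] j \<otimes> b [^] j) \<otimes> b" unfolding j using assms(1) by (simp add: nat_pow_mult)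
 then show ?thesis using P2_coset_square(1)[of b "b [^] j"] assms(1) by simp
qed

lemma orth_hyperbolic:
 assumes "orth_fst R x0" "x0 \<noteq> \<one>"
 obtains n a b a' b' where "n \<ge> 1" "\<forall>x. orth_fst R x \<longrightarrow> x \<in> tor2 n"
  "orth_fst R a" "orth_fst R b" "orth_snd R a'" "orth_snd R b'" "a' \<in> tor2 n" "b' \<in> tor2 n"
  "\<gamma> (P2 #> a) = P2 #> a'" "\<gamma> (P2 #> b) = P2 #> b'" "bpow n a b = -1" "\<beta> a' b' = \<beta> a b"
proof -
 \<comment> \<open>Minimality of \<open>n\<close> provides an \<open>a\<close> of exact order
   \<open>2 ^ n\<close> in the complement, and nondegeneracy then a \<open>b\<close> with
   \<open>bpow n a b = -1\<close>, as \<open>hyperbolic_split\<close> requires.\<close>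
 define n where "n = (LEAST n. \<forall>x. orth_fst R x \<longrightarrow> x [^] ((2::nat) ^ n) = \<one>)"
 have n: "x [^] ((2::nat) ^ n) = \<one>" if "orth_fst R x" for x
  using LeastI_ex[OF R_two] that unfolding n_def by blast
 have tor: "x \<in> tor2 n" if "orth_fst R x" for x using n[OF that] orth_closed(1)[OF that] by (simp add: torsion_part_def)
 have n1: "n \<ge> 1"
 proof (rule ccontr)
  assume "\<not> n \<ge> 1"
  then have "n = 0" by simp
  then show False using n[OF assms(1)] orth_closed(1)[OF assms(1)] assms(2) by simp
 qed
 then have "n - 1 < n" by simp
 then obtain a where a: "orth_fst R a" "a [^] ((2::nat) ^ (n - 1)) \<noteq> \<one>" using not_less_Least unfolding n_def by blast
 note aT = orth_closed(1)[OF a(1)]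
 obtain u where u: "u \<in> TT" "\<beta> (a [^] ((2::nat) ^ (n - 1))) u \<noteq> \<beta> \<one> u"
  using nondegenerate_eq[of "a [^] ((2::nat) ^ (n - 1))" \<one>] a(2) aT by auto
 obtain x x' b where b: "(x, x') \<in> R" "orth_fst R b" "u = x \<otimes> b" using R_split_fst[OF u(1)] .
 note bT = orth_closed(1)[OF b(2)]
 have "bpow n a b \<noteq> 1"
  using u orth_beta(1)[OF b(1) a(1)] R_closed(1)[OF b(1)] bT aT by (simp add: b(3) beta_pow_left beta_mult_right)
 then have ab: "bpow n a b = -1" using bpow_sign[OF n1 tor[OF a(1)] bT] by blast
 obtain a' where a': "orth_snd R a'" "a' \<in> tor2 n" "\<gamma> (P2 #> a) = P2 #> a'" using orth_lift[OF a(1) tor[OF a(1)]] .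
 obtain b1 where b1: "orth_snd R b1" "b1 \<in> tor2 n" "\<gamma> (P2 #> b) = P2 #> b1" using orth_lift[OF b(2) tor[OF b(2)]] .
 note cT = torsion_carrier[OF a'(2)] torsion_carrier[OF b1(2)]
 \<comment> \<open>The images pair to the same sign because \<gamma> preserves the form of step
   \<open>n\<close>. Still \<open>\<beta> a' b1\<close> may be another primitive root of unity than
   \<open>\<beta> a b\<close>; an odd power of \<open>b1\<close> corrects this without leaving its
   coset.\<close>
 have ab1: "bpow n a' b1 = -1"
  using flag_stabilizer_facts(3)[OF g n1 tor[OF a(1)] a'(2,3) tor[OF b(2)] b1(2,3)] ab by simp
 obtain m where m: "n = Suc m" using n1 by (cases n) auto
 have "\<beta> a b ^ 2 ^ Suc m = 1" using beta_pow_right[OF bT aT, of "2 ^ n"] n[OF b(2)] aT unfolding m by simp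
 then obtain k where k: "\<beta> a b = \<beta> a' b1 ^ k"
  using root_of_unity_power[OF beta_unit[OF cT] beta_unit[OF aT bT], of m] ab1 unfolding m by auto
 have "bpow n a b = (bpow n a' b1) ^ k" unfolding k by (simp add: power_mult[symmetric] mult.commute)
 then have "(-1 :: 'd) = (-1) ^ k" using ab ab1 by simp
 then have "odd k" by (cases "even k") auto
 define b' where "b' = b1 [^] k"
 have "orth_snd R b'" unfolding b'_def by (rule orth_snd_pow[OF b1(1)])
 moreover have "b' \<in> tor2 n"
  unfolding b'_def using b1(2) cT(2) nat_pow_pow[OF cT(2), of k "2 ^ n"] nat_pow_pow[OF cT(2), of "2 ^ n" k]
  by (simp add: torsion_part_def mult.commute)
 moreover have "\<gamma> (P2 #> b) = P2 #> b'" unfolding b'_def coset_odd_power[OF cT(2) \<open>odd k\<close>] by (rule b1(3))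
 moreover have "\<beta> a' b' = \<beta> a b" unfolding b'_def k using cT by (simp add: beta_pow_right)
 ultimately show thesis using that n1 tor a(1) b(2) a' ab by blast
qed

end

end

context nondegenerate_support
begin

lemma stabilizer_mult:
 assumes g: "n \<in> flag_stabilizer T D" and x: "x \<in> TT" "x' \<in> TT" "n (P2 #> x) = P2 #> x'"
  and y: "y \<in> TT" "y' \<in> TT" "n (P2 #> y) = P2 #> y'"
 shows "n (P2 #> (x \<otimes> y)) = P2 #> (x' \<otimes> y')"
proof -
 have h: "n \<in> hom (V) (V)" using flag_stabilizer_facts(1)[OF g] by (simp add: AutoGroup_iff)
 have c: "P2 #> x \<in> carrier (V)" "P2 #> y \<in> carrier (V)" using x y flag_carrier by blast+
 show ?thesis using hom_mult[OF h c] unfolding flag_mult[OF x(1) y(1)] x(3) y(3) flag_mult[OF x(2) y(2)] .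
qed

lemma stabilizer_one:
 assumes g: "h \<in> flag_stabilizer T D"
 shows "h (P2 #> \<one>) = P2 #> \<one>"
proof -
 interpret V: abelian_grading "V" by (rule flag_space_grading)
 have e: "P2 #> \<one> = \<one>\<^bsub>V\<^esub>"
  using coset_eq_self[OF P2_subgroup one_closed] subgroup.one_closed[OF P2_subgroup] FactGroup_one[of P2]
  by (simp add: flag_space_def)
 have "h \<in> hom (V) (V)" using flag_stabilizer_facts(1)[OF g] by (simp add: AutoGroup_iff)
 from hom_one[OF this V.is_group V.is_group] show ?thesis unfolding e .
qed

lemma stabilizer_pow:
 assumes g: "h \<in> flag_stabilizer T D" and x: "x \<in> TT" "x' \<in> TT" "h (P2 #> x) = P2 #> x'"
 shows "h (P2 #> x [^] (n::nat)) = P2 #> x' [^] n"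
proof (induction n)
 case (Suc n)
 show ?case using stabilizer_mult[OF g _ _ Suc x] x by simp
qed (simp add: stabilizer_one[OF g])

lemma partial_lift_extend:
 assumes g: "h \<in> flag_stabilizer T D" and R: "partial_lift h R" and x0: "orth_fst R x0" "x0 \<noteq> \<one>"
 obtains R' where "partial_lift h R'" "R \<subset> R'"
proof -
 note RC = R_closed[OF g R] and R1 = R_one[OF g R] and RM = R_mult[OF g R] and RB = R_beta[OF g R]
  and oC = orth_closed[OF g R] and oB = orth_beta[OF g R]
 obtain n a b a' b' where n: "n \<ge> 1" and tor': "\<forall>x. orth_fst R x \<longrightarrow> x \<in> tor2 n"
  and o: "orth_fst R a" "orth_fst R b" "orth_snd R a'" "orth_snd R b'" and t': "a' \<in> tor2 n" "b' \<in> tor2 n"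
  and ga: "h (P2 #> a) = P2 #> a'" and gb: "h (P2 #> b) = P2 #> b'" and ab: "bpow n a b = -1" and ab': "\<beta> a' b' = \<beta> a b"
  using orth_hyperbolic[OF g R x0] .
 have tor: "x \<in> tor2 n" if "orth_fst R x" for x using tor' that by blast
 have c: "a \<in> TT" "b \<in> TT" "a' \<in> TT" "b' \<in> TT" using oC o by auto
 note tab = tor[OF o(1)] tor[OF o(2)]
 have abp: "bpow n a' b' = -1" using ab ab' by simp
 have ba': "\<beta> b' a' = \<beta> b a" using beta_swap_eq[OF c(1,2)] beta_swap_eq[OF c(3,4)] ab' by simp
 define R' where "R' = {(x \<otimes> a [^] i \<otimes> b [^] j, x' \<otimes> a' [^] i \<otimes> b' [^] j) | x x' (i::nat) (j::nat). (x, x') \<in> R}"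
 have R'I: "(x, x') \<in> R \<Longrightarrow> s = x \<otimes> a [^] i \<otimes> b [^] j \<Longrightarrow> s' = x' \<otimes> a' [^] i \<otimes> b' [^] j \<Longrightarrow> (s, s') \<in> R'" for x x' s s' and i j :: nat
  unfolding R'_def by blast
 have R'E: "\<exists>x x' i j. (x, x') \<in> R \<and> s = x \<otimes> a [^] (i::nat) \<otimes> b [^] (j::nat) \<and> s' = x' \<otimes> a' [^] i \<otimes> b' [^] j" if "(s, s') \<in> R'" for s s'
  using that unfolding R'_def by blast
 have sub: "R \<subseteq> R'"
 proof (rule subrelI)
  fix x x' assume x: "(x, x') \<in> R"
  then show "(x, x') \<in> R'" by (rule R'I[where i = 0 and j = 0]) (use RC[OF x] in auto)
 qed
 have aR': "(a, a') \<in> R'" by (rule R'I[OF R1, where i = 1 and j = 0]) (use c in auto)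
 have bR': "(b, b') \<in> R'" by (rule R'I[OF R1, where i = 0 and j = 1]) (use c in auto)
 \<comment> \<open>Otherwise 1 and -1 would coincide. So \<open>a\<close> is not orthogonal to
   \<open>b\<close> and cannot occur in \<open>R\<close>, which makes the extension proper.\<close>
 have b1: "\<beta> b a \<noteq> 1"
 proof
  assume "\<beta> b a = 1"
  then have "\<beta> a b = 1" using beta_swap[OF c(2,1)] by simp
  then have "(1::'d) = -1" using ab by simp
  then have "(2::'d) = 0" by (metis add.right_inverse one_add_one)
  then show False by simp
 qed
 then have "(a, a') \<notin> R" using oB(1)[OF _ o(2)] by blast
 then have "R \<subset> R'" using sub aR' by blast
 have ofst: "orth_fst R' r \<longleftrightarrow> orth_fst R r \<and> \<beta> r a = 1 \<and> \<beta> r b = 1" for r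
 proof
  assume r: "orth_fst R' r"
  have "\<beta> r (fst p) = 1" if "p \<in> R'" for p using r that by (auto simp: orth_fst_def)
  from this[OF aR'] this[OF bR'] show "orth_fst R r \<and> \<beta> r a = 1 \<and> \<beta> r b = 1"
   using r sub by (auto simp: orth_fst_def)
 next
  assume r: "orth_fst R r \<and> \<beta> r a = 1 \<and> \<beta> r b = 1"
  then have rc: "r \<in> TT" using oC by blast
  have "\<beta> r s = 1" if ss: "(s, s') \<in> R'" for s s'
  proof -
   obtain x x' i j where x: "(x, x') \<in> R" "s = x \<otimes> a [^] (i::nat) \<otimes> b [^] (j::nat)" using R'E[OF ss] by blast
   then show ?thesis using r rc c RC(1)[OF x(1)] oB(1)[OF x(1)] by (simp add: beta_mult_right beta_pow_right)
  qed
  then show "orth_fst R' r" using rc by (auto simp: orth_fst_def)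
 qed
 have osnd: "orth_snd R' r" if r: "orth_snd R r" "\<beta> r a' = 1" "\<beta> r b' = 1" for r
 proof -
  have rc: "r \<in> TT" using oC r by blast
  have "\<beta> r s' = 1" if ss: "(s, s') \<in> R'" for s s'
  proof -
   obtain x x' i j where x: "(x, x') \<in> R" "s' = x' \<otimes> a' [^] (i::nat) \<otimes> b' [^] (j::nat)" using R'E[OF ss] by blast
   then show ?thesis using r rc c RC(2)[OF x(1)] oB(3)[OF x(1)] by (simp add: beta_mult_right beta_pow_right)
  qed
  then show "orth_snd R' r" using rc by (auto simp: orth_snd_def)
 qed
 have orth_sub: "orth_snd R r'" if "r' \<in> TT" "\<And>s. s \<in> TT \<Longrightarrow> \<beta> a' s = 1 \<Longrightarrow> \<beta> b' s = 1 \<Longrightarrow> \<beta> r s = 1 \<Longrightarrow> \<beta> r' s = 1" "orth_snd R r" for r r'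
  unfolding orth_snd_def
 proof (intro conjI ballI that(1))
  fix p assume "p \<in> R"
  then have p: "(fst p, snd p) \<in> R" by simp
  show "\<beta> r' (snd p) = 1" by (rule that(2)[OF RC(2)[OF p] oB(3)[OF p o(3)] oB(3)[OF p o(4)] oB(3)[OF p that(3)]])
 qed
 have "partial_lift h R'"
  unfolding partial_lift_def
 proof (intro conjI allI impI ballI)
  show "R' \<subseteq> TT \<times> TT" using RC c by (auto simp: R'_def)
  show "(\<one>, \<one>) \<in> R'" using sub R1 by blast
 next
  fix s s' t t' assume "(s, s') \<in> R'" "(t, t') \<in> R'"
  then obtain x x' i j y y' k l where x: "(x, x') \<in> R" "s = x \<otimes> a [^] (i::nat) \<otimes> b [^] (j::nat)" "s' = x' \<otimes> a' [^] i \<otimes> b' [^] j"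
   and y: "(y, y') \<in> R" "t = y \<otimes> a [^] (k::nat) \<otimes> b [^] (l::nat)" "t' = y' \<otimes> a' [^] k \<otimes> b' [^] l"
   using R'E by metis
  note cl = RC[OF x(1)] RC[OF y(1)]
  show "(s \<otimes> t, s' \<otimes> t') \<in> R'"
   by (rule R'I[OF RM[OF x(1) y(1)], where i = "i + k" and j = "j + l"])
    (use cl c in \<open>simp_all add: x y nat_pow_mult[symmetric] m_ac\<close>)
  show "\<beta> s' t' = \<beta> s t"
   unfolding x(2,3) y(2,3)
    beta_hyperbolic[OF cl(1,3) c(1,2) oB(1)[OF x(1) o(1)] oB(1)[OF y(1) o(1)] oB(1)[OF x(1) o(2)] oB(1)[OF y(1) o(2)]]
    beta_hyperbolic[OF cl(2,4) c(3,4) oB(3)[OF x(1) o(3)] oB(3)[OF y(1) o(3)] oB(3)[OF x(1) o(4)] oB(3)[OF y(1) o(4)]]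
   unfolding ab' ba' RB[OF x(1) y(1)] ..
 next
  fix s s' assume "(s, s') \<in> R'"
  then obtain x x' i j where x: "(x, x') \<in> R" "s = x \<otimes> a [^] (i::nat) \<otimes> b [^] (j::nat)" "s' = x' \<otimes> a' [^] i \<otimes> b' [^] j"
   using R'E by metis
  note cl = RC[OF x(1)]
  show "h (P2 #> s) = P2 #> s'" unfolding x(2,3)
   by (intro stabilizer_mult[OF g] stabilizer_pow[OF g] m_closed nat_pow_closed c cl ga gb R_coset[OF g R x(1)])
 next
  fix t assume "t \<in> TT"
  then obtain x x' r where x: "(x, x') \<in> R" "orth_fst R r" "t = x \<otimes> r" by (rule R_split_fst[OF g R])
  note rc = oC(1)[OF x(2)]
  obtain i j r' where r': "r' \<in> TT" "r = a [^] (i::nat) \<otimes> b [^] (j::nat) \<otimes> r'" "\<beta> r' a = 1" "\<beta> r' b = 1"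
   "\<And>s. s \<in> TT \<Longrightarrow> \<beta> a s = 1 \<Longrightarrow> \<beta> b s = 1 \<Longrightarrow> \<beta> r s = 1 \<Longrightarrow> \<beta> r' s = 1"
   using hyperbolic_split[OF n tab ab rc] by metis
  have "orth_fst R r'" unfolding orth_fst_def
  proof (intro conjI ballI r'(1))
   fix p assume "p \<in> R"
   then have p: "(fst p, snd p) \<in> R" by simp
   show "\<beta> r' (fst p) = 1" by (rule r'(5)[OF RC(1)[OF p] oB(1)[OF p o(1)] oB(1)[OF p o(2)] oB(1)[OF p x(2)]])
  qed
  then have "orth_fst R' r'" using ofst r' by blast
  moreover have "(x \<otimes> a [^] i \<otimes> b [^] j, x' \<otimes> a' [^] i \<otimes> b' [^] j) \<in> R'" by (rule R'I[OF x(1) refl refl])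
  moreover have "t = x \<otimes> a [^] i \<otimes> b [^] j \<otimes> r'" unfolding x(3) r'(2) using RC[OF x(1)] c r'(1) by (simp add: m_assoc)
  ultimately show "\<exists>x x' r. (x, x') \<in> R' \<and> orth_fst R' r \<and> t = x \<otimes> r" by blast
 next
  fix t assume "t \<in> TT"
  then obtain x x' r where x: "(x, x') \<in> R" "orth_snd R r" "t = x' \<otimes> r" by (rule R_split_snd[OF g R])
  note rc = oC(2)[OF x(2)]
  obtain i j r' where r': "r' \<in> TT" "r = a' [^] (i::nat) \<otimes> b' [^] (j::nat) \<otimes> r'" "\<beta> r' a' = 1" "\<beta> r' b' = 1"
   "\<And>s. s \<in> TT \<Longrightarrow> \<beta> a' s = 1 \<Longrightarrow> \<beta> b' s = 1 \<Longrightarrow> \<beta> r s = 1 \<Longrightarrow> \<beta> r' s = 1"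
   using hyperbolic_split[OF n t' abp rc] by metis
  have "orth_snd R r'" by (rule orth_sub[OF r'(1,5) x(2)])
  then have "orth_snd R' r'" using osnd r' by blast
  moreover have "(x \<otimes> a [^] i \<otimes> b [^] j, x' \<otimes> a' [^] i \<otimes> b' [^] j) \<in> R'" by (rule R'I[OF x(1) refl refl])
  moreover have "t = x' \<otimes> a' [^] i \<otimes> b' [^] j \<otimes> r'" unfolding x(3) r'(2) using RC[OF x(1)] c r'(1) by (simp add: m_assoc)
  ultimately show "\<exists>x x' r. (x, x') \<in> R' \<and> orth_snd R' r \<and> t = x' \<otimes> r" by blast
 next
  \<comment> \<open>The smaller complements must still match under \<open>h\<close>. A match
    \<open>x'\<close> in the old complement may have components along \<open>a'\<close> and
    \<open>b'\<close>. Their exponents are even, since \<open>x\<close> is orthogonal to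
    \<open>a\<close> and \<open>b\<close> and \<open>h\<close> preserves the form, so removing them
    does not change the coset.\<close>
  fix x assume "orth_fst R' x"
  then have x: "orth_fst R x" "\<beta> x a = 1" "\<beta> x b = 1" using ofst by blast+
  obtain x' where x': "orth_snd R x'" "x' \<in> tor2 n" "h (P2 #> x) = P2 #> x'"
   using orth_lift[OF g R x(1) tor[OF x(1)]] .
  have c': "x' \<in> TT" using oC x' by blast
  obtain i j r where r: "r \<in> TT" "x' = a' [^] (i::nat) \<otimes> b' [^] (j::nat) \<otimes> r" "\<beta> r a' = 1" "\<beta> r b' = 1"
   "\<And>s. s \<in> TT \<Longrightarrow> \<beta> a' s = 1 \<Longrightarrow> \<beta> b' s = 1 \<Longrightarrow> \<beta> x' s = 1 \<Longrightarrow> \<beta> r s = 1"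
   "\<beta> x' b' = \<beta> a' b' ^ i" "\<beta> x' a' = \<beta> b' a' ^ j"
   using hyperbolic_split[OF n t' abp c'] by metis
  have par: "even l" if "(-1::'d) ^ l = 1" for l
   using that by (cases "even l") auto
  have "(bpow n a' b') ^ i = bpow n x' b'" unfolding r(6) by (simp add: power_mult[symmetric] mult.commute)
  also have "\<dots> = bpow n x b" by (rule flag_stabilizer_facts(3)[OF g n tor[OF x(1)] x'(2,3) tab(2) t'(2) gb])
  finally have "even i" unfolding abp x(3) by (intro par) simp
  have bpm: "bpow n b' a' = -1" by (rule bpow_swap[OF c(3,4) abp])
  have "(bpow n b' a') ^ j = bpow n x' a'" unfolding r(7) by (simp add: power_mult[symmetric] mult.commute)
  also have "\<dots> = bpow n x a" by (rule flag_stabilizer_facts(3)[OF g n tor[OF x(1)] x'(2,3) tab(1) t'(1) ga])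
  finally have "even j" unfolding bpm x(2) by (intro par) simp
  obtain i' j' where ij: "i = i' + i'" "j = j' + j'" using \<open>even i\<close> \<open>even j\<close> by (metis evenE mult_2)
  have "x' = (a' [^] i' \<otimes> b' [^] j') \<otimes> (a' [^] i' \<otimes> b' [^] j') \<otimes> r"
   unfolding r(2) ij using c r(1) by (simp add: nat_pow_mult[symmetric] m_ac)
  then have "P2 #> x' = P2 #> r" using P2_coset_square(1)[OF r(1), of "a' [^] i' \<otimes> b' [^] j'"] c by simp
  moreover have "orth_snd R' r" by (rule osnd[OF orth_sub[OF r(1,5) x'(1)] r(3,4)])
  ultimately show "\<exists>x'. orth_snd R' x' \<and> h (P2 #> x) = P2 #> x'" using x'(3) by auto
 next
  show "\<exists>m. \<forall>x. orth_fst R' x \<longrightarrow> x [^] ((2::nat) ^ m) = \<one>" using R_two[OF g R] ofst by blast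
 qed
 then show thesis using that \<open>R \<subset> R'\<close> by blast
qed

end

lemma two_power_odd_factor:
 assumes "(n::nat) > 0"
 obtains k m where "n = 2 ^ k * m" "odd m"
 using assms
proof (induction n arbitrary: thesis rule: less_induct)
 case (less n)
 show ?case
 proof (cases "even n")
  case True
  then obtain h where h: "n = 2 * h" by blast
  then have "h < n" "0 < h" using less.prems(2) by auto
  then obtain k m where "h = 2 ^ k * m" "odd m" using less.IH[of h] by blast
  then show ?thesis using less.prems(1)[of "Suc k" m] h by simp
 qed (use less.prems(1)[of 0 n] in simp)
qed

section \<open>Existence of lifts for all isometries of the flag\<close>

context nondegenerate_support
begin

text \<open>Elements of odd order are squares and thus invisible in the flag space, so the odd part
  of \<open>T\<close> may be lifted by the identity; its complement is a 2-group.\<close>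

lemma partial_lift_base:
 assumes g: "h \<in> flag_stabilizer T D"
 shows "\<exists>R. partial_lift h R"
proof -
 have "card TT \<noteq> 0" using finite_carrier one_closed by auto
 then obtain k o' where ko: "card TT = 2 ^ k * o'" "odd o'"
  using two_power_odd_factor[of "card TT"] by auto
 \<comment> \<open>The factor 2 beyond \<open>2 ^ k\<close> makes \<open>N\<close> even also when
   \<open>card TT\<close> is odd.\<close>
 define M where "M = (2::nat) ^ Suc k"
 have M0: "M \<noteq> 0" by (simp add: M_def)
 have "gcd M o' = 1" using ko(2) by (simp add: M_def coprime_iff_gcd_eq_1[symmetric])
 then obtain e y where ey: "M * e = o' * y + 1" using bezout_nat[OF M0, of o'] by (metis Suc_eq_plus1)
 \<comment> \<open>\<open>N\<close> is divisible by the 2-part of the group order and congruent to 1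
   modulo \<open>o'\<close>, so the \<open>N\<close>-th power is the projection to the odd part of
   \<open>T\<close>; the map \<open>f\<close> below is the complementary projection.\<close>
 define N where "N = M * e"
 have tot: "t [^] (M * o' * l) = \<one>" if t: "t \<in> TT" for t and l :: nat
 proof -
  have "M * o' * l = card TT * (2 * l)" by (simp add: M_def ko(1))
  moreover have "t [^] card TT = \<one>" by (rule power_order_eq_one[OF finite_carrier t])
  ultimately show ?thesis using nat_pow_pow[OF t, of "card TT" "2 * l"] by (simp only: nat_pow_one)
 qed
 define f where "f t = inv (t [^] (o' * y))" for t
 have fc: "f t \<in> TT" if "t \<in> TT" for t using that by (simp add: f_def)
 have split: "t = t [^] N \<otimes> f t" if t: "t \<in> TT" for t
 proof -
  have "t [^] N = t \<otimes> t [^] (o' * y)" using t by (simp add: N_def ey m_comm)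
  then show ?thesis using t by (simp add: f_def m_assoc)
 qed
 have Neven: "N = 2 * (2 ^ k * e)" by (simp add: N_def M_def)
 have NP2: "t [^] N \<in> P2" if t: "t \<in> TT" for t
 proof -
  have "t [^] N = t [^] (2 ^ k * e) \<otimes> t [^] (2 ^ k * e)" using t by (simp add: Neven nat_pow_mult mult_2)
  then show ?thesis using square_P2[of "t [^] (2 ^ k * e)"] t by simp
 qed
 have fN: "\<beta> (f t) (s [^] N) = 1" if t: "t \<in> TT" and s: "s \<in> TT" for s t
 proof -
  have "\<beta> (s [^] N) (t [^] (o' * y)) = \<beta> (s [^] (N * (o' * y))) t"
   using s t by (simp add: beta_pow_left beta_pow_right power_mult)
  also have "N * (o' * y) = M * o' * (e * y)" by (simp add: N_def mult_ac)
  finally show ?thesis using s t by (simp add: f_def beta_inv_left tot del: nat_pow_pow)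
 qed
 define R where "R = (\<lambda>t. (t [^] N, t [^] N)) ` TT"
 have of: "orth_fst R r \<longleftrightarrow> r \<in> TT \<and> (\<forall>s\<in>TT. \<beta> r (s [^] N) = 1)"
  "orth_snd R r \<longleftrightarrow> r \<in> TT \<and> (\<forall>s\<in>TT. \<beta> r (s [^] N) = 1)" for r
  by (auto simp: orth_fst_def orth_snd_def R_def)
 have off: "orth_fst R (f t)" "orth_snd R (f t)" if "t \<in> TT" for t
  using fN[OF that] fc[OF that] by (simp_all add: of)
 have RI: "(t [^] N, t [^] N) \<in> R" if "t \<in> TT" for t using that by (auto simp: R_def)
 have "partial_lift h R"
  unfolding partial_lift_def
 proof (intro conjI allI impI ballI)
  show "R \<subseteq> TT \<times> TT" by (auto simp: R_def)
  show "(\<one>, \<one>) \<in> R" using RI[OF one_closed] by simp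
 next
  fix x x' y y' assume "(x, x') \<in> R" "(y, y') \<in> R"
  then obtain s t where st: "s \<in> TT" "t \<in> TT" "x = s [^] N" "x' = s [^] N" "y = t [^] N" "y' = t [^] N"
   by (auto simp: R_def)
  show "(x \<otimes> y, x' \<otimes> y') \<in> R" using RI[of "s \<otimes> t"] st by (simp add: nat_pow_distrib)
  show "\<beta> x' y' = \<beta> x y" using st by simp
 next
  fix x x' assume "(x, x') \<in> R"
  then obtain s where s: "s \<in> TT" "x = s [^] N" "x' = s [^] N" by (auto simp: R_def)
  have "P2 #> s [^] N = P2 #> \<one>" using NP2[OF s(1)] coset_eq_iff[OF P2_subgroup] s by simp
  then show "h (P2 #> x) = P2 #> x'" using stabilizer_one[OF g] s by simp
 next
  fix t assume t: "t \<in> TT"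
  show "\<exists>x x' r. (x, x') \<in> R \<and> orth_fst R r \<and> t = x \<otimes> r" using RI[OF t] off(1)[OF t] split[OF t] by blast
  show "\<exists>x x' r. (x, x') \<in> R \<and> orth_snd R r \<and> t = x' \<otimes> r" using RI[OF t] off(2)[OF t] split[OF t] by blast
 next
  fix x assume x: "orth_fst R x"
  then have "x \<in> TT" by (simp add: of)
  then have "P2 #> x \<in> carrier (V)" using flag_carrier by blast
  then have "h (P2 #> x) \<in> carrier (V)" by (rule AutoGroup_apply(1)[OF flag_stabilizer_facts(1)[OF g]])
  then obtain z where z: "z \<in> TT" "h (P2 #> x) = P2 #> z" using flag_carrier by blast
  obtain w where w: "w \<in> TT" "z [^] N = w \<otimes> w" using NP2[OF z(1)] power_part_2_iff by blast
  have "P2 #> z = P2 #> (w \<otimes> w \<otimes> f z)" using split[OF z(1)] unfolding w(2) by simp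
  then have "P2 #> z = P2 #> f z" using P2_coset_square(1)[OF fc[OF z(1)] w(1)] by simp
  then show "\<exists>x'. orth_snd R x' \<and> h (P2 #> x) = P2 #> x'" using off(2)[OF z(1)] z(2) by auto
 next
  show "\<exists>m. \<forall>x. orth_fst R x \<longrightarrow> x [^] ((2::nat) ^ m) = \<one>"
  proof (intro exI[of _ "Suc k"] allI impI)
   fix x assume "orth_fst R x"
   then have x: "x \<in> TT" "\<And>s. s \<in> TT \<Longrightarrow> \<beta> x (s [^] N) = 1" by (auto simp: of)
   have "x [^] N = \<one>"
    by (rule nondegenerate_eq) (use x in \<open>auto simp: beta_pow_left beta_pow_right\<close>)
   then have "x = f x" using split[OF x(1)] fc[OF x(1)] by simp
   then have "x [^] M = f x [^] M" by simp
   also have "\<dots> = inv (x [^] (M * o' * y))" using x(1) by (simp add: f_def nat_pow_inv nat_pow_pow mult_ac)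
   also have "\<dots> = \<one>" using tot[OF x(1)] by simp
   finally show "x [^] ((2::nat) ^ Suc k) = \<one>" unfolding M_def .
  qed
 qed
 then show ?thesis by blast
qed

text \<open>A partial lift of largest cardinality has trivial complement by
  \<open>partial_lift_extend\<close>, so it is defined everywhere; nondegeneracy makes it the graph
  of an injective function.\<close>

lemma lift_flag_stabilizer:
 assumes g: "h \<in> flag_stabilizer T D"
 obtains a where "a \<in> carrier (Aut_biform T \<beta>)" "\<And>t. t \<in> TT \<Longrightarrow> P2 #> a t = h (P2 #> t)"
proof -
 have fin: "finite (TT \<times> TT)" using finite_carrier by simp
 have bd: "\<forall>R. partial_lift h R \<longrightarrow> card R < Suc (card (TT \<times> TT))"
  using card_mono[OF fin] by (auto simp: partial_lift_def less_Suc_eq_le)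
 obtain R0 where R0: "partial_lift h R0" using partial_lift_base[OF g] by (rule exE)
 have "\<exists>R. partial_lift h R \<and> (\<forall>R'. partial_lift h R' \<longrightarrow> card R' \<le> card R)"
  by (rule ex_has_greatest_nat[OF R0 bd])
 then obtain R where R: "partial_lift h R" and max: "\<And>R'. partial_lift h R' \<Longrightarrow> card R' \<le> card R"
  by (elim exE conjE) simp
 note RC = R_closed[OF g R] and RM = R_mult[OF g R] and RB = R_beta[OF g R]
 have triv: "r = \<one>" if r: "orth_fst R r" for r
 proof (rule ccontr)
  assume "r \<noteq> \<one>"
  then obtain R' where R': "partial_lift h R'" "R \<subset> R'" using partial_lift_extend[OF g R r] by blast
  have "R' \<subseteq> TT \<times> TT" using R'(1) by (simp add: partial_lift_def)
  then have "finite R'" by (rule finite_subset[OF _ fin])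
  then have "card R < card R'" using R'(2) by (rule psubset_card_mono)
  then show False using max[OF R'(1)] by simp
 qed
 have total: "\<exists>t'. (t, t') \<in> R" if t: "t \<in> TT" for t
 proof -
  obtain x x' r where x: "(x, x') \<in> R" "orth_fst R r" "t = x \<otimes> r" using R_split_fst[OF g R t] .
  then have "t = x" using triv[OF x(2)] RC(1)[OF x(1)] by simp
  then show ?thesis using x(1) by blast
 qed
 have func: "x' = y'" if "(t, x') \<in> R" "(t, y') \<in> R" for t x' y'
 proof (rule nondegenerate_eq[OF RC(2)[OF that(1)] RC(2)[OF that(2)]])
  fix u assume "u \<in> TT"
  then obtain s s' v where s: "(s, s') \<in> R" "orth_snd R v" "u = s' \<otimes> v" by (rule R_split_snd[OF g R])
  note c = RC(2)[OF that(1)] RC(2)[OF that(2)] RC(2)[OF s(1)] orth_closed(2)[OF g R s(2)]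
  show "\<beta> x' u = \<beta> y' u" unfolding s(3) beta_mult_right[OF c(3,4,1)] beta_mult_right[OF c(3,4,2)]
   RB[OF that(1) s(1)] RB[OF that(2) s(1)] orth_beta(4)[OF g R that(1) s(2)] orth_beta(4)[OF g R that(2) s(2)] ..
 qed
 define a where "a t = (if t \<in> TT then SOME t'. (t, t') \<in> R else undefined)" for t
 have al: "(t, a t) \<in> R" if "t \<in> TT" for t using someI_ex[OF total[OF that]] that by (simp add: a_def)
 have ac: "a t \<in> TT" if "t \<in> TT" for t using RC(2)[OF al[OF that]] .
 have iso: "\<beta> (a s) (a t) = \<beta> s t" if "s \<in> TT" "t \<in> TT" for s t using RB[OF al[OF that(1)] al[OF that(2)]] .
 have hom: "a \<in> hom T T"
  by (rule homI) (use ac func[OF al RM[OF al al]] in auto)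
 have inj: "inj_on a TT"
 proof (rule inj_onI)
  fix s t assume st: "s \<in> TT" "t \<in> TT" "a s = a t"
  show "s = t" by (rule nondegenerate_eq[OF st(1,2)]) (use iso st in metis)
 qed
 have "bij_betw a TT TT"
  by (rule bij_betw_imageI[OF inj endo_inj_surj[OF finite_carrier _ inj]]) (use ac in auto)
 then have "a \<in> carrier (Aut_biform T \<beta>)"
  using hom iso unfolding Aut_biform_iff AutoGroup_iff by (auto simp: extensional_def a_def)
 then show thesis using that R_coset[OF g R al] by metis
qed

lemma flag_stabilizer_image:
 "(\<lambda>h. restrict (coset_action h) (carrier (V))) ` carrier (Aut_biform T \<beta>) = flag_stabilizer T D"
proof (intro equalityI subsetI)
 fix c assume "c \<in> (\<lambda>h. restrict (coset_action h) (carrier (V))) ` carrier (Aut_biform T \<beta>)"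
 then obtain h where a: "h \<in> carrier (Aut_biform T \<beta>)" "c = restrict (coset_action h) (carrier (V))" by blast
 show "c \<in> flag_stabilizer T D" unfolding a(2)
  by (rule flag_stabilizerI(1)) (use a(1) torsion_carrier in \<open>auto simp: Aut_biform_iff\<close>)
next
 fix c assume g: "c \<in> flag_stabilizer T D"
 obtain h where a: "h \<in> carrier (Aut_biform T \<beta>)" "\<And>t. t \<in> TT \<Longrightarrow> P2 #> h t = c (P2 #> t)"
  using lift_flag_stabilizer[OF g] by blast
 have aA: "h \<in> carrier (AutoGroup T)" using a(1) by (simp add: Aut_biform_iff)
 have "c = restrict (coset_action h) (carrier (V))"
 proof (rule extensionalityI[of _ "carrier (V)"])
  show "c \<in> extensional (carrier (V))"
   using flag_stabilizer_facts(1)[OF g] by (simp add: AutoGroup_iff)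
  fix X assume "X \<in> carrier (V)"
  then obtain t where t: "t \<in> TT" "X = P2 #> t" using flag_carrier by blast
  have "restrict (coset_action h) (carrier (V)) (P2 #> t) = P2 #> h t"
   by (rule flag_stabilizerI(2)[OF aA _ t(1)]) (use a(1) torsion_carrier in \<open>auto simp: Aut_biform_iff\<close>)
  then show "c X = restrict (coset_action h) (carrier (V)) X" using a(2)[OF t(1)] t(2) by simp
 qed (rule restrict_extensional)
 then show "c \<in> (\<lambda>h. restrict (coset_action h) (carrier (V))) ` carrier (Aut_biform T \<beta>)" using a(1) by blast
qed

end

section \<open>Complex neutral component\<close>

locale complex_neutral = nondegenerate_support T D \<phi> + positive_inv T D \<phi>
 for T :: "'t monoid" (structure) and D :: "'t \<Rightarrow> 'd::real_algebra_1 set" and \<phi> +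
 fixes z
 assumes De_eq: "D \<one> = alg_center" and z: "hunit \<one> z" "\<phi> z = - z"
begin

text \<open>The classical choice \<open>1 + \<phi> k\<close> fails only for \<open>k = -1\<close>,
  where the skew element \<open>z\<close> takes over.\<close>

lemma hilbert_90:
 assumes k: "hunit \<one> k" "k * \<phi> k = 1"
 obtains c where "hunit \<one> c" "\<phi> c = k * c"
proof (cases "k = -1")
 case True
 then show ?thesis using that[OF z(1)] z(2) by simp
next
 case False
 have kc: "k \<in> D \<one>" "\<phi> k \<in> D \<one>" using k(1) hunit_phi[OF k(1)] by (auto simp: hunit_def)
 show ?thesis
 proof (rule that)
  have "1 + \<phi> k \<noteq> 0"
  proof
   assume "1 + \<phi> k = 0"
   then have "\<phi> k = -1" by (metis eq_neg_iff_add_eq_0 add.commute)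
   then have "k = -1" using phi_phi[of k] by (simp add: phi_neg)
   then show False using False by simp
  qed
  then show "hunit \<one> (1 + \<phi> k)" using kc D_add[OF one_closed] by (simp add: hunit_one_D)
  show "\<phi> (1 + \<phi> k) = k * (1 + \<phi> k)" using k(2) by (simp add: phi_add distrib_left add.commute)
 qed
qed

lemma phi_ratio:
 assumes "hunit t x"
 obtains l where "hunit \<one> l" "\<phi> x = l * x" "l * \<phi> l = 1"
proof -
 obtain l where l: "hunit \<one> l" "\<phi> x = l * x" using ratio_unit[OF assms hunit_phi[OF assms]] by blast
 have "x = \<phi> (l * x)" using l(2) phi_phi[of x] by simp
 also have "\<dots> = l * (x * \<phi> l)" by (simp add: phi_mult l(2) mult.assoc)
 also have "x * \<phi> l = \<phi> l * x" using hunit_central[OF hunit_phi[OF l(1)]] by simp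
 finally have "1 * x = (l * \<phi> l) * x" by (simp add: mult.assoc)
 then have "l * \<phi> l = 1" using hunit_cancel[OF assms] by metis
 then show thesis using that l by blast
qed

text \<open>Only pairs on which \<phi> acts by the same neutral scalar \<open>l\<close> enter the
  graph. For given \<open>x\<close> this leaves \<open>y\<close> free up to real factors only, which
  forces the lift to commute with \<phi>. By \<open>hilbert_90\<close> every degree still has such a
  pair.\<close>

lemma lift_commuting_isometry:
 assumes a: "g \<in> carrier (Aut_biform T \<beta>)"
 obtains h where "gr_aut h" "\<And>t. t \<in> TT \<Longrightarrow> aut_deg h t = g t" "\<And>x. h (\<phi> x) = \<phi> (h x)"
proof -
 have A: "g \<in> hom T T" "bij_betw g TT TT" and ab: "\<And>s t. s \<in> TT \<Longrightarrow> t \<in> TT \<Longrightarrow> \<beta> (g s) (g t) = \<beta> s t"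
  using a by (auto simp: Aut_biform_iff AutoGroup_iff)
 interpret a: group_hom T T g by unfold_locales (rule A(1))
 define G where "G x y \<longleftrightarrow> (\<exists>t l. hunit t x \<and> hunit (g t) y \<and> hunit \<one> l \<and> \<phi> x = l * x \<and> \<phi> y = l * y)" for x y
 define P where "P = {(x, y). G x y}"
 have GI: "(x, y) \<in> P" if "hunit t x" "hunit (g t) y" "hunit \<one> l" "\<phi> x = l * x" "\<phi> y = l * y" for x y t l
  using that unfolding P_def G_def by blast
 have GE: "\<exists>t l. hunit t x \<and> hunit (g t) y \<and> hunit \<one> l \<and> \<phi> x = l * x \<and> \<phi> y = l * y" if "(x, y) \<in> P" for x y
  using that unfolding P_def G_def by blast
 have diag: "(l, l) \<in> P" if l: "hunit \<one> l" for l
 proof -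
  obtain m where m: "hunit \<one> m" "\<phi> l = m * l" using phi_ratio[OF l] .
  show ?thesis by (rule GI[OF l _ m(1,2,2)]) (use l in simp)
 qed
 have mult: "(x * x', y * y') \<in> P" if gg: "(x, y) \<in> P" "(x', y') \<in> P" for x y x' y'
 proof -
  obtain t l where x: "hunit t x" "hunit (g t) y" "hunit \<one> l" "\<phi> x = l * x" "\<phi> y = l * y" using GE[OF gg(1)] by blast
  obtain t' l' where x': "hunit t' x'" "hunit (g t') y'" "hunit \<one> l'" "\<phi> x' = l' * x'" "\<phi> y' = l' * y'" using GE[OF gg(2)] by blast
  have c: "t \<in> TT" "t' \<in> TT" using x x' by (auto simp: hunit_def)
  have shape: "\<phi> (u * u') = (l' * l * \<beta> t' t) * (u * u')"
   if "\<phi> u = l * u" "\<phi> u' = l' * u'" "u' * u = \<beta> t' t * (u * u')" for u u'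
  proof -
   have "\<phi> (u * u') = l' * (u' * l) * u" by (simp add: phi_mult that mult.assoc)
   also have "u' * l = l * u'" using hunit_central[OF x(3)] by simp
   also have "l' * (l * u') * u = l' * l * (u' * u)" by (simp add: mult.assoc)
   finally show ?thesis unfolding that(3) by (simp add: mult.assoc)
  qed
  show ?thesis
  proof (rule GI[of "t \<otimes> t'" _ _ "l' * l * \<beta> t' t"])
   show "hunit (t \<otimes> t') (x * x')" by (rule hunit_mult[OF x(1) x'(1)])
   show "hunit (g (t \<otimes> t')) (y * y')" using hunit_mult[OF x(2) x'(2)] c by simp
   show "hunit \<one> (l' * l * \<beta> t' t)" using hunit_mult[OF hunit_mult[OF x'(3) x(3)] beta_unit[OF c(2,1)]] by simp
   show "\<phi> (x * x') = l' * l * \<beta> t' t * (x * x')" by (rule shape[OF x(4) x'(4) beta_commute[OF x'(1) x(1)]])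
   show "\<phi> (y * y') = l' * l * \<beta> t' t * (y * y')"
    by (rule shape[OF x(5) x'(5)]) (use beta_commute[OF x'(2) x(2)] ab c in simp)
  qed
 qed
 have inverse: "(hinv x, hinv y) \<in> P" if gg: "(x, y) \<in> P" for x y
 proof -
  obtain t l where x: "hunit t x" "hunit (g t) y" "hunit \<one> l" "\<phi> x = l * x" "\<phi> y = l * y" using GE[OF gg] by blast
  have c: "t \<in> TT" using x by (simp add: hunit_def)
  have hl: "hunit \<one> (hinv l)" using hunit_hinv[OF x(3)] by simp
  have shape: "\<phi> (hinv u) = hinv l * hinv u" if "hunit s u" "\<phi> u = l * u" for s u
   unfolding phi_hinv[OF that(1)] that(2) hinv_mult[OF x(3) that(1)] using hunit_central[OF hl] by simp
  show ?thesis
   by (rule GI[OF hunit_hinv[OF x(1)] _ hl shape[OF x(1,4)] shape[OF x(2,5)]]) (use hunit_hinv[OF x(2)] c in simp)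
 qed
 have total: "\<exists>x y. hunit t x \<and> (x, y) \<in> P" if t: "t \<in> TT" for t
 proof -
  obtain x y where xy: "hunit t x" "hunit (g t) y" using ex_hunit t by (meson a.hom_closed)
  obtain l where l: "hunit \<one> l" "\<phi> x = l * x" "l * \<phi> l = 1" using phi_ratio[OF xy(1)] .
  obtain m where m: "hunit \<one> m" "\<phi> y = m * y" "m * \<phi> m = 1" using phi_ratio[OF xy(2)] .
  have hm: "hunit \<one> (\<phi> m)" using hunit_phi[OF m(1)] .
  \<comment> \<open>The factor \<open>c\<close> has to turn the scalar \<open>m\<close> of
    \<open>y\<close> into the scalar \<open>l\<close> of \<open>x\<close>, which amounts to
    \<open>\<phi> c = k * c\<close>.\<close>
  define k where "k = l * \<phi> m"
  have k: "hunit \<one> k" using hunit_mult[OF l(1) hm] by (simp add: k_def)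
  have "k * \<phi> k = l * (\<phi> m * m) * \<phi> l" by (simp add: k_def phi_mult mult.assoc)
  also have "\<phi> m * m = 1" using m(3) hunit_central[OF hm, of m] by simp
  finally have "k * \<phi> k = 1" using l(3) by simp
  then obtain c where c: "hunit \<one> c" "\<phi> c = k * c" using hilbert_90[OF k] by blast
  have "\<phi> (c * y) = m * (y * (k * c))" by (simp add: phi_mult m(2) c(2) mult.assoc)
  also have "y * (k * c) = k * c * y" using hunit_central[OF hunit_mult[OF k c(1), simplified]] by simp
  also have "m * (k * c * y) = (m * k) * (c * y)" by (simp add: mult.assoc)
  also have "m * k = l" unfolding k_def using hunit_central[OF l(1), of m] m(3) by (metis mult.assoc mult_1_right)
  finally have "\<phi> (c * y) = l * (c * y)" .
  moreover have "hunit (g t) (c * y)" using hunit_mult[OF c(1) xy(2)] t by simp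
  ultimately show ?thesis using GI[OF xy(1) _ l(1,2)] xy(1) by blast
 qed
 have real: "(1, of_real r) \<in> P" if "r \<noteq> 0" for r
  by (rule GI[of \<one> 1 _ 1]) (use that hunit_of_real in auto)
 have one: "\<exists>r. r \<noteq> 0 \<and> y = of_real r" if gg: "(1, y) \<in> P" for y
 proof -
  obtain t l where x: "hunit t 1" "hunit (g t) y" "\<phi> 1 = l * 1" "\<phi> y = l * y" using GE[OF gg] by blast
  have "t = \<one>" using hunit_unique[OF x(1) hunit_1] by simp
  then have "y \<in> alg_center" "y \<noteq> 0" using x(2) De_eq by (auto simp: hunit_def)
  moreover have "\<phi> y = y" using x(3,4) by simp
  ultimately show ?thesis using sym_center by fastforce
 qed
 have commute: "y * y' = m * (y' * y)"
  if gg: "(x, y) \<in> P" "(x', y') \<in> P" "hunit \<one> m" "x * x' = m * (x' * x)" for x y x' y' m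
 proof -
  obtain t where x: "hunit t x" "hunit (g t) y" using GE[OF gg(1)] by blast
  obtain t' where x': "hunit t' x'" "hunit (g t') y'" using GE[OF gg(2)] by blast
  have "\<beta> t t' = m" by (rule beta_eqI[OF x(1) x'(1) _ gg(4)]) (use gg(3) in \<open>simp add: hunit_def\<close>)
  then show ?thesis using beta_commute[OF x(2) x'(2)] ab x(1) x'(1) by (simp add: hunit_def)
 qed
 \<comment> \<open>A neutral square means a degree of order at most 2; then the same
   \<open>l\<close> turns both squares into the positive reals \<open>x * \<phi> x\<close> and
   \<open>y * \<phi> y\<close>.\<close>
 have square: "\<exists>r>0. y * y = r *\<^sub>R (x * x)" if gg: "(x, y) \<in> P" "hunit \<one> (x * x)" for x y
 proof -
  obtain t l where x: "hunit t x" "hunit (g t) y" "hunit \<one> l" "\<phi> x = l * x" "\<phi> y = l * y" using GE[OF gg(1)] by blast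
  have c: "t \<in> TT" using x by (simp add: hunit_def)
  have tt: "t \<otimes> t = \<one>" using hunit_unique[OF hunit_mult[OF x(1,1)] gg(2)] by simp
  then have att: "g t \<otimes> g t = \<one>" using c by (metis a.hom_mult a.hom_one)
  obtain r1 where r1: "r1 > 0" "x * \<phi> x = of_real r1" using positive[OF x(1) tt] by blast
  obtain r2 where r2: "r2 > 0" "y * \<phi> y = of_real r2" using positive[OF x(2) att] by blast
  have sh: "l * (u * u) = u * \<phi> u" if "\<phi> u = l * u" for u
   unfolding that using hunit_central[OF x(3), of u] by (metis mult.assoc)
  have e1: "l * (x * x) = r1 *\<^sub>R 1" using sh[OF x(4)] r1(2) by (simp add: of_real_def)
  have e2: "l * (y * y) = r2 *\<^sub>R 1" using sh[OF x(5)] r2(2) by (simp add: of_real_def)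
  have "l * (y * y) = l * ((r2 / r1) *\<^sub>R (x * x))" unfolding e2 using e1 r1(1) by simp
  then have "hinv l * (l * (y * y)) = hinv l * (l * ((r2 / r1) *\<^sub>R (x * x)))" by (rule arg_cong)
  then have "y * y = (r2 / r1) *\<^sub>R (x * x)" unfolding hunit_inv2(2)[OF x(3)] .
  then show ?thesis using r1 r2 by (intro exI[of _ "r2 / r1"]) simp
 qed
 obtain h where aut: "gr_aut h" and deg: "\<And>t. t \<in> TT \<Longrightarrow> aut_deg h t = g t"
  and gam: "\<And>x y. (x, y) \<in> P \<Longrightarrow> \<exists>r. r \<noteq> 0 \<and> h x = r *\<^sub>R y"
 proof (rule lift_automorphism[OF A, of P])
  show "\<exists>t. hunit t x \<and> hunit (g t) y" if "(x, y) \<in> P" for x y using GE[OF that] by blast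
 qed (erule (1) mult | erule inverse | erule total | erule diag | erule real | erule one | erule (3) commute
   | erule (1) square | blast intro: that)+
 \<comment> \<open>From the graph \<open>h\<close> multiplies each neutral unit by a real factor.
   For nonreal \<open>l\<close>, additivity on \<open>1 + l\<close> forces this factor to be
   1.\<close>
 have fix_De: "h l = l" if l: "hunit \<one> l" for l
 proof (cases "\<exists>r. l = of_real r")
  case True
  then show ?thesis using aut_of_real[OF aut] by auto
 next
  case False
  obtain r where r: "h l = r *\<^sub>R l" using gam[OF diag[OF l]] by blast
  have "1 + l \<noteq> 0"
  proof
   assume "1 + l = 0"
   then have "l = of_real (-1)" by (simp add: eq_neg_iff_add_eq_0 add.commute)
   then show False using False by blast
  qed
  then have "hunit \<one> (1 + l)" using l D_add[OF one_closed] by (simp add: hunit_one_D)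
  then obtain r' where r': "h (1 + l) = r' *\<^sub>R (1 + l)" using gam[OF diag] by blast
  have e: "(1 - r') *\<^sub>R 1 = (r' - r) *\<^sub>R l" using r r' by (simp add: aut_add[OF aut] aut_1[OF aut] scaleR_diff_left scaleR_add_right algebra_simps)
  have "r' - r = 0"
  proof (rule ccontr)
   assume n: "r' - r \<noteq> 0"
   have "l = (1 / (r' - r)) *\<^sub>R ((r' - r) *\<^sub>R l)" using n by simp
   also have "\<dots> = of_real ((1 - r') / (r' - r))" unfolding e[symmetric] by (simp add: of_real_def)
   finally show False using False by blast
  qed
  with e have "r = 1" by simp
  then show ?thesis using r by simp
 qed
 have "1 * h (\<phi> x) = \<phi> (h x) * 1" for x
 proof (rule aut_commutes_hom[OF aut])
  fix t x assume t: "t \<in> TT" "x \<in> D t"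
  show "1 * h (\<phi> x) = \<phi> (h x) * 1"
  proof (cases "x = 0")
   case False
   obtain x0 y0 where x0: "hunit t x0" "(x0, y0) \<in> P" using total[OF t(1)] by blast
   have hx: "hunit t x" using t False by (simp add: hunit_def)
   obtain c where c: "hunit \<one> c" "x = c * x0" using ratio_unit[OF x0(1) hx] .
   have xy: "(x, c * y0) \<in> P" unfolding c(2) by (rule mult[OF diag[OF c(1)] x0(2)])
   obtain l where l: "hunit \<one> l" "\<phi> x = l * x" "\<phi> (c * y0) = l * (c * y0)" using GE[OF xy] by blast
   obtain r where r: "h x = r *\<^sub>R (c * y0)" using gam[OF xy] by blast
   have "h (\<phi> x) = l * h x" unfolding l(2) aut_mult[OF aut] fix_De[OF l(1)] ..
   also have "\<dots> = \<phi> (h x)" unfolding r by (simp add: phi_scale l(3))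
   finally show ?thesis by simp
  qed (simp add: aut_0[OF aut])
 qed
 then show thesis using that aut deg by simp
qed

lemma aut_power: "gr_aut h \<Longrightarrow> h (x ^ n) = h x ^ n"
 by (induction n) (simp_all add: aut_1 aut_mult)

text \<open>The degree map preserves \<beta> only up to the action of \<open>h\<close> on the
  neutral component, which can be conjugation. The values of the flag forms are 1 and -1 and are not
  affected, so the induced map stabilizes the flag, and some isometry of \<beta> induces the same
  map.\<close>

lemma aut_isometry_mod_squares:
 assumes aut: "gr_aut h"
 obtains a where "a \<in> carrier (Aut_biform T \<beta>)" "\<And>t. t \<in> TT \<Longrightarrow> P2 #> a t = P2 #> aut_deg h t"
proof -
 have b: "bpow i (aut_deg h s) (aut_deg h t) = bpow i s t"
  if "i \<ge> 1" "s \<in> tor2 i" "t \<in> tor2 i" for i s t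
 proof -
  note c = torsion_carrier[OF that(2)] torsion_carrier[OF that(3)]
  have "bpow i (aut_deg h s) (aut_deg h t) = h (bpow i s t)" unfolding aut_beta[OF aut c] aut_power[OF aut] ..
  also have "\<dots> = bpow i s t" using bpow_sign[OF that(1,2) c(2)] aut_neg[OF aut] aut_1[OF aut] by auto
  finally show ?thesis .
 qed
 let ?g = "restrict (coset_action (aut_deg h)) (carrier (V))"
 note st = flag_stabilizerI[OF aut_deg_AutoGroup[OF aut] b]
 have g: "?g \<in> flag_stabilizer T D" by (rule st(1))
 obtain a where al: "a \<in> carrier (Aut_biform T \<beta>)" "\<And>t. t \<in> TT \<Longrightarrow> P2 #> a t = ?g (P2 #> t)"
  using lift_flag_stabilizer[OF g] by blast
 have "?g (P2 #> t) = P2 #> aut_deg h t" if "t \<in> TT" for t by (rule st(2)) (use that in auto)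
 then show thesis using that al by metis
qed

lemma classified_complex_neutral:
 assumes ns: "\<not> iso_split_complex K" and nr: "K \<noteq> range of_real"
  and ic: "iso_complex K"
 shows "M_classified_by T D \<phi> P2 (Aut_biform T \<beta>) coset_action"
 unfolding M_classified_by_def
proof (intro conjI allI impI)
 show "subgroup P2 T" by (rule P2_subgroup)
 show "elementary_abelian_2 (T Mod P2)" by (rule elementary_abelian_FactGroup[OF P2_subgroup square_P2])
 fix q s ds e q' s' ds' e'
 assume adm: "adm q s ds e" "adm q' s' ds' e'"
 note A = admissible_facts[OF adm(1)] and B = admissible_facts[OF adm(2)]
 have d1: "e = 1" "e' = 1" using A(5) B(5) nr by auto
 have dc: "deg d \<in> TT" if "d \<in> set ds \<union> set ds'" for d using that A(3) B(3) by (auto simp: hunit_def)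
 have AG: "a \<in> carrier (AutoGroup T)" if "a \<in> carrier (Aut_biform T \<beta>)" for a using that by (simp add: Aut_biform_iff)
 have orb: "multiset_orbit (Aut_biform T \<beta>) coset_action (degs P2 ds) =
    multiset_orbit (Aut_biform T \<beta>) coset_action (degs P2 ds') \<longleftrightarrow>
   (\<exists>a\<in>carrier (Aut_biform T \<beta>). degs P2 ds' = mset (map (\<lambda>d. P2 #> a (deg d)) ds))"
  by (rule orbit_coset_action[OF P2_subgroup _ Aut_biform_group_like[OF T_group] P2_image[OF AG]])
   (use A(3) B(3) AG in auto)
 have sgn: "signature T D \<phi> e ds = signature T D \<phi> e' ds' \<longleftrightarrow> sign_diff ds = sign_diff ds'"
 proof -
  have i: "iso_complex (D \<one>)" using ic De_eq by simp
  have "signature T D \<phi> 1 ds = Some (sign_diff ds)" "signature T D \<phi> 1 ds' = Some (sign_diff ds')"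
   by (rule signature_eq[OF ns], use A(3) i in blast, use i in blast,
     rule signature_eq[OF ns], use B(3) i in blast, use i in blast)
  then show ?thesis using d1 by simp
 qed
 have "M_equiv q s ds e q' s' ds' e' \<longleftrightarrow> q = q' \<and> s = s' \<and>
   sign_diff ds = sign_diff ds' \<and>
   (\<exists>a\<in>carrier (Aut_biform T \<beta>). degs P2 ds' = mset (map (\<lambda>d. P2 #> a (deg d)) ds))" (is "?L \<longleftrightarrow> ?R")
 proof
  assume ?L
  then obtain h v p where q: "q = q'" "s = s'" and aut: "gr_aut h" and tw: "twists h v" and pv: "\<phi> v = (e * e') *\<^sub>R v"
   and p: "bij_betw p {..<q} {..<q}" and lk: "\<And>i. i < q \<Longrightarrow> linked h v (ds ! i) (ds' ! p i)"
   unfolding equivalent_iff[OF adm] by blast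
  obtain u where u: "hunit u v" using tw by (auto simp: twists_def)
  have uc: "u \<in> TT" using u by (simp add: hunit_def)
  have "\<beta> u w = 1" if "w \<in> tor 2" for w
   by (rule twist_orthogonal[OF aut tw u]) (use that in \<open>auto simp: torsion_part_def pow2\<close>)
  \<comment> \<open>Orthogonality to the 2-torsion means being a square, so twisting by
    \<open>v\<close> does not move classes modulo squares.\<close>
  then have uP: "u \<in> P2" using perp_torsion[of 2] uc by (auto simp: perp_def)
  have vv: "norm_form v \<or> norm_form (- v)" by (rule symmetric_square_degree[OF u _ uP]) (use pv d1 in simp)
  have "sign_diff ds = sign_diff ds'"
   by (rule linked_sign_diff[OF aut tw vv p A(1) _ lk]) (use A B q d1 in auto)
  moreover obtain a where al: "a \<in> carrier (Aut_biform T \<beta>)" "\<And>t. t \<in> TT \<Longrightarrow> P2 #> a t = P2 #> aut_deg h t"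
   using aut_isometry_mod_squares[OF aut] by blast
  moreover have "degs P2 ds' = mset (map (\<lambda>d. P2 #> a (deg d)) ds)"
   unfolding coset_multiset_eq
  proof (rule mset_image_nth[OF p A(1)])
   fix i assume i: "i < q"
   then have m: "ds ! i \<in> set ds" "ds' ! p i \<in> set ds'" using A(1) B(1) q bij_betwE[OF p] by auto
   let ?t = "deg (ds ! i)" and ?t' = "deg (ds' ! p i)"
   have c: "?t \<in> TT" "?t' \<in> TT" "aut_deg h ?t \<in> TT" using dc m aut_deg_closed[OF aut] by auto
   obtain r where r: "r \<in> TT" "r \<otimes> r \<otimes> ?t' = u \<otimes> aut_deg h ?t"
    by (rule linked_degree[OF aut u lk[OF i] A(3)[OF m(1)] B(3)[OF m(2)]])
   obtain w where w: "w \<in> TT" "u = w \<otimes> w" using uP power_part_2_iff by blast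
   have "P2 #> ?t' = P2 #> (r \<otimes> r \<otimes> ?t')" using P2_coset_square(1)[OF c(2) r(1)] by simp
   also have "\<dots> = P2 #> aut_deg h ?t" unfolding r(2) w(2) by (rule P2_coset_square(1)[OF c(3) w(1)])
   finally show "P2 #> ?t' = P2 #> a ?t" using al(2)[OF c(1)] by simp
  qed (use B q in simp)
  ultimately show ?R using q by blast
 next
  assume R: ?R
  then obtain a where al: "a \<in> carrier (Aut_biform T \<beta>)" and key: "degs P2 ds' = mset (map (\<lambda>d. P2 #> a (deg d)) ds)" by blast
  have q: "q' = q" "s' = s" "e' = e" using R d1 by auto
  obtain h where aut: "gr_aut h" and deg: "\<And>t. t \<in> TT \<Longrightarrow> aut_deg h t = a t" and com: "\<And>x. h (\<phi> x) = \<phi> (h x)"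
   using lift_commuting_isometry[OF al] by blast
  show ?L unfolding q
  proof (rule linked_matching[OF aut com adm(1) adm(2)[unfolded q]])
   have "mset (map (\<lambda>d. P2 #> aut_deg h (deg d)) ds) = mset (map (\<lambda>d. P2 #> a (deg d)) ds)"
    by (rule arg_cong[of _ _ mset], rule map_cong[OF refl]) (use deg dc in auto)
   then show "mset (map (\<lambda>d. P2 #> aut_deg h (deg d)) ds) = mset (map (\<lambda>d. P2 #> deg d) ds')"
    using key by (simp add: coset_multiset_eq)
   fix d assume d: "d \<in> set ds" "deg d \<notin> P2"
   then have c: "deg d \<in> TT" using dc by blast
   have "aut_deg h (deg d) \<notin> P2" using aut_power_part[OF aut c] d by blast
   then show "\<exists>w\<in>TT. w \<otimes> w = \<one> \<and> \<beta> w (aut_deg h (deg d)) = -1"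
    by (rule torsion_nontrivial[OF aut_deg_closed[OF aut c]])
  qed (use R d1 in auto)
 qed
 then show "M_equiv q s ds e q' s' ds' e' \<longleftrightarrow>
      q = q' \<and> s = s' \<and> e = e' \<and>
      signature T D \<phi> e ds = signature T D \<phi> e' ds' \<and>
      multiset_orbit (Aut_biform T \<beta>) coset_action (degs P2 ds) =
      multiset_orbit (Aut_biform T \<beta>) coset_action (degs P2 ds')"
  unfolding orb sgn using d1 by auto
qed

end

theorem theorem5p15:
  fixes T :: "'t monoid"
    and D :: "'t \<Rightarrow> 'd::real_algebra_1 set"
    and \<phi> :: "'d \<Rightarrow> 'd"
  assumes "fin_dim TYPE('d)"
    and "graded_division_algebra T D"
    and "comm_group T"
    and "D \<one>\<^bsub>T\<^esub> \<subseteq> alg_center"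
    and "is_involution \<phi>"
    and "degree_preserving T D \<phi>"
    and "central_simple_with_involution \<phi>"
    and "involution_convention T D \<phi>"
  defines "K \<equiv> (alg_center :: 'd set)"
  shows
    "(K = range of_real \<or> iso_complex K \<or> iso_split_complex K) \<and>
     (K = range of_real \<longrightarrow>
        (\<forall>t\<in>carrier T. is_mu_value D t (mu D t)) \<and>
        (\<forall>s\<in>carrier T. \<forall>t\<in>carrier T. is_beta_value T D s t (beta T D s t)) \<and>
        quadratic_form T (beta T D) (mu D) \<and>
        M_classified_by T D \<phi> {\<one>\<^bsub>T\<^esub>} (Aut_form T (mu D)) coset_action) \<and>
     (iso_complex K \<longrightarrow>
        (D \<one>\<^bsub>T\<^esub> = range of_real \<or> iso_complex (D \<one>\<^bsub>T\<^esub>)) \<and>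
        (\<forall>s\<in>carrier T. \<forall>t\<in>carrier T. is_beta_value T D s t (beta T D s t)) \<and>
        alternating_bicharacter T (D \<one>\<^bsub>T\<^esub>) (beta T D)) \<and>
     (iso_complex K \<and> D \<one>\<^bsub>T\<^esub> = range of_real \<longrightarrow>
        (let H = supp_center T D; V = T Mod H; \<beta>' = induced_biform (beta T D) in
         (\<forall>s\<in>carrier T. \<forall>t\<in>carrier T. \<beta>' (H #>\<^bsub>T\<^esub> s) (H #>\<^bsub>T\<^esub> t) = beta T D s t) \<and>
         alternating_bicharacter V (D \<one>\<^bsub>T\<^esub>) \<beta>' \<and> nondegenerate V \<beta>' \<and>
         M_classified_by T D \<phi> H (Aut_biform V \<beta>') (\<lambda>\<alpha>. \<alpha>))) \<and>
     (iso_complex K \<and> iso_complex (D \<one>\<^bsub>T\<^esub>) \<longrightarrow>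
        M_classified_by T D \<phi> (power_part T 2) (Aut_biform T (beta T D)) coset_action \<and>
        flag_forms_symplectic T D \<and>
        (\<lambda>\<alpha>. restrict (coset_action \<alpha>) (carrier (flag_space T))) `
            carrier (Aut_biform T (beta T D)) = flag_stabilizer T D) \<and>
     (iso_split_complex K \<longrightarrow>
        (let H = supp_center T D; V = T Mod H;
             \<beta>' = induced_biform (beta T D); \<mu>' = induced_form (mu D) in
         (\<forall>t\<in>carrier T. is_mu_value D t (mu D t)) \<and>
         (\<forall>s\<in>carrier T. \<forall>t\<in>carrier T. is_beta_value T D s t (beta T D s t)) \<and>
         (\<forall>t\<in>carrier T. \<mu>' (H #>\<^bsub>T\<^esub> t) = mu D t) \<and>
         (\<forall>s\<in>carrier T. \<forall>t\<in>carrier T. \<beta>' (H #>\<^bsub>T\<^esub> s) (H #>\<^bsub>T\<^esub> t) = beta T D s t) \<and>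
         quadratic_form V \<beta>' \<mu>' \<and>
         M_classified_by T D \<phi> H (semidirect V (Aut_form V \<mu>')) (affine_action V)))"
proof -
  interpret gr_div_inv T D \<phi> by (rule gr_div_inv.intro) fact+
  \<comment> \<open>The convention constrains \<phi> only if the centre does not split; positivity
    is therefore available in all cases but that one.\<close>
  have pos: "positive_inv T D \<phi>" if ns: "\<not> iso_split_complex (alg_center :: 'd set)"
  proof unfold_locales
    fix t x assume "hunit t x" "t \<otimes>\<^bsub>T\<^esub> t = \<one>\<^bsub>T\<^esub>"
    then have "pos_real (x * \<phi> x)" using assms(8) ns by (auto simp: involution_convention_def hunit_def)
    then show "\<exists>r>0. x * \<phi> x = of_real r" by (simp add: pos_real_def)
  qed
  show ?thesis
  proof (cases "K = range of_real")
    case True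
    then have K: "(alg_center :: 'd set) = range of_real" by (simp add: K_def)
    note c = center_real_case[OF K]
    interpret positive_inv T D \<phi> by (rule pos[OF c(3)])
    interpret real_positive T D \<phi> by unfold_locales (rule c(1))
    show ?thesis
      using classified_real[OF K] mu_props(1) beta_value quadratic_form_mu c True by (simp add: K_def)
  next
    case False
    then have nr: "(alg_center :: 'd set) \<noteq> range of_real" by (simp add: K_def)
    obtain f z e where fz: "hunit f z" "z \<in> alg_center" "\<phi> z = - z" "e = 1 \<or> e = -1"
      "z * z = of_real e" "H = {\<one>\<^bsub>T\<^esub>, f}" "f \<noteq> \<one>\<^bsub>T\<^esub> \<longrightarrow> D \<one>\<^bsub>T\<^esub> = range of_real" "f = \<one>\<^bsub>T\<^esub> \<longrightarrow> D \<one>\<^bsub>T\<^esub> = alg_center \<and> e = -1"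
      "e = -1 \<longrightarrow> iso_complex (alg_center :: 'd set) \<and> \<not> iso_split_complex (alg_center :: 'd set)"
      "e = 1 \<longrightarrow> iso_split_complex (alg_center :: 'd set) \<and> \<not> iso_complex (alg_center :: 'd set)"
      by (rule center_nonreal_case[OF nr]) blast
    show ?thesis
    proof (cases "e = 1")
      case True
      then have f: "f \<noteq> \<one>\<^bsub>T\<^esub>" using fz(8) by auto
      note c = fz(10)[rule_format, OF True]
      interpret real_neutral T D \<phi> by unfold_locales (rule fz(7)[rule_format, OF f])
      have zz: "z * z = 1" using fz(5) True by simp
      note cl = classified_split_complex[OF conjunct1[OF c] nr fz(1,3) zz fz(2) f fz(6)]
      have ife: "induced_form (mu D) (H #>\<^bsub>T\<^esub> t) = mu D t" if "t \<in> carrier T" for t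
        by (rule induced_form_eq[OF cl(2) that])
      have "quadratic_form (T Mod H) (induced_biform \<beta>) (induced_form (mu D))"
        by (rule induced_quadratic_form[OF cl(2)])
      then show ?thesis using c cl(1) ife mu_props(1) beta_value induced_biform_eq nr by (simp add: K_def Let_def)
    next
      case False
      then have e: "e = -1" using fz(4) by blast
      note c = fz(9)[rule_format, OF e]
      have zz: "z * z = -1" using fz(5) e by simp
      interpret positive_inv T D \<phi> by (rule pos) (use c in simp)
      show ?thesis
      proof (cases "f = \<one>\<^bsub>T\<^esub>")
        case True
        then have De: "D \<one>\<^bsub>T\<^esub> = alg_center" using fz(8) by blast
        interpret complex_neutral T D \<phi> z
          by unfold_locales (use De fz True in simp_all)
        show ?thesis
          using c De nr classified_complex_neutral flag_symplectic flag_stabilizer_image beta_value beta_alternating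
          by (simp add: K_def)
      next
        case f: False
        interpret real_positive T D \<phi> by unfold_locales (rule fz(7)[rule_format, OF f])
        have "\<not> iso_complex (D \<one>\<^bsub>T\<^esub>)" using iso_complex_not_real De_real by blast
        then show ?thesis
          using c De_real nr classified_complex_real_neutral[OF _ nr fz(1,3) zz f fz(6)] induced_alternating induced_biform_eq
            beta_value beta_alternating by (simp add: K_def Let_def)
      qed
    qed
  qed
qed

end
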